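(* Let $d\ge1$, $q_1,\dots,q_d\ge1$ be integers, and for $n\ge1$ let $F_n=(F_{1,n},\dots,F_{d,n})$ with $F_{i,n}=I_{q_i}(f_{i,n})$, $f_{i,n}\in\mathfrak{H}^{\odot q_i}$. Let $Z_n$ be a centered Gaussian vector with the same covariance matrix as $F_n$. Let $g:\mathbb{R}^d\to\mathbb{R}$ be three times differentiable with bounded derivatives up to order three. a) If, for $1\le i,j\le d$, the sequence $(F_n,\widetilde\Gamma_{ij}(F_n))_{n\ge1}$ is ACN whenever $\limsup_n\sqrt{\operatorname{Var}\Gamma_{ij}(F_n)}/\Delta_\Gamma(F_n)>0$, then $$\frac{\operatorname{E}[g(F_n)]-\mathcal{E}_3(F_n,Z_n,g)}{\Delta_\Gamma(F_n)}\to0 .$$ b) If there exists a covariance matrix $C$ such that $\Delta_C(F_n)\to0$ and, for $1\le i,j\le d$, the sequence $(F_n,\widetilde\Gamma_{ij}(F_n))_{n\ge1}$ is ACN whenever $$\limsup_n\frac{\sqrt{\operatorname{Var}\Gamma_{ij}(F_n)}+|\operatorname{E}[F_{i,n}F_{j,n}]-C_{ij}|}{\varphi_C(F_n)}>0,$$ then $$\frac{\operatorname{E}[g(F_n)]-\mathcal{E}_3(F_n,Z,g)}{\varphi_C(F_n)}\to0 ,$$ where $Z$ is a centered $d$-dimensional Gaussian vector with covariance matrix $C$.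
   Context: Let $X=\{X(h):h\in\mathfrak{H}\}$ be an isonormal Gaussian process over a real separable Hilbert space $\mathfrak{H}$ on $(\Omega,\mathcal{F},P)$ with $\mathcal{F}$ generated by $X$. $\mathfrak{H}^{\odot q}$ is the $q$th symmetric tensor product, and $I_q:\mathfrak{H}^{\odot q}\to L^2(\Omega)$ is the multiple integral of order $q$, mapping onto the $q$th Wiener chaos, with $\operatorname{E}[I_q(f)I_q(g)]=q!\langle f,g\rangle_{\mathfrak{H}^{\otimes q}}$. $D$ is the Malliavin derivative; with $J_q$ the orthogonal projection onto the $q$th Wiener chaos, $L^{-1}=\sum_{q\ge1}-\frac1qJ_q$. $\Gamma_{ij}(F_n)=\langle DF_{i,n},-DL^{-1}F_{j,n}\rangle_{\mathfrak{H}}=\frac1{q_j}\langle DF_{i,n},DF_{j,n}\rangle_{\mathfrak{H}}$, $\widetilde\Gamma_{ij}(F_n)=\big(\Gamma_{ij}(F_n)-\operatorname{E}[\Gamma_{ij}(F_n)]\big)/\sqrt{\operatorname{Var}\Gamma_{ij}(F_n)}$, $\Delta_\Gamma(F_n)=\sqrt{\sum_{i,j=1}^d\operatorname{Var}\Gamma_{ij}(F_n)}$, $\Delta_C(F_n)=\sqrt{\sum_{i,j=1}^d(\operatorname{E}[F_{i,n}F_{j,n}]-C_{ij})^2}$, $\varphi_C(F_n)=\Delta_\Gamma(F_n)+\Delta_C(F_n)$. Denominators are understood to be non-zero. With $\mu_{ij}(F_n)=\operatorname{E}[F_{i,n}F_{j,n}]$ and $\mu_{ijk}(F_n)=\operatorname{E}[F_{i,n}F_{j,n}F_{k,n}]$,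 the third-order generalized Edgeworth expansions are $$\mathcal{E}_3(F_n,Z_n,g)=\operatorname{E}[g(Z_n)]+\sum_{i,j,k=1}^d\frac{\mu_{ijk}(F_n)}{3!}\operatorname{E}[\partial_{ijk}g(Z_n)],$$ $$\mathcal{E}_3(F_n,Z,g)=\operatorname{E}[g(Z)]+\sum_{i,j=1}^d\frac{\mu_{ij}(F_n)-C_{ij}}{2}\operatorname{E}[\partial_{ij}g(Z)]+\sum_{i,j,k=1}^d\frac{\mu_{ijk}(F_n)}{3!}\operatorname{E}[\partial_{ijk}g(Z)].$$ ACN (asymptotically close to normal): a sequence $(X_n)$ of random vectors with finite first and second moments is ACN if $\beta(P_{X_n},P_{Z_n})\to0$, where $Z_n$ is Gaussian (possibly degenerate) with the same first and second moments as $X_n$, $P_Y$ denotes the law of $Y$, and $\beta(P,Q)=\sup\{|\int f\,d(P-Q)|:\|f\|_\infty+\|f\|_L\le1\}$ is the Fortet-Mourier metric ($\|\cdot\|_L$ the Lipschitz seminorm). *)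

theory Defs
  imports "HOL-Probability.Probability"
begin

section \<open>Gaussian laws and asymptotic closeness to normal\<close>

text \<open>Degenerate Gaussian laws are included: standard deviation \<open>0\<close> means a Dirac mass.\<close>

definition normal_law :: "real \<Rightarrow> real \<Rightarrow> real measure" where
  "normal_law m \<sigma> = (if \<sigma> = 0 then return borel m else density lborel (normal_density m \<sigma>))"

definition gaussian_law :: "'e::euclidean_space measure \<Rightarrow> bool" where
  "gaussian_law \<nu> \<longleftrightarrow> sets \<nu> = sets borel \<and>
     (\<forall>t. \<exists>m. \<exists>\<sigma>\<ge>0. distr \<nu> borel (\<lambda>x. t \<bullet> x) = normal_law m \<sigma>)"

definition covariance_matrix :: "real^'d^'d \<Rightarrow> bool" where
  "covariance_matrix C \<longleftrightarrow> transpose C = C \<and> (\<forall>x. 0 \<le> x \<bullet> (C *v x))"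

definition centered_gaussian_vector ::
  "'b measure \<Rightarrow> ('b \<Rightarrow> real^'d) \<Rightarrow> real^'d^'d \<Rightarrow> bool" where
  "centered_gaussian_vector N Z C \<longleftrightarrow>
     prob_space N \<and> Z \<in> borel_measurable N \<and> gaussian_law (distr N borel Z) \<and>
     (\<forall>i. (\<integral>\<omega>. Z \<omega> $ i \<partial>N) = 0) \<and>
     (\<forall>i j. (\<integral>\<omega>. Z \<omega> $ i * Z \<omega> $ j \<partial>N) = C $ i $ j)"

text \<open>In the next definition, \<open>a\<close> bounds the supremum norm of \<open>f\<close> and \<open>b\<close> its Lipschitz seminorm;
  such bounds with \<open>a + b \<le> 1\<close> exist iff the two norms add up to at most \<open>1\<close>.\<close>

definition fortet_mourier :: "'e::euclidean_space measure \<Rightarrow> 'e measure \<Rightarrow> real" where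
  "fortet_mourier P Q =
     (SUP f \<in> {f::'e \<Rightarrow> real. \<exists>a b. a + b \<le> 1 \<and> (\<forall>x. \<bar>f x\<bar> \<le> a) \<and> b-lipschitz_on UNIV f}.
        \<bar>(\<integral>x. f x \<partial>P) - (\<integral>x. f x \<partial>Q)\<bar>)"

definition sq_integrable ::
  "'a measure \<Rightarrow> ('a \<Rightarrow> 'b::{banach, second_countable_topology}) \<Rightarrow> bool" where
  "sq_integrable M U \<longleftrightarrow> U \<in> borel_measurable M \<and> integrable M (\<lambda>\<omega>. (norm (U \<omega>))\<^sup>2)"

definition ACN :: "'a measure \<Rightarrow> (nat \<Rightarrow> 'a \<Rightarrow> 'e::euclidean_space) \<Rightarrow> bool" where
  "ACN M Y \<longleftrightarrow>
     (\<forall>n. sq_integrable M (Y n)) \<and>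
     (\<exists>\<nu>. (\<forall>n. gaussian_law (\<nu> n) \<and>
              (\<integral>x. x \<partial>\<nu> n) = (\<integral>\<omega>. Y n \<omega> \<partial>M) \<and>
              (\<forall>u v. (\<integral>x. (u \<bullet> x) * (v \<bullet> x) \<partial>\<nu> n) = (\<integral>\<omega>. (u \<bullet> Y n \<omega>) * (v \<bullet> Y n \<omega>) \<partial>M))) \<and>
          (\<lambda>n. fortet_mourier (distr M borel (Y n)) (\<nu> n)) \<longlonglongrightarrow> 0)"


section \<open>Isonormal Gaussian processes and multiple integrals\<close>

locale isonormal_gaussian_process = prob_space M
  for M :: "'a measure" +
  fixes X :: "'h::{real_inner, banach, second_countable_topology} \<Rightarrow> 'a \<Rightarrow> real"
  assumes X_measurable: "\<And>h. X h \<in> borel_measurable M"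
    and X_jointly_gaussian: "\<And>(S::'h set) c. finite S \<Longrightarrow>
          \<exists>\<sigma>\<ge>0. distr M borel (\<lambda>\<omega>. \<Sum>h\<in>S. c h * X h \<omega>) = normal_law 0 \<sigma>"
    and X_covariance: "\<And>h h'. (\<integral>\<omega>. X h \<omega> * X h' \<omega> \<partial>M) = h \<bullet> h'"
    and X_generates: "sets M = sigma_sets (space M) {X h -` B \<inter> space M | h B. B \<in> sets borel}"

text \<open>The Hilbert tensor power of order \<open>q\<close> is realised as the space of Hilbert--Schmidt
  \<open>q\<close>-linear functionals, the pure tensor of \<open>h\<^sub>0, \<dots>, h\<^bsub>q-1\<^esub>\<close> being
  \<open>v \<mapsto> \<Prod>k<q. h\<^sub>k \<bullet> v\<^sub>k\<close>. Only the entries \<open>v k\<close> with \<open>k < q\<close> matter. The Hilbert--Schmidt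
  norm, usually computed along an orthonormal basis, is by Bessel's inequality the supremum over
  finite orthonormal sets; its finiteness implies boundedness of the functional.\<close>

type_synonym 'h tensor = "(nat \<Rightarrow> 'h) \<Rightarrow> real"

definition orthonormal_set :: "'h::real_inner set \<Rightarrow> bool" where
  "orthonormal_set E \<longleftrightarrow> pairwise orthogonal E \<and> (\<forall>e\<in>E. norm e = 1)"

definition hs_sums :: "nat \<Rightarrow> 'h::real_inner tensor \<Rightarrow> real set" where
  "hs_sums q f =
     (\<lambda>E. \<Sum>e\<in>({..<q} \<rightarrow>\<^sub>E E). (f e)\<^sup>2) ` {E. finite E \<and> orthonormal_set E}"

definition tensor_norm :: "nat \<Rightarrow> 'h::real_inner tensor \<Rightarrow> real" where
  "tensor_norm q f = sqrt (Sup (hs_sums q f))"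

definition sym_tensors :: "nat \<Rightarrow> 'h::real_inner tensor set" where
  "sym_tensors q = {f.
     (\<forall>v w. (\<forall>k<q. v k = w k) \<longrightarrow> f v = f w) \<and>
     (\<forall>v. \<forall>k<q. linear (\<lambda>x. f (v(k := x)))) \<and>
     bdd_above (hs_sums q f) \<and>
     (\<forall>\<pi> v. \<pi> permutes {..<q} \<longrightarrow> f (v \<circ> \<pi>) = f v)}"

definition tensor_power :: "nat \<Rightarrow> 'h::real_inner \<Rightarrow> 'h tensor" where
  "tensor_power q h = (\<lambda>v. \<Prod>k<q. h \<bullet> v k)"

text \<open>Monic (probabilists') Hermite polynomials.\<close>

fun hermite :: "nat \<Rightarrow> real \<Rightarrow> real" where
  "hermite 0 x = 1"
| "hermite (Suc 0) x = x"
| "hermite (Suc (Suc n)) x = x * hermite (Suc n) x - real (Suc n) * hermite n x"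

definition L2_tendsto ::
  "'a measure \<Rightarrow> (nat \<Rightarrow> 'a \<Rightarrow> 'b::{banach, second_countable_topology}) \<Rightarrow> ('a \<Rightarrow> 'b) \<Rightarrow> bool" where
  "L2_tendsto M Us U \<longleftrightarrow>
     (\<forall>m. sq_integrable M (Us m)) \<and> sq_integrable M U \<and>
     (\<lambda>m. \<integral>\<omega>. (norm (Us m \<omega> - U \<omega>))\<^sup>2 \<partial>M) \<longlonglongrightarrow> 0"

text \<open>\<open>I\<^sub>q\<close> is the continuous linear extension of \<open>h\<^bsup>\<otimes>q\<^esup> \<mapsto> hermite q (X h)\<close>, \<open>norm h = 1\<close>.
  As \<open>I\<^sub>q(f)\<close> is a class of almost surely equal random variables,
  \<open>is_multiple_integral M X q f F\<close> says that \<open>F\<close> is a version of it.\<close>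

definition is_multiple_integral ::
  "'a measure \<Rightarrow> ('h::real_inner \<Rightarrow> 'a \<Rightarrow> real) \<Rightarrow> nat \<Rightarrow> 'h tensor \<Rightarrow> ('a \<Rightarrow> real) \<Rightarrow> bool" where
  "is_multiple_integral M X q f F \<longleftrightarrow> f \<in> sym_tensors q \<and>
     (\<exists>(S :: nat \<Rightarrow> 'h set) c. (\<forall>m. finite (S m) \<and> (\<forall>h\<in>S m. norm h = 1)) \<and>
        (\<lambda>m. tensor_norm q (\<lambda>v. (\<Sum>h\<in>S m. c m h * tensor_power q h v) - f v)) \<longlonglongrightarrow> 0 \<and>
        L2_tendsto M (\<lambda>m \<omega>. \<Sum>h\<in>S m. c m h * hermite q (X h \<omega>)) F)"

definition wiener_chaos ::
  "'a measure \<Rightarrow> ('h::real_inner \<Rightarrow> 'a \<Rightarrow> real) \<Rightarrow> nat \<Rightarrow> ('a \<Rightarrow> real) set" where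
  "wiener_chaos M X q = {F.
     \<exists>(S :: nat \<Rightarrow> 'h set) c. (\<forall>m. finite (S m) \<and> (\<forall>h\<in>S m. norm h = 1)) \<and>
        L2_tendsto M (\<lambda>m \<omega>. \<Sum>h\<in>S m. c m h * hermite q (X h \<omega>)) F}"


section \<open>Malliavin operators\<close>

text \<open>Functions of \<open>m\<close> real variables are written as functions on \<open>nat \<Rightarrow> real\<close> which only depend on
  the coordinates below \<open>m\<close>. \<open>smooth_poly_growth m\<close> consists of those which are infinitely often
  differentiable and, together with all their partial derivatives, of polynomial growth.\<close>

definition coord_deriv :: "nat \<Rightarrow> ((nat \<Rightarrow> real) \<Rightarrow> real) \<Rightarrow> (nat \<Rightarrow> real) \<Rightarrow> real" where
  "coord_deriv i \<phi> x = deriv (\<lambda>t. \<phi> (x(i := t))) (x i)"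

definition smooth_poly_growth :: "nat \<Rightarrow> ((nat \<Rightarrow> real) \<Rightarrow> real) set" where
  "smooth_poly_growth m = {\<phi>.
     (\<forall>x y. (\<forall>i<m. x i = y i) \<longrightarrow> \<phi> x = \<phi> y) \<and>
     (\<forall>is. set is \<subseteq> {..<m} \<longrightarrow>
        (let \<psi> = foldr coord_deriv is \<phi> in
           continuous_on UNIV \<psi> \<and>
           (\<forall>x. \<forall>i<m. (\<lambda>t. \<psi> (x(i := t))) differentiable (at (x i))) \<and>
           (\<exists>K r. \<forall>x. \<bar>\<psi> x\<bar> \<le> K * (1 + (\<Sum>i<m. \<bar>x i\<bar>)) ^ r)))}"

definition smooth_with_derivative ::
  "('h::real_inner \<Rightarrow> 'a \<Rightarrow> real) \<Rightarrow> ('a \<Rightarrow> real) \<Rightarrow> ('a \<Rightarrow> 'h) \<Rightarrow> bool" where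
  "smooth_with_derivative X F U \<longleftrightarrow>
     (\<exists>m \<phi> (h :: nat \<Rightarrow> 'h). \<phi> \<in> smooth_poly_growth m \<and>
        F = (\<lambda>\<omega>. \<phi> (\<lambda>i. X (h i) \<omega>)) \<and>
        U = (\<lambda>\<omega>. \<Sum>i<m. coord_deriv i \<phi> (\<lambda>i. X (h i) \<omega>) *\<^sub>R h i))"

text \<open>The Malliavin derivative is the closure, in the square-integrable sense, of its restriction to
  smooth cylindrical random variables.  \<open>malliavin_D\<close>, \<open>chaos_proj\<close> and \<open>OU_inv\<close> choose a version
  of operators whose values are determined almost surely; outside the domain of the
  operator the chosen value is meaningless.\<close>

definition has_malliavin_derivative ::
  "'a measure \<Rightarrow> ('h::{real_inner, banach, second_countable_topology} \<Rightarrow> 'a \<Rightarrow> real) \<Rightarrow>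
   ('a \<Rightarrow> real) \<Rightarrow> ('a \<Rightarrow> 'h) \<Rightarrow> bool" where
  "has_malliavin_derivative M X F U \<longleftrightarrow>
     (\<exists>Fs Us. (\<forall>m. smooth_with_derivative X (Fs m) (Us m)) \<and>
        L2_tendsto M Fs F \<and> L2_tendsto M Us U)"

definition malliavin_D ::
  "'a measure \<Rightarrow> ('h::{real_inner, banach, second_countable_topology} \<Rightarrow> 'a \<Rightarrow> real) \<Rightarrow>
   ('a \<Rightarrow> real) \<Rightarrow> 'a \<Rightarrow> 'h" where
  "malliavin_D M X F = (SOME U. has_malliavin_derivative M X F U)"

definition chaos_proj ::
  "'a measure \<Rightarrow> ('h::real_inner \<Rightarrow> 'a \<Rightarrow> real) \<Rightarrow> nat \<Rightarrow> ('a \<Rightarrow> real) \<Rightarrow> 'a \<Rightarrow> real" where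
  "chaos_proj M X q F = (SOME G. G \<in> wiener_chaos M X q \<and>
     (\<forall>K \<in> wiener_chaos M X q. (\<integral>\<omega>. (F \<omega> - G \<omega>) * K \<omega> \<partial>M) = 0))"

definition OU_inv ::
  "'a measure \<Rightarrow> ('h::real_inner \<Rightarrow> 'a \<Rightarrow> real) \<Rightarrow> ('a \<Rightarrow> real) \<Rightarrow> 'a \<Rightarrow> real" where
  "OU_inv M X F = (SOME G.
     L2_tendsto M (\<lambda>m \<omega>. \<Sum>q=1..m. - (1 / real q) * chaos_proj M X q F \<omega>) G)"


section \<open>The quantities attached to a random vector\<close>

definition Gam ::
  "'a measure \<Rightarrow> ('h::{real_inner, banach, second_countable_topology} \<Rightarrow> 'a \<Rightarrow> real) \<Rightarrow>
   ('a \<Rightarrow> real^'d) \<Rightarrow> 'd \<Rightarrow> 'd \<Rightarrow> 'a \<Rightarrow> real" where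
  "Gam M X F i j = (\<lambda>\<omega>. malliavin_D M X (\<lambda>\<omega>. F \<omega> $ i) \<omega> \<bullet>
                         (- malliavin_D M X (OU_inv M X (\<lambda>\<omega>. F \<omega> $ j)) \<omega>))"

text \<open>Where the variance vanishes, \<open>Gam_normalized\<close> is \<open>0\<close> by the convention \<open>x / 0 = 0\<close>.\<close>

definition Gam_normalized ::
  "'a measure \<Rightarrow> ('h::{real_inner, banach, second_countable_topology} \<Rightarrow> 'a \<Rightarrow> real) \<Rightarrow>
   ('a \<Rightarrow> real^'d) \<Rightarrow> 'd \<Rightarrow> 'd \<Rightarrow> 'a \<Rightarrow> real" where
  "Gam_normalized M X F i j = (\<lambda>\<omega>.
     (Gam M X F i j \<omega> - prob_space.expectation M (Gam M X F i j)) /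
     sqrt (prob_space.variance M (Gam M X F i j)))"

definition moment2 :: "'a measure \<Rightarrow> ('a \<Rightarrow> real^'d) \<Rightarrow> 'd \<Rightarrow> 'd \<Rightarrow> real" where
  "moment2 M F i j = (\<integral>\<omega>. F \<omega> $ i * F \<omega> $ j \<partial>M)"

definition moment3 :: "'a measure \<Rightarrow> ('a \<Rightarrow> real^'d) \<Rightarrow> 'd \<Rightarrow> 'd \<Rightarrow> 'd \<Rightarrow> real" where
  "moment3 M F i j k = (\<integral>\<omega>. F \<omega> $ i * F \<omega> $ j * F \<omega> $ k \<partial>M)"

definition Delta_Gam ::
  "'a measure \<Rightarrow> ('h::{real_inner, banach, second_countable_topology} \<Rightarrow> 'a \<Rightarrow> real) \<Rightarrow>
   ('a \<Rightarrow> real^'d) \<Rightarrow> real" where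
  "Delta_Gam M X F = sqrt (\<Sum>i\<in>UNIV. \<Sum>j\<in>UNIV. prob_space.variance M (Gam M X F i j))"

definition Delta_C :: "'a measure \<Rightarrow> ('a \<Rightarrow> real^'d) \<Rightarrow> real^'d^'d \<Rightarrow> real" where
  "Delta_C M F C = sqrt (\<Sum>i\<in>UNIV. \<Sum>j\<in>UNIV. (moment2 M F i j - C $ i $ j)\<^sup>2)"

definition phi_C ::
  "'a measure \<Rightarrow> ('h::{real_inner, banach, second_countable_topology} \<Rightarrow> 'a \<Rightarrow> real) \<Rightarrow>
   ('a \<Rightarrow> real^'d) \<Rightarrow> real^'d^'d \<Rightarrow> real" where
  "phi_C M X F C = Delta_Gam M X F + Delta_C M F C"


section \<open>Test functions and Edgeworth expansions\<close>

definition partial :: "'d \<Rightarrow> (real^'d \<Rightarrow> real) \<Rightarrow> real^'d \<Rightarrow> real" where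
  "partial i g x = frechet_derivative g (at x) (axis i 1)"

definition three_times_differentiable :: "(real^'d \<Rightarrow> real) \<Rightarrow> bool" where
  "three_times_differentiable g \<longleftrightarrow>
     (\<forall>x. g differentiable (at x)) \<and>
     (\<forall>i x. partial i g differentiable (at x)) \<and>
     (\<forall>i j x. partial i (partial j g) differentiable (at x))"

definition bounded_derivatives3 :: "(real^'d \<Rightarrow> real) \<Rightarrow> bool" where
  "bounded_derivatives3 g \<longleftrightarrow>
     (\<forall>i. bounded (range (partial i g))) \<and>
     (\<forall>i j. bounded (range (partial i (partial j g)))) \<and>
     (\<forall>i j k. bounded (range (partial i (partial j (partial k g)))))"

text \<open>\<open>edgeworth3_same\<close> is the expansion around a Gaussian vector with the covariance of \<open>F\<close>,
  \<open>edgeworth3\<close> the one around a Gaussian vector with covariance matrix \<open>C\<close>.\<close>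

definition edgeworth3_same ::
  "'a measure \<Rightarrow> ('a \<Rightarrow> real^'d) \<Rightarrow> 'b measure \<Rightarrow> ('b \<Rightarrow> real^'d) \<Rightarrow> (real^'d \<Rightarrow> real) \<Rightarrow> real" where
  "edgeworth3_same M F N Z g =
     (\<integral>\<omega>. g (Z \<omega>) \<partial>N) +
     (\<Sum>i\<in>UNIV. \<Sum>j\<in>UNIV. \<Sum>k\<in>UNIV. moment3 M F i j k / fact 3 *
        (\<integral>\<omega>. partial i (partial j (partial k g)) (Z \<omega>) \<partial>N))"

definition edgeworth3 ::
  "'a measure \<Rightarrow> ('a \<Rightarrow> real^'d) \<Rightarrow> real^'d^'d \<Rightarrow> 'b measure \<Rightarrow> ('b \<Rightarrow> real^'d) \<Rightarrow>
   (real^'d \<Rightarrow> real) \<Rightarrow> real" where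
  "edgeworth3 M F C N Z g =
     (\<integral>\<omega>. g (Z \<omega>) \<partial>N) +
     (\<Sum>i\<in>UNIV. \<Sum>j\<in>UNIV. (moment2 M F i j - C $ i $ j) / 2 *
        (\<integral>\<omega>. partial i (partial j g) (Z \<omega>) \<partial>N)) +
     (\<Sum>i\<in>UNIV. \<Sum>j\<in>UNIV. \<Sum>k\<in>UNIV. moment3 M F i j k / fact 3 *
        (\<integral>\<omega>. partial i (partial j (partial k g)) (Z \<omega>) \<partial>N))"

end

theory Submission
 imports Defs
begin

text \<open>
 Let \<open>Z\<close> be a Gaussian vector with the covariance of \<open>F\<close>, independent of \<open>F\<close>, and put
 \<open>Y \<theta> = sin \<theta> F + cos \<theta> Z\<close>. Differentiating \<open>E g(Y \<theta>)\<close> in \<open>\<theta>\<close> and integrating by parts, with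
 \<open>\<Gamma>\<^sub>i\<^sub>j\<close> as a Stein kernel of \<open>F\<close> and the covariance as one of \<open>Z\<close>, gives
 \<open>E g(F) - E g(Z) = \<integral> sin \<theta> cos \<theta> (\<Sum>i j. E[(\<Gamma>\<^sub>i\<^sub>j - E \<Gamma>\<^sub>i\<^sub>j) \<partial>\<^sub>i\<^sub>j g(Y \<theta>)]) d\<theta>\<close> over \<open>[0, \<pi>/2]\<close>
 (lemma \<open>interpolation_bound\<close>). Write \<open>\<Gamma>\<^sub>i\<^sub>j - E \<Gamma>\<^sub>i\<^sub>j = s\<^sub>i\<^sub>j W\<^sub>i\<^sub>j\<close> with \<open>s\<^sub>i\<^sub>j\<close> the standard deviation.
 If \<open>(F, W\<^sub>i\<^sub>j)\<close> is asymptotically close to normal, then \<open>E[W\<^sub>i\<^sub>j \<partial>\<^sub>i\<^sub>j g(Y \<theta>)]\<close> may be computed, up to an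
 error that vanishes uniformly in \<open>\<theta>\<close>, for a Gaussian pair with the same covariances. Gaussian
 integration by parts then yields \<open>sin \<theta> (\<Sum>k. E[W\<^sub>i\<^sub>j F\<^sub>k] E[\<partial>\<^sub>k\<^sub>i\<^sub>j g(Z)])\<close>, since rotating two
 independent copies of a Gaussian vector does not change the law (\<open>ACN_interpolation_limit\<close>).
 If instead \<open>s\<^sub>i\<^sub>j\<close> is negligible, so is the whole \<open>(i, j)\<close> term, because both expressions stay
 bounded; for the second one this uses that \<open>E[W\<^sub>i\<^sub>j F\<^sub>k] = E[V Z\<^sub>k]\<close> for all \<open>k\<close> with a linear functional \<open>V\<close> of
 \<open>Z\<close> of variance at most one (\<open>D3_contraction_bound\<close>). As \<open>\<integral> sin\<^sup>2 \<theta> cos \<theta> d\<theta> = 1/3\<close> and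
 \<open>E[F\<^sub>i F\<^sub>j F\<^sub>k] = E[\<Gamma>\<^sub>i\<^sub>j F\<^sub>k] + E[\<Gamma>\<^sub>k\<^sub>j F\<^sub>i]\<close>, what remains is the third-order term of the expansion
 (\<open>edgeworth_rate\<close>).

 For a limiting covariance \<open>C\<close> the ratios in the hypothesis add up to at least one, so that some pair
 \<open>(i, j)\<close> is asymptotically close to normal; its Gaussian approximations supply vectors \<open>Z\<^sub>n\<close> with the
 covariance of \<open>F\<^sub>n\<close>. It remains to pass from \<open>Z\<^sub>n\<close> to \<open>Z\<close>. The same interpolation between two Gaussian
 vectors shows that \<open>E g(Z\<^sub>n) - E g(Z)\<close> is the second-order term up to the power \<open>3/2\<close> of the distance of the
 covariances (\<open>gaussian_compare_expansion\<close>). The third derivatives of \<open>g\<close> may be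
 discontinuous, so convergence of the covariances does not by itself give convergence of
 \<open>E \<partial>\<^sub>i\<^sub>j\<^sub>k g(Z\<^sub>n)\<close> if \<open>C\<close> is singular. What converges are the contractions with the covariances \<open>E[W\<^sub>i\<^sub>j F\<^sub>k]\<close>
 that occur here: up to a vanishing part they involve only directions in the range of \<open>C\<close>, along which one
 integrates by parts
 (\<open>D3_contraction_tendsto\<close>).

 On the side of the chaos, \<open>stein_kernel\<close> collects what is needed of \<open>\<Gamma>\<close>, and \<open>chaos_stein_kernel\<close>
 provides it: for finite Hermite sums the integration by parts formula follows from
 that for the isonormal process, and it passes to the limit because mean square convergence in a fixed
 chaos implies convergence of all fourth moments, also of the derivatives
 (\<open>hermite_sum_fourth_moment\<close>).
\<close>

section \<open>Square integrability and mean square convergence\<close>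

lemma sq_integrable_inner:
 fixes U V :: "'a => 'h::{real_inner,banach,second_countable_topology}"
 assumes "sq_integrable M U" "sq_integrable M V"
 shows "integrable M (\<lambda>w. U w \<bullet> V w)"
proof (rule Bochner_Integration.integrable_bound)
 show "integrable M (\<lambda>w. (norm (U w))\<^sup>2 + (norm (V w))\<^sup>2)"
  using assms by (auto simp: sq_integrable_def)
 show "(\<lambda>w. U w \<bullet> V w) \<in> borel_measurable M"
  using assms by (auto simp: sq_integrable_def)
 have "\<bar>u \<bullet> v\<bar> \<le> (norm u)\<^sup>2 + (norm v)\<^sup>2" for u v :: 'h
 proof -
  have "\<bar>u \<bullet> v\<bar> \<le> norm u * norm v" by (rule Cauchy_Schwarz_ineq2)
  also have "\<dots> \<le> (norm u)\<^sup>2 + (norm v)\<^sup>2"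
   using sum_squares_bound[of "norm u" "norm v"] mult_nonneg_nonneg[OF norm_ge_zero[of u] norm_ge_zero[of v]]
   by linarith
  finally show ?thesis .
 qed
 then show "AE x in M. norm (U x \<bullet> V x) \<le> norm ((norm (U x))\<^sup>2 + (norm (V x))\<^sup>2)"
  by (intro AE_I2) (auto intro!: order_trans[OF _ abs_ge_self])
qed

lemma sq_integrable_add:
 fixes U V :: "'a => 'h::{real_inner,banach,second_countable_topology}"
 assumes "sq_integrable M U" "sq_integrable M V"
 shows "sq_integrable M (\<lambda>w. U w + V w)"
proof -
 have "(norm (U w + V w))\<^sup>2 = (norm (U w))\<^sup>2 + 2 * (U w \<bullet> V w) + (norm (V w))\<^sup>2" for w
  by (simp add: power2_norm_eq_inner inner_add_left inner_add_right inner_commute)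
 moreover have "integrable M (\<lambda>w. (norm (U w))\<^sup>2 + 2 * (U w \<bullet> V w) + (norm (V w))\<^sup>2)"
  using assms sq_integrable_inner[OF assms] by (auto simp: sq_integrable_def)
 ultimately show ?thesis using assms by (auto simp: sq_integrable_def)
qed

lemma sq_integrable_scaleR:
 fixes U :: "'a => 'h::{real_inner,banach,second_countable_topology}"
 assumes "sq_integrable M U"
 shows "sq_integrable M (\<lambda>w. c *\<^sub>R U w)"
 using assms by (auto simp: sq_integrable_def power_mult_distrib)

lemma sq_integrable_mult_const:
 assumes "sq_integrable M (U :: 'a => real)"
 shows "sq_integrable M (\<lambda>w. c * U w)"
 using sq_integrable_scaleR[OF assms, of c] by simp

lemma sq_integrable_diff:
 fixes U V :: "'a => 'h::{real_inner,banach,second_countable_topology}"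
 assumes "sq_integrable M U" "sq_integrable M V"
 shows "sq_integrable M (\<lambda>w. U w - V w)"
 using sq_integrable_add[OF assms(1) sq_integrable_scaleR[OF assms(2), of "-1"]] by simp

lemma sq_integrable_sum:
 fixes U :: "'i => 'a => 'h::{real_inner,banach,second_countable_topology}"
 assumes "\<And>i. i \<in> I ==> sq_integrable M (U i)"
 shows "sq_integrable M (\<lambda>w. \<Sum>i\<in>I. U i w)"
 using assms
 by (induction I rule: infinite_finite_induct)
   (auto intro: sq_integrable_add simp: sq_integrable_def[of M "\<lambda>_. 0"])

lemma sq_integrable_mult:
 fixes U V :: "'a => real"
 assumes "sq_integrable M U" "sq_integrable M V"
 shows "integrable M (\<lambda>w. U w * V w)"
 using sq_integrable_inner[OF assms] by simp

lemma (in prob_space) sq_integrable_const: "sq_integrable M (\<lambda>_. c)"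
 by (simp add: sq_integrable_def)

lemma (in prob_space) sq_integrable_integrable:
 fixes U :: "'a => real"
 assumes "sq_integrable M U" shows "integrable M U"
 using sq_integrable_mult[OF assms sq_integrable_const[of 1]] by simp

text \<open>For \<open>c = 0\<close> an affine function is nonnegative everywhere only if it is constant.\<close>

lemma nonneg_quadratic_discriminant:
 fixes a b c :: real
 assumes q: "\<And>t. 0 \<le> a + 2 * t * b + t\<^sup>2 * c" and c0: "0 \<le> c"
 shows "b\<^sup>2 \<le> a * c"
proof (cases "c = 0")
 case True
 have "b = 0"
 proof (rule ccontr)
  assume "b \<noteq> 0"
  have "0 \<le> a + 2 * (-(a + 1) / (2 * b)) * b" using q[of "-(a + 1) / (2 * b)"] True by simp
  then show False using \<open>b \<noteq> 0\<close> by (simp add: field_simps)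
 qed
 then show ?thesis using True by simp
next
 case False
 then have "c > 0" using c0 by simp
 have "0 \<le> a + 2 * (- b / c) * b + (- b / c)\<^sup>2 * c" by (rule q)
 also have "\<dots> = a - b\<^sup>2 / c" using \<open>c > 0\<close> by (simp add: field_simps power2_eq_square)
 finally show ?thesis using \<open>c > 0\<close> by (simp add: field_simps)
qed

lemma integral_inner_Cauchy_Schwarz:
 fixes U V :: "'a => 'h::{real_inner,banach,second_countable_topology}"
 assumes U: "sq_integrable M U" and V: "sq_integrable M V"
 shows "(LINT w|M. U w \<bullet> V w)\<^sup>2 \<le> (LINT w|M. (norm (U w))\<^sup>2) * (LINT w|M. (norm (V w))\<^sup>2)"
proof -
 define a where "a = (LINT w|M. (norm (U w))\<^sup>2)"
 define b where "b = (LINT w|M. U w \<bullet> V w)"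
 define c where "c = (LINT w|M. (norm (V w))\<^sup>2)"
 have q: "0 \<le> a + 2 * t * b + t\<^sup>2 * c" for t
 proof -
  have "0 \<le> (LINT w|M. (norm (U w + t *\<^sub>R V w))\<^sup>2)" by simp
  also have "(\<lambda>w. (norm (U w + t *\<^sub>R V w))\<^sup>2) =
    (\<lambda>w. (norm (U w))\<^sup>2 + 2 * t * (U w \<bullet> V w) + t\<^sup>2 * (norm (V w))\<^sup>2)"
   by (rule ext) (simp add: power2_norm_eq_inner inner_add_left inner_add_right inner_commute
     power2_eq_square[of t])
  also have "(LINT w|M. (norm (U w))\<^sup>2 + 2 * t * (U w \<bullet> V w) + t\<^sup>2 * (norm (V w))\<^sup>2) = a + 2 * t * b + t\<^sup>2 * c"
   using U V sq_integrable_inner[OF U V] by (simp add: a_def b_def c_def sq_integrable_def)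
  finally show ?thesis .
 qed
 have "b\<^sup>2 \<le> a * c" by (rule nonneg_quadratic_discriminant[OF q]) (simp add: c_def)
 then show ?thesis by (simp add: a_def b_def c_def)
qed

lemma integral_mult_Cauchy_Schwarz:
 fixes U V :: "'a => real"
 assumes "sq_integrable M U" "sq_integrable M V"
 shows "(LINT w|M. U w * V w)\<^sup>2 \<le> (LINT w|M. (U w)\<^sup>2) * (LINT w|M. (V w)\<^sup>2)"
 using integral_inner_Cauchy_Schwarz[OF assms] by simp

lemma abs_integral_mult_le:
 fixes U V :: "'a => real"
 assumes "sq_integrable M U" "sq_integrable M V"
 shows "\<bar>LINT w|M. U w * V w\<bar> \<le> sqrt (LINT w|M. (U w)\<^sup>2) * sqrt (LINT w|M. (V w)\<^sup>2)"
 using real_sqrt_le_mono[OF integral_mult_Cauchy_Schwarz[OF assms]] by (simp add: real_sqrt_mult)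

lemma L2_tendstoD:
 assumes "L2_tendsto M Us U"
 shows "sq_integrable M (Us m)" "sq_integrable M U"
  "(\<lambda>m. LINT w|M. (norm (Us m w - U w))\<^sup>2) \<longlonglongrightarrow> 0"
 using assms by (auto simp: L2_tendsto_def)

lemma L2_tendsto_inner_zero:
 fixes Us :: "nat => 'a => 'h::{real_inner,banach,second_countable_topology}"
 assumes U: "\<And>m. sq_integrable M (Us m)" and V: "\<And>m. sq_integrable M (Vs m)"
  and lim: "(\<lambda>m. LINT w|M. (norm (Us m w))\<^sup>2) \<longlonglongrightarrow> 0"
  and bd: "\<And>m. (LINT w|M. (norm (Vs m w))\<^sup>2) \<le> K"
 shows "(\<lambda>m. LINT w|M. Us m w \<bullet> Vs m w) \<longlonglongrightarrow> 0"
proof -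
 have "(LINT w|M. Us m w \<bullet> Vs m w)\<^sup>2 \<le> (LINT w|M. (norm (Us m w))\<^sup>2) * K" for m
  by (rule order_trans[OF integral_inner_Cauchy_Schwarz[OF U V]])
    (intro mult_left_mono bd, simp)
 moreover have "(\<lambda>m. (LINT w|M. (norm (Us m w))\<^sup>2) * K) \<longlonglongrightarrow> 0 * K"
  by (intro tendsto_intros lim)
 ultimately have "(\<lambda>m. (LINT w|M. Us m w \<bullet> Vs m w)\<^sup>2) \<longlonglongrightarrow> 0"
  using tendsto_sandwich[OF always_eventually always_eventually tendsto_const, rule_format,
    of 0 "\<lambda>m. (LINT w|M. Us m w \<bullet> Vs m w)\<^sup>2" "\<lambda>m. (LINT w|M. (norm (Us m w))\<^sup>2) * K"]
  by (simp only: mult_zero_left zero_le_power2)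
 from tendsto_real_sqrt[OF this] show ?thesis by (simp add: tendsto_rabs_zero_iff)
qed

lemma L2_tendsto_inner:
 fixes Us :: "nat => 'a => 'h::{real_inner,banach,second_countable_topology}"
 assumes U: "L2_tendsto M Us U" and V: "L2_tendsto M Vs V"
 shows "(\<lambda>m. LINT w|M. Us m w \<bullet> Vs m w) \<longlonglongrightarrow> (LINT w|M. U w \<bullet> V w)"
proof -
 note u = L2_tendstoD[OF U] and v = L2_tendstoD[OF V]
 note dU = sq_integrable_diff[OF u(1,2)] and dV = sq_integrable_diff[OF v(1,2)]
 obtain K where K: "\<And>m. (LINT w|M. (norm (Vs m w - V w))\<^sup>2) \<le> K"
  using convergent_imp_Bseq[OF convergentI[OF v(3)]] unfolding Bseq_def real_norm_def
  by (meson abs_le_D1)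
 have 1: "(\<lambda>m. LINT w|M. (Us m w - U w) \<bullet> (Vs m w - V w)) \<longlonglongrightarrow> 0"
  by (rule L2_tendsto_inner_zero[OF dU dV u(3) K])
 have 2: "(\<lambda>m. LINT w|M. (Us m w - U w) \<bullet> V w) \<longlonglongrightarrow> 0"
  by (rule L2_tendsto_inner_zero[OF dU v(2) u(3) order_refl])
 have 3: "(\<lambda>m. LINT w|M. (Vs m w - V w) \<bullet> U w) \<longlonglongrightarrow> 0"
  by (rule L2_tendsto_inner_zero[OF dV u(2) v(3) order_refl])
 have "(LINT w|M. Us m w \<bullet> Vs m w) = (LINT w|M. (Us m w - U w) \<bullet> (Vs m w - V w))
   + (LINT w|M. (Us m w - U w) \<bullet> V w) + (LINT w|M. (Vs m w - V w) \<bullet> U w) + (LINT w|M. U w \<bullet> V w)" for m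
 proof -
  have "(\<lambda>w. Us m w \<bullet> Vs m w) = (\<lambda>w. (Us m w - U w) \<bullet> (Vs m w - V w)
    + (Us m w - U w) \<bullet> V w + (Vs m w - V w) \<bullet> U w + U w \<bullet> V w)"
   by (rule ext) (simp add: inner_diff_left inner_diff_right inner_commute)
  then show ?thesis
   using sq_integrable_inner[OF dU dV, of m m] sq_integrable_inner[OF dU v(2), of m]
    sq_integrable_inner[OF dV u(2), of m] sq_integrable_inner[OF u(2) v(2)] by simp
 qed
 then show ?thesis using tendsto_add[OF tendsto_add[OF tendsto_add[OF 1 2] 3] tendsto_const] by simp
qed

lemma L2_tendsto_const: "sq_integrable M U ==> L2_tendsto M (\<lambda>_. U) U"
 by (simp add: L2_tendsto_def)

lemma L2_tendsto_integral_mult: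
 fixes Us :: "nat => 'a => real"
 assumes "L2_tendsto M Us U" "L2_tendsto M Vs V"
 shows "(\<lambda>m. LINT w|M. Us m w * Vs m w) \<longlonglongrightarrow> (LINT w|M. U w * V w)"
 using L2_tendsto_inner[OF assms] by simp

lemma L2_tendsto_cong_AE:
 assumes "L2_tendsto M Us U" "AE x in M. U x = V x" "V \<in> borel_measurable M"
 shows "L2_tendsto M Us V"
proof -
 note u = L2_tendstoD[OF assms(1)]
 have [measurable]: "U \<in> borel_measurable M" "\<And>m. Us m \<in> borel_measurable M" "V \<in> borel_measurable M"
  using u(1,2) assms(3) unfolding sq_integrable_def by blast+
 have "(LINT w|M. (norm (Us m w - V w))\<^sup>2) = (LINT w|M. (norm (Us m w - U w))\<^sup>2)" for m
  by (rule integral_cong_AE, measurable) (use assms(2) in \<open>eventually_elim, simp\<close>)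
 moreover have "integrable M (\<lambda>x. (norm (V x))\<^sup>2) \<longleftrightarrow> integrable M (\<lambda>x. (norm (U x))\<^sup>2)"
  by (rule integrable_cong_AE, measurable) (use assms(2) in \<open>eventually_elim, simp\<close>)
 ultimately show ?thesis using u assms(3) by (simp add: L2_tendsto_def sq_integrable_def)
qed

lemma L2_tendsto_unique:
 fixes U :: "'a => 'h::{real_inner,banach,second_countable_topology}"
 assumes U: "L2_tendsto M Us U" and V: "L2_tendsto M Us V"
 shows "AE x in M. U x = V x"
proof -
 note u = L2_tendstoD[OF U] and v = L2_tendstoD[OF V]
 have "L2_tendsto M (\<lambda>m w. U w - Us m w) (\<lambda>_. 0)"
  using u sq_integrable_diff[OF u(2,1)]
  by (auto simp: L2_tendsto_def sq_integrable_def norm_minus_commute)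
 moreover have "sq_integrable M (\<lambda>w. U w - V w)" by (intro sq_integrable_diff u v)
 ultimately have 1: "(\<lambda>m. LINT w|M. (U w - Us m w) \<bullet> (U w - V w)) \<longlonglongrightarrow> 0"
  using L2_tendsto_inner[OF _ L2_tendsto_const] by fastforce
 have "L2_tendsto M (\<lambda>m w. Us m w - V w) (\<lambda>_. 0)"
  using v sq_integrable_diff[OF v(1,2)]
  by (auto simp: L2_tendsto_def sq_integrable_def)
 with \<open>sq_integrable M (\<lambda>w. U w - V w)\<close>
 have 2: "(\<lambda>m. LINT w|M. (Us m w - V w) \<bullet> (U w - V w)) \<longlonglongrightarrow> 0"
  using L2_tendsto_inner[OF _ L2_tendsto_const] by fastforce
 have "(LINT w|M. (U w - Us m w) \<bullet> (U w - V w)) + (LINT w|M. (Us m w - V w) \<bullet> (U w - V w))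
   = (LINT w|M. (norm (U w - V w))\<^sup>2)" for m
 proof -
  have eq: "(\<lambda>w. (norm (U w - V w))\<^sup>2) = (\<lambda>w. (U w - Us m w) \<bullet> (U w - V w) + (Us m w - V w) \<bullet> (U w - V w))"
   by (rule ext) (simp add: power2_norm_eq_inner inner_add_left[symmetric])
  show ?thesis unfolding eq
   using sq_integrable_inner[OF sq_integrable_diff[OF u(2,1)] sq_integrable_diff[OF u(2) v(2)], of m]
    sq_integrable_inner[OF sq_integrable_diff[OF v(1,2)] sq_integrable_diff[OF u(2) v(2)], of m]
   by (subst Bochner_Integration.integral_add) auto
 qed
 with tendsto_add[OF 1 2] have "(LINT w|M. (norm (U w - V w))\<^sup>2) = 0"
  by (simp add: LIMSEQ_const_iff)
 then have "AE x in M. (norm (U x - V x))\<^sup>2 = 0"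
  using sq_integrable_diff[OF u(2) v(2)]
  by (subst (asm) integral_nonneg_eq_0_iff_AE) (auto simp: sq_integrable_def)
 then show ?thesis by simp
qed

lemma L2_tendsto_AE_subseq:
 assumes "L2_tendsto M Us U"
 shows "\<exists>r. strict_mono r \<and> (AE x in M. (\<lambda>m. Us (r m) x) \<longlonglongrightarrow> U x)"
proof -
 have [measurable]: "U \<in> borel_measurable M" "\<And>m. Us m \<in> borel_measurable M"
  using assms by (auto simp: L2_tendsto_def sq_integrable_def)
 have int: "integrable M (\<lambda>x. (norm (Us m x - U x))\<^sup>2)" for m
 proof (rule Bochner_Integration.integrable_bound)
  show "integrable M (\<lambda>x. 2 * (norm (Us m x))\<^sup>2 + 2 * (norm (U x))\<^sup>2)"
   using assms by (auto simp: L2_tendsto_def sq_integrable_def)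
  have "(norm (a - b))\<^sup>2 \<le> 2 * (norm a)\<^sup>2 + 2 * (norm b)\<^sup>2" for a b :: 'b
  proof -
   have "(norm (a - b))\<^sup>2 \<le> (norm a + norm b)\<^sup>2"
    by (intro power_mono norm_triangle_ineq4) simp
   then show ?thesis using sum_squares_bound[of "norm a" "norm b"] by (simp add: power2_sum)
  qed
  then show "AE x in M. norm ((norm (Us m x - U x))\<^sup>2) \<le> norm (2 * (norm (Us m x))\<^sup>2 + 2 * (norm (U x))\<^sup>2)"
   by (intro AE_I2) (simp add: order_trans[OF _ abs_ge_self])
 qed simp
 have "(\<lambda>m. LINT x|M. norm ((norm (Us m x - U x))\<^sup>2)) \<longlonglongrightarrow> 0" using assms by (simp add: L2_tendsto_def)
 from tendsto_L1_AE_subseq[OF int this] obtain r where r: "strict_mono r"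
  "AE x in M. (\<lambda>n. (norm (Us (r n) x - U x))\<^sup>2) \<longlonglongrightarrow> 0" by blast
 have "AE x in M. (\<lambda>m. Us (r m) x) \<longlonglongrightarrow> U x"
  using r(2)
 proof eventually_elim
  case (elim x)
  from tendsto_real_sqrt[OF this] have "(\<lambda>n. norm (Us (r n) x - U x)) \<longlonglongrightarrow> 0" by simp
  then show ?case by (simp add: LIM_zero_iff tendsto_norm_zero_iff)
 qed
 with r(1) show ?thesis by blast
qed

text \<open>Fatou's lemma in Bochner form: the bound on the integrals also yields integrability of the limit.\<close>

lemma integral_Fatou:
 fixes f :: "nat => 'a => real"
 assumes f: "\<And>m. integrable M (f m)" "\<And>m x. 0 \<le> f m x" and K: "\<And>m. (LINT x|M. f m x) \<le> K"
  and g[measurable]: "g \<in> borel_measurable M" and lim: "AE x in M. (\<lambda>m. f m x) \<longlonglongrightarrow> g x"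
 shows "integrable M g" "(LINT x|M. g x) \<le> K"
proof -
 have [measurable]: "\<And>m. f m \<in> borel_measurable M" using f(1) by auto
 have g0: "AE x in M. 0 \<le> g x" using lim
  by eventually_elim (rule LIMSEQ_le_const, use f(2) in auto)
 have K0: "0 \<le> K" by (rule order_trans[OF _ K[of 0]]) (simp add: f(2))
 have "(\<integral>\<^sup>+x. ennreal (g x) \<partial>M) = (\<integral>\<^sup>+x. liminf (\<lambda>m. ennreal (f m x)) \<partial>M)"
  by (rule nn_integral_cong_AE)
    (use lim in eventually_elim, auto intro!: lim_imp_Liminf[symmetric] tendsto_ennrealI)
 also have "\<dots> \<le> liminf (\<lambda>m. \<integral>\<^sup>+x. ennreal (f m x) \<partial>M)"
  by (rule nn_integral_liminf) simp
 also have "\<dots> \<le> ennreal K"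
  by (intro Liminf_le always_eventually allI)
    (auto simp: nn_integral_eq_integral f K intro!: ennreal_leI)
 finally have *: "(\<integral>\<^sup>+x. ennreal (g x) \<partial>M) \<le> ennreal K" .
 show int: "integrable M g"
  by (rule integrableI_nonneg[OF g g0]) (use le_less_trans[OF * ennreal_less_top] in simp)
 show "(LINT x|M. g x) \<le> K"
  using * K0 by (simp add: nn_integral_eq_integral[OF int g0])
qed

text \<open>Riesz--Fischer for Hilbert space valued maps: the limit is the pointwise limit along a subsequence that is
 almost everywhere Cauchy, and Fatou's lemma turns the pointwise limit into a mean square one.\<close>

lemma (in prob_space) L2_complete:
 fixes Us :: "nat => 'a => 'h::{real_inner,banach,second_countable_topology}"
 assumes sq: "\<And>m. sq_integrable M (Us m)"
  and Cauchy: "\<And>e. e > 0 ==> \<exists>N. \<forall>i\<ge>N. \<forall>j\<ge>N. (LINT w|M. (norm (Us i w - Us j w))\<^sup>2) < e"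
 shows "\<exists>U. L2_tendsto M Us U"
proof -
 have [measurable]: "Us m \<in> borel_measurable M" for m using sq by (auto simp: sq_integrable_def)
 have sqd: "sq_integrable M (\<lambda>w. Us i w - Us j w)" for i j by (intro sq_integrable_diff sq)
 have sqn: "sq_integrable M (\<lambda>w. norm (Us i w))" for i
  using sq[of i] by (auto simp: sq_integrable_def)
 have sqdn: "sq_integrable M (\<lambda>w. norm (Us i w - Us j w))" for i j
  using sqd[of i j] by (auto simp: sq_integrable_def)
 have int: "integrable M (Us m)" for m
  using sq_integrable_integrable[OF sqn[of m]] by (subst (asm) integrable_norm_iff) auto
 have "\<exists>N. \<forall>i\<ge>N. \<forall>j\<ge>N. (LINT x|M. norm (Us i x - Us j x)) < e" if "e > 0" for e
 proof -
  obtain N where N: "\<forall>i\<ge>N. \<forall>j\<ge>N. (LINT w|M. (norm (Us i w - Us j w))\<^sup>2) < e\<^sup>2"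
   using Cauchy[of "e\<^sup>2"] \<open>e > 0\<close> by auto
  have "(LINT x|M. norm (Us i x - Us j x)) < e" if "i \<ge> N" "j \<ge> N" for i j
  proof -
   have "(LINT x|M. norm (Us i x - Us j x))\<^sup>2 \<le> (LINT x|M. (norm (Us i x - Us j x))\<^sup>2)"
    using integral_mult_Cauchy_Schwarz[OF sqdn[of i j] sq_integrable_const[of 1]]
    by (simp add: prob_space)
   also have "\<dots> < e\<^sup>2" using N that by blast
   finally show ?thesis using \<open>e > 0\<close> by (simp add: power2_less_imp_less)
  qed
  then show ?thesis by blast
 qed
 from cauchy_L1_AE_cauchy_subseq[OF int this]
 obtain r where r: "strict_mono r" "AE x in M. Cauchy (\<lambda>i. Us (r i) x)" by blast
 define U where "U x = (if Cauchy (\<lambda>i. Us (r i) x) then lim (\<lambda>i. Us (r i) x) else 0)" for x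
 have [measurable]: "U \<in> borel_measurable M" unfolding U_def by measurable
 have conv: "AE x in M. (\<lambda>i. Us (r i) x) \<longlonglongrightarrow> U x"
  using r(2) by eventually_elim (auto simp: U_def convergent_LIMSEQ_iff[symmetric] Cauchy_convergent)
 have key: "integrable M (\<lambda>x. (norm (Us i x - U x))\<^sup>2) \<and> (LINT x|M. (norm (Us i x - U x))\<^sup>2) \<le> e"
  if N: "\<forall>i\<ge>N. \<forall>j\<ge>N. (LINT w|M. (norm (Us i w - Us j w))\<^sup>2) < e" and i: "i \<ge> N" for i N e
 proof -
  have b: "(LINT x|M. (norm (Us i x - Us (r (m + N)) x))\<^sup>2) \<le> e" for m
  proof -
   have "m + N \<le> r (m + N)" by (rule seq_suble[OF r(1)])
   then show ?thesis using N i by (simp add: less_imp_le)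
  qed
  have c: "AE x in M. (\<lambda>m. (norm (Us i x - Us (r (m + N)) x))\<^sup>2) \<longlonglongrightarrow> (norm (Us i x - U x))\<^sup>2"
   using conv by eventually_elim (intro tendsto_intros LIMSEQ_ignore_initial_segment, assumption)
  have a: "integrable M (\<lambda>x. (norm (Us i x - Us (r (m + N)) x))\<^sup>2)" for m
   using sqd by (auto simp: sq_integrable_def)
  show ?thesis using integral_Fatou[OF a _ b _ c] by auto
 qed
 obtain N1 where N1: "\<forall>i\<ge>N1. \<forall>j\<ge>N1. (LINT w|M. (norm (Us i w - Us j w))\<^sup>2) < 1"
  using Cauchy[of 1] by auto
 have "sq_integrable M (\<lambda>x. Us N1 x - U x)"
  using key[OF N1 order_refl] by (auto simp: sq_integrable_def)
 from sq_integrable_diff[OF sq[of N1] this] have sU: "sq_integrable M U" by simp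
 have "(\<lambda>m. LINT w|M. (norm (Us m w - U w))\<^sup>2) \<longlonglongrightarrow> 0"
 proof (rule LIMSEQ_I)
  fix e :: real assume "e > 0"
  then obtain N where N: "\<forall>i\<ge>N. \<forall>j\<ge>N. (LINT w|M. (norm (Us i w - Us j w))\<^sup>2) < e/2"
   using Cauchy[of "e/2"] by auto
  have "norm ((LINT w|M. (norm (Us m w - U w))\<^sup>2) - 0) < e" if "m \<ge> N" for m
   using key[OF N that] \<open>e > 0\<close> by simp
  then show "\<exists>no. \<forall>n\<ge>no. norm ((LINT w|M. (norm (Us n w - U w))\<^sup>2) - 0) < e" by blast
 qed
 with sq sU show ?thesis by (auto simp: L2_tendsto_def)
qed

section \<open>Joint laws and characteristic functions\<close>

text \<open>After normalisation the weights are densities of probability measures, to which the one-dimensional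
 uniqueness theorem applies.\<close>

lemma weighted_char_unique:
 fixes Y :: "'a => real" and Y' :: "'b => real"
 assumes "finite_measure A" "finite_measure B"
  and [measurable]: "Y \<in> borel_measurable A" "w \<in> borel_measurable A"
   "Y' \<in> borel_measurable B" "w' \<in> borel_measurable B"
  and w: "\<And>x. 0 \<le> w x" "\<And>x. w x \<le> K" and w': "\<And>x. 0 \<le> w' x" "\<And>x. w' x \<le> K"
  and eq: "\<And>s. (CLINT x|A. complex_of_real (w x) * iexp (s * Y x)) =
         (CLINT x|B. complex_of_real (w' x) * iexp (s * Y' x))"
  and S[measurable]: "S \<in> sets borel"
 shows "(LINT x|A. w x * indicator S (Y x)) = (LINT x|B. w' x * indicator S (Y' x))"
proof -
 interpret A: finite_measure A by fact
 interpret B: finite_measure B by fact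
 have iw: "integrable A w" by (rule A.integrable_const_bound[where B=K]) (use w in auto)
 have iw': "integrable B w'" by (rule B.integrable_const_bound[where B=K]) (use w' in auto)
 define c where "c = (LINT x|A. w x)"
 have c': "c = (LINT x|B. w' x)" using eq[of 0] by (simp add: c_def)
 have c0: "0 \<le> c" using w by (simp add: c_def)
 show ?thesis
 proof (cases "c = 0")
  case True
  have "AE x in A. w x = 0" using True w integral_nonneg_eq_0_iff_AE[OF iw] by (simp add: c_def)
  then have 1: "(LINT x|A. w x * indicator S (Y x)) = 0"
   by (intro integral_eq_zero_AE) auto
  have "AE x in B. w' x = 0" using True w' integral_nonneg_eq_0_iff_AE[OF iw'] by (simp add: c')
  then have 2: "(LINT x|B. w' x * indicator S (Y' x)) = 0"
   by (intro integral_eq_zero_AE) auto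
  show ?thesis using 1 2 by simp
 next
  case False
  with c0 have c: "c > 0" by simp
  have real: "real_distribution (distr (density D (\<lambda>x. ennreal (v x / c))) borel V)"
   and char: "char (distr (density D (\<lambda>x. ennreal (v x / c))) borel V) s =
     (CLINT x|D. complex_of_real (v x) * iexp (s * V x)) / c"
   and meas: "measure (distr (density D (\<lambda>x. ennreal (v x / c))) borel V) S =
     (LINT x|D. v x * indicator S (V x)) / c"
   if D: "finite_measure D" and v: "\<And>x. 0 \<le> v x" "integrable D v" "(LINT x|D. v x) = c"
    and [measurable]: "V \<in> borel_measurable D" "v \<in> borel_measurable D"
   for v V :: "'c => real" and D s
  proof -
   let ?D = "density D (\<lambda>x. ennreal (v x / c))"
   have "emeasure ?D (space ?D) = (\<integral>\<^sup>+x. ennreal (v x / c) \<partial>D)"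
    by (simp add: emeasure_density cong: nn_integral_cong)
   also have "\<dots> = ennreal (LINT x|D. v x / c)"
    by (rule nn_integral_eq_integral) (use v c in auto)
   also have "\<dots> = 1" using v c by simp
   finally have P: "prob_space ?D" by (rule prob_spaceI)
   then show R: "real_distribution (distr ?D borel V)"
    by (intro prob_space.real_distribution_distr) auto
   show "char (distr ?D borel V) s = (CLINT x|D. complex_of_real (v x) * iexp (s * V x)) / c"
    unfolding char_def using v c
    by (subst integral_distr) (auto simp: integral_density scaleR_conv_of_real mult.commute
      simp flip: integral_divide_zero)
   have "measure (distr ?D borel V) S = (LINT x|?D. indicator S (V x))"
    using integral_distr[of V ?D borel "indicator S :: real => real"]
    by (simp add: space_borel)
   also have "\<dots> = (LINT x|D. v x * indicator S (V x)) / c"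
    using v c by (subst integral_density) (auto simp flip: integral_divide_zero)
   finally show "measure (distr ?D borel V) S = (LINT x|D. v x * indicator S (V x)) / c" .
  qed
  have "char (distr (density A (\<lambda>x. ennreal (w x / c))) borel Y) s =
    char (distr (density B (\<lambda>x. ennreal (w' x / c))) borel Y') s" for s
   using char[OF assms(1) w(1) iw _ assms(3,4), of s] char[OF assms(2) w'(1) iw' _ assms(5,6), of s] eq[of s]
   by (simp add: c_def flip: c')
  then have "distr (density A (\<lambda>x. ennreal (w x / c))) borel Y = distr (density B (\<lambda>x. ennreal (w' x / c))) borel Y'"
   using iw iw' w w' c'
   by (intro Levy_uniqueness real[OF assms(1)] real[OF assms(2)] ext) (auto simp: c_def)
  then have "(LINT x|A. w x * indicator S (Y x)) / c = (LINT x|B. w' x * indicator S (Y' x)) / c"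
   using meas[OF assms(1), of w Y] meas[OF assms(2), of w' Y'] iw iw' w w' c'
   by (simp add: c_def)
  then show ?thesis using c by simp
 qed
qed

lemma (in finite_measure) integrable_bounded_complex:
 assumes "f \<in> borel_measurable M" "\<And>x. cmod (f x) \<le> K"
 shows "integrable M f"
 by (rule integrable_const_bound[where B=K]) (use assms in auto)

lemma integral_combination3:
 fixes f g h :: "'a => complex"
 assumes "integrable M f" "integrable M g" "integrable M h"
 shows "(LINT x|M. f x + c * g x + d * h x) = (LINT x|M. f x) + c * (LINT x|M. g x) + d * (LINT x|M. h x)"
 using assms by simp

text \<open>Trades frequencies for indicators one coordinate at a time. One-dimensional uniqueness needs nonnegative weights,
 whereas the other coordinates contribute the complex factor \<open>exp (i T)\<close>; the nonnegative weights
 \<open>1\<close>, \<open>1 + cos T\<close> and \<open>1 + sin T\<close> recover it.\<close>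

lemma joint_char_indicator:
 fixes Y :: "'i => 'a => real" and Y' :: "'i => 'b => real"
 assumes A: "finite_measure A" and B: "finite_measure B" and I: "finite I"
  and Y: "\<And>i. i \<in> I ==> Y i \<in> borel_measurable A"
  and Y': "\<And>i. i \<in> I ==> Y' i \<in> borel_measurable B"
  and eq: "\<And>u. (CLINT v|A. iexp (\<Sum>i\<in>I. u i * Y i v)) = (CLINT v|B. iexp (\<Sum>i\<in>I. u i * Y' i v))"
  and J: "finite J" "J \<subseteq> I" and S: "\<And>j. j \<in> J ==> S j \<in> sets borel"
 shows "(CLINT v|A. complex_of_real (\<Prod>j\<in>J. indicator (S j) (Y j v)) * iexp (\<Sum>i\<in>I-J. u i * Y i v)) =
     (CLINT v|B. complex_of_real (\<Prod>j\<in>J. indicator (S j) (Y' j v)) * iexp (\<Sum>i\<in>I-J. u i * Y' i v))"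
 using J S
proof (induction J arbitrary: u rule: finite_induct)
 case empty
 then show ?case using eq[of u] by simp
next
 case (insert j J)
 interpret A: finite_measure A by fact
 interpret B: finite_measure B by fact
 have jI: "j \<in> I" and JI: "J \<subseteq> I" and Sj[measurable]: "S j \<in> sets borel" using insert by auto
 have IH: "(CLINT v|A. complex_of_real (\<Prod>j\<in>J. indicator (S j) (Y j v)) * iexp (\<Sum>i\<in>I-J. u i * Y i v)) =
     (CLINT v|B. complex_of_real (\<Prod>j\<in>J. indicator (S j) (Y' j v)) * iexp (\<Sum>i\<in>I-J. u i * Y' i v))" for u
  using insert by auto
 define w where "w v = (\<Prod>j\<in>J. indicator (S j) (Y j v) :: real)" for v
 define w' where "w' v = (\<Prod>j\<in>J. indicator (S j) (Y' j v) :: real)" for v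
 define T where "T v = (\<Sum>i\<in>I-insert j J. u i * Y i v)" for v
 define T' where "T' v = (\<Sum>i\<in>I-insert j J. u i * Y' i v)" for v
 have YJ: "\<And>i. i \<in> J ==> Y i \<in> borel_measurable A" "\<And>i. i \<in> J ==> Y' i \<in> borel_measurable B"
  using Y Y' JI by auto
 have [measurable]: "Y j \<in> borel_measurable A" "Y' j \<in> borel_measurable B" using Y Y' jI by auto
 have [measurable]: "w \<in> borel_measurable A" "w' \<in> borel_measurable B"
  unfolding w_def w'_def using YJ insert.prems
  by (auto intro!: borel_measurable_prod measurable_compose[OF _ borel_measurable_indicator])
 have [measurable]: "T \<in> borel_measurable A" "T' \<in> borel_measurable B"
  unfolding T_def T'_def using Y Y' by (auto intro!: borel_measurable_sum borel_measurable_times)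
 have w: "0 \<le> w x" "w x \<le> 1" for x unfolding w_def by (auto intro!: prod_nonneg prod_le_1)
 have w': "0 \<le> w' x" "w' x \<le> 1" for x unfolding w'_def by (auto intro!: prod_nonneg prod_le_1)
 \<comment> \<open>used for \<open>r\<close> equal to \<open>0\<close>, \<open>1\<close> and \<open>-1\<close>, from which sine and cosine of \<open>T\<close> are formed\<close>
 have IH': "(CLINT v|A. complex_of_real (w v) * iexp (s * Y j v + r * T v)) =
   (CLINT v|B. complex_of_real (w' v) * iexp (s * Y' j v + r * T' v))" for s r
 proof -
  have D: "I - J = insert j (I - insert j J)" using insert jI by auto
  have "(\<Sum>i\<in>I-J. (if i = j then s else r * u i) * Z i) = s * Z j + r * (\<Sum>i\<in>I-insert j J. u i * Z i)"
   for Z :: "'i => real"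
   unfolding D using I by (subst sum.insert) (auto simp: sum_distrib_left mult.assoc intro!: sum.cong)
  with IH[of "\<lambda>i. if i = j then s else r * u i"] show ?thesis
   by (simp add: w_def w'_def T_def T'_def)
 qed
 have cmodw: "cmod (complex_of_real (w x) * iexp y) \<le> 1" "cmod (complex_of_real (w' x') * iexp y) \<le> 1" for x x' y
  using w[of x] w'[of x'] by (auto simp: norm_mult)
 have intA: "integrable A (\<lambda>v. complex_of_real (w v) * iexp (s * Y j v + r * T v))" for s r
  by (rule A.integrable_bounded_complex[where K=1], measurable, rule cmodw)
 have intB: "integrable B (\<lambda>v. complex_of_real (w' v) * iexp (s * Y' j v + r * T' v))" for s r
  by (rule B.integrable_bounded_complex[where K=1], measurable, rule cmodw)
 have eC: "complex_of_real (w0 * (1 + cos t)) * iexp (s * y) = complex_of_real w0 * iexp (s * y + 0 * t)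
   + (1/2) * (complex_of_real w0 * iexp (s * y + 1 * t)) + (1/2) * (complex_of_real w0 * iexp (s * y + (-1) * t))"
  for w0 t s y :: real
  by (simp add: complex_eq_iff Re_exp Im_exp cos_add sin_add cos_diff sin_diff field_simps)
 have eS: "complex_of_real (w0 * (1 + sin t)) * iexp (s * y) = complex_of_real w0 * iexp (s * y + 0 * t)
   + (-\<i>/2) * (complex_of_real w0 * iexp (s * y + 1 * t)) + (\<i>/2) * (complex_of_real w0 * iexp (s * y + (-1) * t))"
  for w0 t s y :: real
  by (simp add: complex_eq_iff Re_exp Im_exp cos_add sin_add cos_diff sin_diff field_simps)
 have trig: "0 \<le> 1 + cos t" "1 + cos t \<le> 2" "0 \<le> 1 + sin t" "1 + sin t \<le> 2" for t :: real
  using cos_ge_minus_one[of t] cos_le_one[of t] sin_ge_minus_one[of t] sin_le_one[of t] by linarith+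
 have C: "(LINT x|A. (w x * (1 + cos (T x))) * indicator (S j) (Y j x)) =
   (LINT x|B. (w' x * (1 + cos (T' x))) * indicator (S j) (Y' j x))"
 proof (rule weighted_char_unique[OF A B])
  show "(CLINT x|A. complex_of_real (w x * (1 + cos (T x))) * iexp (s * Y j x)) =
   (CLINT x|B. complex_of_real (w' x * (1 + cos (T' x))) * iexp (s * Y' j x))" for s
   unfolding eC integral_combination3[OF intA intA intA] integral_combination3[OF intB intB intB] IH' ..
  show "0 \<le> w x * (1 + cos (T x))" for x using w[of x] trig[of "T x"] by (intro mult_nonneg_nonneg)
  show "0 \<le> w' x * (1 + cos (T' x))" for x using w'[of x] trig[of "T' x"] by (intro mult_nonneg_nonneg)
  show "w x * (1 + cos (T x)) \<le> 2" for x using mult_mono[of "w x" 1 "1 + cos (T x)" 2] w[of x] trig[of "T x"] by simp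
  show "w' x * (1 + cos (T' x)) \<le> 2" for x using mult_mono[of "w' x" 1 "1 + cos (T' x)" 2] w'[of x] trig[of "T' x"] by simp
 qed measurable
 have Sn: "(LINT x|A. (w x * (1 + sin (T x))) * indicator (S j) (Y j x)) =
   (LINT x|B. (w' x * (1 + sin (T' x))) * indicator (S j) (Y' j x))"
 proof (rule weighted_char_unique[OF A B])
  show "(CLINT x|A. complex_of_real (w x * (1 + sin (T x))) * iexp (s * Y j x)) =
   (CLINT x|B. complex_of_real (w' x * (1 + sin (T' x))) * iexp (s * Y' j x))" for s
   unfolding eS integral_combination3[OF intA intA intA] integral_combination3[OF intB intB intB] IH' ..
  show "0 \<le> w x * (1 + sin (T x))" for x using w[of x] trig[of "T x"] by (intro mult_nonneg_nonneg)
  show "0 \<le> w' x * (1 + sin (T' x))" for x using w'[of x] trig[of "T' x"] by (intro mult_nonneg_nonneg)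
  show "w x * (1 + sin (T x)) \<le> 2" for x using mult_mono[of "w x" 1 "1 + sin (T x)" 2] w[of x] trig[of "T x"] by simp
  show "w' x * (1 + sin (T' x)) \<le> 2" for x using mult_mono[of "w' x" 1 "1 + sin (T' x)" 2] w'[of x] trig[of "T' x"] by simp
 qed measurable
 have O: "(LINT x|A. w x * indicator (S j) (Y j x)) = (LINT x|B. w' x * indicator (S j) (Y' j x))"
 proof (rule weighted_char_unique[OF A B])
  show "(CLINT x|A. complex_of_real (w x) * iexp (s * Y j x)) =
   (CLINT x|B. complex_of_real (w' x) * iexp (s * Y' j x))" for s
   using IH'[of s 0] by simp
 qed (use w w' in measurable)
 have eI: "complex_of_real (w0 * i0) * iexp t = complex_of_real ((w0 * (1 + cos t)) * i0)
   + \<i> * complex_of_real ((w0 * (1 + sin t)) * i0) - (1 + \<i>) * complex_of_real (w0 * i0)" for w0 i0 t :: real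
  by (simp add: complex_eq_iff Re_exp Im_exp field_simps)
 have bd: "\<bar>(w0 * (1 + c)) * i0\<bar> \<le> 2" if "0 \<le> w0" "w0 \<le> 1" "\<bar>c\<bar> \<le> 1" "i0 = 0 \<or> i0 = 1" for w0 c i0 :: real
  using that mult_mono[of w0 1 "1 + c" 2] mult_nonneg_nonneg[of w0 "1 + c"] by auto
 have ind: "indicator X y = (0::real) \<or> indicator X y = (1::real)" for X and y :: real
  by (auto simp: indicator_def)
 have iA: "integrable A (\<lambda>x. (w x * (1 + cos (T x))) * indicator (S j) (Y j x))"
   "integrable A (\<lambda>x. (w x * (1 + sin (T x))) * indicator (S j) (Y j x))"
   "integrable A (\<lambda>x. w x * indicator (S j) (Y j x))"
  using bd[OF w abs_cos_le_one ind] bd[OF w abs_sin_le_one ind] bd[OF w _ ind, of 0]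
  by (auto intro!: A.integrable_const_bound[where B=2])
 have iB: "integrable B (\<lambda>x. (w' x * (1 + cos (T' x))) * indicator (S j) (Y' j x))"
   "integrable B (\<lambda>x. (w' x * (1 + sin (T' x))) * indicator (S j) (Y' j x))"
   "integrable B (\<lambda>x. w' x * indicator (S j) (Y' j x))"
  using bd[OF w' abs_cos_le_one ind] bd[OF w' abs_sin_le_one ind] bd[OF w' _ ind, of 0]
  by (auto intro!: B.integrable_const_bound[where B=2])
 have "(CLINT x|A. complex_of_real (w x * indicator (S j) (Y j x)) * iexp (T x)) =
   (CLINT x|B. complex_of_real (w' x * indicator (S j) (Y' j x)) * iexp (T' x))"
  unfolding eI using iA iB C Sn O
  by (simp del: of_real_mult of_real_add add: integral_complex_of_real)
 then show ?case
  using insert by (simp add: w_def w'_def T_def T'_def mult.commute mult.left_commute)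
qed

text \<open>With all coordinates traded for indicators, the two laws agree on the boxes that generate the product
 sigma-algebra.\<close>

theorem joint_char_unique:
 fixes Y :: "'i => 'a => real" and Y' :: "'i => 'b => real"
 assumes A: "prob_space A" and B: "prob_space B" and I: "finite I"
  and Y: "\<And>i. i \<in> I ==> Y i \<in> borel_measurable A"
  and Y': "\<And>i. i \<in> I ==> Y' i \<in> borel_measurable B"
  and eq: "\<And>u. (CLINT w|A. iexp (\<Sum>i\<in>I. u i * Y i w)) = (CLINT w|B. iexp (\<Sum>i\<in>I. u i * Y' i w))"
 shows "distr A (PiM I (\<lambda>_. borel)) (\<lambda>w. \<lambda>i\<in>I. Y i w) = distr B (PiM I (\<lambda>_. borel)) (\<lambda>w. \<lambda>i\<in>I. Y' i w)"
  (is "?P = ?Q")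
proof -
 interpret A: prob_space A by fact
 interpret B: prob_space B by fact
 have mA[measurable]: "(\<lambda>w. \<lambda>i\<in>I. Y i w) \<in> measurable A (PiM I (\<lambda>_. borel))"
  using Y by (intro measurable_restrict) auto
 have mB[measurable]: "(\<lambda>w. \<lambda>i\<in>I. Y' i w) \<in> measurable B (PiM I (\<lambda>_. borel))"
  using Y' by (intro measurable_restrict) auto
 interpret P: prob_space ?P by (rule A.prob_space_distr) simp
 interpret Q: prob_space ?Q by (rule B.prob_space_distr) simp
 have rect: "measure (distr D (PiM I (\<lambda>_. borel)) (\<lambda>w. \<lambda>i\<in>I. V i w)) (Pi\<^sub>E I S)
   = Re (CLINT w|D. complex_of_real (\<Prod>j\<in>I. indicator (S j) (V j w)))"
  if "prob_space D" and V: "\<And>i. i \<in> I ==> V i \<in> borel_measurable D" and S: "\<And>i. i \<in> I ==> S i \<in> sets borel"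
  for D and V :: "'i => 'c => real" and S
 proof -
  interpret D: prob_space D by fact
  have mD: "(\<lambda>w. \<lambda>i\<in>I. V i w) \<in> measurable D (PiM I (\<lambda>_. borel))"
   using V by (intro measurable_restrict) auto
  have "Pi\<^sub>E I S \<in> sets (PiM I (\<lambda>_. borel))" using S I by (intro sets_PiM_I_finite) auto
  then have "measure (distr D (PiM I (\<lambda>_. borel)) (\<lambda>w. \<lambda>i\<in>I. V i w)) (Pi\<^sub>E I S)
   = (LINT x|D. indicator (Pi\<^sub>E I S) (\<lambda>i\<in>I. V i x))"
   using integral_distr[OF mD, of "indicator (Pi\<^sub>E I S) :: _ => real"] by (simp add: space_PiM Int_absorb2 PiE_mono)
  also have "(\<lambda>x. indicator (Pi\<^sub>E I S) (\<lambda>i\<in>I. V i x) :: real) = (\<lambda>w. \<Prod>j\<in>I. indicator (S j) (V j w))"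
   using I by (intro ext) (auto simp: indicator_def PiE_def Pi_def prod_zero_iff split: if_splits)
  finally show ?thesis by (simp only: integral_complex_of_real Re_complex_of_real)
 qed
 show ?thesis
 proof (rule measure_eqI_PiM_finite[OF I])
  fix S :: "'i => real set" assume S: "\<And>i. i \<in> I ==> S i \<in> sets borel"
  have "measure ?P (Pi\<^sub>E I S) = Re (CLINT w|A. complex_of_real (\<Prod>j\<in>I. indicator (S j) (Y j w)))"
   by (rule rect[OF A]) (use Y S in auto)
  also have "(CLINT w|A. complex_of_real (\<Prod>j\<in>I. indicator (S j) (Y j w))) =
    (CLINT w|B. complex_of_real (\<Prod>j\<in>I. indicator (S j) (Y' j w)))"
   using joint_char_indicator[where u="\<lambda>_. 0" and J=I and S=S,
     OF A.finite_measure_axioms B.finite_measure_axioms I Y Y' eq I subset_refl S] by simp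
  also have "Re \<dots> = measure ?Q (Pi\<^sub>E I S)"
   by (rule rect[OF B, symmetric]) (use Y' S in auto)
  finally have "measure ?P (Pi\<^sub>E I S) = measure ?Q (Pi\<^sub>E I S)" .
  then show "emeasure ?P (Pi\<^sub>E I S) = emeasure ?Q (Pi\<^sub>E I S)"
   by (simp add: P.emeasure_eq_measure Q.emeasure_eq_measure)
 next
  show "range (\<lambda>i::nat. Pi\<^sub>E I (\<lambda>_. UNIV)) \<subseteq> prod_algebra I (\<lambda>_. borel :: real measure)"
   using I by (auto intro!: prod_algebraI_finite)
  show "(\<Union>i::nat. Pi\<^sub>E I (\<lambda>_. UNIV)) = space (PiM I (\<lambda>_. borel :: real measure))"
   by (simp add: space_PiM)
  show "emeasure ?P (Pi\<^sub>E I (\<lambda>_. UNIV)) \<noteq> \<infinity>" by simp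
 qed simp_all
qed

section \<open>Random variables with moments of all orders\<close>

definition all_moments :: "'a measure => ('a => real) => bool" where
 "all_moments A Y \<longleftrightarrow> Y \<in> borel_measurable A \<and> (\<forall>k::nat. integrable A (\<lambda>w. \<bar>Y w\<bar> ^ k))"

lemma all_moments_bound:
 assumes G: "all_moments A G" and F: "F \<in> borel_measurable A"
  and le: "\<And>w. w \<in> space A ==> \<bar>F w\<bar> \<le> G w"
 shows "all_moments A F"
 unfolding all_moments_def
proof (intro conjI F allI)
 fix k :: nat
 show "integrable A (\<lambda>w. \<bar>F w\<bar> ^ k)"
 proof (rule Bochner_Integration.integrable_bound)
  show "integrable A (\<lambda>w. \<bar>G w\<bar> ^ k)" using G by (simp add: all_moments_def)
  show "AE x in A. norm (\<bar>F x\<bar> ^ k) \<le> norm (\<bar>G x\<bar> ^ k)"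
   using le by (intro AE_I2) (auto simp: power_abs intro!: power_mono order_trans[OF le abs_ge_self])
 qed (use F in measurable)
qed

lemma all_moments_abs: "all_moments A Y ==> all_moments A (\<lambda>w. \<bar>Y w\<bar>)"
 by (auto simp: all_moments_def)

lemma (in prob_space) all_moments_const: "all_moments M (\<lambda>_. c)"
 by (simp add: all_moments_def)

lemma all_moments_add:
 assumes "all_moments A Y" "all_moments A Z"
 shows "all_moments A (\<lambda>w. Y w + Z w)"
 unfolding all_moments_def
proof (intro conjI allI)
 have [measurable]: "Y \<in> borel_measurable A" "Z \<in> borel_measurable A" using assms by (auto simp: all_moments_def)
 show "(\<lambda>w. Y w + Z w) \<in> borel_measurable A" by measurable
 fix k
 have b: "\<bar>a + b\<bar> ^ k \<le> 2 ^ k * \<bar>a\<bar> ^ k + 2 ^ k * \<bar>b\<bar> ^ k" for a b :: real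
 proof -
  have "\<bar>a + b\<bar> ^ k \<le> (2 * max \<bar>a\<bar> \<bar>b\<bar>) ^ k" by (intro power_mono) auto
  also have "\<dots> \<le> 2 ^ k * \<bar>a\<bar> ^ k + 2 ^ k * \<bar>b\<bar> ^ k" by (auto simp: power_mult_distrib max_def)
  finally show ?thesis .
 qed
 show "integrable A (\<lambda>w. \<bar>Y w + Z w\<bar> ^ k)"
 proof (rule Bochner_Integration.integrable_bound)
  show "integrable A (\<lambda>w. 2 ^ k * \<bar>Y w\<bar> ^ k + 2 ^ k * \<bar>Z w\<bar> ^ k)"
   using assms by (auto simp: all_moments_def)
  show "AE x in A. norm (\<bar>Y x + Z x\<bar> ^ k) \<le> norm (2 ^ k * \<bar>Y x\<bar> ^ k + 2 ^ k * \<bar>Z x\<bar> ^ k)"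
   using b by (intro AE_I2) (simp add: order_trans[OF _ abs_ge_self])
 qed measurable
qed

lemma all_moments_mult:
 assumes "all_moments A Y" "all_moments A Z"
 shows "all_moments A (\<lambda>w. Y w * Z w)"
 unfolding all_moments_def
proof (intro conjI allI)
 have [measurable]: "Y \<in> borel_measurable A" "Z \<in> borel_measurable A" using assms by (auto simp: all_moments_def)
 show "(\<lambda>w. Y w * Z w) \<in> borel_measurable A" by measurable
 fix k
 have b: "\<bar>a * b\<bar> ^ k \<le> \<bar>a\<bar> ^ (k + k) + \<bar>b\<bar> ^ (k + k)" for a b :: real
 proof -
  have "2 * (\<bar>a\<bar> ^ k * \<bar>b\<bar> ^ k) \<le> (\<bar>a\<bar> ^ k)\<^sup>2 + (\<bar>b\<bar> ^ k)\<^sup>2" using sum_squares_bound[of "\<bar>a\<bar> ^ k" "\<bar>b\<bar> ^ k"] by simp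
  moreover have "0 \<le> \<bar>a\<bar> ^ k * \<bar>b\<bar> ^ k" by simp
  ultimately have "\<bar>a\<bar> ^ k * \<bar>b\<bar> ^ k \<le> (\<bar>a\<bar> ^ k)\<^sup>2 + (\<bar>b\<bar> ^ k)\<^sup>2" by linarith
  then show ?thesis by (simp add: abs_mult power_mult_distrib power2_eq_square power_add)
 qed
 show "integrable A (\<lambda>w. \<bar>Y w * Z w\<bar> ^ k)"
 proof (rule Bochner_Integration.integrable_bound)
  show "integrable A (\<lambda>w. \<bar>Y w\<bar> ^ (k + k) + \<bar>Z w\<bar> ^ (k + k))"
   using assms unfolding all_moments_def by (intro Bochner_Integration.integrable_add) blast+
  show "AE x in A. norm (\<bar>Y x * Z x\<bar> ^ k) \<le> norm (\<bar>Y x\<bar> ^ (k + k) + \<bar>Z x\<bar> ^ (k + k))"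
   using b by (intro AE_I2) (simp add: order_trans[OF _ abs_ge_self])
 qed measurable
qed

lemma (in prob_space) all_moments_sum:
 "(\<And>i. i \<in> I ==> all_moments M (Y i)) ==> all_moments M (\<lambda>w. \<Sum>i\<in>I. Y i w)"
 by (induction I rule: infinite_finite_induct) (auto intro: all_moments_add all_moments_const)

lemma (in prob_space) all_moments_cmult: "all_moments M Y ==> all_moments M (\<lambda>w. c * Y w)"
 by (intro all_moments_mult all_moments_const)

lemma (in prob_space) all_moments_minus:
 assumes "all_moments M Y" "all_moments M Z" shows "all_moments M (\<lambda>w. Y w - Z w)"
 using all_moments_add[OF assms(1) all_moments_cmult[OF assms(2), of "-1"]] by simp

lemma (in prob_space) all_moments_power: "all_moments M Y ==> all_moments M (\<lambda>w. Y w ^ n)"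
 by (induction n) (auto intro: all_moments_mult all_moments_const)

lemma all_moments_integrable:
 assumes "all_moments A Y" shows "integrable A Y"
proof -
 have "integrable A (\<lambda>w. \<bar>Y w\<bar> ^ 1)" using assms unfolding all_moments_def by blast
 then show ?thesis using assms integrable_norm_iff[of Y A] by (simp add: all_moments_def)
qed

lemma all_moments_sq_integrable: "all_moments A Y ==> sq_integrable A Y"
 by (auto simp: all_moments_def sq_integrable_def dest!: spec[of _ 2])

section \<open>One-dimensional normal laws\<close>

lemma all_moments_std_normal: "all_moments std_normal_distribution (\<lambda>x. x)"
proof -
 have "integrable std_normal_distribution (\<lambda>x. \<bar>x\<bar> ^ k)" for k
  using integrable_norm[OF integrable_std_normal_distribution_moment[of k]] by (simp add: power_abs)
 then show ?thesis by (simp add: all_moments_def)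
qed

lemma prob_space_std_normal: "prob_space std_normal_distribution"
 by (rule prob_space_normal_density) simp

text \<open>Covers the Dirac mass \<open>\<sigma> = 0\<close> together with the densities, so that later arguments need not treat
 degenerate laws separately.\<close>

lemma normal_law_affine:
 assumes "\<sigma> \<ge> 0"
 shows "normal_law m \<sigma> = distr std_normal_distribution borel (\<lambda>x. m + \<sigma> * x)"
proof -
 interpret prob_space std_normal_distribution by (rule prob_space_std_normal)
 show ?thesis
 proof (cases "\<sigma> = 0")
  case True
  then show ?thesis by (simp add: normal_law_def)
 next
  case False
  have id: "distributed std_normal_distribution lborel (\<lambda>x. x) std_normal_density"
   by (auto simp: distributed_def distr_id2)
  have "distributed std_normal_distribution lborel (\<lambda>x. m + \<sigma> * x) (normal_density (m + \<sigma> * 0) (\<bar>\<sigma>\<bar> * 1))"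
   by (rule normal_density_affine[OF id]) (use False in auto)
  then have "distr std_normal_distribution lborel (\<lambda>x. m + \<sigma> * x) = density lborel (normal_density m \<sigma>)"
   using assms by (simp add: distributed_def)
  moreover have "distr std_normal_distribution lborel (\<lambda>x. m + \<sigma> * x) = distr std_normal_distribution borel (\<lambda>x. m + \<sigma> * x)"
   by (rule distr_cong) auto
  ultimately show ?thesis using False by (simp add: normal_law_def)
 qed
qed

lemma
 assumes A: "prob_space A" and Y[measurable]: "Y \<in> borel_measurable A" and s: "\<sigma> \<ge> 0"
  and law: "distr A borel Y = normal_law m \<sigma>"
 shows normal_law_all_moments: "all_moments A Y"
  and normal_law_mean: "(LINT w|A. Y w) = m"
  and normal_law_variance: "m = 0 ==> (LINT w|A. (Y w)\<^sup>2) = \<sigma>\<^sup>2"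
  and normal_law_char: "m = 0 ==> (CLINT w|A. iexp (Y w)) = complex_of_real (exp (- \<sigma>\<^sup>2 / 2))"
  and normal_law_integral: "f \<in> borel_measurable borel ==>
     (LINT w|A. (f (Y w) :: real)) = (LINT x|std_normal_distribution. f (m + \<sigma> * x))"
proof -
 let ?S = "std_normal_distribution"
 interpret S: prob_space ?S by (rule prob_space_std_normal)
 interpret A: prob_space A by fact
 have eq: "distr A borel Y = distr ?S borel (\<lambda>x. m + \<sigma> * x)"
  using law normal_law_affine[OF s] by simp
 have int: "integrable A (\<lambda>w. f (Y w)) \<longleftrightarrow> integrable ?S (\<lambda>x. f (m + \<sigma> * x))"
  if [measurable]: "f \<in> borel_measurable borel" for f :: "real => real"
  using arg_cong[OF eq, of "\<lambda>M. integrable M f"] by (simp add: integrable_distr_eq)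
 show val: "(LINT w|A. f (Y w)) = (LINT x|?S. f (m + \<sigma> * x))"
  if [measurable]: "f \<in> borel_measurable borel" for f :: "real => real"
  using arg_cong[OF eq, of "\<lambda>M. integral\<^sup>L M f"] by (simp add: integral_distr)
 have aff: "all_moments ?S (\<lambda>x. m + \<sigma> * x)"
  by (intro all_moments_add S.all_moments_const S.all_moments_cmult all_moments_std_normal)
 then show "all_moments A Y"
  using int[of "\<lambda>x. \<bar>x\<bar> ^ k" for k] by (simp add: all_moments_def)
 have 1: "(LINT x|?S. x) = 0" using integral_std_normal_distribution_moment_odd[of 1] by simp
 have 2: "(LINT x|?S. x\<^sup>2) = 1" using std_normal_distribution_even_moments(1)[of 1] by simp
 have i1: "integrable ?S (\<lambda>x. x)" using integrable_std_normal_distribution_moment[of 1] by simp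
 have i2: "integrable ?S (\<lambda>x. x\<^sup>2)" by (rule integrable_std_normal_distribution_moment)
 show "(LINT w|A. Y w) = m"
 proof -
  have "(LINT w|A. Y w) = (LINT x|?S. m + \<sigma> * x)" using val[of "\<lambda>x. x"] by simp
  also have "\<dots> = m * measure ?S (space ?S) + \<sigma> * (LINT x|?S. x)"
   using i1 by (subst Bochner_Integration.integral_add) auto
  finally show ?thesis by (simp only: 1 S.prob_space)
 qed
 show "(LINT w|A. (Y w)\<^sup>2) = \<sigma>\<^sup>2" if "m = 0"
  using val[of "\<lambda>x. x\<^sup>2"] i2 2 that by (simp add: power_mult_distrib)
 show "(CLINT w|A. iexp (Y w)) = complex_of_real (exp (- \<sigma>\<^sup>2 / 2))" if "m = 0"
 proof -
  have "(CLINT w|A. iexp (Y w)) = (CLINT x|distr A borel Y. iexp x)"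
   by (subst integral_distr) auto
  also have "\<dots> = (CLINT x|?S. iexp (\<sigma> * x))"
   unfolding eq using that by (subst integral_distr) auto
  also have "\<dots> = char ?S \<sigma>" by (simp add: char_def)
  finally show ?thesis by (simp add: char_std_normal_distribution)
 qed
qed

lemma poly_growth_of_derivative:
 fixes f f' :: "real => real"
 assumes f: "\<And>x. (f has_real_derivative f' x) (at x)"
  and growth: "\<And>x. \<bar>f' x\<bar> \<le> K * (1 + \<bar>x\<bar>) ^ r"
 shows "\<bar>f x\<bar> \<le> (\<bar>f 0\<bar> + K) * (1 + \<bar>x\<bar>) ^ Suc r"
proof -
 have K0: "0 \<le> K" using growth[of 0] by simp
 have "\<exists>z. \<bar>z\<bar> \<le> \<bar>x\<bar> \<and> f x - f 0 = x * f' z"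
 proof (cases x "0::real" rule: linorder_cases)
  case less
  with MVT2[of x 0 f f'] f obtain z where "x < z" "z < 0" "f 0 - f x = (0 - x) * f' z" by blast
  then show ?thesis by (intro exI[of _ z]) auto
 next
  case greater
  with MVT2[of 0 x f f'] f obtain z where "0 < z" "z < x" "f x - f 0 = (x - 0) * f' z" by blast
  then show ?thesis by (intro exI[of _ z]) auto
 qed auto
 then obtain z where z: "\<bar>z\<bar> \<le> \<bar>x\<bar>" "f x - f 0 = x * f' z" by blast
 have f'z: "\<bar>f' z\<bar> \<le> K * (1 + \<bar>x\<bar>) ^ r"
  by (rule order_trans[OF growth]) (use z(1) K0 in \<open>intro mult_left_mono power_mono, auto\<close>)
 have "\<bar>f x\<bar> \<le> \<bar>f 0\<bar> + \<bar>x\<bar> * \<bar>f' z\<bar>" using z(2) by (simp flip: abs_mult)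
 also have "\<dots> \<le> \<bar>f 0\<bar> + \<bar>x\<bar> * (K * (1 + \<bar>x\<bar>) ^ r)"
  by (intro add_left_mono mult_left_mono f'z) simp
 also have "\<dots> \<le> \<bar>f 0\<bar> * (1 + \<bar>x\<bar>) ^ Suc r + K * (1 + \<bar>x\<bar>) ^ Suc r"
 proof (rule add_mono)
  have "1 \<le> (1 + \<bar>x\<bar>) ^ Suc r" by (rule one_le_power) simp
  then show "\<bar>f 0\<bar> \<le> \<bar>f 0\<bar> * (1 + \<bar>x\<bar>) ^ Suc r" using mult_left_mono[of 1 _ "\<bar>f 0\<bar>"] by simp
  show "\<bar>x\<bar> * (K * (1 + \<bar>x\<bar>) ^ r) \<le> K * (1 + \<bar>x\<bar>) ^ Suc r"
   using K0 by (simp add: algebra_simps)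
 qed
 finally show ?thesis by (simp only: distrib_right)
qed

text \<open>With the density \<open>\<rho>\<close> one has \<open>(\<rho> f)' = \<rho> f' - x \<rho> f\<close>, and \<open>\<rho> f\<close> vanishes at infinity.\<close>

lemma stein_std_normal:
 fixes f f' :: "real => real"
 assumes f: "\<And>x. (f has_real_derivative f' x) (at x)" and [measurable]: "f' \<in> borel_measurable borel"
  and growth: "\<And>x. \<bar>f' x\<bar> \<le> K * (1 + \<bar>x\<bar>) ^ r"
 shows "(LINT x|std_normal_distribution. x * f x) = (LINT x|std_normal_distribution. f' x)"
proof -
 let ?S = "std_normal_distribution"
 interpret S: prob_space ?S by (rule prob_space_std_normal)
 have cont: "continuous_on UNIV f"
  using f DERIV_isCont by (blast intro: continuous_at_imp_continuous_on)
 then have [measurable]: "f \<in> borel_measurable borel" by (rule borel_measurable_continuous_onI)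
 have P: "all_moments ?S (\<lambda>x. C * (1 + \<bar>x\<bar>) ^ k)" for C k
  by (intro S.all_moments_cmult S.all_moments_power all_moments_add S.all_moments_const
    all_moments_abs all_moments_std_normal)
 have mf': "all_moments ?S f'" by (rule all_moments_bound[OF P]) (use growth in auto)
 have mf: "all_moments ?S f"
  by (rule all_moments_bound[OF P[of "\<bar>f 0\<bar> + K" "Suc r"] _ poly_growth_of_derivative[OF f growth]]) measurable
 have mxf: "all_moments ?S (\<lambda>x. x * f x)" by (intro all_moments_mult all_moments_std_normal mf)
 let ?\<phi> = std_normal_density
 define h where "h x = ?\<phi> x * f' x - ?\<phi> x * (x * f x)" for x
 have i1: "integrable lborel (\<lambda>x. ?\<phi> x * f' x)" and i2: "integrable lborel (\<lambda>x. ?\<phi> x * (x * f x))"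
  using all_moments_integrable[OF mf'] all_moments_integrable[OF mxf]
  by (auto simp: integrable_density normal_density_nonneg)
 have ih: "integrable lborel h" unfolding h_def by (intro Bochner_Integration.integrable_diff i1 i2)
 have deriv: "((\<lambda>x. ?\<phi> x * f x) has_vector_derivative h x) (at x within S)" for x S
 proof -
  have "((\<lambda>x. c * exp (- x\<^sup>2 / 2)) has_real_derivative - x * (c * exp (- x\<^sup>2 / 2))) (at x)" for c
   by (auto intro!: derivative_eq_intros)
  from this[of "1 / sqrt (2 * pi)"] have "(?\<phi> has_real_derivative - x * ?\<phi> x) (at x)"
   unfolding std_normal_density_def .
  from DERIV_mult[OF this f[of x]] have "((\<lambda>x. ?\<phi> x * f x) has_real_derivative h x) (at x)"
   by (simp add: h_def algebra_simps)
  then show ?thesis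
   by (auto simp: has_real_derivative_iff_has_vector_derivative intro: has_vector_derivative_at_within)
 qed
 have part: "(LINT x|lborel. indicator {-real n..real n} x * h x) = ?\<phi> (real n) * f (real n) - ?\<phi> (- real n) * f (- real n)" for n
 proof -
  have "(h has_integral (?\<phi> (real n) * f (real n) - ?\<phi> (- real n) * f (- real n))) {-real n..real n}"
   by (rule fundamental_theorem_of_calculus) (auto intro: deriv)
  moreover have "set_integrable lborel {-real n..real n} h"
   using ih unfolding set_integrable_def by (intro integrable_mult_indicator) auto
  ultimately show ?thesis
   using set_borel_integral_eq_integral(2)[of "{-real n..real n}" h]
   by (simp add: set_lebesgue_integral_def integral_unique)
 qed
 have "(\<lambda>n. LINT x|lborel. indicator {-real n..real n} x * h x) \<longlonglongrightarrow> (LINT x|lborel. h x)"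
 proof (rule integral_dominated_convergence[where w="\<lambda>x. \<bar>h x\<bar>"])
  show "AE x in lborel. (\<lambda>n. indicator {- real n..real n} x * h x) \<longlonglongrightarrow> h x"
  proof (intro AE_I2 tendsto_eventually)
   fix x :: real
   obtain N where N: "\<bar>x\<bar> \<le> real N" using real_arch_simple by blast
   have "\<forall>n\<ge>N. indicator {- real n..real n} x * h x = h x"
    using N by (auto simp: indicator_def abs_le_iff)
   then show "\<forall>\<^sub>F n in sequentially. indicator {- real n..real n} x * h x = h x"
    unfolding eventually_sequentially by blast
  qed
 qed (use ih in \<open>auto simp: abs_mult indicator_def\<close>)
 moreover have "(\<lambda>n. ?\<phi> (real n) * f (real n) - ?\<phi> (- real n) * f (- real n)) \<longlonglongrightarrow> 0"
 proof -
  define C where "C = \<bar>f 0\<bar> + K"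
  have bnd: "norm (?\<phi> y * f y) \<le> C * exp (3/2) * ((1 + real n) ^ Suc r / exp (1 + real n))"
   if y: "\<bar>y\<bar> = real n" for y n
  proof -
   have "y\<^sup>2 = (real n)\<^sup>2" using y by (metis power2_abs)
   then have "- y\<^sup>2 / 2 \<le> 3/2 - (1 + real n)"
    using zero_le_power2[of "real n - 1"] by (simp add: power2_diff)
   then have "exp (- y\<^sup>2 / 2) \<le> exp (3/2) / exp (1 + real n)"
    by (metis exp_diff exp_le_cancel_iff)
   moreover have "1 / sqrt (2 * pi) \<le> 1" using pi_gt3 by (simp add: real_le_rsqrt)
   ultimately have "?\<phi> y \<le> 1 * (exp (3/2) / exp (1 + real n))"
    unfolding std_normal_density_def by (intro mult_mono) auto
   moreover have "\<bar>f y\<bar> \<le> C * (1 + real n) ^ Suc r"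
    using poly_growth_of_derivative[OF f growth, of y] y by (simp add: C_def)
   ultimately have "?\<phi> y * \<bar>f y\<bar> \<le> (exp (3/2) / exp (1 + real n)) * (C * (1 + real n) ^ Suc r)"
    by (intro mult_mono) auto
   then show ?thesis by (simp add: abs_mult field_simps)
  qed
  have "(\<lambda>n. (1 + real n) ^ Suc r / exp (1 + real n)) \<longlonglongrightarrow> 0"
   by (rule filterlim_compose[OF tendsto_power_div_exp_0])
     (auto intro!: filterlim_tendsto_add_at_top filterlim_real_sequentially)
  from tendsto_mult[OF tendsto_const this]
  have z: "(\<lambda>n. C * exp (3/2) * ((1 + real n) ^ Suc r / exp (1 + real n))) \<longlonglongrightarrow> 0" by fastforce
  have "(\<lambda>n. ?\<phi> (real n) * f (real n)) \<longlonglongrightarrow> 0" "(\<lambda>n. ?\<phi> (- real n) * f (- real n)) \<longlonglongrightarrow> 0"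
   by (rule Lim_null_comparison[OF _ z], rule always_eventually, rule allI, rule bnd, simp)+
  from tendsto_diff[OF this] show ?thesis by simp
 qed
 ultimately have "(LINT x|lborel. h x) = 0" unfolding part by (rule LIMSEQ_unique)
 then have "(LINT x|lborel. ?\<phi> x * f' x) = (LINT x|lborel. ?\<phi> x * (x * f x))"
  using i1 i2 by (simp add: h_def)
 then show ?thesis by (simp add: integral_density normal_density_nonneg)
qed

lemma stein_normal_law:
 fixes f f' :: "real => real"
 assumes A: "prob_space A" and Y: "Y \<in> borel_measurable A" and s: "\<sigma> > 0"
  and law: "distr A borel Y = normal_law 0 \<sigma>"
  and f: "\<And>x. (f has_real_derivative f' x) (at x)" and [measurable]: "f' \<in> borel_measurable borel"
  and growth: "\<And>x. \<bar>f' x\<bar> \<le> K * (1 + \<bar>x\<bar>) ^ r"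
 shows "(LINT w|A. Y w * f (Y w)) = \<sigma>\<^sup>2 * (LINT w|A. f' (Y w))"
proof -
 have cont: "continuous_on UNIV f"
  using f DERIV_isCont by (blast intro: continuous_at_imp_continuous_on)
 then have [measurable]: "f \<in> borel_measurable borel" by (rule borel_measurable_continuous_onI)
 have K0: "0 \<le> K" using growth[of 0] by simp
 have fs: "((\<lambda>x. f (\<sigma> * x)) has_real_derivative \<sigma> * f' (\<sigma> * x)) (at x)" for x
 proof -
  have "((\<lambda>x. f (\<sigma> * x)) has_real_derivative f' (\<sigma> * x) * \<sigma>) (at x)"
   by (rule DERIV_chain2[OF f]) (auto intro!: derivative_eq_intros)
  then show ?thesis by (simp add: mult.commute)
 qed
 have g: "\<bar>\<sigma> * f' (\<sigma> * x)\<bar> \<le> \<sigma> * K * (1 + \<sigma>) ^ r * (1 + \<bar>x\<bar>) ^ r" for x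
 proof -
  have "\<bar>f' (\<sigma> * x)\<bar> \<le> K * ((1 + \<sigma>) * (1 + \<bar>x\<bar>)) ^ r"
   by (rule order_trans[OF growth])
     (use s K0 in \<open>auto intro!: mult_left_mono power_mono simp: abs_mult algebra_simps\<close>)
  then show ?thesis using s by (simp add: abs_mult power_mult_distrib mult.assoc mult_left_mono)
 qed
 note val = normal_law_integral[OF A Y less_imp_le[OF s] law]
 have "(LINT w|A. Y w * f (Y w)) = \<sigma> * (LINT x|std_normal_distribution. x * f (\<sigma> * x))"
  using val[of "\<lambda>y. y * f y"] by (simp add: mult.assoc)
 also have "(LINT x|std_normal_distribution. x * f (\<sigma> * x)) = (LINT x|std_normal_distribution. \<sigma> * f' (\<sigma> * x))"
  by (rule stein_std_normal[OF fs _ g]) measurable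
 also have "\<dots> = \<sigma> * (LINT w|A. f' (Y w))" using val[of f'] by simp
 finally show ?thesis by (simp add: power2_eq_square)
qed

section \<open>Gaussian families\<close>

definition gaussian_family :: "'a measure => 'i set => ('i => 'a => real) => bool" where
 "gaussian_family A I Y \<longleftrightarrow> prob_space A \<and> finite I \<and> (\<forall>i\<in>I. Y i \<in> borel_measurable A) \<and>
   (\<forall>c. \<exists>\<sigma>\<ge>0. distr A borel (\<lambda>w. \<Sum>i\<in>I. c i * Y i w) = normal_law 0 \<sigma>)"

lemma gaussian_family_combination:
 assumes "gaussian_family A I Y"
 shows "all_moments A (\<lambda>w. \<Sum>i\<in>I. c i * Y i w)"
  and "(LINT w|A. (\<Sum>i\<in>I. c i * Y i w)) = 0"
  and "(CLINT w|A. iexp (\<Sum>i\<in>I. c i * Y i w)) = exp (- (LINT w|A. (\<Sum>i\<in>I. c i * Y i w)\<^sup>2) / 2)"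
proof -
 have m: "(\<lambda>w. \<Sum>i\<in>I. c i * Y i w) \<in> borel_measurable A"
  using assms by (auto simp: gaussian_family_def intro!: borel_measurable_sum borel_measurable_times)
 obtain \<sigma> where s: "\<sigma> \<ge> 0" "distr A borel (\<lambda>w. \<Sum>i\<in>I. c i * Y i w) = normal_law 0 \<sigma>"
  using assms by (auto simp: gaussian_family_def)
 have P: "prob_space A" using assms by (simp add: gaussian_family_def)
 note nl = normal_law_all_moments[OF P m s] normal_law_mean[OF P m s] normal_law_variance[OF P m s]
  normal_law_char[OF P m s]
 show "all_moments A (\<lambda>w. \<Sum>i\<in>I. c i * Y i w)" "(LINT w|A. (\<Sum>i\<in>I. c i * Y i w)) = 0" using nl by auto
 show "(CLINT w|A. iexp (\<Sum>i\<in>I. c i * Y i w)) = exp (- (LINT w|A. (\<Sum>i\<in>I. c i * Y i w)\<^sup>2) / 2)"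
  using nl(3,4) by simp
qed

lemma gaussian_family_member:
 assumes G: "gaussian_family A I Y" and i: "i \<in> I"
 shows "all_moments A (Y i)" "(LINT w|A. Y i w) = 0"
  "\<exists>\<sigma>\<ge>0. distr A borel (Y i) = normal_law 0 \<sigma> \<and> (LINT w|A. (Y i w)\<^sup>2) = \<sigma>\<^sup>2"
proof -
 have fin: "finite I" using G by (simp add: gaussian_family_def)
 have e: "(\<Sum>j\<in>I. (if j = i then 1 else 0) * Y j w) = Y i w" for w
  using i fin by (simp add: if_distrib[of "\<lambda>c. c * _"] cong: if_cong)
 show "all_moments A (Y i)" "(LINT w|A. Y i w) = 0"
  using gaussian_family_combination(1,2)[OF G, of "\<lambda>j. if j = i then 1 else 0"] by (simp_all only: e)
 have P: "prob_space A" and m: "Y i \<in> borel_measurable A" using G i by (auto simp: gaussian_family_def)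
 have "\<forall>c. \<exists>\<sigma>\<ge>0. distr A borel (\<lambda>w. \<Sum>j\<in>I. c j * Y j w) = normal_law 0 \<sigma>"
  using G by (simp add: gaussian_family_def)
 from spec[OF this, of "\<lambda>j. if j = i then 1 else 0"]
 obtain \<sigma> where s: "\<sigma> \<ge> 0" "distr A borel (Y i) = normal_law 0 \<sigma>" unfolding e by blast
 with normal_law_variance[OF P m s] show "\<exists>\<sigma>\<ge>0. distr A borel (Y i) = normal_law 0 \<sigma> \<and> (LINT w|A. (Y i w)\<^sup>2) = \<sigma>\<^sup>2"
  by auto
qed

text \<open>Regression on \<open>Y w\<close>: write \<open>Y i = b i * Y w + R i\<close> with \<open>R\<close> independent of \<open>Y w\<close>, and apply Stein's identity
 to \<open>Y w\<close> with \<open>R\<close> frozen. The independence is realised on a product space: the family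
 \<open>b i * Y w + R i\<close> with \<open>Y w\<close> and \<open>R\<close> read off from different factors is Gaussian with the same covariance, hence
 has the same law.\<close>

theorem gaussian_family_IBP:
 fixes \<phi> \<phi>' :: "('i => real) => real" and Y :: "'i => 'a => real"
 assumes G: "gaussian_family A I Y" and w: "w \<in> I"
  and [measurable]: "\<phi> \<in> borel_measurable (PiM I (\<lambda>_. borel))" "\<phi>' \<in> borel_measurable (PiM I (\<lambda>_. borel))"
  and growth: "\<And>x. \<bar>\<phi> x\<bar> \<le> K * (1 + (\<Sum>i\<in>I. \<bar>x i\<bar>)) ^ r" "\<And>x. \<bar>\<phi>' x\<bar> \<le> K' * (1 + (\<Sum>i\<in>I. \<bar>x i\<bar>)) ^ r'"
  and deriv: "\<And>x. ((\<lambda>t. \<phi> (\<lambda>i\<in>I. x i + t * (LINT v|A. Y w v * Y i v))) has_real_derivative \<phi>' (\<lambda>i\<in>I. x i)) (at 0)"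
 shows "(LINT v|A. Y w v * \<phi> (\<lambda>i\<in>I. Y i v)) = (LINT v|A. \<phi>' (\<lambda>i\<in>I. Y i v))"
proof -
 define a where "a i = (LINT v|A. Y w v * Y i v)" for i
 have P: "prob_space A" and fin: "finite I" using G by (auto simp: gaussian_family_def)
 interpret A: prob_space A by fact
 interpret AA: pair_prob_space A A ..
 have am: "all_moments A (Y i)" if "i \<in> I" for i using gaussian_family_member[OF G that] by blast
 have Ym: "Y i \<in> borel_measurable A" if "i \<in> I" for i using am[OF that] by (simp add: all_moments_def)
 note [measurable] = Ym[OF w]
 have mY[measurable]: "(\<lambda>v. \<lambda>i\<in>I. Y i v) \<in> measurable A (PiM I (\<lambda>_. borel))"
  using Ym by (intro measurable_restrict) auto
 have amS: "all_moments A (\<lambda>v. C * (1 + (\<Sum>i\<in>I. \<bar>Y i v\<bar>)) ^ k)" for C k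
  by (intro A.all_moments_cmult A.all_moments_power all_moments_add A.all_moments_const
    A.all_moments_sum all_moments_abs am)
 have am\<phi>: "all_moments A (\<lambda>v. \<phi> (\<lambda>i\<in>I. Y i v))"
  by (rule all_moments_bound[OF amS[of K r]]) (use growth(1)[of "\<lambda>i\<in>I. Y i v" for v] in auto)
 have am\<phi>': "all_moments A (\<lambda>v. \<phi>' (\<lambda>i\<in>I. Y i v))"
  by (rule all_moments_bound[OF amS[of K' r']]) (use growth(2)[of "\<lambda>i\<in>I. Y i v" for v] in auto)
 obtain \<sigma> where s0: "\<sigma> \<ge> 0" and law: "distr A borel (Y w) = normal_law 0 \<sigma>"
  and var: "(LINT v|A. (Y w v)\<^sup>2) = \<sigma>\<^sup>2" using gaussian_family_member(3)[OF G w] by blast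
 have aw: "a w = \<sigma>\<^sup>2" using var by (simp add: a_def power2_eq_square)
 show ?thesis
 proof (cases "\<sigma> = 0")
  case True
  have "AE v in A. (Y w v)\<^sup>2 = 0"
   using var True all_moments_sq_integrable[OF am[OF w]]
   by (subst integral_nonneg_eq_0_iff_AE[symmetric]) (auto simp: sq_integrable_def)
  then have z: "AE v in A. Y w v = 0" by simp
  have "a i = 0" for i unfolding a_def by (rule integral_eq_zero_AE) (use z in \<open>eventually_elim, simp\<close>)
  then have "((\<lambda>t. \<phi> (\<lambda>i\<in>I. x i)) has_real_derivative \<phi>' (\<lambda>i\<in>I. x i)) (at 0)" for x
   using deriv[of x] by (simp add: a_def)
  then have "\<phi>' (\<lambda>i\<in>I. x i) = 0" for x using DERIV_unique DERIV_const by blast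
  moreover have "(LINT v|A. Y w v * \<phi> (\<lambda>i\<in>I. Y i v)) = 0"
   by (rule integral_eq_zero_AE) (use z in \<open>eventually_elim, simp\<close>)
  ultimately show ?thesis by simp
 next
  case False
  with s0 have s: "\<sigma> > 0" by simp
  define b where "b i = a i / \<sigma>\<^sup>2" for i
  have bw: "b w = 1" using s aw by (simp add: b_def)
  define Z where "Z i = (\<lambda>(v1, v2). b i * Y w v1 + (Y i v2 - b i * Y w v2))" for i
  have Zm: "Z i \<in> borel_measurable (A \<Otimes>\<^sub>M A)" if "i \<in> I" for i
   using Ym[OF that] unfolding Z_def by measurable
  \<comment> \<open>regression on \<open>Y w\<close>: replacing \<open>Y w\<close> by an independent copy in the regression does not change the law\<close>
  have law_eq: "distr A (PiM I (\<lambda>_. borel)) (\<lambda>v. \<lambda>i\<in>I. Y i v) =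
    distr (A \<Otimes>\<^sub>M A) (PiM I (\<lambda>_. borel)) (\<lambda>v. \<lambda>i\<in>I. Z i v)"
  proof (rule joint_char_unique[OF P _ fin Ym Zm])
   show "prob_space (A \<Otimes>\<^sub>M A)" by (rule AA.prob_space_axioms)
   fix u :: "'i => real"
   define L where "L v = (\<Sum>i\<in>I. u i * Y i v)" for v
   define \<beta> where "\<beta> = (\<Sum>i\<in>I. u i * b i)"
   have amL: "all_moments A L" unfolding L_def by (rule gaussian_family_combination(1)[OF G])
   have [measurable]: "L \<in> borel_measurable A" using amL by (simp add: all_moments_def)
   have e1: "\<beta> * Y w v = (\<Sum>i\<in>I. (if i = w then \<beta> else 0) * Y i v)" for v
    using w fin by (simp add: if_distrib[of "\<lambda>c. c * _"] cong: if_cong)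
   have e2: "L v - \<beta> * Y w v = (\<Sum>i\<in>I. (u i - (if i = w then \<beta> else 0)) * Y i v)" for v
    unfolding e1 L_def by (simp add: sum_subtractf left_diff_distrib)
   have i1: "integrable A (\<lambda>v. Y w v * (u i * Y i v))" if "i \<in> I" for i
    by (intro all_moments_integrable all_moments_mult A.all_moments_cmult am w that)
   have WL: "(LINT v|A. Y w v * L v) = \<beta> * \<sigma>\<^sup>2"
   proof -
    have "(LINT v|A. Y w v * L v) = (LINT v|A. (\<Sum>i\<in>I. Y w v * (u i * Y i v)))"
     by (simp add: L_def sum_distrib_left)
    also have "\<dots> = (\<Sum>i\<in>I. LINT v|A. Y w v * (u i * Y i v))"
     by (rule Bochner_Integration.integral_sum) (rule i1)
    also have "\<dots> = (\<Sum>i\<in>I. u i * a i)"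
     by (intro sum.cong refl) (simp add: a_def mult.left_commute)
    also have "\<dots> = \<beta> * \<sigma>\<^sup>2" using s by (simp add: \<beta>_def sum_distrib_right b_def)
    finally show ?thesis .
   qed
   have sqW: "sq_integrable A (Y w)" "sq_integrable A L"
    by (intro all_moments_sq_integrable am w amL)+
   have int: "integrable A (\<lambda>v. (L v)\<^sup>2)" "integrable A (\<lambda>v. (Y w v)\<^sup>2)" "integrable A (\<lambda>v. Y w v * L v)"
    using sqW sq_integrable_mult[OF sqW] by (auto simp: sq_integrable_def)
   have V1: "(LINT v|A. (\<beta> * Y w v)\<^sup>2) = \<beta>\<^sup>2 * \<sigma>\<^sup>2"
    using var by (simp add: power_mult_distrib)
   have "(\<lambda>v. (L v - \<beta> * Y w v)\<^sup>2) = (\<lambda>v. (L v)\<^sup>2 - (2 * \<beta>) * (Y w v * L v) + \<beta>\<^sup>2 * (Y w v)\<^sup>2)"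
    by (rule ext) (simp add: power2_diff power_mult_distrib)
   then have V2: "(LINT v|A. (L v - \<beta> * Y w v)\<^sup>2) = (LINT v|A. (L v)\<^sup>2) - \<beta>\<^sup>2 * \<sigma>\<^sup>2"
    using int WL var by (simp add: power2_eq_square)
   have sumZ: "(\<Sum>i\<in>I. u i * Z i (v1, v2)) = \<beta> * Y w v1 + (L v2 - \<beta> * Y w v2)" for v1 v2
   proof -
    have "(\<Sum>i\<in>I. u i * Z i (v1, v2)) = (\<Sum>i\<in>I. (u i * b i) * (Y w v1 - Y w v2) + u i * Y i v2)"
     by (intro sum.cong refl) (simp add: Z_def algebra_simps)
    also have "\<dots> = \<beta> * (Y w v1 - Y w v2) + L v2"
     by (simp add: sum.distrib L_def \<beta>_def flip: sum_distrib_right)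
    finally show ?thesis by (simp add: algebra_simps)
   qed
   have mS: "(\<lambda>v. \<Sum>i\<in>I. u i * Z i v) \<in> borel_measurable (A \<Otimes>\<^sub>M A)"
    using Zm by (auto intro!: borel_measurable_sum borel_measurable_times)
   have "(CLINT v|(A \<Otimes>\<^sub>M A). iexp (\<Sum>i\<in>I. u i * Z i v)) =
     (CLINT v1|A. CLINT v2|A. iexp (\<Sum>i\<in>I. u i * Z i (v1, v2)))"
    by (rule AA.integral_fst'[symmetric], rule AA.integrable_const_bound[where B=1])
      (use mS in \<open>auto simp del: of_real_sum of_real_mult\<close>)
   also have "\<dots> = (CLINT v1|A. iexp (\<beta> * Y w v1) * (CLINT v2|A. iexp (L v2 - \<beta> * Y w v2)))"
    unfolding sumZ by (simp add: exp_add distrib_left)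
   also have "\<dots> = (CLINT v1|A. iexp (\<beta> * Y w v1)) * (CLINT v2|A. iexp (L v2 - \<beta> * Y w v2))"
    by simp
   also have "\<dots> = exp (- (LINT v|A. (\<beta> * Y w v)\<^sup>2) / 2) * exp (- (LINT v|A. (L v - \<beta> * Y w v)\<^sup>2) / 2)"
    using gaussian_family_combination(3)[OF G, of "\<lambda>i. if i = w then \<beta> else 0"]
     gaussian_family_combination(3)[OF G, of "\<lambda>i. u i - (if i = w then \<beta> else 0)"]
    by (simp only: e1[symmetric] e2[symmetric] of_real_mult)
   also have "\<dots> = exp (- (LINT v|A. (L v)\<^sup>2) / 2)"
    unfolding V1 V2 by (simp add: field_simps flip: exp_add)
   also have "\<dots> = (CLINT v|A. iexp (\<Sum>i\<in>I. u i * Y i v))"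
    unfolding gaussian_family_combination(3)[OF G] L_def ..
   finally show "(CLINT v|A. iexp (\<Sum>i\<in>I. u i * Y i v)) = (CLINT v|(A \<Otimes>\<^sub>M A). iexp (\<Sum>i\<in>I. u i * Z i v))" ..
  qed
  have mZ[measurable]: "(\<lambda>v. \<lambda>i\<in>I. Z i v) \<in> measurable (A \<Otimes>\<^sub>M A) (PiM I (\<lambda>_. borel))"
   using Zm by (intro measurable_restrict) auto
  have tr: "(LINT v|A. \<psi> (\<lambda>i\<in>I. Y i v)) = (LINT v2|A. (LINT v1|A. \<psi> (\<lambda>i\<in>I. Z i (v1, v2))))"
   if [measurable]: "\<psi> \<in> borel_measurable (PiM I (\<lambda>_. borel))" and int: "integrable A (\<lambda>v. \<psi> (\<lambda>i\<in>I. Y i v))"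
   for \<psi> :: "('i => real) => real"
  proof -
   have "(LINT v|A. \<psi> (\<lambda>i\<in>I. Y i v)) = (LINT v|(A \<Otimes>\<^sub>M A). \<psi> (\<lambda>i\<in>I. Z i v))"
    using arg_cong[OF law_eq, of "\<lambda>D. integral\<^sup>L D \<psi>"] by (simp add: integral_distr)
   moreover have "integrable (A \<Otimes>\<^sub>M A) (\<lambda>v. \<psi> (\<lambda>i\<in>I. Z i v))"
    using arg_cong[OF law_eq, of "\<lambda>D. integrable D \<psi>"] int by (simp add: integrable_distr_eq)
   then have "(LINT v2|A. (LINT v1|A. \<psi> (\<lambda>i\<in>I. Z i (v1, v2)))) = (LINT v|(A \<Otimes>\<^sub>M A). \<psi> (\<lambda>i\<in>I. Z i v))"
    using AA.integral_snd[of "\<lambda>v1 v2. \<psi> (\<lambda>i\<in>I. Z i (v1, v2))"] by (simp add: case_prod_unfold)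
   ultimately show ?thesis by simp
  qed
  have inner: "(LINT v1|A. Y w v1 * \<phi> (\<lambda>i\<in>I. Z i (v1, v2))) = (LINT v1|A. \<phi>' (\<lambda>i\<in>I. Z i (v1, v2)))" for v2
  proof -
   define q where "q i = Y i v2 - b i * Y w v2" for i
   define f where "f y = \<phi> (\<lambda>i\<in>I. b i * y + q i)" for y
   define f' where "f' y = \<phi>' (\<lambda>i\<in>I. b i * y + q i) / \<sigma>\<^sup>2" for y
   have d: "(f has_real_derivative f' y) (at y)" for y
   proof -
    have d1: "((\<lambda>z. (z - y) / \<sigma>\<^sup>2) has_real_derivative 1 / \<sigma>\<^sup>2) (at y)"
     by (rule DERIV_cdivide) (auto intro!: derivative_eq_intros)
    have d2: "((\<lambda>t. \<phi> (\<lambda>i\<in>I. (b i * y + q i) + t * a i)) has_real_derivative \<phi>' (\<lambda>i\<in>I. b i * y + q i)) (at ((y - y) / \<sigma>\<^sup>2))"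
     using deriv[of "\<lambda>i. b i * y + q i"] by (simp add: a_def)
    have "((\<lambda>z. \<phi> (\<lambda>i\<in>I. (b i * y + q i) + (z - y) / \<sigma>\<^sup>2 * a i)) has_real_derivative
      \<phi>' (\<lambda>i\<in>I. b i * y + q i) * (1 / \<sigma>\<^sup>2)) (at y)"
     by (rule DERIV_chain2[where g="\<lambda>z. (z - y) / \<sigma>\<^sup>2" and f="\<lambda>t. \<phi> (\<lambda>i\<in>I. (b i * y + q i) + t * a i)", OF d2 d1])
    moreover have "(b i * y + q i) + (z - y) / \<sigma>\<^sup>2 * a i = b i * z + q i" for i z
     using s by (simp add: b_def field_simps)
    ultimately have "((\<lambda>z. \<phi> (\<lambda>i\<in>I. b i * z + q i)) has_real_derivative
      \<phi>' (\<lambda>i\<in>I. b i * y + q i) * (1 / \<sigma>\<^sup>2)) (at y)" by (simp only:)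
    then show ?thesis by (simp add: f_def[abs_def] f'_def)
   qed
   have m: "f' \<in> borel_measurable borel" unfolding f'_def
    by (intro borel_measurable_divide borel_measurable_const measurable_compose[OF _ assms(4)] measurable_restrict) measurable
   have K0: "0 \<le> K'" using growth(2)[of "\<lambda>_. 0"] by simp
   define B where "B = (\<Sum>i\<in>I. \<bar>b i\<bar>)"
   define Q where "Q = (\<Sum>i\<in>I. \<bar>q i\<bar>)"
   have BQ: "0 \<le> B" "0 \<le> Q" by (simp_all add: B_def Q_def sum_nonneg)
   define c where "c = 1 + B + Q"
   have g: "\<bar>f' y\<bar> \<le> (K' * c ^ r' / \<sigma>\<^sup>2) * (1 + \<bar>y\<bar>) ^ r'" for y
   proof -
    have ce: "c * (1 + \<bar>y\<bar>) = 1 + B + Q + \<bar>y\<bar> + B * \<bar>y\<bar> + Q * \<bar>y\<bar>"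
     by (simp add: c_def algebra_simps)
    have "(\<Sum>i\<in>I. \<bar>(\<lambda>i\<in>I. b i * y + q i) i\<bar>) \<le> (\<Sum>i\<in>I. \<bar>b i\<bar> * \<bar>y\<bar> + \<bar>q i\<bar>)"
     by (intro sum_mono) (auto simp flip: abs_mult)
    also have "\<dots> = B * \<bar>y\<bar> + Q" by (simp add: B_def Q_def sum.distrib sum_distrib_right)
    finally have "1 + (\<Sum>i\<in>I. \<bar>(\<lambda>i\<in>I. b i * y + q i) i\<bar>) \<le> c * (1 + \<bar>y\<bar>)"
     unfolding ce using mult_nonneg_nonneg[OF BQ(2) abs_ge_zero[of y]] BQ by linarith
    then have "\<bar>\<phi>' (\<lambda>i\<in>I. b i * y + q i)\<bar> \<le> K' * (c * (1 + \<bar>y\<bar>)) ^ r'"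
     by (intro order_trans[OF growth(2)] mult_left_mono power_mono K0 add_nonneg_nonneg sum_nonneg) simp_all
    then show ?thesis using s by (simp add: f'_def power_mult_distrib divide_right_mono)
   qed
   have "(LINT v1|A. Y w v1 * f (Y w v1)) = \<sigma>\<^sup>2 * (LINT v1|A. f' (Y w v1))"
    by (rule stein_normal_law[OF P Ym[OF w] s law d m g])
   moreover have "(\<lambda>i\<in>I. Z i (v1, v2)) = (\<lambda>i\<in>I. b i * Y w v1 + q i)" for v1
    by (simp add: Z_def q_def)
   ultimately show ?thesis using s by (simp add: f_def f'_def)
  qed
  have "(LINT v|A. Y w v * \<phi> (\<lambda>i\<in>I. Y i v)) = (LINT v2|A. (LINT v1|A. Y w v1 * \<phi> (\<lambda>i\<in>I. Z i (v1, v2))))"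
  proof -
   have "integrable A (\<lambda>v. Y w v * \<phi> (\<lambda>i\<in>I. Y i v))"
    by (intro all_moments_integrable all_moments_mult am w am\<phi>)
   then show ?thesis using tr[of "\<lambda>x. x w * \<phi> x"] w bw by (simp add: Z_def)
  qed
  also have "\<dots> = (LINT v2|A. (LINT v1|A. \<phi>' (\<lambda>i\<in>I. Z i (v1, v2))))" unfolding inner ..
  also have "\<dots> = (LINT v|A. \<phi>' (\<lambda>i\<in>I. Y i v))"
   by (rule tr[symmetric], rule assms(4), rule all_moments_integrable, rule am\<phi>')
  finally show ?thesis .
 qed
qed

section \<open>Cylindrical functionals\<close>

text \<open>Functionals of the whole field that depend on finitely many coordinates. Indexing by vectors instead of
 numbers lets two functionals be combined over the union of their coordinates.\<close>

definition cylindrical_on :: "'i set => (('i => real) => real) => bool" where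
 "cylindrical_on I \<Phi> \<longleftrightarrow> \<Phi> \<in> borel_measurable (PiM I (\<lambda>_. borel)) \<and> (\<forall>x. \<Phi> (restrict x I) = \<Phi> x) \<and>
   (\<exists>K r. \<forall>x. \<bar>\<Phi> x\<bar> \<le> K * (1 + (\<Sum>i\<in>I. \<bar>x i\<bar>)) ^ r)"

lemma cylindrical_onI:
 assumes "\<Phi> \<in> borel_measurable (PiM I (\<lambda>_. borel))" "\<And>x. \<Phi> (restrict x I) = \<Phi> x"
  and "\<And>x. \<bar>\<Phi> x\<bar> \<le> \<Psi> x" "cylindrical_on I \<Psi>"
 shows "cylindrical_on I \<Phi>"
proof -
 obtain K r where "\<And>x. \<bar>\<Psi> x\<bar> \<le> K * (1 + (\<Sum>i\<in>I. \<bar>x i\<bar>)) ^ r" using assms(4) by (auto simp: cylindrical_on_def)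
 then have "\<bar>\<Phi> x\<bar> \<le> K * (1 + (\<Sum>i\<in>I. \<bar>x i\<bar>)) ^ r" for x
  using order_trans[OF assms(3) order_trans[OF abs_ge_self]] by blast
 then show ?thesis using assms by (auto simp: cylindrical_on_def)
qed

lemma poly_growth_weaken:
 assumes "\<bar>a\<bar> \<le> K * (1 + s) ^ r" "0 \<le> (s::real)" "K \<le> K'" "r \<le> r'" "0 \<le> K'"
 shows "\<bar>a\<bar> \<le> K' * (1 + s) ^ r'"
proof -
 have "K * (1 + s) ^ r \<le> K' * (1 + s) ^ r" by (rule mult_right_mono) (use assms in auto)
 also have "\<dots> \<le> K' * (1 + s) ^ r'" by (intro mult_left_mono power_increasing) (use assms in auto)
 finally show ?thesis using assms by linarith
qed

lemma cylindrical_on_mono: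
 assumes "cylindrical_on I \<Phi>" "I \<subseteq> J" "finite J"
 shows "cylindrical_on J \<Phi>"
proof -
 have r: "\<Phi> (restrict x I) = \<Phi> x" for x using assms by (auto simp: cylindrical_on_def)
 have "(\<lambda>x. \<Phi> (restrict x I)) \<in> borel_measurable (PiM J (\<lambda>_. borel))"
  using assms by (intro measurable_compose[OF measurable_restrict_subset[OF assms(2)]]) (auto simp: cylindrical_on_def)
 then have m: "\<Phi> \<in> borel_measurable (PiM J (\<lambda>_. borel))" by (simp add: r)
 have rJ: "\<Phi> (restrict x J) = \<Phi> x" for x
  using r[of "restrict x J"] r[of x] assms(2) by (simp add: Int_absorb1 Int_absorb2)
 obtain K r where K: "\<And>x. \<bar>\<Phi> x\<bar> \<le> K * (1 + (\<Sum>i\<in>I. \<bar>x i\<bar>)) ^ r" using assms(1) by (auto simp: cylindrical_on_def)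
 have K0: "0 \<le> K" using K[of "\<lambda>_. 0"] by simp
 have "\<bar>\<Phi> x\<bar> \<le> K * (1 + (\<Sum>i\<in>J. \<bar>x i\<bar>)) ^ r" for x
  by (rule order_trans[OF K mult_left_mono[OF power_mono K0]])
    (use assms in \<open>auto intro!: sum_mono2 add_nonneg_nonneg sum_nonneg\<close>)
 with m rJ show ?thesis by (auto simp: cylindrical_on_def)
qed

lemma cylindrical_on_const: "cylindrical_on I (\<lambda>_. c)"
 unfolding cylindrical_on_def by (intro conjI exI[of _ "\<bar>c\<bar>"] exI[of _ 0]) auto

lemma cylindrical_on_coordinate:
 assumes "i \<in> I" "finite I" shows "cylindrical_on I (\<lambda>x. x i)"
proof -
 have "\<bar>x i\<bar> \<le> 1 * (1 + (\<Sum>j\<in>I. \<bar>x j\<bar>)) ^ 1" for x :: "'a => real"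
  using member_le_sum[of i I "\<lambda>j. \<bar>x j\<bar>"] assms by simp
 then show ?thesis using assms unfolding cylindrical_on_def
  by (intro conjI exI[of _ 1] allI measurable_component_singleton) auto
qed

lemma cylindrical_on_abs: "cylindrical_on I \<Phi> ==> cylindrical_on I (\<lambda>x. \<bar>\<Phi> x\<bar>)"
 by (auto simp: cylindrical_on_def)

lemma cylindrical_on_add:
 assumes "cylindrical_on I \<Phi>" "cylindrical_on I \<Psi>" shows "cylindrical_on I (\<lambda>x. \<Phi> x + \<Psi> x)"
proof -
 obtain K r K' r' where K: "\<And>x. \<bar>\<Phi> x\<bar> \<le> K * (1 + (\<Sum>i\<in>I. \<bar>x i\<bar>)) ^ r"
  "\<And>x. \<bar>\<Psi> x\<bar> \<le> K' * (1 + (\<Sum>i\<in>I. \<bar>x i\<bar>)) ^ r'" using assms by (auto simp: cylindrical_on_def)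
 have K0: "0 \<le> K" "0 \<le> K'" using K(1)[of "\<lambda>_. 0"] K(2)[of "\<lambda>_. 0"] by auto
 have "\<bar>\<Phi> x + \<Psi> x\<bar> \<le> (K + K') * (1 + (\<Sum>i\<in>I. \<bar>x i\<bar>)) ^ (r + r')" for x
 proof -
  have s: "0 \<le> (\<Sum>i\<in>I. \<bar>x i\<bar>)" by (simp add: sum_nonneg)
  have "\<bar>\<Phi> x\<bar> \<le> K * (1 + (\<Sum>i\<in>I. \<bar>x i\<bar>)) ^ (r + r')" "\<bar>\<Psi> x\<bar> \<le> K' * (1 + (\<Sum>i\<in>I. \<bar>x i\<bar>)) ^ (r + r')"
   by (rule poly_growth_weaken[OF K(1) s] poly_growth_weaken[OF K(2) s], use K0 in auto)+
  then show ?thesis by (simp add: distrib_right)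
 qed
 moreover have "(\<lambda>x. \<Phi> x + \<Psi> x) \<in> borel_measurable (PiM I (\<lambda>_. borel))" "\<And>x. \<Phi> (restrict x I) + \<Psi> (restrict x I) = \<Phi> x + \<Psi> x"
  using assms by (auto simp: cylindrical_on_def)
 ultimately show ?thesis unfolding cylindrical_on_def by blast
qed

lemma cylindrical_on_mult:
 assumes "cylindrical_on I \<Phi>" "cylindrical_on I \<Psi>" shows "cylindrical_on I (\<lambda>x. \<Phi> x * \<Psi> x)"
proof -
 obtain K r K' r' where K: "\<And>x. \<bar>\<Phi> x\<bar> \<le> K * (1 + (\<Sum>i\<in>I. \<bar>x i\<bar>)) ^ r"
  "\<And>x. \<bar>\<Psi> x\<bar> \<le> K' * (1 + (\<Sum>i\<in>I. \<bar>x i\<bar>)) ^ r'" using assms by (auto simp: cylindrical_on_def)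
 have "\<bar>\<Phi> x * \<Psi> x\<bar> \<le> (K * K') * (1 + (\<Sum>i\<in>I. \<bar>x i\<bar>)) ^ (r + r')" for x
  using mult_mono[OF K(1)[of x] K(2)[of x]] order_trans[OF abs_ge_zero K(1)[of x]]
  by (simp add: abs_mult power_add mult_ac)
 moreover have "(\<lambda>x. \<Phi> x * \<Psi> x) \<in> borel_measurable (PiM I (\<lambda>_. borel))" "\<And>x. \<Phi> (restrict x I) * \<Psi> (restrict x I) = \<Phi> x * \<Psi> x"
  using assms by (auto simp: cylindrical_on_def)
 ultimately show ?thesis unfolding cylindrical_on_def by blast
qed

lemma cylindrical_on_cmult: "cylindrical_on I \<Phi> ==> cylindrical_on I (\<lambda>x. c * \<Phi> x)"
 by (intro cylindrical_on_mult cylindrical_on_const)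

lemma cylindrical_on_diff:
 assumes "cylindrical_on I \<Phi>" "cylindrical_on I \<Psi>" shows "cylindrical_on I (\<lambda>x. \<Phi> x - \<Psi> x)"
 using cylindrical_on_add[OF assms(1) cylindrical_on_cmult[OF assms(2), of "-1"]] by simp

lemma cylindrical_on_sum:
 "(\<And>j. j \<in> J ==> cylindrical_on I (\<Phi> j)) ==> cylindrical_on I (\<lambda>x. \<Sum>j\<in>J. \<Phi> j x)"
 by (induction J rule: infinite_finite_induct) (auto intro: cylindrical_on_add cylindrical_on_const)

lemma cylindrical_on_power: "cylindrical_on I \<Phi> ==> cylindrical_on I (\<lambda>x. \<Phi> x ^ n)"
 by (induction n) (auto intro: cylindrical_on_mult cylindrical_on_const)

text \<open>\<open>direction_deriv k \<Phi> \<Phi>'\<close>: \<open>\<Phi>'\<close> is the derivative of \<open>\<Phi>\<close> along the Cameron--Martin shift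
 \<open>x v \<mapsto> x v + t * (k \<bullet> v)\<close> of the field.\<close>

definition direction_deriv ::
 "'h::real_inner => (('h => real) => real) => (('h => real) => real) => bool" where
 "direction_deriv k \<Phi> \<Phi>' \<longleftrightarrow> (\<forall>x. ((\<lambda>t. \<Phi> (\<lambda>v. x v + t * (k \<bullet> v))) has_real_derivative \<Phi>' x) (at 0))"

lemma direction_deriv_const: "direction_deriv k (\<lambda>_. c) (\<lambda>_. 0)"
 by (simp add: direction_deriv_def)

lemma direction_deriv_mult:
 assumes "direction_deriv k \<Phi> \<Phi>'" "direction_deriv k \<Psi> \<Psi>'"
 shows "direction_deriv k (\<lambda>x. \<Phi> x * \<Psi> x) (\<lambda>x. \<Phi>' x * \<Psi> x + \<Phi> x * \<Psi>' x)"
 unfolding direction_deriv_def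
proof
 fix x :: "'a => real"
 from DERIV_mult[OF assms(1)[unfolded direction_deriv_def, rule_format, of x] assms(2)[unfolded direction_deriv_def, rule_format, of x]]
 show "((\<lambda>t. \<Phi> (\<lambda>v. x v + t * (k \<bullet> v)) * \<Psi> (\<lambda>v. x v + t * (k \<bullet> v))) has_real_derivative \<Phi>' x * \<Psi> x + \<Phi> x * \<Psi>' x) (at 0)"
  by (simp add: mult.commute)
qed

lemma direction_deriv_cmult:
 "direction_deriv k \<Phi> \<Phi>' ==> direction_deriv k (\<lambda>x. c * \<Phi> x) (\<lambda>x. c * \<Phi>' x)"
 unfolding direction_deriv_def by (intro allI DERIV_cmult) auto

lemma direction_deriv_sum:
 "(\<And>j. j \<in> J ==> direction_deriv k (\<Phi> j) (\<Phi>' j)) ==> direction_deriv k (\<lambda>x. \<Sum>j\<in>J. \<Phi> j x) (\<lambda>x. \<Sum>j\<in>J. \<Phi>' j x)"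
 unfolding direction_deriv_def by (intro allI DERIV_sum) auto

lemma direction_deriv_compose:
 assumes "\<And>y. (f has_real_derivative f' y) (at y)" "direction_deriv k \<Phi> \<Phi>'"
 shows "direction_deriv k (\<lambda>x. f (\<Phi> x)) (\<lambda>x. f' (\<Phi> x) * \<Phi>' x)"
 unfolding direction_deriv_def
proof
 fix x :: "'a => real"
 show "((\<lambda>t. f (\<Phi> (\<lambda>v. x v + t * (k \<bullet> v)))) has_real_derivative f' (\<Phi> x) * \<Phi>' x) (at 0)"
  using DERIV_chain2[OF assms(1) assms(2)[unfolded direction_deriv_def, rule_format, of x]] by simp
qed

lemma direction_deriv_coordinate: "direction_deriv k (\<lambda>x. x h) (\<lambda>x. k \<bullet> h)"
 unfolding direction_deriv_def by (auto intro!: derivative_eq_intros)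

context isonormal_gaussian_process
begin

lemma gaussian_family_X: "finite I ==> gaussian_family M I X"
 using X_jointly_gaussian X_measurable prob_space_axioms by (auto simp: gaussian_family_def)

lemma all_moments_X: "all_moments M (X h)"
 using gaussian_family_member(1)[OF gaussian_family_X, of "{h}"] by simp

lemma all_moments_cylindrical:
 assumes c: "cylindrical_on I \<Phi>" and fin: "finite I"
 shows "all_moments M (\<lambda>w. \<Phi> (\<lambda>v. X v w))"
proof -
 obtain K r where K: "\<And>x. \<bar>\<Phi> x\<bar> \<le> K * (1 + (\<Sum>i\<in>I. \<bar>x i\<bar>)) ^ r" using c by (auto simp: cylindrical_on_def)
 have r: "\<Phi> (restrict x I) = \<Phi> x" for x using c by (auto simp: cylindrical_on_def)
 show ?thesis
 proof (rule all_moments_bound)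
  show "all_moments M (\<lambda>w. K * (1 + (\<Sum>i\<in>I. \<bar>X i w\<bar>)) ^ r)"
   by (intro all_moments_cmult all_moments_power all_moments_add all_moments_const all_moments_sum
     all_moments_abs all_moments_X)
  have "(\<lambda>w. \<lambda>i\<in>I. X i w) \<in> measurable M (PiM I (\<lambda>_. borel))"
   by (intro measurable_restrict X_measurable)
  moreover have "\<Phi> \<in> borel_measurable (PiM I (\<lambda>_. borel))" using c by (simp add: cylindrical_on_def)
  ultimately have "(\<lambda>w. \<Phi> (\<lambda>i\<in>I. X i w)) \<in> borel_measurable M" by (rule measurable_compose)
  then show "(\<lambda>w. \<Phi> (\<lambda>v. X v w)) \<in> borel_measurable M" by (simp only: r)
 qed (rule K)
qed

text \<open>The integration by parts of a Gaussian family, read along the direction \<open>v \<mapsto> E[X k X v] = k \<bullet> v\<close>.\<close>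

theorem isonormal_IBP:
 assumes c: "cylindrical_on I \<Phi>" "cylindrical_on I \<Phi>'" and fin: "finite I" and d: "direction_deriv k \<Phi> \<Phi>'"
 shows "(LINT w|M. X k w * \<Phi> (\<lambda>v. X v w)) = (LINT w|M. \<Phi>' (\<lambda>v. X v w))"
proof -
 let ?J = "insert k I"
 have c': "cylindrical_on ?J \<Phi>" "cylindrical_on ?J \<Phi>'" using c fin by (auto intro: cylindrical_on_mono)
 obtain K r K' r' where K: "\<And>x. \<bar>\<Phi> x\<bar> \<le> K * (1 + (\<Sum>i\<in>?J. \<bar>x i\<bar>)) ^ r"
  "\<And>x. \<bar>\<Phi>' x\<bar> \<le> K' * (1 + (\<Sum>i\<in>?J. \<bar>x i\<bar>)) ^ r'"
  using c' unfolding cylindrical_on_def by blast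
 have r: "\<Phi> (restrict x ?J) = \<Phi> x" "\<Phi>' (restrict x ?J) = \<Phi>' x" for x using c' by (auto simp: cylindrical_on_def)
 have "(LINT w|M. X k w * \<Phi> (\<lambda>i\<in>?J. X i w)) = (LINT w|M. \<Phi>' (\<lambda>i\<in>?J. X i w))"
 proof (rule gaussian_family_IBP[OF gaussian_family_X _ _ _ K])
  show "((\<lambda>t. \<Phi> (\<lambda>i\<in>?J. x i + t * (LINT w|M. X k w * X i w))) has_real_derivative \<Phi>' (\<lambda>i\<in>?J. x i)) (at 0)" for x
   using d unfolding X_covariance r direction_deriv_def by blast
 qed (use c' fin in \<open>auto simp: cylindrical_on_def\<close>)
 then show ?thesis by (simp only: r)
qed

end

section \<open>Smooth functions of polynomial growth\<close>

lemma
 assumes "\<phi> \<in> smooth_poly_growth m"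
 shows spg_cong: "(\<And>i. i < m ==> x i = y i) ==> \<phi> x = \<phi> y"
  and spg_continuous: "continuous_on UNIV \<phi>"
  and spg_growth: "\<exists>K r. \<forall>x. \<bar>\<phi> x\<bar> \<le> K * (1 + (\<Sum>i<m. \<bar>x i\<bar>)) ^ r"
  and spg_deriv: "i < m ==> ((\<lambda>t. \<phi> (x(i := t))) has_real_derivative coord_deriv i \<phi> x) (at (x i))"
  and spg_coord_deriv: "i < m ==> coord_deriv i \<phi> \<in> smooth_poly_growth m"
proof -
 have dep: "\<phi> x = \<phi> y" if "\<And>i. i < m ==> x i = y i" for x y
  using assms that by (auto simp: smooth_poly_growth_def)
 have all: "set is \<subseteq> {..<m} ==>
    (let \<psi> = foldr coord_deriv is \<phi> in
      continuous_on UNIV \<psi> \<and>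
      (\<forall>x. \<forall>i<m. (\<lambda>t. \<psi> (x(i := t))) differentiable (at (x i))) \<and>
      (\<exists>K r. \<forall>x. \<bar>\<psi> x\<bar> \<le> K * (1 + (\<Sum>i<m. \<bar>x i\<bar>)) ^ r))" for "is"
  using assms by (auto simp: smooth_poly_growth_def)
 show "\<phi> x = \<phi> y" if "\<And>i. i < m ==> x i = y i" using dep that by blast
 show "continuous_on UNIV \<phi>" "\<exists>K r. \<forall>x. \<bar>\<phi> x\<bar> \<le> K * (1 + (\<Sum>i<m. \<bar>x i\<bar>)) ^ r"
  using all[of "[]"] by auto
 show "((\<lambda>t. \<phi> (x(i := t))) has_real_derivative coord_deriv i \<phi> x) (at (x i))" if "i < m"
  using all[of "[]"] that by (simp add: coord_deriv_def real_differentiableE DERIV_deriv_iff_real_differentiable)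
 show "coord_deriv i \<phi> \<in> smooth_poly_growth m" if i: "i < m"
  unfolding smooth_poly_growth_def
 proof (intro CollectI conjI allI impI)
  fix x y :: "nat => real" assume "\<forall>i<m. x i = y i"
  then have "(\<lambda>t. \<phi> (x(i := t))) = (\<lambda>t. \<phi> (y(i := t)))" "x i = y i"
   using i by (auto intro!: dep)
  then show "coord_deriv i \<phi> x = coord_deriv i \<phi> y" by (simp add: coord_deriv_def)
 next
  fix "is" assume "set is \<subseteq> {..<m}"
  then show "(let \<psi> = foldr coord_deriv is (coord_deriv i \<phi>) in
      continuous_on UNIV \<psi> \<and>
      (\<forall>x. \<forall>i<m. (\<lambda>t. \<psi> (x(i := t))) differentiable (at (x i))) \<and>
      (\<exists>K r. \<forall>x. \<bar>\<psi> x\<bar> \<le> K * (1 + (\<Sum>i<m. \<bar>x i\<bar>)) ^ r))"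
   using all[of "is @ [i]"] i by simp
 qed
qed

text \<open>Only partial derivatives are available, so total differentiability along a line is obtained by adding one
 coordinate at a time, continuity of the partial derivatives being used for the added coordinate.\<close>

lemma chain_rule_of_continuous_partials:
 fixes \<phi> :: "(nat => real) => real"
 assumes cont: "\<And>i. i < m ==> continuous_on UNIV (D i)"
  and deriv: "\<And>i x. i < m ==> ((\<lambda>t. \<phi> (x(i := t))) has_real_derivative D i x) (at (x i))"
  and "n \<le> m"
 shows "((\<lambda>t. \<phi> (\<lambda>i. if i < n then x i + t * a i else x i)) has_real_derivative
   (\<Sum>i<n. a i * D i (\<lambda>i. if i < n then x i + t * a i else x i))) (at t)"
 using \<open>n \<le> m\<close>
proof (induction n arbitrary: x t)
 case 0
 then show ?case by simp
next
 case (Suc n)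
 define p where "p s u = (\<lambda>i. if i < n then x i + s * a i else if i = n then x i + u * a i else x i)" for s u
 define G where "G s u = \<phi> (p s u)" for s u
 define fy where "fy s u = (a n * D n (p s u)) *\<^sub>R (id_blinfun :: real \<Rightarrow>\<^sub>L real)" for s u
 have fx: "((\<lambda>s. G s t) has_derivative (\<lambda>h. h * (\<Sum>i<n. a i * D i (p t t)))) (at t)"
 proof -
  have p: "p s t = (\<lambda>i. if i < n then (x(n := x n + t * a n)) i + s * a i else (x(n := x n + t * a n)) i)" for s
   by (auto simp: p_def fun_eq_iff)
  show ?thesis
   using Suc.IH[of "x(n := x n + t * a n)" t] Suc.prems
   unfolding G_def p has_field_derivative_def by (simp add: mult.commute[of _ "sum _ _"] mult_commute_abs)
 qed
 have fy: "((\<lambda>u. G s u) has_derivative blinfun_apply (fy s u)) (at u)" for s u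
 proof -
  have p: "p s u' = (p s u)(n := x n + u' * a n)" for u' by (auto simp: p_def fun_eq_iff)
  have "((\<lambda>t. \<phi> ((p s u)(n := t))) has_real_derivative D n (p s u)) (at (x n + u * a n))"
   using deriv[of n "p s u"] Suc.prems by (simp add: p_def)
  moreover have "((\<lambda>u. x n + u * a n) has_real_derivative a n) (at u)" by (auto intro!: derivative_eq_intros)
  ultimately have "((\<lambda>u'. \<phi> ((p s u)(n := x n + u' * a n))) has_real_derivative D n (p s u) * a n) (at u)"
   by (rule DERIV_chain2)
  moreover have "blinfun_apply (fy s u) = (*) (D n (p s u) * a n)"
   by (auto simp: fy_def blinfun.scaleR_left fun_eq_iff)
  ultimately show ?thesis unfolding G_def p[symmetric] has_field_derivative_def by simp
 qed
 have cp: "continuous_on UNIV (\<lambda>(s, u). p s u)"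
 proof (rule continuous_on_coordinatewise_then_product)
  fix i
  show "continuous_on UNIV (\<lambda>x. (case x of (s, u) => p s u) i)"
   by (cases "i < n"; cases "i = n") (auto simp: p_def case_prod_unfold intro!: continuous_intros)
 qed
 have "continuous_on UNIV (\<lambda>(s, u). D n (p s u))"
  using continuous_on_compose2[OF cont[of n] cp] Suc.prems by (simp add: case_prod_unfold)
 then have "continuous_on UNIV (\<lambda>(s, u). fy s u)"
  unfolding fy_def case_prod_unfold by (intro continuous_intros)
 then have cfy: "continuous (at (t, t)) (\<lambda>(s, u). fy s u)"
  by (simp add: continuous_on_eq_continuous_at)
 have "((\<lambda>(s, u). G s u) has_derivative (\<lambda>(ts, tu). ts * (\<Sum>i<n. a i * D i (p t t)) + blinfun_apply (fy t t) tu)) (at (t, t))"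
  using has_derivative_partialsI[of G t _ t UNIV UNIV fy] fx fy cfy by simp
 moreover have "((\<lambda>t. (t, t)) has_derivative (\<lambda>h. (h, h))) (at t)"
  by (intro has_derivative_Pair has_derivative_ident)
 ultimately have "((\<lambda>t. G t t) has_derivative (\<lambda>h. h * (\<Sum>i<n. a i * D i (p t t)) + blinfun_apply (fy t t) h)) (at t)"
  using has_derivative_compose[of "\<lambda>t. (t, t)" "\<lambda>h. (h, h)" t UNIV] by fastforce
 moreover have "(\<lambda>h. h * (\<Sum>i<n. a i * D i (p t t)) + blinfun_apply (fy t t) h) = (*) (\<Sum>i<Suc n. a i * D i (p t t))"
  by (auto simp: fy_def blinfun.scaleR_left fun_eq_iff algebra_simps)
 ultimately have "((\<lambda>t. G t t) has_real_derivative (\<Sum>i<Suc n. a i * D i (p t t))) (at t)"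
  unfolding has_field_derivative_def by simp
 moreover have "p s s = (\<lambda>i. if i < Suc n then x i + s * a i else x i)" for s
  by (auto simp: p_def fun_eq_iff less_Suc_eq)
 ultimately show ?case by (simp only: G_def)
qed

lemma spg_cylindrical:
 assumes \<phi>: "\<phi> \<in> smooth_poly_growth m" and I: "h ` {..<m} \<subseteq> I" "finite I"
 shows "cylindrical_on I (\<lambda>x. \<phi> (\<lambda>i. x (h i)))"
proof -
 obtain K r where K: "\<And>x. \<bar>\<phi> x\<bar> \<le> K * (1 + (\<Sum>i<m. \<bar>x i\<bar>)) ^ r" using spg_growth[OF \<phi>] by blast
 have hI: "h i \<in> I" if "i < m" for i using I that by auto
 show ?thesis
 proof (rule cylindrical_onI)
  have "(\<lambda>x i. if i < m then x (h i) else 0) \<in> borel_measurable (PiM I (\<lambda>_. borel :: real measure))"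
  proof (rule measurable_coordinatewise_then_product)
   show "(\<lambda>x. if i < m then x (h i) else 0) \<in> borel_measurable (PiM I (\<lambda>_. borel :: real measure))" for i
    by (cases "i < m") (auto intro!: measurable_component_singleton hI)
  qed
  from measurable_compose[OF this borel_measurable_continuous_onI[OF spg_continuous[OF \<phi>]]]
  show "(\<lambda>x. \<phi> (\<lambda>i. x (h i))) \<in> borel_measurable (PiM I (\<lambda>_. borel))"
   by (rule measurable_cong[THEN iffD1, rotated]) (auto intro!: spg_cong[OF \<phi>])
  show "\<phi> (\<lambda>i. restrict x I (h i)) = \<phi> (\<lambda>i. x (h i))" for x
   by (rule spg_cong[OF \<phi>]) (simp add: hI)
  show "\<bar>\<phi> (\<lambda>i. x (h i))\<bar> \<le> K * (1 + (\<Sum>i<m. \<bar>x (h i)\<bar>)) ^ r" for x by (rule K)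
  show "cylindrical_on I (\<lambda>x. K * (1 + (\<Sum>i<m. \<bar>x (h i)\<bar>)) ^ r)"
   by (intro cylindrical_on_cmult cylindrical_on_power cylindrical_on_add cylindrical_on_const
     cylindrical_on_sum cylindrical_on_abs cylindrical_on_coordinate I hI) simp
 qed
qed

lemma spg_direction_deriv:
 assumes \<phi>: "\<phi> \<in> smooth_poly_growth m"
 shows "direction_deriv k (\<lambda>x. \<phi> (\<lambda>i. x (h i))) (\<lambda>x. \<Sum>i<m. (k \<bullet> h i) * coord_deriv i \<phi> (\<lambda>i. x (h i)))"
 unfolding direction_deriv_def
proof
 fix x
 have "((\<lambda>t. \<phi> (\<lambda>i. if i < m then x (h i) + t * (k \<bullet> h i) else x (h i))) has_real_derivative
   (\<Sum>i<m. (k \<bullet> h i) * coord_deriv i \<phi> (\<lambda>i. if i < m then x (h i) + 0 * (k \<bullet> h i) else x (h i)))) (at 0)"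
  by (rule chain_rule_of_continuous_partials[OF spg_continuous[OF spg_coord_deriv[OF \<phi>]] spg_deriv[OF \<phi>] order_refl])
 moreover have "\<phi> (\<lambda>i. if i < m then x (h i) + t * (k \<bullet> h i) else x (h i)) = \<phi> (\<lambda>i. x (h i) + t * (k \<bullet> h i))" for t
  by (rule spg_cong[OF \<phi>]) simp
 moreover have "(\<lambda>i. if i < m then x (h i) + 0 * (k \<bullet> h i) else x (h i)) = (\<lambda>i. x (h i))" by auto
 ultimately show "((\<lambda>t. \<phi> (\<lambda>i. x (h i) + t * (k \<bullet> h i))) has_real_derivative
   (\<Sum>i<m. (k \<bullet> h i) * coord_deriv i \<phi> (\<lambda>i. x (h i)))) (at 0)"
  by (simp only:)
qed

section \<open>Uniqueness of the Malliavin derivative\<close>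

context isonormal_gaussian_process
begin

text \<open>The divergence: for a smooth \<open>V = (\<Sum>i. Y i h i)\<close> it is \<open>\<Sum>i. X (h i) Y i - D\<^bsub>h i\<^esub> Y i\<close>. Taking \<open>V\<close> to be itself a
 smooth derivative suffices below, since the values that matter are limits of such.\<close>

lemma smooth_derivative_adjoint:
 assumes V: "smooth_with_derivative X G V"
 shows "\<exists>\<delta>. sq_integrable M \<delta> \<and> (\<forall>F U. smooth_with_derivative X F U \<longrightarrow>
      (LINT w|M. U w \<bullet> V w) = (LINT w|M. F w * \<delta> w))"
proof -
 obtain m \<psi> h where \<psi>: "\<psi> \<in> smooth_poly_growth m"
  and Veq: "V = (\<lambda>w. \<Sum>i<m. coord_deriv i \<psi> (\<lambda>i. X (h i) w) *\<^sub>R h i)"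
  using V by (auto simp: smooth_with_derivative_def)
 define Y where "Y i x = coord_deriv i \<psi> (\<lambda>i. x (h i))" for i x
 define DY where "DY i x = (\<Sum>j<m. (h i \<bullet> h j) * coord_deriv j (coord_deriv i \<psi>) (\<lambda>i. x (h i)))" for i x
 define \<delta> where "\<delta> w = (\<Sum>i<m. X (h i) w * Y i (\<lambda>v. X v w) - DY i (\<lambda>v. X v w))" for w
 have Yc: "cylindrical_on I (Y i)" and DYc: "cylindrical_on I (DY i)" and DYd: "direction_deriv (h i) (Y i) (DY i)"
  if "i < m" "h ` {..<m} \<subseteq> I" "finite I" for i I
  unfolding Y_def DY_def
  by (intro spg_cylindrical[OF spg_coord_deriv[OF \<psi> that(1)]] spg_direction_deriv[OF spg_coord_deriv[OF \<psi> that(1)]]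
    cylindrical_on_sum cylindrical_on_cmult spg_cylindrical[OF spg_coord_deriv[OF spg_coord_deriv[OF \<psi> that(1)]]] that; simp)+
 have "all_moments M \<delta>" unfolding \<delta>_def
  by (intro all_moments_sum all_moments_minus all_moments_mult all_moments_X
    all_moments_cylindrical[of "h ` {..<m}"] Yc DYc) auto
 moreover have "(LINT w|M. U w \<bullet> V w) = (LINT w|M. F w * \<delta> w)" if "smooth_with_derivative X F U" for F U
 proof -
  obtain n \<phi> g where \<phi>: "\<phi> \<in> smooth_poly_growth n"
   and Feq: "F = (\<lambda>w. \<phi> (\<lambda>i. X (g i) w))"
   and Ueq: "U = (\<lambda>w. \<Sum>i<n. coord_deriv i \<phi> (\<lambda>i. X (g i) w) *\<^sub>R g i)"
   using \<open>smooth_with_derivative X F U\<close> by (auto simp: smooth_with_derivative_def)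
  define I where "I = h ` {..<m} \<union> g ` {..<n}"
  have I: "h ` {..<m} \<subseteq> I" "g ` {..<n} \<subseteq> I" "finite I" by (auto simp: I_def)
  define \<Phi> where "\<Phi> x = \<phi> (\<lambda>i. x (g i))" for x
  define D\<Phi> where "D\<Phi> i x = (\<Sum>j<n. (h i \<bullet> g j) * coord_deriv j \<phi> (\<lambda>i. x (g i)))" for i x
  have \<Phi>c: "cylindrical_on I \<Phi>" unfolding \<Phi>_def by (rule spg_cylindrical[OF \<phi> I(2,3)])
  have D\<Phi>c: "cylindrical_on I (D\<Phi> i)" for i unfolding D\<Phi>_def
   by (intro cylindrical_on_sum cylindrical_on_cmult spg_cylindrical[OF spg_coord_deriv[OF \<phi>] I(2,3)]) simp
  have D\<Phi>d: "direction_deriv (h i) \<Phi> (D\<Phi> i)" for i unfolding \<Phi>_def D\<Phi>_def by (rule spg_direction_deriv[OF \<phi>])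
  have int: "all_moments M (\<lambda>w. D\<Phi> i (\<lambda>v. X v w) * Y i (\<lambda>v. X v w))"
    "all_moments M (\<lambda>w. \<Phi> (\<lambda>v. X v w) * DY i (\<lambda>v. X v w))"
    "all_moments M (\<lambda>w. X (h i) w * (\<Phi> (\<lambda>v. X v w) * Y i (\<lambda>v. X v w)))" if "i < m" for i
   by (intro all_moments_mult all_moments_X all_moments_cylindrical[OF _ I(3)] \<Phi>c D\<Phi>c Yc[OF that I(1,3)] DYc[OF that I(1,3)])+
  have ibp: "(LINT w|M. D\<Phi> i (\<lambda>v. X v w) * Y i (\<lambda>v. X v w)) =
    (LINT w|M. F w * (X (h i) w * Y i (\<lambda>v. X v w) - DY i (\<lambda>v. X v w)))" if "i < m" for i
  proof -
   have "(LINT w|M. X (h i) w * (\<Phi> (\<lambda>v. X v w) * Y i (\<lambda>v. X v w))) =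
     (LINT w|M. D\<Phi> i (\<lambda>v. X v w) * Y i (\<lambda>v. X v w) + \<Phi> (\<lambda>v. X v w) * DY i (\<lambda>v. X v w))"
    by (rule isonormal_IBP[OF _ _ I(3) direction_deriv_mult[OF D\<Phi>d DYd[OF that I(1,3)]]])
      (intro cylindrical_on_mult cylindrical_on_add \<Phi>c D\<Phi>c Yc[OF that I(1,3)] DYc[OF that I(1,3)])+
   also have "\<dots> = (LINT w|M. D\<Phi> i (\<lambda>v. X v w) * Y i (\<lambda>v. X v w)) + (LINT w|M. \<Phi> (\<lambda>v. X v w) * DY i (\<lambda>v. X v w))"
    by (intro Bochner_Integration.integral_add all_moments_integrable int that)
   finally have "(LINT w|M. D\<Phi> i (\<lambda>v. X v w) * Y i (\<lambda>v. X v w)) =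
     (LINT w|M. X (h i) w * (\<Phi> (\<lambda>v. X v w) * Y i (\<lambda>v. X v w)) - \<Phi> (\<lambda>v. X v w) * DY i (\<lambda>v. X v w))"
    using all_moments_integrable[OF int(2)[OF that]] all_moments_integrable[OF int(3)[OF that]] by simp
   also have "(\<lambda>w. X (h i) w * (\<Phi> (\<lambda>v. X v w) * Y i (\<lambda>v. X v w)) - \<Phi> (\<lambda>v. X v w) * DY i (\<lambda>v. X v w)) =
     (\<lambda>w. F w * (X (h i) w * Y i (\<lambda>v. X v w) - DY i (\<lambda>v. X v w)))"
    by (rule ext) (simp add: Feq \<Phi>_def algebra_simps)
   finally show ?thesis .
  qed
  have "U w \<bullet> V w = (\<Sum>i<m. D\<Phi> i (\<lambda>v. X v w) * Y i (\<lambda>v. X v w))" for w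
  proof -
   have e: "h i \<bullet> U w = D\<Phi> i (\<lambda>v. X v w)" for i
    by (simp add: Ueq D\<Phi>_def inner_sum_right mult.commute)
   have "U w \<bullet> V w = (\<Sum>i<m. Y i (\<lambda>v. X v w) * (h i \<bullet> U w))"
    unfolding Veq by (simp add: inner_sum_right Y_def inner_commute)
   then show ?thesis by (simp add: e mult.commute)
  qed
  then have "(LINT w|M. U w \<bullet> V w) = (\<Sum>i<m. LINT w|M. D\<Phi> i (\<lambda>v. X v w) * Y i (\<lambda>v. X v w))"
   by (simp add: all_moments_integrable[OF int(1)])
  also have "\<dots> = (\<Sum>i<m. LINT w|M. F w * (X (h i) w * Y i (\<lambda>v. X v w) - DY i (\<lambda>v. X v w)))"
   using ibp by simp
  also have "\<dots> = (LINT w|M. (\<Sum>i<m. F w * (X (h i) w * Y i (\<lambda>v. X v w) - DY i (\<lambda>v. X v w))))"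
  proof (rule Bochner_Integration.integral_sum[symmetric])
   fix i assume "i \<in> {..<m}"
   then have "i < m" by simp
   show "integrable M (\<lambda>w. F w * (X (h i) w * Y i (\<lambda>v. X v w) - DY i (\<lambda>v. X v w)))"
    unfolding Feq \<Phi>_def[symmetric]
    by (intro all_moments_integrable all_moments_mult all_moments_minus all_moments_X
      all_moments_cylindrical[OF _ I(3), of \<Phi>, unfolded \<Phi>_def] \<Phi>c[unfolded \<Phi>_def]
      all_moments_cylindrical[OF _ I(3)] Yc[OF \<open>i < m\<close> I(1,3)] DYc[OF \<open>i < m\<close> I(1,3)])
  qed
  also have "\<dots> = (LINT w|M. F w * \<delta> w)" by (simp add: \<delta>_def sum_distrib_left)
  finally show ?thesis .
 qed
 ultimately show ?thesis using all_moments_sq_integrable by blast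
qed

text \<open>By the adjoint formula the difference of two derivatives is orthogonal to every smooth derivative, and it is
 itself a limit of these.\<close>

theorem malliavin_derivative_unique:
 assumes U: "has_malliavin_derivative M X F U" and V: "has_malliavin_derivative M X G V"
  and FG: "AE x in M. F x = G x"
 shows "AE x in M. U x = V x"
proof -
 obtain Fs Us where Us: "\<And>m. smooth_with_derivative X (Fs m) (Us m)" and LF: "L2_tendsto M Fs F" and LU: "L2_tendsto M Us U"
  using U by (auto simp: has_malliavin_derivative_def)
 obtain Gs Vs where Vs: "\<And>m. smooth_with_derivative X (Gs m) (Vs m)" and LG': "L2_tendsto M Gs G" and LV: "L2_tendsto M Vs V"
  using V by (auto simp: has_malliavin_derivative_def)
 have "F \<in> borel_measurable M" using L2_tendstoD(2)[OF LF] by (simp add: sq_integrable_def)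
 then have LG: "L2_tendsto M Gs F" by (intro L2_tendsto_cong_AE[OF LG']) (use FG in auto)
 note sq = L2_tendstoD(1)[OF LU] L2_tendstoD(1)[OF LV] L2_tendstoD(2)[OF LU] L2_tendstoD(2)[OF LV]
 have key: "(LINT w|M. U w \<bullet> D w) = (LINT w|M. V w \<bullet> D w)" if "smooth_with_derivative X H D" "sq_integrable M D" for H D
 proof -
  note HD = that
  obtain \<delta> where d: "sq_integrable M \<delta>" "\<And>F U. smooth_with_derivative X F U ==> (LINT w|M. U w \<bullet> D w) = (LINT w|M. F w * \<delta> w)"
   using smooth_derivative_adjoint[OF HD(1)] by blast
  have "(\<lambda>m. LINT w|M. Us m w \<bullet> D w) \<longlonglongrightarrow> (LINT w|M. U w \<bullet> D w)"
   by (rule L2_tendsto_inner[OF LU L2_tendsto_const[OF that(2)]])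
  moreover have "(\<lambda>m. LINT w|M. Us m w \<bullet> D w) \<longlonglongrightarrow> (LINT w|M. F w * \<delta> w)"
   unfolding d(2)[OF Us] by (rule L2_tendsto_integral_mult[OF LF L2_tendsto_const[OF d(1)]])
  moreover have "(\<lambda>m. LINT w|M. Vs m w \<bullet> D w) \<longlonglongrightarrow> (LINT w|M. V w \<bullet> D w)"
   by (rule L2_tendsto_inner[OF LV L2_tendsto_const[OF that(2)]])
  moreover have "(\<lambda>m. LINT w|M. Vs m w \<bullet> D w) \<longlonglongrightarrow> (LINT w|M. F w * \<delta> w)"
   unfolding d(2)[OF Vs] by (rule L2_tendsto_integral_mult[OF LG L2_tendsto_const[OF d(1)]])
  ultimately show ?thesis using LIMSEQ_unique by metis
 qed
 have sqW: "sq_integrable M (\<lambda>w. U w - V w)" by (intro sq_integrable_diff sq)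
 have z: "(LINT w|M. D w \<bullet> (U w - V w)) = 0" if "smooth_with_derivative X H D" "sq_integrable M D" for H D
  using key[OF that] sq_integrable_inner[OF that(2) sq(3)] sq_integrable_inner[OF that(2) sq(4)]
  by (simp add: inner_diff_right inner_commute)
 have "(\<lambda>m. LINT w|M. Us m w \<bullet> (U w - V w)) \<longlonglongrightarrow> (LINT w|M. U w \<bullet> (U w - V w))"
  by (rule L2_tendsto_inner[OF LU L2_tendsto_const[OF sqW]])
 then have 1: "(LINT w|M. U w \<bullet> (U w - V w)) = 0" by (simp add: z[OF Us sq(1)] LIMSEQ_const_iff)
 have "(\<lambda>m. LINT w|M. Vs m w \<bullet> (U w - V w)) \<longlonglongrightarrow> (LINT w|M. V w \<bullet> (U w - V w))"
  by (rule L2_tendsto_inner[OF LV L2_tendsto_const[OF sqW]])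
 then have 2: "(LINT w|M. V w \<bullet> (U w - V w)) = 0" by (simp add: z[OF Vs sq(2)] LIMSEQ_const_iff)
 have "(LINT w|M. (norm (U w - V w))\<^sup>2) = (LINT w|M. U w \<bullet> (U w - V w) - V w \<bullet> (U w - V w))"
  by (simp add: power2_norm_eq_inner inner_diff_left)
 also have "\<dots> = 0" using 1 2 sq_integrable_inner[OF sq(3) sqW] sq_integrable_inner[OF sq(4) sqW] by simp
 finally have "AE x in M. (norm (U x - V x))\<^sup>2 = 0"
  using sqW by (subst (asm) integral_nonneg_eq_0_iff_AE) (auto simp: sq_integrable_def)
 then show ?thesis by simp
qed

end

section \<open>Hermite polynomials\<close>

text \<open>The convention \<open>0 - 1 = 0\<close> is harmless because of the factor \<open>real n\<close>.\<close>

lemma hermite_Suc: "hermite (Suc n) x = x * hermite n x - real n * hermite (n - 1) x"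
 by (cases n) auto

lemma hermite_deriv: "(hermite n has_real_derivative real n * hermite (n - 1) x) (at x)"
proof (induction n x rule: hermite.induct)
 case (1 x)
 have "hermite 0 = (\<lambda>_. 1)" by auto
 then show ?case by simp
next
 case (2 x)
 have "hermite (Suc 0) = (\<lambda>x. x)" by auto
 then show ?case by simp
next
 case (3 n x)
 have "hermite (Suc (Suc n)) = (\<lambda>x. x * hermite (Suc n) x - real (Suc n) * hermite n x)" by auto
 moreover have "((\<lambda>x. x * hermite (Suc n) x - real (Suc n) * hermite n x) has_real_derivative
   (1 * hermite (Suc n) x + x * (real (Suc n) * hermite n x)) - real (Suc n) * (real n * hermite (n - 1) x)) (at x)"
  using 3 by (auto intro!: derivative_eq_intros)
 moreover have "(1 * hermite (Suc n) x + x * (real (Suc n) * hermite n x)) - real (Suc n) * (real n * hermite (n - 1) x)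
   = real (Suc (Suc n)) * hermite (Suc (Suc n) - 1) x"
  by (simp add: hermite_Suc algebra_simps)
 ultimately show ?case by metis
qed

lemma cylindrical_on_hermite: "i \<in> I ==> finite I ==> cylindrical_on I (\<lambda>x. hermite n (x i))"
proof (induction n rule: induct_nat_012)
 case (ge2 n)
 then show ?case by (auto intro!: cylindrical_on_diff cylindrical_on_mult cylindrical_on_cmult cylindrical_on_coordinate)
qed (auto intro: cylindrical_on_const cylindrical_on_coordinate)

lemma direction_deriv_hermite:
 "direction_deriv k (\<lambda>x. hermite n (x h)) (\<lambda>x. real n * hermite (n - 1) (x h) * (k \<bullet> h))"
 by (rule direction_deriv_compose[OF hermite_deriv direction_deriv_coordinate])

definition hermite_sum :: "'h set => ('h => real) => nat => ('h => real) => real" where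
 "hermite_sum S c q x = (\<Sum>h\<in>S. c h * hermite q (x h))"

text \<open>The Malliavin derivative of the Hermite sum, in coordinates of the field.\<close>

definition hermite_grad :: "'h::real_vector set => ('h => real) => nat => ('h => real) => 'h" where
 "hermite_grad S c q x = (\<Sum>h\<in>S. (c h * (real q * hermite (q - 1) (x h))) *\<^sub>R h)"

lemma cylindrical_on_hermite_sum: "S \<subseteq> I ==> finite I ==> cylindrical_on I (hermite_sum S c q)"
 unfolding hermite_sum_def
 by (intro cylindrical_on_sum cylindrical_on_cmult cylindrical_on_hermite) auto

lemma cylindrical_on_hermite_grad: "S \<subseteq> I ==> finite I ==> cylindrical_on I (\<lambda>x. k \<bullet> hermite_grad S c q x)"
 unfolding hermite_grad_def inner_sum_right inner_scaleR_right
 by (intro cylindrical_on_sum cylindrical_on_mult cylindrical_on_hermite cylindrical_on_const) auto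

lemma direction_deriv_hermite_sum:
 "direction_deriv k (hermite_sum S c q) (\<lambda>x. k \<bullet> hermite_grad S c q x)"
proof -
 have "direction_deriv k (\<lambda>x. \<Sum>h\<in>S. c h * hermite q (x h)) (\<lambda>x. \<Sum>h\<in>S. c h * (real q * hermite (q - 1) (x h) * (k \<bullet> h)))"
  by (intro direction_deriv_sum direction_deriv_cmult direction_deriv_hermite)
 then show ?thesis by (simp add: hermite_sum_def[abs_def] hermite_grad_def inner_sum_right mult.assoc)
qed

text \<open>Coefficients are extended by zero, so that differences of Hermite sums over different finite sets are again
 Hermite sums and second and fourth moment identities apply to Cauchy differences.\<close>

lemma hermite_sum_diff:
 assumes "finite S" "finite T"
 shows "hermite_sum S c q x - hermite_sum T d q x =
   hermite_sum (S \<union> T) (\<lambda>h. (if h \<in> S then c h else 0) - (if h \<in> T then d h else 0)) q x"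
  and "hermite_grad S c q x - hermite_grad T d q x =
   hermite_grad (S \<union> T) (\<lambda>h. (if h \<in> S then c h else 0) - (if h \<in> T then d h else 0)) q x"
proof -
 have e: "(\<Sum>h\<in>S \<union> T. (if h \<in> A then f h else 0)) = (\<Sum>h\<in>A. f h)" if "A \<subseteq> S \<union> T" for A and f :: "'a => 'b::comm_monoid_add"
 proof -
  have "(\<Sum>h\<in>S \<union> T. (if h \<in> A then f h else 0)) = (\<Sum>h\<in>(S \<union> T) \<inter> A. f h)"
   by (rule sum.inter_restrict[symmetric]) (use assms in auto)
  also have "(S \<union> T) \<inter> A = A" using that by auto
  finally show ?thesis .
 qed
 have "hermite_sum S c q x = (\<Sum>h\<in>S \<union> T. (if h \<in> S then c h * hermite q (x h) else 0))"
   "hermite_sum T d q x = (\<Sum>h\<in>S \<union> T. (if h \<in> T then d h * hermite q (x h) else 0))"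
  by (simp_all add: e hermite_sum_def)
 then show "hermite_sum S c q x - hermite_sum T d q x =
   hermite_sum (S \<union> T) (\<lambda>h. (if h \<in> S then c h else 0) - (if h \<in> T then d h else 0)) q x"
  by (simp add: hermite_sum_def sum_subtractf[symmetric] left_diff_distrib if_distrib[of "\<lambda>c. c * _"] cong: if_cong)
 have "hermite_grad S c q x = (\<Sum>h\<in>S \<union> T. (if h \<in> S then (c h * (real q * hermite (q - 1) (x h))) *\<^sub>R h else 0))"
   "hermite_grad T d q x = (\<Sum>h\<in>S \<union> T. (if h \<in> T then (d h * (real q * hermite (q - 1) (x h))) *\<^sub>R h else 0))"
  by (simp_all add: e hermite_grad_def)
 then show "hermite_grad S c q x - hermite_grad T d q x =
   hermite_grad (S \<union> T) (\<lambda>h. (if h \<in> S then c h else 0) - (if h \<in> T then d h else 0)) q x"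
  by (auto simp: hermite_grad_def sum_subtractf[symmetric] algebra_simps intro!: sum.cong)
qed

section \<open>Hermite sums are smooth\<close>

lemma hermite_is_poly: "\<exists>P. \<forall>x. hermite n x = poly P x"
proof (induction n rule: induct_nat_012)
 case (ge2 n)
 then obtain P Q where "\<forall>x. hermite n x = poly P x" "\<forall>x. hermite (Suc n) x = poly Q x" by blast
 then have "\<forall>x. hermite (Suc (Suc n)) x = poly ([:0, 1:] * Q - smult (real (Suc n)) P) x" by simp
 then show ?case by blast
next
 case 0
 show ?case by (rule exI[of _ 1]) simp
next
 case 1
 show ?case by (rule exI[of _ "[:0, 1:]"]) simp
qed

lemma coord_deriv_sum_of_polys:
 assumes "i < m"
 shows "((\<lambda>t. \<Sum>j<m. poly (p j) ((x(i := t)) j)) has_real_derivative poly (pderiv (p i)) s) (at s)"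
  and "coord_deriv i (\<lambda>x. \<Sum>j<m. poly (p j) (x j)) = (\<lambda>x. poly (pderiv (p i)) (x i))"
proof -
 have d: "((\<lambda>t. \<Sum>j<m. poly (p j) ((x(i := t)) j)) has_real_derivative poly (pderiv (p i)) s) (at s)" for x s
 proof -
  have "((\<lambda>t. \<Sum>j<m. poly (p j) ((x(i := t)) j)) has_real_derivative (\<Sum>j<m. if j = i then poly (pderiv (p i)) s else 0)) (at s)"
   by (rule DERIV_sum) auto
  then show ?thesis using assms by simp
 qed
 show "((\<lambda>t. \<Sum>j<m. poly (p j) ((x(i := t)) j)) has_real_derivative poly (pderiv (p i)) s) (at s)" by (rule d)
 show "coord_deriv i (\<lambda>x. \<Sum>j<m. poly (p j) (x j)) = (\<lambda>x. poly (pderiv (p i)) (x i))"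
  unfolding coord_deriv_def by (rule ext, rule DERIV_imp_deriv, rule d)
qed

lemma cylindrical_on_poly: "i \<in> I ==> finite I ==> cylindrical_on I (\<lambda>x. poly P (x i))"
 by (induction P) (auto intro!: cylindrical_on_add cylindrical_on_mult cylindrical_on_const cylindrical_on_coordinate)

lemma sum_of_polys_spg: "(\<lambda>x. \<Sum>j<m. poly (p j) (x j)) \<in> smooth_poly_growth m"
 unfolding smooth_poly_growth_def
proof (intro CollectI conjI allI impI)
 fix x y :: "nat => real" assume "\<forall>i<m. x i = y i"
 then show "(\<Sum>j<m. poly (p j) (x j)) = (\<Sum>j<m. poly (p j) (y j))" by (intro sum.cong) auto
next
 fix "is" assume "set is \<subseteq> {..<m}"
 then have "\<exists>p'. foldr coord_deriv is (\<lambda>x. \<Sum>j<m. poly (p j) (x j)) = (\<lambda>x. \<Sum>j<m. poly (p' j) (x j))"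
 proof (induction "is")
  case (Cons i "is")
  then obtain p' where p': "foldr coord_deriv is (\<lambda>x. \<Sum>j<m. poly (p j) (x j)) = (\<lambda>x. \<Sum>j<m. poly (p' j) (x j))"
   by auto
  have "i < m" using Cons by simp
  have "(\<lambda>x. poly (pderiv (p' i)) (x i)) = (\<lambda>x. \<Sum>j<m. poly (if j = i then pderiv (p' i) else 0) (x j))"
  proof
   fix x :: "nat => real"
   have "(\<Sum>j<m. poly (if j = i then pderiv (p' i) else 0) (x j)) = (\<Sum>j<m. if j = i then poly (pderiv (p' i)) (x i) else 0)"
    by (intro sum.cong) auto
   then show "poly (pderiv (p' i)) (x i) = (\<Sum>j<m. poly (if j = i then pderiv (p' i) else 0) (x j))"
    using \<open>i < m\<close> by simp
  qed
  then show ?case unfolding foldr.simps comp_apply p' coord_deriv_sum_of_polys(2)[OF \<open>i < m\<close>]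
   by (intro exI[of _ "\<lambda>j. if j = i then pderiv (p' i) else 0"])
 qed auto
 then obtain p' where p': "foldr coord_deriv is (\<lambda>x. \<Sum>j<m. poly (p j) (x j)) = (\<lambda>x. \<Sum>j<m. poly (p' j) (x j))" by blast
 have "cylindrical_on {..<m} (\<lambda>x. \<Sum>j<m. poly (p' j) (x j))"
  by (intro cylindrical_on_sum cylindrical_on_poly) auto
 then have "\<exists>K r. \<forall>x. \<bar>\<Sum>j<m. poly (p' j) (x j)\<bar> \<le> K * (1 + (\<Sum>i<m. \<bar>x i\<bar>)) ^ r"
  by (auto simp: cylindrical_on_def)
 moreover have "continuous_on UNIV (\<lambda>x::nat => real. \<Sum>j<m. poly (p' j) (x j))"
  by (intro continuous_on_sum continuous_on_poly continuous_on_product_coordinates)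
 moreover have "(\<lambda>t. \<Sum>j<m. poly (p' j) ((x(i := t)) j)) differentiable (at (x i))" if "i < m" for i x
  using coord_deriv_sum_of_polys(1)[OF that] unfolding real_differentiable_def by blast
 ultimately show "let \<psi> = foldr coord_deriv is (\<lambda>x. \<Sum>j<m. poly (p j) (x j)) in
      continuous_on UNIV \<psi> \<and>
      (\<forall>x. \<forall>i<m. (\<lambda>t. \<psi> (x(i := t))) differentiable (at (x i))) \<and>
      (\<exists>K r. \<forall>x. \<bar>\<psi> x\<bar> \<le> K * (1 + (\<Sum>i<m. \<bar>x i\<bar>)) ^ r)"
  unfolding p' Let_def by blast
qed

lemma smooth_with_derivative_hermite_sum:
 assumes "finite S"
 shows "smooth_with_derivative X (\<lambda>w. hermite_sum S c q (\<lambda>v. X v w)) (\<lambda>w. hermite_grad S c q (\<lambda>v. X v w))"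
proof -
 obtain h where h: "bij_betw h {0..<card S} S" using ex_bij_betw_nat_finite[OF assms] by blast
 define m where "m = card S"
 have h: "bij_betw h {..<m} S" using h by (simp add: m_def atLeast0LessThan)
 obtain P where P: "\<And>x. hermite q x = poly P x" using hermite_is_poly by blast
 have dP: "poly (pderiv P) x = real q * hermite (q - 1) x" for x
 proof -
  have "hermite q = poly P" using P by auto
  then have "(hermite q has_real_derivative poly (pderiv P) x) (at x)" using poly_DERIV[of P x] by simp
  then show ?thesis using DERIV_unique hermite_deriv by blast
 qed
 define \<phi> where "\<phi> = (\<lambda>x. \<Sum>j<m. poly (smult (c (h j)) P) (x j))"
 have "coord_deriv i \<phi> = (\<lambda>x. c (h i) * (real q * hermite (q - 1) (x i)))" if "i < m" for i
  using coord_deriv_sum_of_polys(2)[OF that, of "\<lambda>j. smult (c (h j)) P"] by (simp add: \<phi>_def pderiv_smult dP)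
 then have 1: "(\<Sum>i<m. coord_deriv i \<phi> (\<lambda>i. X (h i) w) *\<^sub>R h i) = hermite_grad S c q (\<lambda>v. X v w)" for w
  unfolding hermite_grad_def by (subst sum.reindex_bij_betw[OF h, symmetric]) simp
 have 2: "\<phi> (\<lambda>i. X (h i) w) = hermite_sum S c q (\<lambda>v. X v w)" for w
  unfolding hermite_sum_def \<phi>_def by (subst sum.reindex_bij_betw[OF h, symmetric]) (simp add: P)
 have "\<phi> \<in> smooth_poly_growth m" unfolding \<phi>_def by (rule sum_of_polys_spg)
 then show ?thesis unfolding smooth_with_derivative_def
  by (intro exI[of _ m] exI[of _ \<phi>] exI[of _ h]) (simp add: 1 2)
qed

section \<open>Positive semidefinite kernels\<close>

text \<open>Gram--Schmidt on a finite set.\<close>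

lemma finite_orthonormal_expansion:
 fixes S :: "'h::real_inner set"
 assumes "finite S"
 shows "\<exists>E. finite E \<and> (\<forall>h\<in>S. \<forall>k. h \<bullet> k = (\<Sum>e\<in>E. (h \<bullet> e) * (k \<bullet> e)))"
proof -
 have "\<exists>E. finite E \<and> orthonormal_set E \<and> (\<forall>h\<in>S. h = (\<Sum>e\<in>E. (h \<bullet> e) *\<^sub>R e))"
  using assms
 proof (induction S rule: finite_induct)
  case empty
  show ?case by (intro exI[of _ "{}"]) (simp add: orthonormal_set_def)
 next
  case (insert x S)
  then obtain E where E: "finite E" "orthonormal_set E" "\<And>h. h \<in> S ==> h = (\<Sum>e\<in>E. (h \<bullet> e) *\<^sub>R e)" by blast
  define y where "y = x - (\<Sum>e\<in>E. (x \<bullet> e) *\<^sub>R e)"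
  have oe: "e \<bullet> e' = (if e = e' then 1 else 0)" if "e \<in> E" "e' \<in> E" for e e'
   using E(2) that by (auto simp: orthonormal_set_def pairwise_def orthogonal_def norm_eq_1)
  have ye: "y \<bullet> e = 0" if "e \<in> E" for e
  proof -
   have "(\<Sum>e'\<in>E. (x \<bullet> e') * (e' \<bullet> e)) = (\<Sum>e'\<in>E. if e' = e then x \<bullet> e else 0)"
    by (intro sum.cong) (auto simp: oe that)
   then show ?thesis using that E(1) by (simp add: y_def inner_diff_left inner_sum_left)
  qed
  show ?case
  proof (cases "y = 0")
   case True
   then show ?thesis using E by (intro exI[of _ E]) (auto simp: y_def)
  next
   case False
   define e0 where "e0 = y /\<^sub>R norm y"
   have e0: "norm e0 = 1" "e0 \<noteq> 0" using False by (auto simp: e0_def)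
   have e0E: "e0 \<bullet> e = 0" "e \<bullet> e0 = 0" if "e \<in> E" for e using ye[OF that] by (auto simp: e0_def inner_commute)
   have e0n: "e0 \<notin> E" using e0E[of e0] e0 by auto
   have S: "h \<bullet> e0 = 0" if "h \<in> S" for h
    by (subst E(3)[OF that]) (simp add: inner_sum_left e0E)
   have "x \<bullet> y = y \<bullet> y"
   proof -
    have "e \<bullet> y = 0" if "e \<in> E" for e using ye[OF that] by (simp add: inner_commute)
    then have "(\<Sum>e\<in>E. (x \<bullet> e) *\<^sub>R e) \<bullet> y = 0" by (simp add: inner_sum_left)
    then show ?thesis by (simp add: y_def inner_diff_left)
   qed
   moreover have "(x \<bullet> e0) *\<^sub>R e0 = ((x \<bullet> y) / (norm y * norm y)) *\<^sub>R y" by (simp add: e0_def divide_inverse mult_ac)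
   ultimately have "(x \<bullet> e0) *\<^sub>R e0 = y" using False by (simp add: dot_square_norm power2_eq_square)
   then have x: "x = (\<Sum>e\<in>insert e0 E. (x \<bullet> e) *\<^sub>R e)" using e0n E(1) by (simp add: y_def)
   have "orthonormal_set (insert e0 E)" using E(2) e0 e0E
    by (auto simp: orthonormal_set_def pairwise_insert orthogonal_def)
   then show ?thesis using E x S e0n by (intro exI[of _ "insert e0 E"]) auto
  qed
 qed
 then obtain E where E: "finite E" "\<And>h. h \<in> S ==> h = (\<Sum>e\<in>E. (h \<bullet> e) *\<^sub>R e)" by blast
 have "h \<bullet> k = (\<Sum>e\<in>E. (h \<bullet> e) * (k \<bullet> e))" if "h \<in> S" for h k
  by (subst E(2)[OF that]) (simp add: inner_sum_left inner_commute[of k])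
 then show ?thesis using E(1) by blast
qed

text \<open>The Schur product theorem for powers of a Gram matrix: expanding one factor \<open>h \<bullet> k\<close> in an orthonormal basis
 of the span of \<open>S\<close> lowers the exponent by one.\<close>

lemma schur_power_nonneg:
 fixes f :: "'h::real_inner => 'b::real_inner"
 assumes "finite S"
 shows "0 \<le> (\<Sum>h\<in>S. \<Sum>k\<in>S. a h * a k * (h \<bullet> k) ^ r * (f h \<bullet> f k))"
proof -
 obtain E where E: "finite E" "\<And>h k. h \<in> S ==> h \<bullet> k = (\<Sum>e\<in>E. (h \<bullet> e) * (k \<bullet> e))"
  using finite_orthonormal_expansion[OF assms] by blast
 show ?thesis
 proof (induction r arbitrary: a)
  case 0
  have "(\<Sum>h\<in>S. \<Sum>k\<in>S. a h * a k * (f h \<bullet> f k)) = (\<Sum>h\<in>S. a h *\<^sub>R f h) \<bullet> (\<Sum>k\<in>S. a k *\<^sub>R f k)"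
   by (subst inner_sum_left) (simp add: inner_sum_right sum_distrib_left mult_ac)
  then show ?case by simp
 next
  case (Suc r)
  have "(\<Sum>h\<in>S. \<Sum>k\<in>S. a h * a k * (h \<bullet> k) ^ Suc r * (f h \<bullet> f k)) =
    (\<Sum>h\<in>S. \<Sum>k\<in>S. \<Sum>e\<in>E. (a h * (h \<bullet> e)) * (a k * (k \<bullet> e)) * (h \<bullet> k) ^ r * (f h \<bullet> f k))"
  proof (intro sum.cong refl)
   fix h k assume "h \<in> S"
   have "a h * a k * (h \<bullet> k) ^ Suc r * (f h \<bullet> f k) = (h \<bullet> k) * (a h * a k * (h \<bullet> k) ^ r * (f h \<bullet> f k))" by (simp add: mult_ac)
   also have "\<dots> = (\<Sum>e\<in>E. (h \<bullet> e) * (k \<bullet> e)) * (a h * a k * (h \<bullet> k) ^ r * (f h \<bullet> f k))"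
    using E(2)[OF \<open>h \<in> S\<close>, of k] by simp
   also have "\<dots> = (\<Sum>e\<in>E. (a h * (h \<bullet> e)) * (a k * (k \<bullet> e)) * (h \<bullet> k) ^ r * (f h \<bullet> f k))"
    unfolding sum_distrib_right by (intro sum.cong refl) (simp add: mult_ac)
   finally show "a h * a k * (h \<bullet> k) ^ Suc r * (f h \<bullet> f k) =
    (\<Sum>e\<in>E. (a h * (h \<bullet> e)) * (a k * (k \<bullet> e)) * (h \<bullet> k) ^ r * (f h \<bullet> f k))" .
  qed
  also have "\<dots> = (\<Sum>h\<in>S. \<Sum>e\<in>E. \<Sum>k\<in>S. (a h * (h \<bullet> e)) * (a k * (k \<bullet> e)) * (h \<bullet> k) ^ r * (f h \<bullet> f k))"
   by (intro sum.cong refl sum.swap)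
  also have "\<dots> = (\<Sum>e\<in>E. \<Sum>h\<in>S. \<Sum>k\<in>S. (a h * (h \<bullet> e)) * (a k * (k \<bullet> e)) * (h \<bullet> k) ^ r * (f h \<bullet> f k))"
   by (rule sum.swap)
  also have "0 \<le> \<dots>" by (rule sum_nonneg) (rule Suc.IH[of "\<lambda>h. a h * (h \<bullet> _)"])
  finally show ?case .
 qed
qed

text \<open>The inner product of \<open>\<Sum>h. a h h\<^bsup>\<otimes>r\<^esup>\<close> and \<open>\<Sum>h. b h h\<^bsup>\<otimes>r\<^esup>\<close> in the tensor power of order \<open>r\<close>.\<close>

definition power_form :: "'h::real_inner set => nat => ('h => real) => ('h => real) => real" where
 "power_form S r a b = (\<Sum>h\<in>S. \<Sum>k\<in>S. a h * b k * (h \<bullet> k) ^ r)"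

lemma power_form_nonneg: "finite S ==> 0 \<le> power_form S r a a"
 using schur_power_nonneg[of S a r "\<lambda>_. 1::real"] by (simp add: power_form_def)

lemma power_form_sym: "power_form S r a b = power_form S r b a"
 unfolding power_form_def by (subst sum.swap) (simp add: inner_commute mult_ac)

lemma power_form_Cauchy_Schwarz:
 assumes "finite S"
 shows "(power_form S r a b)\<^sup>2 \<le> power_form S r a a * power_form S r b b"
proof (rule nonneg_quadratic_discriminant)
 fix t
 have "power_form S r (\<lambda>h. a h + t * b h) (\<lambda>h. a h + t * b h)
   = power_form S r a a + t * power_form S r a b + t * power_form S r b a + t\<^sup>2 * power_form S r b b"
  unfolding power_form_def by (simp add: algebra_simps sum.distrib sum_distrib_left power2_eq_square)
 then show "0 \<le> power_form S r a a + 2 * t * power_form S r a b + t\<^sup>2 * power_form S r b b"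
  using power_form_nonneg[OF assms, of r "\<lambda>h. a h + t * b h"] power_form_sym[of S r a b] by (simp add: algebra_simps)
qed (rule power_form_nonneg[OF assms])

text \<open>The contraction inequality \<open>\<parallel>A \<otimes>\<^sub>r B\<parallel> \<le> \<parallel>A\<parallel> \<parallel>B\<parallel>\<close> for \<open>A = (\<Sum>h. a h h\<^bsup>\<otimes>r+1\<^esup>)\<close> and
 \<open>B = (\<Sum>h. b h h\<^bsup>\<otimes>r\<^esup>)\<close>. Testing the contraction \<open>v\<close> against itself reduces it to a
 Cauchy--Schwarz inequality of order \<open>r\<close> and to positivity of the kernel \<open>\<parallel>v\<parallel>\<^sup>2 (h \<bullet> k) - (h \<bullet> v) (k \<bullet> v)\<close>
 multiplied by \<open>(h \<bullet> k)\<^bsup>r\<^esup>\<close>.\<close>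

lemma contraction_bound:
 fixes a b w :: "'h::real_inner => real"
 assumes S: "finite S" and w_def: "\<And>h. w h = a h * (\<Sum>m\<in>S. b m * (h \<bullet> m) ^ r)"
 shows "power_form S 1 w w \<le> power_form S r b b * power_form S (Suc r) a a"
proof -
 define v where "v = (\<Sum>h\<in>S. w h *\<^sub>R h)"
 have wv: "(\<Sum>h\<in>S. w h * (h \<bullet> k)) = v \<bullet> k" for k by (simp add: v_def inner_sum_left)
 have T: "power_form S 1 w w = v \<bullet> v"
  unfolding power_form_def v_def by (subst inner_sum_left) (simp add: inner_sum_right sum_distrib_left mult_ac)
 show ?thesis
 proof (cases "v = 0")
  case True
  then show ?thesis using T power_form_nonneg[OF S] by simp
 next
  case False
  define u where "u h = a h * (h \<bullet> v)" for h
  have vv: "v \<bullet> v > 0" using False by simp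
  have "v \<bullet> v = (\<Sum>h\<in>S. w h * (h \<bullet> v))" by (simp add: wv)
  also have "\<dots> = power_form S r u b"
   unfolding power_form_def w_def u_def by (intro sum.cong refl) (simp add: sum_distrib_left mult_ac)
  finally have le: "(v \<bullet> v)\<^sup>2 \<le> power_form S r u u * power_form S r b b"
   using power_form_Cauchy_Schwarz[OF S, of r u b] by simp
  have uu: "power_form S r u u \<le> (v \<bullet> v) * power_form S (Suc r) a a"
  proof -
   define f where "f h = norm v *\<^sub>R h - ((h \<bullet> v) / norm v) *\<^sub>R v" for h
   have f: "f h \<bullet> f k = (v \<bullet> v) * (h \<bullet> k) - (h \<bullet> v) * (k \<bullet> v)" for h k
   proof -
    define n where "n = norm v"
    have n: "n \<noteq> 0" "v \<bullet> v = n * n" using False by (simp_all add: n_def dot_square_norm power2_eq_square)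
    have "f h \<bullet> f k = n * n * (h \<bullet> k) - (n * ((k \<bullet> v) / n)) * (h \<bullet> v) - ((h \<bullet> v) / n * n) * (v \<bullet> k)
      + ((h \<bullet> v) / n) * ((k \<bullet> v) / n) * (v \<bullet> v)"
     unfolding f_def n_def[symmetric] inner_diff_left inner_diff_right inner_scaleR_left inner_scaleR_right
     by (simp only: mult_ac) (simp add: algebra_simps)
    also have "\<dots> = n * n * (h \<bullet> k) - (h \<bullet> v) * (k \<bullet> v)"
     unfolding n(2) inner_commute[of v k] using n(1) by (simp add: mult_ac)
    finally show ?thesis by (simp add: n(2))
   qed
   have "0 \<le> (\<Sum>h\<in>S. \<Sum>k\<in>S. a h * a k * (h \<bullet> k) ^ r * (f h \<bullet> f k))" by (rule schur_power_nonneg[OF S])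
   also have "\<dots> = (v \<bullet> v) * power_form S (Suc r) a a - power_form S r u u"
    unfolding f power_form_def u_def
    by (simp add: right_diff_distrib sum_subtractf sum_distrib_left mult_ac)
   finally show ?thesis by simp
  qed
  have "(v \<bullet> v) * (v \<bullet> v) \<le> (v \<bullet> v) * (power_form S r b b * power_form S (Suc r) a a)"
   using order_trans[OF le mult_right_mono[OF uu power_form_nonneg[OF S]]]
   by (simp add: power2_eq_square mult_ac)
  then show ?thesis using vv T by simp
 qed
qed

context isonormal_gaussian_process
begin

abbreviation fld :: "'a => 'h => real" where "fld w \<equiv> (\<lambda>v. X v w)"

section \<open>Moments of Hermite sums\<close>

text \<open>The recursion of the Hermite polynomials absorbs the term produced by differentiating \<open>hermite p (X k)\<close>.\<close>

lemma hermite_IBP: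
 assumes c: "cylindrical_on I \<Phi>" "cylindrical_on I \<Phi>'" and fin: "finite I"
  and d: "direction_deriv k \<Phi> \<Phi>'" and k: "norm k = 1"
 shows "(LINT w|M. hermite (Suc p) (X k w) * \<Phi> (fld w)) = (LINT w|M. hermite p (X k w) * \<Phi>' (fld w))"
proof -
 define J where "J = insert k I"
 have J: "finite J" "k \<in> J" using fin by (auto simp: J_def)
 have cJ: "cylindrical_on J \<Phi>" "cylindrical_on J \<Phi>'" using c J(1) by (auto intro: cylindrical_on_mono simp: J_def)
 note cH = cylindrical_on_hermite[OF J(2,1)]
 have kk: "k \<bullet> k = 1" using k by (simp add: norm_eq_1)
 have cA: "cylindrical_on J (\<lambda>x. hermite p (x k) * \<Phi> x)"
  and cB: "cylindrical_on J (\<lambda>x. (real p * hermite (p - 1) (x k)) * \<Phi> x)"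
  and cC: "cylindrical_on J (\<lambda>x. hermite p (x k) * \<Phi>' x)"
  by (intro cylindrical_on_mult cylindrical_on_const cH cJ)+
 note i = all_moments_integrable[OF all_moments_cylindrical[OF cB J(1)]]
  all_moments_integrable[OF all_moments_cylindrical[OF cC J(1)]]
  all_moments_integrable[OF all_moments_mult[OF all_moments_X all_moments_cylindrical[OF cA J(1)]]]
 have dd: "direction_deriv k (\<lambda>x. hermite p (x k) * \<Phi> x)
   (\<lambda>x. real p * hermite (p - 1) (x k) * (k \<bullet> k) * \<Phi> x + hermite p (x k) * \<Phi>' x)"
  by (rule direction_deriv_mult[OF direction_deriv_hermite d])
 have "(LINT w|M. X k w * (hermite p (X k w) * \<Phi> (fld w))) =
   (LINT w|M. (real p * hermite (p - 1) (X k w)) * \<Phi> (fld w) + hermite p (X k w) * \<Phi>' (fld w))"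
  using isonormal_IBP[OF cA cylindrical_on_add[OF cB cC] J(1)] dd by (simp add: kk)
 also have "\<dots> = (LINT w|M. (real p * hermite (p - 1) (X k w)) * \<Phi> (fld w)) + (LINT w|M. hermite p (X k w) * \<Phi>' (fld w))"
  using i by simp
 finally have "(LINT w|M. hermite p (X k w) * \<Phi>' (fld w)) =
   (LINT w|M. X k w * (hermite p (X k w) * \<Phi> (fld w)) - (real p * hermite (p - 1) (X k w)) * \<Phi> (fld w))"
  using i by simp
 then show ?thesis by (simp add: hermite_Suc left_diff_distrib mult.assoc)
qed

lemma all_moments_hermite: "all_moments M (\<lambda>w. hermite p (X k w))"
 using all_moments_cylindrical[OF cylindrical_on_hermite[of k "{k}" p]] by simp

lemma hermite_orthogonal:
 assumes "norm k = 1" "norm l = 1"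
 shows "(LINT w|M. hermite p (X k w) * hermite q (X l w)) = (if p = q then fact p * (k \<bullet> l) ^ p else 0)"
proof (induction p arbitrary: q)
 case 0
 show ?case
 proof (cases q)
  case 0
  then show ?thesis by (simp add: prob_space)
 next
  case (Suc n)
  have "(LINT w|M. hermite (Suc n) (X l w) * 1) = (LINT w|M. hermite n (X l w) * 0)"
   by (rule hermite_IBP[of "{}" "\<lambda>_. 1" "\<lambda>_. 0"]) (auto intro: cylindrical_on_const direction_deriv_const assms)
  then show ?thesis using Suc by simp
 qed
next
 case (Suc p)
 have "(LINT w|M. hermite (Suc p) (X k w) * hermite q (X l w)) =
   (LINT w|M. hermite p (X k w) * (real q * hermite (q - 1) (X l w) * (k \<bullet> l)))"
  by (rule hermite_IBP[OF _ _ _ direction_deriv_hermite assms(1), of "{l}"])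
    (auto intro!: cylindrical_on_mult cylindrical_on_const cylindrical_on_hermite)
 also have "\<dots> = real q * (k \<bullet> l) * (LINT w|M. hermite p (X k w) * hermite (q - 1) (X l w))"
 proof -
  have "(\<lambda>w. hermite p (X k w) * (real q * hermite (q - 1) (X l w) * (k \<bullet> l))) =
    (\<lambda>w. real q * (k \<bullet> l) * (hermite p (X k w) * hermite (q - 1) (X l w)))"
   by (rule ext) (simp only: mult_ac)
  then show ?thesis by (simp only: integral_mult_right_zero)
 qed
 also have "\<dots> = real q * (k \<bullet> l) * (if p = q - 1 then fact p * (k \<bullet> l) ^ p else 0)" by (simp only: Suc.IH)
 also have "\<dots> = (if Suc p = q then fact (Suc p) * (k \<bullet> l) ^ Suc p else 0)" by (cases q) auto
 finally show ?case .
qed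

lemma all_moments_hermite_sum: "finite S ==> all_moments M (\<lambda>w. hermite_sum S c q (fld w))"
 by (rule all_moments_cylindrical[OF cylindrical_on_hermite_sum]) auto

lemma hermite_sum_inner:
 assumes "\<forall>h\<in>S. norm h = 1" "\<forall>h\<in>T. norm h = 1"
 shows "(LINT w|M. hermite_sum S c p (fld w) * hermite_sum T d q (fld w)) =
  (if p = q then fact p * (\<Sum>h\<in>S. \<Sum>k\<in>T. c h * d k * (h \<bullet> k) ^ p) else 0)"
proof -
 have int: "integrable M (\<lambda>w. (c h * d k) * (hermite p (X h w) * hermite q (X k w)))" for h k
  by (intro all_moments_integrable all_moments_cmult all_moments_mult all_moments_hermite)
 have "(LINT w|M. hermite_sum S c p (fld w) * hermite_sum T d q (fld w)) =
   (LINT w|M. (\<Sum>h\<in>S. \<Sum>k\<in>T. (c h * d k) * (hermite p (X h w) * hermite q (X k w))))"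
  by (simp add: hermite_sum_def sum_product mult_ac)
 also have "\<dots> = (\<Sum>h\<in>S. \<Sum>k\<in>T. (c h * d k) * (LINT w|M. hermite p (X h w) * hermite q (X k w)))"
  using int by simp
 also have "\<dots> = (\<Sum>h\<in>S. \<Sum>k\<in>T. (c h * d k) * (if p = q then fact p * (h \<bullet> k) ^ p else 0))"
  using assms by (intro sum.cong refl) (simp add: hermite_orthogonal)
 also have "\<dots> = (if p = q then fact p * (\<Sum>h\<in>S. \<Sum>k\<in>T. c h * d k * (h \<bullet> k) ^ p) else 0)"
  by (auto simp: sum_distrib_left mult_ac)
 finally show ?thesis .
qed

text \<open>Up to a factor, \<open>hermite_form S c p r\<close> is the squared norm of the \<open>r\<close>-th derivative of a Hermite sum
 of order \<open>p + r\<close>.\<close>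

definition hermite_form :: "'h set => ('h => real) => nat => nat => ('h => real) => real" where
 "hermite_form S c p r x = power_form S r (\<lambda>h. c h * hermite p (x h)) (\<lambda>h. c h * hermite p (x h))"

lemma cylindrical_on_hermite_form: "finite S ==> cylindrical_on S (hermite_form S c p r)"
 unfolding hermite_form_def[abs_def] power_form_def
 by (intro cylindrical_on_sum cylindrical_on_mult cylindrical_on_const cylindrical_on_hermite)

lemma hermite_form_0: "hermite_form S c q 0 x = (hermite_sum S c q x)\<^sup>2"
 by (simp add: hermite_form_def power_form_def hermite_sum_def sum_product power2_eq_square)

lemma norm_hermite_grad: "(norm (hermite_grad S c q x))\<^sup>2 = (real q)\<^sup>2 * hermite_form S c (q - 1) 1 x"
proof -
 have "hermite_grad S c q x = real q *\<^sub>R (\<Sum>h\<in>S. (c h * hermite (q - 1) (x h)) *\<^sub>R h)"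
  by (simp add: hermite_grad_def scaleR_sum_right mult_ac)
 moreover have "(norm (\<Sum>h\<in>S. (c h * hermite (q - 1) (x h)) *\<^sub>R h))\<^sup>2 = hermite_form S c (q - 1) 1 x"
  unfolding power2_norm_eq_inner hermite_form_def power_form_def
  by (subst inner_sum_left) (simp add: inner_sum_right sum_distrib_left mult_ac)
 ultimately show ?thesis by (simp add: power_mult_distrib)
qed

lemma integral_hermite_form:
 assumes "\<forall>h\<in>S. norm h = 1"
 shows "(LINT w|M. hermite_form S c p r (fld w)) = fact p * power_form S (p + r) c c"
proof -
 have int: "integrable M (\<lambda>w. (c h * c k * (h \<bullet> k) ^ r) * (hermite p (X h w) * hermite p (X k w)))" for h k
  by (intro all_moments_integrable all_moments_cmult all_moments_mult all_moments_hermite)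
 have "(LINT w|M. hermite_form S c p r (fld w)) =
   (LINT w|M. (\<Sum>h\<in>S. \<Sum>k\<in>S. (c h * c k * (h \<bullet> k) ^ r) * (hermite p (X h w) * hermite p (X k w))))"
  by (simp add: hermite_form_def power_form_def mult_ac)
 also have "\<dots> = (\<Sum>h\<in>S. \<Sum>k\<in>S. (c h * c k * (h \<bullet> k) ^ r) * (LINT w|M. hermite p (X h w) * hermite p (X k w)))"
  using int by simp
 also have "\<dots> = (\<Sum>h\<in>S. \<Sum>k\<in>S. (c h * c k * (h \<bullet> k) ^ r) * (fact p * (h \<bullet> k) ^ p))"
  using assms by (intro sum.cong refl) (simp add: hermite_orthogonal)
 also have "\<dots> = fact p * power_form S (p + r) c c"
  by (simp add: power_form_def sum_distrib_left power_add mult_ac)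
 finally show ?thesis .
qed

lemma hermite_sum_second_moment:
 assumes "\<forall>h\<in>S. norm h = 1"
 shows "(LINT w|M. (hermite_sum S c q (fld w))\<^sup>2) = fact q * power_form S q c c"
 using integral_hermite_form[OF assms, of c q 0] by (simp add: hermite_form_0)

lemma hermite_grad_second_moment:
 assumes "\<forall>h\<in>S. norm h = 1"
 shows "(LINT w|M. (norm (hermite_grad S c q (fld w)))\<^sup>2) = real q * (LINT w|M. (hermite_sum S c q (fld w))\<^sup>2)"
 unfolding norm_hermite_grad hermite_sum_second_moment[OF assms]
 using integral_hermite_form[OF assms, of c "q - 1" 1]
 by (cases q) (simp_all add: power2_eq_square)

text \<open>Let \<open>N\<close> and \<open>N'\<close> be the forms on the two sides. One factor \<open>hermite (p + 1)\<close> in \<open>E N\<^sup>2\<close> is integrated by parts. The three resulting terms are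
 \<open>N * N'\<close> and contractions bounded by \<open>N * N'\<close> pointwise, whence \<open>E N\<^sup>2 \<le> 3 (p + 1) E[N N']\<close>;
 Cauchy--Schwarz concludes.\<close>

lemma hermite_form_moment_step:
 assumes S: "finite S" and n: "\<forall>h\<in>S. norm h = 1"
 shows "(LINT u|M. (hermite_form S c (Suc p) r (fld u))\<^sup>2) \<le>
   9 * (real (Suc p))\<^sup>2 * (LINT u|M. (hermite_form S c p (Suc r) (fld u))\<^sup>2)"
proof -
 define a where "a h x = c h * hermite p (x h)" for h and x :: "'h => real"
 define b where "b h x = c h * hermite (Suc p) (x h)" for h and x :: "'h => real"
 define B where "B h x = (\<Sum>m\<in>S. b m x * (h \<bullet> m) ^ r)" for h x
 define B' where "B' h x = (\<Sum>m\<in>S. (c m * (real (Suc p) * hermite p (x m) * (h \<bullet> m))) * (h \<bullet> m) ^ r)" for h x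
 define N where "N = hermite_form S c (Suc p) r"
 define N' where "N' = hermite_form S c p (Suc r)"
 define DN where "DN h x = (\<Sum>m\<in>S. \<Sum>l\<in>S. ((c m * (real (Suc p) * hermite p (x m) * (h \<bullet> m))) * b l x +
   b m x * (c l * (real (Suc p) * hermite p (x l) * (h \<bullet> l)))) * (m \<bullet> l) ^ r)" for h x
 have ca: "cylindrical_on S (a h)" and cb: "cylindrical_on S (b h)" if "h \<in> S" for h
  unfolding a_def b_def by (intro cylindrical_on_cmult cylindrical_on_hermite S that)+
 have cB: "cylindrical_on S (B h)" and cB': "cylindrical_on S (B' h)" and cDN: "cylindrical_on S (DN h)" for h
  unfolding B_def B'_def DN_def
  by (intro cylindrical_on_sum cylindrical_on_mult cylindrical_on_add cylindrical_on_const cylindrical_on_hermite cb S; assumption)+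
 have cN: "cylindrical_on S N" "cylindrical_on S N'" unfolding N_def N'_def by (intro cylindrical_on_hermite_form S)+
 have db: "direction_deriv k (b m) (\<lambda>x. c m * (real (Suc p) * hermite p (x m) * (k \<bullet> m)))" for k m
  unfolding b_def using direction_deriv_cmult[OF direction_deriv_hermite[of k "Suc p" m], of "c m"] by simp
 have dcm: "direction_deriv k (\<lambda>x. \<Phi> x * e) (\<lambda>x. \<Phi>' x * e)" if "direction_deriv k \<Phi> \<Phi>'" for k e \<Phi> \<Phi>'
  using direction_deriv_cmult[OF that, of e] by (simp add: mult.commute)
 have dB: "direction_deriv h (B h) (B' h)" for h unfolding B_def B'_def
  by (intro direction_deriv_sum dcm db)
 have Nb: "N x = (\<Sum>m\<in>S. \<Sum>l\<in>S. (b m x * b l x) * (m \<bullet> l) ^ r)" for x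
  by (simp add: N_def hermite_form_def power_form_def b_def)
 have dN: "direction_deriv h N (DN h)" for h
  unfolding Nb[abs_def] DN_def by (intro direction_deriv_sum dcm direction_deriv_mult db)
 have am: "all_moments M (\<lambda>u. \<Phi> (fld u))" if "cylindrical_on S \<Phi>" for \<Phi>
  by (rule all_moments_cylindrical[OF that S])
 have NB: "N x = (\<Sum>h\<in>S. b h x * B h x)" for x
  by (simp add: Nb B_def sum_distrib_left mult_ac)
 have sq: "(N x)\<^sup>2 = (\<Sum>h\<in>S. c h * (hermite (Suc p) (x h) * (B h x * N x)))" for x
 proof -
  have "(N x)\<^sup>2 = (\<Sum>h\<in>S. b h x * B h x) * N x" using NB[of x] by (simp add: power2_eq_square)
  also have "\<dots> = (\<Sum>h\<in>S. c h * (hermite (Suc p) (x h) * (B h x * N x)))"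
   unfolding sum_distrib_right b_def by (simp only: mult_ac)
  finally show ?thesis .
 qed
 have "(LINT u|M. (N (fld u))\<^sup>2) = (LINT u|M. (\<Sum>h\<in>S. c h * (hermite (Suc p) (X h u) * (B h (fld u) * N (fld u)))))"
  by (simp add: sq del: hermite.simps)
 also have "\<dots> = (\<Sum>h\<in>S. c h * (LINT u|M. hermite (Suc p) (X h u) * (B h (fld u) * N (fld u))))"
 proof -
  have "integrable M (\<lambda>u. hermite (Suc p) (X h u) * (B h (fld u) * N (fld u)))" for h
   by (intro all_moments_integrable all_moments_mult all_moments_hermite am cB cN)
  then show ?thesis by simp
 qed
 also have "\<dots> = (\<Sum>h\<in>S. c h * (LINT u|M. hermite p (X h u) * (B' h (fld u) * N (fld u) + B h (fld u) * DN h (fld u))))"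
  by (intro sum.cong refl arg_cong2[where f="(*)"]
    hermite_IBP[OF cylindrical_on_mult[OF cB cN(1)] cylindrical_on_add[OF cylindrical_on_mult[OF cB' cN(1)] cylindrical_on_mult[OF cB cDN]] S
     direction_deriv_mult[OF dB dN]]) (use n in auto)
 also have "\<dots> = (LINT u|M. (\<Sum>h\<in>S. c h * (hermite p (X h u) * (B' h (fld u) * N (fld u) + B h (fld u) * DN h (fld u)))))"
 proof -
  have "integrable M (\<lambda>u. hermite p (X h u) * (B' h (fld u) * N (fld u) + B h (fld u) * DN h (fld u)))" for h
   by (intro all_moments_integrable all_moments_mult all_moments_add all_moments_hermite am cB cB' cN cDN)
  then show ?thesis by simp
 qed
 also have "\<dots> \<le> (LINT u|M. 3 * real (Suc p) * (N (fld u) * N' (fld u)))"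
 proof (rule integral_mono)
  show "integrable M (\<lambda>u. \<Sum>h\<in>S. c h * (hermite p (X h u) * (B' h (fld u) * N (fld u) + B h (fld u) * DN h (fld u))))"
   by (intro all_moments_integrable all_moments_sum all_moments_cmult all_moments_mult all_moments_add all_moments_hermite am cB cB' cN cDN)
  show "integrable M (\<lambda>u. 3 * real (Suc p) * (N (fld u) * N' (fld u)))"
   by (intro all_moments_integrable all_moments_cmult all_moments_mult am cN)
  fix u
  define x where "x = fld u"
  define w where "w h = a h x * B h x" for h
  have 1: "(\<Sum>h\<in>S. a h x * B' h x) = real (Suc p) * N' x"
   unfolding N'_def hermite_form_def power_form_def B'_def a_def sum_distrib_left
   by (intro sum.cong refl) (simp add: mult_ac)
  have DN: "DN h x = 2 * real (Suc p) * (\<Sum>m\<in>S. w m * (h \<bullet> m))" for h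
  proof -
   have e1: "(\<Sum>m\<in>S. \<Sum>l\<in>S. (a m x * (h \<bullet> m)) * b l x * (m \<bullet> l) ^ r) = (\<Sum>m\<in>S. w m * (h \<bullet> m))"
    unfolding w_def B_def sum_distrib_left sum_distrib_right by (intro sum.cong refl) (simp add: mult_ac)
   have e2: "(\<Sum>m\<in>S. \<Sum>l\<in>S. (a l x * (h \<bullet> l)) * b m x * (m \<bullet> l) ^ r) = (\<Sum>m\<in>S. w m * (h \<bullet> m))"
    unfolding e1[symmetric] by (subst sum.swap) (simp add: inner_commute)
   have "DN h x = real (Suc p) * ((\<Sum>m\<in>S. \<Sum>l\<in>S. (a m x * (h \<bullet> m)) * b l x * (m \<bullet> l) ^ r) +
     (\<Sum>m\<in>S. \<Sum>l\<in>S. (a l x * (h \<bullet> l)) * b m x * (m \<bullet> l) ^ r))"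
    unfolding DN_def a_def sum.distrib[symmetric] sum_distrib_left by (intro sum.cong refl) (simp add: algebra_simps)
   then show ?thesis unfolding e1 e2 by simp
  qed
  have 2: "(\<Sum>h\<in>S. a h x * (B h x * DN h x)) = 2 * real (Suc p) * power_form S 1 w w"
   unfolding DN power_form_def sum_distrib_left w_def by (intro sum.cong refl) (simp add: mult_ac)
  \<comment> \<open>the quadratic form of the contraction is bounded by the product of the two norms\<close>
  have 3: "power_form S 1 w w \<le> N x * N' x"
   unfolding N_def N'_def hermite_form_def
   by (rule contraction_bound[OF S]) (simp add: w_def a_def B_def b_def)
  have "(\<Sum>h\<in>S. c h * (hermite p (x h) * (B' h x * N x + B h x * DN h x))) =
    (\<Sum>h\<in>S. a h x * B' h x) * N x + (\<Sum>h\<in>S. a h x * (B h x * DN h x))"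
   by (simp add: a_def sum_distrib_left sum_distrib_right sum.distrib algebra_simps)
  also have "\<dots> \<le> 3 * real (Suc p) * (N x * N' x)"
   unfolding 1 2 using mult_left_mono[OF 3, of "2 * real (Suc p)"] by (simp add: algebra_simps)
  finally show "(\<Sum>h\<in>S. c h * (hermite p (X h u) * (B' h (fld u) * N (fld u) + B h (fld u) * DN h (fld u))))
   \<le> 3 * real (Suc p) * (N (fld u) * N' (fld u))" by (simp add: x_def)
 qed
 finally have le: "(LINT u|M. (N (fld u))\<^sup>2) \<le> 3 * real (Suc p) * (LINT u|M. N (fld u) * N' (fld u))" by simp
 define P where "P = (LINT u|M. (N (fld u))\<^sup>2)"
 define Q where "Q = (LINT u|M. (N' (fld u))\<^sup>2)"
 define R where "R = (LINT u|M. N (fld u) * N' (fld u))"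
 have P0: "0 \<le> P" "0 \<le> Q" by (simp_all add: P_def Q_def)
 have RPQ: "R\<^sup>2 \<le> P * Q" unfolding P_def Q_def R_def
  by (intro integral_mult_Cauchy_Schwarz all_moments_sq_integrable am cN)
 have "P \<le> 9 * (real (Suc p))\<^sup>2 * Q"
 proof (cases "P = 0")
  case False
  then have "P > 0" using P0 by simp
  have "P\<^sup>2 \<le> (3 * real (Suc p) * R)\<^sup>2" using le P0 by (intro power_mono) (simp_all add: P_def R_def)
  also have "\<dots> = 9 * (real (Suc p))\<^sup>2 * R\<^sup>2" by (simp add: power_mult_distrib del: of_nat_Suc)
  also have "\<dots> \<le> 9 * (real (Suc p))\<^sup>2 * (P * Q)" by (intro mult_left_mono RPQ) simp
  finally have "P * P \<le> P * (9 * (real (Suc p))\<^sup>2 * Q)" by (simp add: power2_eq_square mult_ac)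
  then show ?thesis using \<open>P > 0\<close> by simp
 qed (use P0 in simp)
 then show ?thesis by (simp add: P_def Q_def N_def N'_def)
qed

lemma hermite_form_moment:
 assumes S: "finite S" and n: "\<forall>h\<in>S. norm h = 1"
 shows "(LINT w|M. (hermite_form S c p r (fld w))\<^sup>2) \<le> 9 ^ p * (fact p)\<^sup>2 * (power_form S (p + r) c c)\<^sup>2"
proof (induction p arbitrary: r)
 case 0
 show ?case by (simp add: hermite_form_def prob_space)
next
 case (Suc p)
 have "(LINT w|M. (hermite_form S c (Suc p) r (fld w))\<^sup>2) \<le>
   9 * (real (Suc p))\<^sup>2 * (9 ^ p * (fact p)\<^sup>2 * (power_form S (p + Suc r) c c)\<^sup>2)"
  by (rule order_trans[OF hermite_form_moment_step[OF S n] mult_left_mono[OF Suc.IH]]) simp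
 then show ?case by (simp add: power_mult_distrib mult_ac)
qed

text \<open>Hypercontractivity with a non-optimal constant. Iterating the previous step trades Hermite degree for tensor
 order until nothing random is left.\<close>

lemma hermite_sum_fourth_moment:
 assumes S: "finite S" and n: "\<forall>h\<in>S. norm h = 1"
 shows "(LINT w|M. (norm (hermite_sum S c q (fld w))) ^ 4) \<le> (real q + 1)\<^sup>2 * 9 ^ q * (LINT w|M. (hermite_sum S c q (fld w))\<^sup>2)\<^sup>2"
  and "(LINT w|M. (norm (hermite_grad S c q (fld w))) ^ 4) \<le> (real q + 1)\<^sup>2 * 9 ^ q * (LINT w|M. (hermite_sum S c q (fld w))\<^sup>2)\<^sup>2"
proof -
 define Q where "Q = (fact q * power_form S q c c)\<^sup>2"
 have Q0: "0 \<le> Q" by (simp add: Q_def)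
 have p4: "y ^ 4 = (y\<^sup>2)\<^sup>2" for y :: real by (simp flip: power_mult)
 have "(LINT w|M. (norm (hermite_sum S c q (fld w))) ^ 4) = (LINT w|M. (hermite_form S c q 0 (fld w))\<^sup>2)"
  by (simp only: p4 hermite_form_0 real_norm_def power2_abs)
 also have "\<dots> \<le> 9 ^ q * Q"
  using hermite_form_moment[OF S n, of c q 0] by (simp add: Q_def power_mult_distrib mult.assoc)
 also have "\<dots> \<le> (real q + 1)\<^sup>2 * 9 ^ q * Q"
  using mult_right_mono[of 1 "(real q + 1)\<^sup>2" "9 ^ q * Q"] Q0 by (simp add: mult.assoc)
 finally show "(LINT w|M. (norm (hermite_sum S c q (fld w))) ^ 4) \<le> (real q + 1)\<^sup>2 * 9 ^ q * (LINT w|M. (hermite_sum S c q (fld w))\<^sup>2)\<^sup>2"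
  by (simp add: hermite_sum_second_moment[OF n] Q_def)
 have "(LINT w|M. (norm (hermite_grad S c q (fld w))) ^ 4) = (real q) ^ 4 * (LINT w|M. (hermite_form S c (q - 1) 1 (fld w))\<^sup>2)"
 proof -
  have "(norm (hermite_grad S c q x)) ^ 4 = (real q) ^ 4 * (hermite_form S c (q - 1) 1 x)\<^sup>2" for x
   by (subst p4, subst norm_hermite_grad) (simp add: power_mult_distrib)
  then show ?thesis by simp
 qed
 also have "\<dots> \<le> (real q)\<^sup>2 * 9 ^ q * Q"
 proof (cases q)
  case (Suc p)
  have "(real q) ^ 4 * (LINT w|M. (hermite_form S c (q - 1) 1 (fld w))\<^sup>2) \<le>
    (real q) ^ 4 * (9 ^ p * (fact p)\<^sup>2 * (power_form S (p + 1) c c)\<^sup>2)"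
   using hermite_form_moment[OF S n, of c p 1] Suc by (intro mult_left_mono) auto
  also have "\<dots> = (real q)\<^sup>2 * 9 ^ p * Q" using Suc
   by (simp add: Q_def power_mult_distrib power4_eq_xxxx power2_eq_square mult_ac)
  also have "\<dots> \<le> (real q)\<^sup>2 * 9 ^ q * Q" using Q0 Suc
   by (intro mult_right_mono mult_left_mono) auto
  finally show ?thesis .
 qed simp
 also have "\<dots> \<le> (real q + 1)\<^sup>2 * 9 ^ q * Q"
  using Q0 by (intro mult_right_mono power_mono) auto
 finally show "(LINT w|M. (norm (hermite_grad S c q (fld w))) ^ 4) \<le> (real q + 1)\<^sup>2 * 9 ^ q * (LINT w|M. (hermite_sum S c q (fld w))\<^sup>2)\<^sup>2"
  by (simp add: hermite_sum_second_moment[OF n] Q_def)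
qed

end

section \<open>Convergence of fourth moments\<close>

definition pow4_integrable :: "'a measure => ('a => 'b::{banach,second_countable_topology}) => bool" where
 "pow4_integrable M U \<longleftrightarrow> U \<in> borel_measurable M \<and> integrable M (\<lambda>w. (norm (U w)) ^ 4)"

definition L4_tendsto ::
 "'a measure => (nat => 'a => 'b::{banach,second_countable_topology}) => ('a => 'b) => bool" where
 "L4_tendsto M Us U \<longleftrightarrow> (\<forall>m. pow4_integrable M (Us m)) \<and> pow4_integrable M U \<and>
   (\<lambda>m. LINT w|M. (norm (Us m w - U w)) ^ 4) \<longlonglongrightarrow> 0"

lemma tendsto_zero_of_le:
 fixes f g :: "nat => real"
 assumes "\<And>m. 0 \<le> f m" "\<And>m. f m \<le> g m" "g \<longlonglongrightarrow> 0"
 shows "f \<longlonglongrightarrow> 0"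
 by (rule Lim_null_comparison[OF always_eventually assms(3)]) (use assms(1,2) in simp)

lemma pow4_add_le: "(x + y) ^ 4 \<le> 8 * x ^ 4 + 8 * y ^ 4" for x y :: real
proof -
 have p4: "z ^ 4 = (z\<^sup>2)\<^sup>2" for z :: real by (simp flip: power_mult)
 have sq: "(u + v)\<^sup>2 \<le> 2 * u\<^sup>2 + 2 * v\<^sup>2" for u v :: real
  using sum_squares_bound[of u v] by (simp add: power2_sum)
 have "((x + y)\<^sup>2)\<^sup>2 \<le> (2 * x\<^sup>2 + 2 * y\<^sup>2)\<^sup>2" by (rule power_mono[OF sq]) simp
 also have "\<dots> \<le> 2 * (2 * x\<^sup>2)\<^sup>2 + 2 * (2 * y\<^sup>2)\<^sup>2" by (rule sq)
 also have "\<dots> = 8 * (x\<^sup>2)\<^sup>2 + 8 * (y\<^sup>2)\<^sup>2" by (simp only: power_mult_distrib) simp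
 finally show ?thesis by (simp only: p4)
qed

lemma norm_add_pow4_le:
 fixes u v :: "'b::real_normed_vector"
 shows "norm (u + v) ^ 4 \<le> 8 * norm u ^ 4 + 8 * norm v ^ 4"
 by (rule order_trans[OF power_mono[OF norm_triangle_ineq] pow4_add_le]) simp

lemma pow4_integrable_add:
 assumes "pow4_integrable M U" "pow4_integrable M V" shows "pow4_integrable M (\<lambda>w. U w + V w)"
proof -
 have "integrable M (\<lambda>w. (norm (U w + V w)) ^ 4)"
 proof (rule Bochner_Integration.integrable_bound)
  show "integrable M (\<lambda>w. 8 * norm (U w) ^ 4 + 8 * norm (V w) ^ 4)" using assms by (simp add: pow4_integrable_def)
  show "AE x in M. norm ((norm (U x + V x)) ^ 4) \<le> norm (8 * norm (U x) ^ 4 + 8 * norm (V x) ^ 4)"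
   using norm_add_pow4_le by (intro AE_I2) simp
 qed (use assms in \<open>auto simp: pow4_integrable_def\<close>)
 then show ?thesis using assms by (auto simp: pow4_integrable_def)
qed

lemma pow4_integrable_minus: "pow4_integrable M U ==> pow4_integrable M (\<lambda>w. - U w)"
 by (simp add: pow4_integrable_def)

lemma pow4_integrable_diff:
 assumes "pow4_integrable M U" "pow4_integrable M V" shows "pow4_integrable M (\<lambda>w. U w - V w)"
 using pow4_integrable_add[OF assms(1) pow4_integrable_minus[OF assms(2)]] by simp

lemma pow4_integrable_sq: "pow4_integrable M U ==> sq_integrable M (\<lambda>w. (norm (U w))\<^sup>2)"
 by (auto simp: pow4_integrable_def sq_integrable_def simp flip: power_mult)

lemma (in prob_space) pow4_integrable_sq_integrable:
 assumes "pow4_integrable M U" shows "sq_integrable M U"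
 using sq_integrable_integrable[OF pow4_integrable_sq[OF assms]] assms
 by (simp add: pow4_integrable_def sq_integrable_def)

lemma (in prob_space) L4_imp_L2:
 assumes "L4_tendsto M Us U" shows "L2_tendsto M Us U"
proof -
 have d: "pow4_integrable M (\<lambda>w. Us m w - U w)" for m
  using assms by (intro pow4_integrable_diff) (auto simp: L4_tendsto_def)
 have "(LINT w|M. (norm (Us m w - U w))\<^sup>2)\<^sup>2 \<le> (LINT w|M. (norm (Us m w - U w)) ^ 4)" for m
  using integral_mult_Cauchy_Schwarz[OF pow4_integrable_sq[OF d[of m]] sq_integrable_const[of 1]]
  by (simp add: prob_space flip: power_mult)
 then have le: "(LINT w|M. (norm (Us m w - U w))\<^sup>2) \<le> sqrt (LINT w|M. (norm (Us m w - U w)) ^ 4)" for m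
  by (intro real_le_rsqrt)
 have "(\<lambda>m. LINT w|M. (norm (Us m w - U w)) ^ 4) \<longlonglongrightarrow> 0" using assms by (simp add: L4_tendsto_def)
 from tendsto_real_sqrt[OF this]
 have lim: "(\<lambda>m. sqrt (LINT w|M. (norm (Us m w - U w)) ^ 4)) \<longlonglongrightarrow> 0" by simp
 have "(\<lambda>m. LINT w|M. (norm (Us m w - U w))\<^sup>2) \<longlonglongrightarrow> 0"
  by (rule tendsto_zero_of_le[OF _ le lim]) simp
 then show ?thesis using assms by (auto simp: L2_tendsto_def L4_tendsto_def intro: pow4_integrable_sq_integrable)
qed

lemma sq_integrable_pow4_scaleR:
 fixes V :: "'a => 'b::{real_inner,banach,second_countable_topology}"
 assumes "pow4_integrable M f" "pow4_integrable M V"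
 shows "sq_integrable M (\<lambda>w. (f w :: real) *\<^sub>R V w)"
  and "(LINT w|M. (norm (f w *\<^sub>R V w))\<^sup>2) \<le> sqrt (LINT w|M. norm (f w) ^ 4) * sqrt (LINT w|M. norm (V w) ^ 4)"
proof -
 note s = pow4_integrable_sq[OF assms(1)] pow4_integrable_sq[OF assms(2)]
 have e: "(norm (f w *\<^sub>R V w))\<^sup>2 = (norm (f w))\<^sup>2 * (norm (V w))\<^sup>2" for w
  by (simp add: power_mult_distrib)
 show "sq_integrable M (\<lambda>w. f w *\<^sub>R V w)"
  using sq_integrable_mult[OF s] assms unfolding sq_integrable_def e by (auto simp: pow4_integrable_def)
 show "(LINT w|M. (norm (f w *\<^sub>R V w))\<^sup>2) \<le> sqrt (LINT w|M. norm (f w) ^ 4) * sqrt (LINT w|M. norm (V w) ^ 4)"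
  unfolding e using abs_integral_mult_le[OF s] by (simp flip: power_mult)
qed

text \<open>The reason for working with fourth moments: products of two convergent sequences converge in mean square.\<close>

lemma L4_tendsto_scaleR:
 fixes V :: "'a => 'b::{real_inner,banach,second_countable_topology}"
 assumes f: "L4_tendsto M fs f" and V: "L4_tendsto M Vs V"
 shows "L2_tendsto M (\<lambda>m w. (fs m w :: real) *\<^sub>R Vs m w) (\<lambda>w. f w *\<^sub>R V w)"
proof -
 have i: "pow4_integrable M (fs m)" "pow4_integrable M f" "pow4_integrable M (Vs m)" "pow4_integrable M V" for m
  using f V by (auto simp: L4_tendsto_def)
 have i4: "integrable M (\<lambda>w. norm (fs m w) ^ 4)" "integrable M (\<lambda>w. norm (Vs m w) ^ 4)" "integrable M (\<lambda>w. norm (V w) ^ 4)"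
  "integrable M (\<lambda>w. norm (Vs m w - V w) ^ 4)" for m
  using i pow4_integrable_diff[OF i(3,4)] by (auto simp: pow4_integrable_def)
 define df where "df m = (LINT w|M. norm (fs m w - f w) ^ 4)" for m
 define dV where "dV m = (LINT w|M. norm (Vs m w - V w) ^ 4)" for m
 define I where "I = (LINT w|M. norm (V w) ^ 4)"
 define J where "J = (LINT w|M. norm (f w) ^ 4)"
 have lim: "df \<longlonglongrightarrow> 0" "dV \<longlonglongrightarrow> 0" using f V by (auto simp: L4_tendsto_def df_def[abs_def] dV_def[abs_def])
 have bV: "(LINT w|M. norm (Vs m w) ^ 4) \<le> 8 * dV m + 8 * I" for m
 proof -
  have "(LINT w|M. norm (Vs m w) ^ 4) \<le> (LINT w|M. 8 * norm (Vs m w - V w) ^ 4 + 8 * norm (V w) ^ 4)"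
   using norm_add_pow4_le[of "Vs m w - V w" "V w" for w] i4 by (intro integral_mono) auto
  also have "\<dots> = 8 * dV m + 8 * I" using i4 by (simp add: dV_def I_def)
  finally show ?thesis .
 qed
 have s1: "sq_integrable M (\<lambda>w. (fs m w - f w) *\<^sub>R Vs m w)" and s2: "sq_integrable M (\<lambda>w. f w *\<^sub>R (Vs m w - V w))" for m
  by (intro sq_integrable_pow4_scaleR pow4_integrable_diff i)+
 have le: "(LINT w|M. (norm (fs m w *\<^sub>R Vs m w - f w *\<^sub>R V w))\<^sup>2) \<le> 2 * (sqrt (df m) * sqrt (8 * dV m + 8 * I)) + 2 * (sqrt J * sqrt (dV m))" for m
 proof -
  have "(norm (fs m w *\<^sub>R Vs m w - f w *\<^sub>R V w))\<^sup>2 \<le> 2 * (norm ((fs m w - f w) *\<^sub>R Vs m w))\<^sup>2 + 2 * (norm (f w *\<^sub>R (Vs m w - V w)))\<^sup>2" for w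
  proof -
   have "fs m w *\<^sub>R Vs m w - f w *\<^sub>R V w = (fs m w - f w) *\<^sub>R Vs m w + f w *\<^sub>R (Vs m w - V w)"
    by (simp add: algebra_simps)
   also have "(norm \<dots>)\<^sup>2 \<le> (norm ((fs m w - f w) *\<^sub>R Vs m w) + norm (f w *\<^sub>R (Vs m w - V w)))\<^sup>2"
    by (intro power_mono norm_triangle_ineq) simp
   also have "\<dots> \<le> 2 * (norm ((fs m w - f w) *\<^sub>R Vs m w))\<^sup>2 + 2 * (norm (f w *\<^sub>R (Vs m w - V w)))\<^sup>2"
    using sum_squares_bound[of "norm ((fs m w - f w) *\<^sub>R Vs m w)" "norm (f w *\<^sub>R (Vs m w - V w))"] by (simp add: power2_sum)
   finally show ?thesis .
  qed
  then have "(LINT w|M. (norm (fs m w *\<^sub>R Vs m w - f w *\<^sub>R V w))\<^sup>2) \<le>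
    (LINT w|M. 2 * (norm ((fs m w - f w) *\<^sub>R Vs m w))\<^sup>2 + 2 * (norm (f w *\<^sub>R (Vs m w - V w)))\<^sup>2)"
   using s1[of m] s2[of m] sq_integrable_diff[OF sq_integrable_pow4_scaleR(1)[OF i(1,3)] sq_integrable_pow4_scaleR(1)[OF i(2,4)]]
   by (intro integral_mono) (auto simp: sq_integrable_def simp del: norm_scaleR)
  also have "\<dots> = 2 * (LINT w|M. (norm ((fs m w - f w) *\<^sub>R Vs m w))\<^sup>2) + 2 * (LINT w|M. (norm (f w *\<^sub>R (Vs m w - V w)))\<^sup>2)"
  proof -
   have "integrable M (\<lambda>w. (norm ((fs m w - f w) *\<^sub>R Vs m w))\<^sup>2)" "integrable M (\<lambda>w. (norm (f w *\<^sub>R (Vs m w - V w)))\<^sup>2)"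
    using s1[of m] s2[of m] unfolding sq_integrable_def by blast+
   then show ?thesis by (simp del: norm_scaleR)
  qed
  also have "\<dots> \<le> 2 * (sqrt (df m) * sqrt (LINT w|M. norm (Vs m w) ^ 4)) + 2 * (sqrt J * sqrt (dV m))"
   unfolding df_def dV_def J_def
   by (intro add_mono mult_left_mono sq_integrable_pow4_scaleR(2) pow4_integrable_diff i) auto
  also have "\<dots> \<le> 2 * (sqrt (df m) * sqrt (8 * dV m + 8 * I)) + 2 * (sqrt J * sqrt (dV m))"
   by (intro add_right_mono mult_left_mono real_sqrt_le_mono bV) (auto simp: df_def)
  finally show ?thesis .
 qed
 have "(\<lambda>m. 2 * (sqrt (df m) * sqrt (8 * dV m + 8 * I)) + 2 * (sqrt J * sqrt (dV m)))
   \<longlonglongrightarrow> 2 * (sqrt 0 * sqrt (8 * 0 + 8 * I)) + 2 * (sqrt J * sqrt 0)"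
  by (intro tendsto_intros lim)
 then have lim0: "(\<lambda>m. 2 * (sqrt (df m) * sqrt (8 * dV m + 8 * I)) + 2 * (sqrt J * sqrt (dV m))) \<longlonglongrightarrow> 0" by simp
 have "(\<lambda>m. LINT w|M. (norm (fs m w *\<^sub>R Vs m w - f w *\<^sub>R V w))\<^sup>2) \<longlonglongrightarrow> 0"
  by (rule tendsto_zero_of_le[OF _ le lim0]) simp
 then show ?thesis unfolding L2_tendsto_def using sq_integrable_pow4_scaleR(1) i by blast
qed

text \<open>The mean square limit is already known; Fatou's lemma along an almost everywhere convergent subsequence
 improves the mode of convergence.\<close>

lemma L4_tendsto_of_Cauchy:
 assumes L2: "L2_tendsto M Us U" and i: "\<And>m. pow4_integrable M (Us m)"
  and Cauchy: "\<And>e. e > 0 ==> \<exists>N. \<forall>i\<ge>N. \<forall>j\<ge>N. (LINT w|M. norm (Us i w - Us j w) ^ 4) \<le> e"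
 shows "L4_tendsto M Us U"
proof -
 obtain r where r: "strict_mono r" "AE x in M. (\<lambda>m. Us (r m) x) \<longlonglongrightarrow> U x"
  using L2_tendsto_AE_subseq[OF L2] by blast
 have [measurable]: "Us m \<in> borel_measurable M" "U \<in> borel_measurable M" for m
  using L2_tendstoD(1,2)[OF L2] by (auto simp: sq_integrable_def)
 have d: "pow4_integrable M (\<lambda>w. Us i w - Us j w)" for i j by (intro pow4_integrable_diff i)
 have key: "integrable M (\<lambda>x. norm (Us i x - U x) ^ 4) \<and> (LINT x|M. norm (Us i x - U x) ^ 4) \<le> e"
  if N: "\<forall>i\<ge>N. \<forall>j\<ge>N. (LINT w|M. norm (Us i w - Us j w) ^ 4) \<le> e" and i: "i \<ge> N" for i N e
 proof -
  have b: "(LINT x|M. norm (Us i x - Us (r (m + N)) x) ^ 4) \<le> e" for m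
  proof -
   have "m + N \<le> r (m + N)" by (rule seq_suble[OF r(1)])
   then show ?thesis using N i by simp
  qed
  have c: "AE x in M. (\<lambda>m. norm (Us i x - Us (r (m + N)) x) ^ 4) \<longlonglongrightarrow> norm (Us i x - U x) ^ 4"
   using r(2) by eventually_elim (intro tendsto_intros LIMSEQ_ignore_initial_segment, assumption)
  have a: "integrable M (\<lambda>x. norm (Us i x - Us (r (m + N)) x) ^ 4)" for m
   using d by (auto simp: pow4_integrable_def)
  show ?thesis using integral_Fatou[OF a _ b _ c] by auto
 qed
 obtain N1 where N1: "\<forall>i\<ge>N1. \<forall>j\<ge>N1. (LINT w|M. norm (Us i w - Us j w) ^ 4) \<le> 1" using Cauchy[of 1] by auto
 have "pow4_integrable M (\<lambda>x. Us N1 x - U x)" using key[OF N1 order_refl] by (auto simp: pow4_integrable_def)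
 from pow4_integrable_diff[OF i[of N1] this] have iU: "pow4_integrable M U" by simp
 have "(\<lambda>m. LINT w|M. norm (Us m w - U w) ^ 4) \<longlonglongrightarrow> 0"
 proof (rule LIMSEQ_I)
  fix e :: real assume "e > 0"
  then obtain N where N: "\<forall>i\<ge>N. \<forall>j\<ge>N. (LINT w|M. norm (Us i w - Us j w) ^ 4) \<le> e/2" using Cauchy[of "e/2"] by auto
  have "norm ((LINT w|M. norm (Us m w - U w) ^ 4) - 0) < e" if "m \<ge> N" for m
   using key[OF N that] \<open>e > 0\<close> by simp
  then show "\<exists>no. \<forall>n\<ge>no. norm ((LINT w|M. norm (Us n w - U w) ^ 4) - 0) < e" by blast
 qed
 with i iU show ?thesis by (auto simp: L4_tendsto_def)
qed

lemma sum_pow4_le: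
 assumes "finite I"
 shows "\<exists>C\<ge>0. \<forall>a::'i => real. (\<Sum>i\<in>I. a i) ^ 4 \<le> C * (\<Sum>i\<in>I. a i ^ 4)"
 using assms
proof (induction I rule: finite_induct)
 case (insert x I)
 from insert.IH obtain C where C: "C \<ge> 0" "\<forall>a::'i => real. (\<Sum>i\<in>I. a i) ^ 4 \<le> C * (\<Sum>i\<in>I. a i ^ 4)"
  by (elim exE conjE)
 have "(\<Sum>i\<in>insert x I. a i) ^ 4 \<le> (8 + 8 * C) * (\<Sum>i\<in>insert x I. a i ^ 4)" for a :: "'i => real"
 proof -
  have "(\<Sum>i\<in>insert x I. a i) ^ 4 \<le> 8 * a x ^ 4 + 8 * (\<Sum>i\<in>I. a i) ^ 4"
   using insert(1,2) pow4_add_le[of "a x" "\<Sum>i\<in>I. a i"] by simp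
  also have "\<dots> \<le> 8 * a x ^ 4 + 8 * (C * (\<Sum>i\<in>I. a i ^ 4))" using spec[OF C(2), of a] by simp
  also have "\<dots> \<le> (8 + 8 * C) * (a x ^ 4 + (\<Sum>i\<in>I. a i ^ 4))"
  proof -
   have "0 \<le> C * a x ^ 4" "0 \<le> (\<Sum>i\<in>I. a i ^ 4)" using C(1) by (auto intro!: sum_nonneg mult_nonneg_nonneg)
   moreover have "(8 + 8 * C) * (a x ^ 4 + (\<Sum>i\<in>I. a i ^ 4)) = 8 * a x ^ 4 + 8 * (C * (\<Sum>i\<in>I. a i ^ 4)) + 8 * (\<Sum>i\<in>I. a i ^ 4) + 8 * (C * a x ^ 4)"
    by (simp add: algebra_simps)
   ultimately show ?thesis by linarith
  qed
  finally show ?thesis using insert by simp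
 qed
 then show ?case using C(1) by (intro exI[of _ "8 + 8 * C"]) auto
qed auto

lemma L4_tendsto_Lipschitz:
 fixes Us :: "'i::finite => nat => 'a => real"
 assumes L4: "\<And>i. L4_tendsto M (Us i) (U i)"
  and f: "\<And>m. pow4_integrable M (f m)" "pow4_integrable M g"
  and le: "\<And>m w. norm (f m w - g w) \<le> L * (\<Sum>i\<in>UNIV. \<bar>Us i m w - U i w\<bar>)"
 shows "L4_tendsto M f g"
proof -
 obtain C where C: "C \<ge> 0" "\<And>a::'i => real. (\<Sum>i\<in>UNIV. a i) ^ 4 \<le> C * (\<Sum>i\<in>UNIV. a i ^ 4)"
  using sum_pow4_le[of "UNIV :: 'i set"] by auto
 have i: "integrable M (\<lambda>w. \<bar>Us i m w - U i w\<bar> ^ 4)" for i m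
  using L4[of i] pow4_integrable_diff[of M "Us i m" "U i"] by (simp add: L4_tendsto_def pow4_integrable_def)
 have le4: "(LINT w|M. norm (f m w - g w) ^ 4) \<le> (\<bar>L\<bar> ^ 4 * C) * (\<Sum>i\<in>UNIV. LINT w|M. \<bar>Us i m w - U i w\<bar> ^ 4)" for m
 proof -
  have "(LINT w|M. norm (f m w - g w) ^ 4) \<le> (LINT w|M. (\<bar>L\<bar> ^ 4 * C) * (\<Sum>i\<in>UNIV. \<bar>Us i m w - U i w\<bar> ^ 4))"
  proof (rule integral_mono)
   show "integrable M (\<lambda>w. norm (f m w - g w) ^ 4)"
    using pow4_integrable_diff[OF f(1)[of m] f(2)] by (simp add: pow4_integrable_def)
   show "integrable M (\<lambda>w. (\<bar>L\<bar> ^ 4 * C) * (\<Sum>i\<in>UNIV. \<bar>Us i m w - U i w\<bar> ^ 4))" using i by simp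
   fix w
   have "norm (f m w - g w) \<le> \<bar>L\<bar> * (\<Sum>i\<in>UNIV. \<bar>Us i m w - U i w\<bar>)"
    by (rule order_trans[OF le]) (intro mult_right_mono, auto intro: sum_nonneg)
   then have "norm (f m w - g w) ^ 4 \<le> (\<bar>L\<bar> * (\<Sum>i\<in>UNIV. \<bar>Us i m w - U i w\<bar>)) ^ 4" by (rule power_mono) simp
   also have "\<dots> \<le> \<bar>L\<bar> ^ 4 * (C * (\<Sum>i\<in>UNIV. \<bar>Us i m w - U i w\<bar> ^ 4))"
    unfolding power_mult_distrib by (intro mult_left_mono C(2)) simp
   finally show "norm (f m w - g w) ^ 4 \<le> (\<bar>L\<bar> ^ 4 * C) * (\<Sum>i\<in>UNIV. \<bar>Us i m w - U i w\<bar> ^ 4)" by (simp only: mult.assoc)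
  qed
  also have "\<dots> = (\<bar>L\<bar> ^ 4 * C) * (\<Sum>i\<in>UNIV. LINT w|M. \<bar>Us i m w - U i w\<bar> ^ 4)" using i by simp
  finally show ?thesis .
 qed
 have "(\<lambda>m. LINT w|M. \<bar>Us i m w - U i w\<bar> ^ 4) \<longlonglongrightarrow> 0" for i
  using L4[of i] by (simp add: L4_tendsto_def)
 then have "(\<lambda>m. (\<bar>L\<bar> ^ 4 * C) * (\<Sum>i\<in>UNIV. LINT w|M. \<bar>Us i m w - U i w\<bar> ^ 4)) \<longlonglongrightarrow> (\<bar>L\<bar> ^ 4 * C) * (\<Sum>i\<in>(UNIV::'i set). 0)"
  by (intro tendsto_intros)
 then have lim0: "(\<lambda>m. (\<bar>L\<bar> ^ 4 * C) * (\<Sum>i\<in>UNIV. LINT w|M. \<bar>Us i m w - U i w\<bar> ^ 4)) \<longlonglongrightarrow> 0" by simp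
 have "(\<lambda>m. LINT w|M. norm (f m w - g w) ^ 4) \<longlonglongrightarrow> 0"
  by (rule tendsto_zero_of_le[OF _ le4 lim0]) simp
 then show ?thesis using f by (auto simp: L4_tendsto_def)
qed

lemma L2_tendsto_scaleR_const:
 fixes U :: "'a => 'h::{real_inner,banach,second_countable_topology}"
 assumes "L2_tendsto M Us U" shows "L2_tendsto M (\<lambda>m w. c *\<^sub>R Us m w) (\<lambda>w. c *\<^sub>R U w)"
proof -
 have "(LINT w|M. (norm (c *\<^sub>R Us m w - c *\<^sub>R U w))\<^sup>2) = c\<^sup>2 * (LINT w|M. (norm (Us m w - U w))\<^sup>2)" for m
 proof -
  have "(norm (c *\<^sub>R Us m w - c *\<^sub>R U w))\<^sup>2 = c\<^sup>2 * (norm (Us m w - U w))\<^sup>2" for w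
   using arg_cong[OF scaleR_diff_right[of c "Us m w" "U w"], of "\<lambda>v. (norm v)\<^sup>2"]
   by (simp only: norm_scaleR power_mult_distrib power2_abs)
  then show ?thesis by simp
 qed
 moreover have "(\<lambda>m. c\<^sup>2 * (LINT w|M. (norm (Us m w - U w))\<^sup>2)) \<longlonglongrightarrow> c\<^sup>2 * 0"
  by (intro tendsto_intros L2_tendstoD(3)[OF assms])
 ultimately show ?thesis using L2_tendstoD[OF assms] by (simp add: L2_tendsto_def sq_integrable_scaleR)
qed

section \<open>Malliavin operators on a fixed chaos\<close>

context isonormal_gaussian_process
begin

text \<open>Simultaneous approximation of a chaos element and of its derivative by the same Hermite sums.\<close>

definition hermite_approx :: "nat => ('a => real) => ('a => 'h) => (nat => 'h set) => (nat => 'h => real) => bool" where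
 "hermite_approx q F U S c \<longleftrightarrow> (\<forall>m. finite (S m) \<and> (\<forall>h\<in>S m. norm h = 1)) \<and>
   L4_tendsto M (\<lambda>m w. hermite_sum (S m) (c m) q (fld w)) F \<and>
   L4_tendsto M (\<lambda>m w. hermite_grad (S m) (c m) q (fld w)) U"

lemma pow4_integrable_hermite_sum: "finite S ==> pow4_integrable M (\<lambda>w. hermite_sum S c q (fld w))"
 using all_moments_hermite_sum[of S c q] by (simp only: all_moments_def pow4_integrable_def real_norm_def)

lemma pow4_integrable_hermite_grad:
 assumes S: "finite S" shows "pow4_integrable M (\<lambda>w. hermite_grad S c q (fld w))"
proof -
 have p4: "y ^ 4 = (y\<^sup>2)\<^sup>2" for y :: real by (simp flip: power_mult)
 have [measurable]: "(\<lambda>w. hermite p (X h w)) \<in> borel_measurable M" for p h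
  using all_moments_hermite[of p h] by (simp add: all_moments_def)
 have "(\<lambda>w. hermite_grad S c q (fld w)) \<in> borel_measurable M" unfolding hermite_grad_def by measurable
 moreover have "integrable M (\<lambda>w. (norm (hermite_grad S c q (fld w))) ^ 4)"
  unfolding p4 norm_hermite_grad
  by (intro all_moments_integrable all_moments_power all_moments_cmult all_moments_cylindrical[OF cylindrical_on_hermite_form] S)
 ultimately show ?thesis by (simp add: pow4_integrable_def)
qed

text \<open>On a fixed chaos the fourth moments of differences of Hermite sums and of their gradients are
 controlled by the second moments of the sums, so a mean square Cauchy sequence is Cauchy in the stronger
 sense as well, and the gradients converge along with it.\<close>

lemma hermite_approx_exists:
 assumes "F \<in> wiener_chaos M X q"
 shows "\<exists>U S c. hermite_approx q F U S c"
proof -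
 obtain S c where S: "\<And>m. finite (S m)" "\<And>m. \<forall>h\<in>S m. norm h = 1"
  and LF: "L2_tendsto M (\<lambda>m w. hermite_sum (S m) (c m) q (fld w)) F"
  using assms unfolding wiener_chaos_def hermite_sum_def by auto
 define hs where "hs m w = hermite_sum (S m) (c m) q (fld w)" for m w
 define gr where "gr m w = hermite_grad (S m) (c m) q (fld w)" for m w
 define d where "d i j = (LINT w|M. (hs i w - hs j w)\<^sup>2)" for i j
 define K where "K = (real q + 1)\<^sup>2 * 9 ^ q"
 have K: "K > 0" by (simp add: K_def)
 have LF: "L2_tendsto M hs F" using LF by (simp add: hs_def[abs_def])
 have d0: "0 \<le> d i j" for i j by (simp add: d_def)
 have p4: "pow4_integrable M (hs m)" "pow4_integrable M (gr m)" for m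
  unfolding hs_def gr_def by (intro pow4_integrable_hermite_sum pow4_integrable_hermite_grad S)+
 have diff: "(LINT w|M. (norm (gr i w - gr j w))\<^sup>2) = real q * d i j"
   "(LINT w|M. norm (hs i w - hs j w) ^ 4) \<le> K * (d i j)\<^sup>2"
   "(LINT w|M. norm (gr i w - gr j w) ^ 4) \<le> K * (d i j)\<^sup>2" for i j
 proof -
  have u: "finite (S i \<union> S j)" "\<forall>h\<in>S i \<union> S j. norm h = 1" using S by auto
  show "(LINT w|M. (norm (gr i w - gr j w))\<^sup>2) = real q * d i j"
   "(LINT w|M. norm (hs i w - hs j w) ^ 4) \<le> K * (d i j)\<^sup>2"
   "(LINT w|M. norm (gr i w - gr j w) ^ 4) \<le> K * (d i j)\<^sup>2"
   unfolding gr_def hs_def d_def K_def hermite_sum_diff[OF S(1) S(1)]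
   by (rule hermite_grad_second_moment[OF u(2)] hermite_sum_fourth_moment[OF u])+
 qed
 have Cauchy: "\<exists>N. \<forall>i\<ge>N. \<forall>j\<ge>N. d i j < e" if "e > 0" for e
 proof -
  have "\<exists>N. \<forall>i\<ge>N. (LINT w|M. (norm (hs i w - F w))\<^sup>2) < e / 4"
   using LIMSEQ_D[OF L2_tendstoD(3)[OF LF], of "e/4"] \<open>e > 0\<close> by auto
  then obtain N where N: "\<And>i. i \<ge> N ==> (LINT w|M. (norm (hs i w - F w))\<^sup>2) < e / 4" by blast
  have sq_diff: "(u - v)\<^sup>2 \<le> 2 * u\<^sup>2 + 2 * v\<^sup>2" for u v :: real
   using zero_le_power2[of "u + v"] by (simp add: power2_sum power2_diff)
  have "d i j < e" if "i \<ge> N" "j \<ge> N" for i j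
  proof -
   have s: "sq_integrable M (\<lambda>w. hs m w - F w)" for m by (intro sq_integrable_diff L2_tendstoD[OF LF])
   have "d i j \<le> (LINT w|M. 2 * (norm (hs i w - F w))\<^sup>2 + 2 * (norm (hs j w - F w))\<^sup>2)"
    unfolding d_def
   proof (rule integral_mono)
    show "integrable M (\<lambda>w. (hs i w - hs j w)\<^sup>2)"
     using sq_integrable_diff[OF L2_tendstoD(1)[OF LF, of i] L2_tendstoD(1)[OF LF, of j]] by (simp add: sq_integrable_def)
    show "integrable M (\<lambda>w. 2 * (norm (hs i w - F w))\<^sup>2 + 2 * (norm (hs j w - F w))\<^sup>2)"
     using s[of i] s[of j] by (simp add: sq_integrable_def)
    fix w
    have "(hs i w - hs j w)\<^sup>2 = ((hs i w - F w) - (hs j w - F w))\<^sup>2" by simp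
    also have "\<dots> \<le> 2 * (hs i w - F w)\<^sup>2 + 2 * (hs j w - F w)\<^sup>2"
     by (rule sq_diff)
    finally show "(hs i w - hs j w)\<^sup>2 \<le> 2 * (norm (hs i w - F w))\<^sup>2 + 2 * (norm (hs j w - F w))\<^sup>2" by simp
   qed
   also have "\<dots> = 2 * (LINT w|M. (norm (hs i w - F w))\<^sup>2) + 2 * (LINT w|M. (norm (hs j w - F w))\<^sup>2)"
    using s[of i] s[of j] by (simp add: sq_integrable_def)
   also have "\<dots> < e" using N[OF that(1)] N[OF that(2)] by linarith
   finally show ?thesis .
  qed
  then show ?thesis by blast
 qed
 have Cauchy2: "\<exists>N. \<forall>i\<ge>N. \<forall>j\<ge>N. real q * d i j < e" if "e > 0" for e
 proof -
  obtain N where N: "\<And>i j. i \<ge> N ==> j \<ge> N ==> d i j < e / (real q + 1)" using Cauchy[of "e / (real q + 1)"] \<open>e > 0\<close> by auto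
  have "real q * d i j < e" if "i \<ge> N" "j \<ge> N" for i j
  proof -
   have "real q * d i j \<le> (real q + 1) * d i j" using d0 by (intro mult_right_mono) auto
   also have "\<dots> < e" using N[OF that] by (simp add: pos_less_divide_eq mult.commute)
   finally show ?thesis .
  qed
  then show ?thesis by blast
 qed
 have Cauchy4: "\<exists>N. \<forall>i\<ge>N. \<forall>j\<ge>N. K * (d i j)\<^sup>2 \<le> e" if "e > 0" for e
 proof -
  obtain N where N: "\<And>i j. i \<ge> N ==> j \<ge> N ==> d i j < sqrt (e / K)" using Cauchy[of "sqrt (e / K)"] \<open>e > 0\<close> K by auto
  have "K * (d i j)\<^sup>2 \<le> e" if "i \<ge> N" "j \<ge> N" for i j
  proof -
   have "(d i j)\<^sup>2 \<le> (sqrt (e / K))\<^sup>2" using N[OF that] d0 by (intro power_mono) auto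
   then have "(d i j)\<^sup>2 \<le> e / K" using \<open>e > 0\<close> K by simp
   then show ?thesis using K by (simp add: field_simps)
  qed
  then show ?thesis by blast
 qed
 obtain U where LU: "L2_tendsto M gr U"
  using L2_complete[of gr] Cauchy2 pow4_integrable_sq_integrable[OF p4(2)] unfolding diff(1) by blast
 have "\<exists>N. \<forall>i\<ge>N. \<forall>j\<ge>N. (LINT w|M. norm (hs i w - hs j w) ^ 4) \<le> e" if e: "e > 0" for e
  using Cauchy4[OF e] by (elim exE) (intro exI allI impI order_trans[OF diff(2)], blast)
 from L4_tendsto_of_Cauchy[OF LF p4(1) this] have "L4_tendsto M hs F" .
 moreover have "\<exists>N. \<forall>i\<ge>N. \<forall>j\<ge>N. (LINT w|M. norm (gr i w - gr j w) ^ 4) \<le> e" if e: "e > 0" for e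
  using Cauchy4[OF e] by (elim exE) (intro exI allI impI order_trans[OF diff(3)], blast)
 from L4_tendsto_of_Cauchy[OF LU p4(2) this] have "L4_tendsto M gr U" .
 ultimately show ?thesis unfolding hermite_approx_def hs_def[abs_def] gr_def[abs_def] using S by blast
qed

lemma hermite_approxD:
 assumes "hermite_approx q F U S c"
 shows "finite (S m)" "\<forall>h\<in>S m. norm h = 1"
  "L4_tendsto M (\<lambda>m w. hermite_sum (S m) (c m) q (fld w)) F"
  "L4_tendsto M (\<lambda>m w. hermite_grad (S m) (c m) q (fld w)) U"
  "L2_tendsto M (\<lambda>m w. hermite_sum (S m) (c m) q (fld w)) F"
  "L2_tendsto M (\<lambda>m w. hermite_grad (S m) (c m) q (fld w)) U"
proof -
 note a = assms[unfolded hermite_approx_def]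
 show "finite (S m)" "\<forall>h\<in>S m. norm h = 1" using a by blast+
 show 1: "L4_tendsto M (\<lambda>m w. hermite_sum (S m) (c m) q (fld w)) F" using a by blast
 show 2: "L4_tendsto M (\<lambda>m w. hermite_grad (S m) (c m) q (fld w)) U" using a by blast
 show "L2_tendsto M (\<lambda>m w. hermite_sum (S m) (c m) q (fld w)) F" by (rule L4_imp_L2[OF 1])
 show "L2_tendsto M (\<lambda>m w. hermite_grad (S m) (c m) q (fld w)) U" by (rule L4_imp_L2[OF 2])
qed

lemma has_malliavin_derivative_chaos:
 assumes "hermite_approx q F U S c"
 shows "has_malliavin_derivative M X (\<lambda>w. a * F w) (\<lambda>w. a *\<^sub>R U w)"
proof -
 note D = hermite_approxD[OF assms]
 have s: "a * hermite_sum S c q x = hermite_sum S (\<lambda>h. a * c h) q x"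
  "a *\<^sub>R hermite_grad S c q x = hermite_grad S (\<lambda>h. a * c h) q x" for S c x
  by (simp_all add: hermite_sum_def hermite_grad_def sum_distrib_left scaleR_sum_right mult_ac)
 have "smooth_with_derivative X (\<lambda>w. a * hermite_sum (S m) (c m) q (fld w)) (\<lambda>w. a *\<^sub>R hermite_grad (S m) (c m) q (fld w))" for m
  unfolding s by (rule smooth_with_derivative_hermite_sum[OF D(1)])
 moreover have "L2_tendsto M (\<lambda>m w. a * hermite_sum (S m) (c m) q (fld w)) (\<lambda>w. a * F w)"
  using L2_tendsto_scaleR_const[OF D(5), of a] by simp
 moreover note L2_tendsto_scaleR_const[OF D(6), of a]
 ultimately show ?thesis unfolding has_malliavin_derivative_def
  by (intro exI[of _ "\<lambda>m w. a * hermite_sum (S m) (c m) q (fld w)"]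
    exI[of _ "\<lambda>m w. a *\<^sub>R hermite_grad (S m) (c m) q (fld w)"] conjI allI)
qed

text \<open>Whatever version the choice operator selects, uniqueness identifies it almost everywhere.\<close>

lemma malliavin_D_AE:
 assumes "has_malliavin_derivative M X F U" "AE w in M. F w = G w" "G \<in> borel_measurable M"
 shows "AE w in M. malliavin_D M X G w = U w" "malliavin_D M X G \<in> borel_measurable M"
proof -
 obtain Fs Us where "\<And>m. smooth_with_derivative X (Fs m) (Us m)" "L2_tendsto M Fs F" "L2_tendsto M Us U"
  using assms(1) by (auto simp: has_malliavin_derivative_def)
 then have "has_malliavin_derivative M X G U"
  using L2_tendsto_cong_AE[OF _ assms(2,3)] by (auto simp: has_malliavin_derivative_def)
 then have D: "has_malliavin_derivative M X G (malliavin_D M X G)" unfolding malliavin_D_def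
  by (rule someI[of "has_malliavin_derivative M X G"])
 show "AE w in M. malliavin_D M X G w = U w"
  by (rule malliavin_derivative_unique[OF D assms(1)]) (use assms(2) in \<open>eventually_elim, simp\<close>)
 show "malliavin_D M X G \<in> borel_measurable M"
  using D by (auto simp: has_malliavin_derivative_def L2_tendsto_def sq_integrable_def)
qed

lemma chaos_orthogonal:
 assumes F: "F \<in> wiener_chaos M X p" and G: "G \<in> wiener_chaos M X q" and "p \<noteq> q"
 shows "(LINT w|M. F w * G w) = 0"
proof -
 obtain U S c where a: "hermite_approx p F U S c" using hermite_approx_exists[OF F] by blast
 obtain V T d where b: "hermite_approx q G V T d" using hermite_approx_exists[OF G] by blast
 note A = hermite_approxD[OF a] and B = hermite_approxD[OF b]
 have "(\<lambda>m. LINT w|M. hermite_sum (S m) (c m) p (fld w) * hermite_sum (T m) (d m) q (fld w)) \<longlonglongrightarrow> (LINT w|M. F w * G w)"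
  by (rule L2_tendsto_integral_mult[OF A(5) B(5)])
 then show ?thesis using \<open>p \<noteq> q\<close> by (simp add: hermite_sum_inner[OF A(2) B(2)] LIMSEQ_const_iff)
qed

lemma chaos_sq_integrable: "F \<in> wiener_chaos M X q ==> sq_integrable M F"
 by (auto simp: wiener_chaos_def L2_tendsto_def)

lemma integral_sq_zero_AE:
 assumes "sq_integrable M (f :: 'a => real)" "(LINT w|M. f w * f w) = 0" shows "AE w in M. f w = 0"
proof -
 have "AE w in M. (f w)\<^sup>2 = 0" using assms
  by (subst integral_nonneg_eq_0_iff_AE[symmetric]) (auto simp: sq_integrable_def power2_eq_square)
 then show ?thesis by simp
qed

text \<open>\<open>F\<close> itself, respectively \<open>0\<close>, is a valid projection, and a valid projection is almost everywhere unique since the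
 difference of two of them lies in the chaos and is orthogonal to it.\<close>

lemma chaos_proj_chaos:
 assumes F: "F \<in> wiener_chaos M X q"
 shows "AE w in M. chaos_proj M X p F w = (if p = q then F w else 0)" "chaos_proj M X p F \<in> borel_measurable M"
proof -
 define G0 where "G0 = (\<lambda>w. if p = q then F w else 0)"
 have zero: "(\<lambda>_. 0) \<in> wiener_chaos M X p"
  unfolding wiener_chaos_def
  by (intro CollectI exI[of _ "\<lambda>_. {}"] exI[of _ "\<lambda>_ _. 0"]) (auto intro: L2_tendsto_const sq_integrable_const)
 have G0: "G0 \<in> wiener_chaos M X p" using F zero by (cases "p = q") (simp_all add: G0_def)
 have orth0: "(LINT w|M. (F w - G0 w) * K w) = 0" if "K \<in> wiener_chaos M X p" for K
  using chaos_orthogonal[OF F that] by (cases "p = q") (simp_all add: G0_def)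
 define G where "G = chaos_proj M X p F"
 have G: "G \<in> wiener_chaos M X p" "\<And>K. K \<in> wiener_chaos M X p ==> (LINT w|M. (F w - G w) * K w) = 0"
  using someI[of "\<lambda>G. G \<in> wiener_chaos M X p \<and> (\<forall>K \<in> wiener_chaos M X p. (LINT w|M. (F w - G w) * K w) = 0)" G0] G0 orth0
  unfolding G_def chaos_proj_def by auto
 note sF = chaos_sq_integrable[OF F] and s0 = chaos_sq_integrable[OF G0] and sG = chaos_sq_integrable[OF G(1)]
 have eq: "(LINT w|M. (G0 w - G w) * K w) = 0" if K: "K \<in> wiener_chaos M X p" for K
 proof -
  note sK = chaos_sq_integrable[OF K]
  have i: "integrable M (\<lambda>w. (F w - G w) * K w)" "integrable M (\<lambda>w. (F w - G0 w) * K w)"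
   by (intro sq_integrable_mult sq_integrable_diff sF s0 sG sK)+
  have "(\<lambda>w. (G0 w - G w) * K w) = (\<lambda>w. (F w - G w) * K w - (F w - G0 w) * K w)"
   by (rule ext) (simp add: algebra_simps)
  then show ?thesis using i G(2)[OF K] orth0[OF K] by simp
 qed
 have i: "integrable M (\<lambda>w. (G0 w - G w) * G0 w)" "integrable M (\<lambda>w. (G0 w - G w) * G w)"
  by (intro sq_integrable_mult sq_integrable_diff s0 sG)+
 have "(LINT w|M. (G0 w - G w) * (G0 w - G w)) = (LINT w|M. (G0 w - G w) * G0 w - (G0 w - G w) * G w)"
  by (simp add: right_diff_distrib)
 also have "\<dots> = 0" using i eq[OF G0] eq[OF G(1)] by simp
 finally have "AE w in M. G0 w - G w = 0" by (intro integral_sq_zero_AE sq_integrable_diff s0 sG)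
 then show "AE w in M. chaos_proj M X p F w = (if p = q then F w else 0)"
  by eventually_elim (simp add: G0_def G_def)
 show "chaos_proj M X p F \<in> borel_measurable M" using sG by (simp add: G_def sq_integrable_def)
qed

text \<open>All summands of the series except the one of order \<open>q\<close> vanish almost everywhere, so the partial sums are eventually
 constant.\<close>

lemma OU_inv_chaos:
 assumes F: "F \<in> wiener_chaos M X q" and q: "q \<ge> 1"
 shows "AE w in M. - (1 / real q) * F w = OU_inv M X F w" "OU_inv M X F \<in> borel_measurable M"
proof -
 define s where "s m w = (\<Sum>p=1..m. - (1 / real p) * chaos_proj M X p F w)" for m :: nat and w
 define G0 where "G0 w = - (1 / real q) * F w" for w
 note sF = chaos_sq_integrable[OF F]
 have [measurable]: "s m \<in> borel_measurable M" "F \<in> borel_measurable M" for m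
  unfolding s_def using chaos_proj_chaos(2)[OF F] sF by (auto simp: sq_integrable_def)
 have sG0: "sq_integrable M G0" unfolding G0_def by (intro sq_integrable_mult_const sF)
 have ae: "AE w in M. s m w = (if m \<ge> q then G0 w else 0)" for m
 proof -
  have "AE w in M. \<forall>p\<in>{1..m}. chaos_proj M X p F w = (if p = q then F w else 0)"
   by (rule AE_finite_allI, simp, rule chaos_proj_chaos(1)[OF F])
  then show ?thesis
  proof eventually_elim
   case (elim w)
   then have "s m w = (\<Sum>p=1..m. if p = q then G0 w else 0)"
    unfolding s_def by (intro sum.cong) (auto simp: G0_def)
   then show ?case using q by simp
  qed
 qed
 have sq: "sq_integrable M (s m)" for m
 proof -
  have "sq_integrable M (\<lambda>w. if m \<ge> q then G0 w else 0)" using sG0 sq_integrable_const by (cases "m \<ge> q") auto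
  moreover have "integrable M (\<lambda>w. (norm (s m w))\<^sup>2) \<longleftrightarrow> integrable M (\<lambda>w. (norm (if m \<ge> q then G0 w else 0))\<^sup>2)"
   by (rule integrable_cong_AE) (use ae[of m] sG0 in \<open>auto simp: sq_integrable_def\<close>)
  ultimately show ?thesis by (simp add: sq_integrable_def)
 qed
 have "(LINT w|M. (norm (s m w - G0 w))\<^sup>2) = 0" if "m \<ge> q" for m
  by (rule integral_eq_zero_AE) (use ae[of m] that in auto)
 then have "(\<lambda>m. LINT w|M. (norm (s m w - G0 w))\<^sup>2) \<longlonglongrightarrow> 0"
  by (intro tendsto_eventually eventually_sequentiallyI[of q])
 with sq sG0 have L: "L2_tendsto M s G0" by (simp add: L2_tendsto_def)
 then have L': "L2_tendsto M s (OU_inv M X F)"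
  using someI[of "\<lambda>G. L2_tendsto M s G" G0] unfolding OU_inv_def s_def[abs_def] by blast
 show "AE w in M. - (1 / real q) * F w = OU_inv M X F w"
  using L2_tendsto_unique[OF L L'] by (simp add: G0_def)
 show "OU_inv M X F \<in> borel_measurable M" using L2_tendstoD(2)[OF L'] by (simp add: sq_integrable_def)
qed

end

section \<open>Stein kernels of vectors of chaos elements\<close>

lemma vec_lambda_eq_sum_axis: "(\<chi> i. f i) = (\<Sum>i\<in>(UNIV::'d::finite set). f i *\<^sub>R axis i (1::real))"
 by (simp add: vec_eq_iff axis_def if_distrib cong: if_cong)

lemma borel_measurable_vec_lambda:
 fixes f :: "'d::finite => 'a => real"
 assumes "\<And>i. f i \<in> borel_measurable M"
 shows "(\<lambda>w. \<chi> i. f i w) \<in> borel_measurable M"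
 unfolding vec_lambda_eq_sum_axis using assms by measurable

lemma DERIV_along_curve:
 fixes f :: "'d::finite => real => real"
 assumes \<phi>: "\<And>y. (\<phi> has_derivative (\<lambda>v. \<Sum>i\<in>UNIV. v $ i * d\<phi> i y)) (at y)"
  and f: "\<And>i. (f i has_real_derivative f' i) (at s)"
 shows "((\<lambda>t. \<phi> (\<chi> i. f i t)) has_real_derivative (\<Sum>i\<in>UNIV. f' i * d\<phi> i (\<chi> i. f i s))) (at s)"
proof -
 have "((\<lambda>t. \<Sum>i\<in>UNIV. f i t *\<^sub>R axis i (1::real)) has_derivative (\<lambda>h. \<Sum>i\<in>UNIV. (f' i * h) *\<^sub>R axis i 1)) (at s)"
  using f unfolding has_field_derivative_def by (intro has_derivative_sum has_derivative_scaleR_left) auto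
 then have "((\<lambda>t. \<chi> i. f i t) has_derivative (\<lambda>h. \<chi> i. f' i * h)) (at s)"
  by (simp only: vec_lambda_eq_sum_axis)
 from has_derivative_compose[OF this \<phi>]
 have "((\<lambda>t. \<phi> (\<chi> i. f i t)) has_derivative (\<lambda>h. \<Sum>i\<in>UNIV. (f' i * h) * d\<phi> i (\<chi> i. f i s))) (at s)" by simp
 moreover have "(\<lambda>h. \<Sum>i\<in>UNIV. (f' i * h) * d\<phi> i (\<chi> i. f i s)) = (*) (\<Sum>i\<in>UNIV. f' i * d\<phi> i (\<chi> i. f i s))"
  by (rule ext) (simp add: sum_distrib_left sum_distrib_right mult_ac)
 ultimately show ?thesis by (simp add: has_field_derivative_def)
qed

lemma bounded_partials_Lipschitz:
 fixes y z :: "real^'d::finite"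
 assumes \<phi>: "\<And>y. (\<phi> has_derivative (\<lambda>v. \<Sum>i\<in>UNIV. v $ i * d\<phi> i y)) (at y)"
  and B: "\<And>i y. \<bar>d\<phi> i y\<bar> \<le> B"
 shows "\<bar>\<phi> y - \<phi> z\<bar> \<le> B * (\<Sum>i\<in>UNIV. \<bar>y $ i - z $ i\<bar>)"
proof -
 define f where "f i t = z $ i + t * (y $ i - z $ i)" for i t
 have d: "((\<lambda>t. \<phi> (\<chi> i. f i t)) has_real_derivative (\<Sum>i\<in>UNIV. (y $ i - z $ i) * d\<phi> i (\<chi> i. f i s))) (at s)" for s
  by (rule DERIV_along_curve[OF \<phi>]) (auto simp: f_def intro!: derivative_eq_intros)
 obtain t where "\<phi> (\<chi> i. f i 1) - \<phi> (\<chi> i. f i 0) = (1 - 0) * (\<Sum>i\<in>UNIV. (y $ i - z $ i) * d\<phi> i (\<chi> i. f i t))"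
  using MVT2[of 0 1 "\<lambda>t. \<phi> (\<chi> i. f i t)", OF _ d] by auto
 moreover have "(\<chi> i. f i 1) = y" "(\<chi> i. f i 0) = z" by (simp_all add: f_def vec_eq_iff)
 ultimately have "\<bar>\<phi> y - \<phi> z\<bar> = \<bar>\<Sum>i\<in>UNIV. (y $ i - z $ i) * d\<phi> i (\<chi> i. f i t)\<bar>" by simp
 also have "\<dots> \<le> (\<Sum>i\<in>UNIV. \<bar>y $ i - z $ i\<bar> * B)"
  by (rule order_trans[OF sum_abs]) (auto simp: abs_mult intro!: sum_mono mult_left_mono B)
 also have "\<dots> = B * (\<Sum>i\<in>UNIV. \<bar>y $ i - z $ i\<bar>)" by (simp add: sum_distrib_left mult.commute)
 finally show ?thesis .
qed

text \<open>The Lipschitz condition on the partial derivatives lets them be evaluated along approximating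
 Hermite sums.\<close>

definition smooth_test :: "(real^'d::finite => real) => ('d => real^'d => real) => bool" where
 "smooth_test \<phi> d\<phi> \<longleftrightarrow> (\<forall>y. (\<phi> has_derivative (\<lambda>v. \<Sum>i\<in>UNIV. v $ i * d\<phi> i y)) (at y)) \<and>
   (\<exists>B. \<forall>i y. \<bar>d\<phi> i y\<bar> \<le> B) \<and> (\<exists>L. \<forall>i y z. \<bar>d\<phi> i y - d\<phi> i z\<bar> \<le> L * norm (y - z))"

text \<open>The only properties of the random vector and of the matrix \<open>\<Gamma>\<close> that the expansion uses. The
 identity for third moments is integration by parts for the test function \<open>y \<mapsto> y $ i * y $ k\<close>, which is
 stated separately because its derivatives are unbounded.\<close>

definition stein_kernel :: "'a measure => ('a => real^'d::finite) => ('d => 'd => 'a => real) => bool" where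
 "stein_kernel M F G \<longleftrightarrow> (\<forall>i. sq_integrable M (\<lambda>w. F w $ i)) \<and> (\<forall>i. (LINT w|M. F w $ i) = 0) \<and>
   (\<forall>i j. sq_integrable M (G i j)) \<and>
   (\<forall>\<phi> d\<phi> j. smooth_test \<phi> d\<phi> \<longrightarrow>
    (LINT w|M. F w $ j * \<phi> (F w)) = (\<Sum>i\<in>UNIV. LINT w|M. G i j w * d\<phi> i (F w))) \<and>
   (\<forall>i j k. (LINT w|M. F w $ i * F w $ j * F w $ k) = (LINT w|M. G i j w * F w $ k) + (LINT w|M. G k j w * F w $ i))"

context isonormal_gaussian_process
begin

text \<open>Every vector \<open>h\<close> in the sum contributes an integration by parts in direction \<open>h\<close>; together they form the
 gradient of the sum divided by its order.\<close>

lemma hermite_sum_IBP: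
 assumes S: "finite S" "\<forall>h\<in>S. norm h = 1" and q: "q \<ge> 1" and I: "finite I"
  and c: "cylindrical_on I \<Phi>" "\<And>k. cylindrical_on I (\<lambda>x. k \<bullet> G x)"
  and d: "\<And>k. direction_deriv k \<Phi> (\<lambda>x. k \<bullet> G x)"
 shows "(LINT w|M. hermite_sum S c q (fld w) * \<Phi> (fld w)) =
   (LINT w|M. (1 / real q) * (hermite_grad S c q (fld w) \<bullet> G (fld w)))"
proof -
 obtain p where p: "q = Suc p" using q by (cases q) auto
 have am: "all_moments M (\<lambda>w. \<Phi> (fld w))" "all_moments M (\<lambda>w. k \<bullet> G (fld w))" for k
  using all_moments_cylindrical[OF c(1) I] all_moments_cylindrical[OF c(2) I] by auto
 have i1: "integrable M (\<lambda>w. hermite q (X h w) * \<Phi> (fld w))" for h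
  by (intro all_moments_integrable all_moments_mult all_moments_hermite am)
 have i2: "integrable M (\<lambda>w. hermite p (X h w) * (h \<bullet> G (fld w)))" for h
  by (intro all_moments_integrable all_moments_mult all_moments_hermite am)
 have "(LINT w|M. hermite_sum S c q (fld w) * \<Phi> (fld w)) = (LINT w|M. (\<Sum>h\<in>S. c h * (hermite q (X h w) * \<Phi> (fld w))))"
  by (simp add: hermite_sum_def sum_distrib_right mult.assoc)
 also have "\<dots> = (\<Sum>h\<in>S. c h * (LINT w|M. hermite q (X h w) * \<Phi> (fld w)))"
  using i1 by simp
 also have "\<dots> = (\<Sum>h\<in>S. c h * (LINT w|M. hermite p (X h w) * (h \<bullet> G (fld w))))"
  unfolding p using S(2) by (intro sum.cong refl arg_cong2[where f="(*)"] hermite_IBP[OF c(1) c(2) I d]) auto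
 also have "\<dots> = (LINT w|M. (\<Sum>h\<in>S. c h * (hermite p (X h w) * (h \<bullet> G (fld w)))))"
  using i2 by simp
 also have "\<dots> = (LINT w|M. (1 / real q) * (hermite_grad S c q (fld w) \<bullet> G (fld w)))"
 proof (intro Bochner_Integration.integral_cong refl)
  fix w
  have "hermite_grad S c q (fld w) \<bullet> G (fld w) = real q * (\<Sum>h\<in>S. c h * (hermite p (X h w) * (h \<bullet> G (fld w))))"
   by (simp add: hermite_grad_def inner_sum_left p sum_distrib_left mult_ac)
  then show "(\<Sum>h\<in>S. c h * (hermite p (X h w) * (h \<bullet> G (fld w)))) = (1 / real q) * (hermite_grad S c q (fld w) \<bullet> G (fld w))"
   using q by simp
 qed
 finally show ?thesis .
qed

lemma direction_deriv_vector_function: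
 fixes \<Phi> :: "'d::finite => ('h => real) => real"
 assumes \<phi>: "\<And>y. (\<phi> has_derivative (\<lambda>v. \<Sum>i\<in>UNIV. v $ i * d\<phi> i y)) (at y)"
  and \<Phi>: "\<And>i. direction_deriv k (\<Phi> i) (\<Phi>' i)"
 shows "direction_deriv k (\<lambda>x. \<phi> (\<chi> i. \<Phi> i x)) (\<lambda>x. \<Sum>i\<in>UNIV. \<Phi>' i x * d\<phi> i (\<chi> i. \<Phi> i x))"
 unfolding direction_deriv_def
proof
 fix x
 show "((\<lambda>t. \<phi> (\<chi> i. \<Phi> i (\<lambda>v. x v + t * (k \<bullet> v)))) has_real_derivative
    (\<Sum>i\<in>UNIV. \<Phi>' i x * d\<phi> i (\<chi> i. \<Phi> i x))) (at 0)"
  using DERIV_along_curve[OF \<phi>, of "\<lambda>i t. \<Phi> i (\<lambda>v. x v + t * (k \<bullet> v))" "\<lambda>i. \<Phi>' i x" 0] \<Phi>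
  by (simp add: direction_deriv_def)
qed

lemma cylindrical_on_vector_function:
 fixes \<Phi> :: "'d::finite => ('h => real) => real"
 assumes c: "\<And>i. cylindrical_on I (\<Phi> i)" and \<phi>: "continuous_on UNIV \<phi>"
  and B: "\<And>y. \<bar>\<phi> y\<bar> \<le> A + B * (\<Sum>i\<in>UNIV. \<bar>y $ i\<bar>)"
 shows "cylindrical_on I (\<lambda>x. \<phi> (\<chi> i. \<Phi> i x))"
proof (rule cylindrical_onI)
 have "(\<lambda>x. \<chi> i. \<Phi> i x) \<in> borel_measurable (PiM I (\<lambda>_. borel))"
  by (rule borel_measurable_vec_lambda) (use c in \<open>simp add: cylindrical_on_def\<close>)
 from measurable_compose[OF this borel_measurable_continuous_onI[OF \<phi>]]
 show "(\<lambda>x. \<phi> (\<chi> i. \<Phi> i x)) \<in> borel_measurable (PiM I (\<lambda>_. borel))" .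
 show "\<phi> (\<chi> i. \<Phi> i (restrict x I)) = \<phi> (\<chi> i. \<Phi> i x)" for x
  using c by (simp add: cylindrical_on_def)
 show "\<bar>\<phi> (\<chi> i. \<Phi> i x)\<bar> \<le> A + B * (\<Sum>i\<in>UNIV. \<bar>\<Phi> i x\<bar>)" for x using B[of "\<chi> i. \<Phi> i x"] by simp
 show "cylindrical_on I (\<lambda>x. A + B * (\<Sum>i\<in>UNIV. \<bar>\<Phi> i x\<bar>))"
  by (intro cylindrical_on_add cylindrical_on_const cylindrical_on_cmult cylindrical_on_sum cylindrical_on_abs c)
qed

text \<open>On the chaos of order \<open>q j\<close> the inverse Ornstein--Uhlenbeck operator is multiplication by \<open>-1 / q j\<close>, so
 \<open>\<Gamma>\<^sub>i\<^sub>j = D F\<^sub>i \<bullet> D F\<^sub>j / q j\<close> almost everywhere. Each asserted identity holds for Hermite sums by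
 \<open>hermite_sum_IBP\<close> and is then carried to the limit.\<close>

theorem chaos_stein_kernel:
 fixes F :: "'a => real^'d::finite"
 assumes F: "\<And>i. (\<lambda>w. F w $ i) \<in> wiener_chaos M X (q i)" and q: "\<And>i. q i \<ge> 1"
 shows "stein_kernel M F (Gam M X F)"
proof -
 have "\<exists>U S c. hermite_approx (q i) (\<lambda>w. F w $ i) U S c" for i by (rule hermite_approx_exists[OF F])
 then obtain U S c where app: "\<And>i. hermite_approx (q i) (\<lambda>w. F w $ i) (U i) (S i) (c i)" by metis
 note A = hermite_approxD[OF app]
 define hs where "hs i m w = hermite_sum (S i m) (c i m) (q i) (fld w)" for i m w
 define gr where "gr i m w = hermite_grad (S i m) (c i m) (q i) (fld w)" for i m w
 have L4h: "L4_tendsto M (hs i) (\<lambda>w. F w $ i)" and L4g: "L4_tendsto M (gr i) (U i)" for i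
  using A(3,4)[of i] by (simp_all add: hs_def[abs_def] gr_def[abs_def])
 note L2h = L4_imp_L2[OF L4h] and L2g = L4_imp_L2[OF L4g]
 have pF: "pow4_integrable M (\<lambda>w. F w $ i)" "pow4_integrable M (U i)" "pow4_integrable M (hs i m)" for i m
  using L4h[of i] L4g[of i] by (auto simp: L4_tendsto_def)
 have sF: "sq_integrable M (\<lambda>w. F w $ i)" for i by (rule pow4_integrable_sq_integrable[OF pF(1)])
 have Fm: "(\<lambda>w. F w $ i) \<in> borel_measurable M" for i using sF[of i] by (simp add: sq_integrable_def)
 have Fm': "F \<in> borel_measurable M" using borel_measurable_vec_lambda[of "\<lambda>i w. F w $ i", OF Fm] by simp
 \<comment> \<open>almost everywhere versions of the operators that enter \<open>Gam\<close>\<close>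
 have G1: "AE w in M. Gam M X F i j w = U i w \<bullet> ((1 / real (q j)) *\<^sub>R U j w)"
  and Gm: "Gam M X F i j \<in> borel_measurable M" for i j
 proof -
  note OU = OU_inv_chaos[OF F q, of j]
  have "AE w in M. 1 * F w $ i = F w $ i" by simp
  note Di = malliavin_D_AE[OF has_malliavin_derivative_chaos[OF app[of i], of 1] this Fm]
  note Dj = malliavin_D_AE[OF has_malliavin_derivative_chaos[OF app[of j], of "- (1 / real (q j))"] OU]
  show "AE w in M. Gam M X F i j w = U i w \<bullet> ((1 / real (q j)) *\<^sub>R U j w)"
   using Di(1) Dj(1) by eventually_elim (simp add: Gam_def)
  show "Gam M X F i j \<in> borel_measurable M" unfolding Gam_def using Di(2) Dj(2) by measurable
 qed
 have Um: "U i \<in> borel_measurable M" for i using pF(2)[of i] by (simp add: pow4_integrable_def)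
 have sG: "sq_integrable M (Gam M X F i j)" for i j
 proof -
  note s = pow4_integrable_sq[OF pF(2)[of i]] pow4_integrable_sq[OF pF(2)[of j]]
  have "integrable M (\<lambda>w. (norm (Gam M X F i j w))\<^sup>2)"
  proof (rule Bochner_Integration.integrable_bound[OF sq_integrable_mult[OF s]])
   show "AE w in M. norm ((norm (Gam M X F i j w))\<^sup>2) \<le> norm ((norm (U i w))\<^sup>2 * (norm (U j w))\<^sup>2)"
    using G1[of i j]
   proof eventually_elim
    case (elim w)
    have "\<bar>Gam M X F i j w\<bar> \<le> norm (U i w) * norm ((1 / real (q j)) *\<^sub>R U j w)"
     unfolding elim by (rule Cauchy_Schwarz_ineq2)
    also have "\<dots> \<le> norm (U i w) * (1 * norm (U j w))"
     unfolding norm_scaleR using q[of j] by (intro mult_left_mono mult_right_mono) auto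
    finally have "(\<bar>Gam M X F i j w\<bar>)\<^sup>2 \<le> (norm (U i w) * norm (U j w))\<^sup>2" by (intro power_mono) auto
    then show ?case by (simp add: power_mult_distrib)
   qed
  qed (use Gm in measurable)
  then show ?thesis using Gm by (simp add: sq_integrable_def)
 qed
 have mean: "(LINT w|M. F w $ i) = 0" for i
 proof -
  have "(\<lambda>m. LINT w|M. hs i m w * 1) \<longlonglongrightarrow> (LINT w|M. F w $ i * 1)"
   by (rule L2_tendsto_integral_mult[OF L2h L2_tendsto_const[OF sq_integrable_const]])
  moreover have "(LINT w|M. hs i m w * 1) = 0" for m
   using hermite_sum_IBP[OF A(1)[of i m] A(2)[of i m] q[of i] finite.emptyI, of "\<lambda>_. 1" "\<lambda>_. 0" "c i m"]
   by (simp add: cylindrical_on_const direction_deriv_const hs_def)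
  ultimately show ?thesis by (simp add: LIMSEQ_const_iff)
 qed
 have Gint: "(LINT w|M. (f w *\<^sub>R U i w) \<bullet> ((1 / real (q j)) *\<^sub>R U j w)) = (LINT w|M. Gam M X F i j w * f w)"
  if [measurable]: "f \<in> borel_measurable M" for f :: "'a => real" and i j
  by (rule integral_cong_AE) (use G1[of i j] Gm[of i j] Um[of i] Um[of j] in \<open>auto simp: mult.commute\<close>)
 define I where "I m = (\<Union>i. S i m)" for m
 have I: "finite (I m)" "S i m \<subseteq> I m" for i m using A(1) by (auto simp: I_def)
 have limG: "(\<lambda>m. LINT w|M. (1 / real (q j)) * (gr j m w \<bullet> V m w)) \<longlonglongrightarrow> (LINT w|M. W w \<bullet> ((1 / real (q j)) *\<^sub>R U j w))"
  if "L2_tendsto M V W" for V W j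
  using L2_tendsto_inner[OF L2_tendsto_scaleR_const[OF L2g, of "1 / real (q j)" j] that] by (simp add: inner_commute)
 have ibp: "(LINT w|M. F w $ j * \<phi> (F w)) = (\<Sum>i\<in>UNIV. LINT w|M. Gam M X F i j w * d\<phi> i (F w))"
  if test: "smooth_test \<phi> d\<phi>" for \<phi> d\<phi> j
 proof -
  have \<phi>: "(\<phi> has_derivative (\<lambda>v. \<Sum>i\<in>UNIV. v $ i * d\<phi> i y)) (at y)" for y using test by (simp add: smooth_test_def)
  obtain B where B: "\<bar>d\<phi> i y\<bar> \<le> B" for i y using test by (auto simp: smooth_test_def)
  obtain L where L: "\<bar>d\<phi> i y - d\<phi> i z\<bar> \<le> L * norm (y - z)" for i y z using test by (auto simp: smooth_test_def)
  have B0: "0 \<le> B" using B[of undefined 0] by linarith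
  have c\<phi>: "continuous_on UNIV \<phi>" using \<phi> by (intro continuous_at_imp_continuous_on) (auto intro: has_derivative_continuous)
  have "L0-lipschitz_on UNIV (d\<phi> i)" if "L0 = max L 0" for i L0
  proof (rule lipschitz_onI)
   show "dist (d\<phi> i y) (d\<phi> i z) \<le> L0 * dist y z" for y z
    using L[of i y z] mult_right_mono[of L L0 "norm (y - z)"] that by (simp add: dist_norm)
  qed (use that in auto)
  then have cd\<phi>: "continuous_on UNIV (d\<phi> i)" for i using lipschitz_on_continuous_on by blast
  have [measurable]: "\<phi> \<in> borel_measurable borel" "d\<phi> i \<in> borel_measurable borel" for i
   by (intro borel_measurable_continuous_onI c\<phi> cd\<phi>)+
  note [measurable] = Fm'
  define H where "H m w = (\<chi> i. hs i m w)" for m w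
  have [measurable]: "H m \<in> borel_measurable M" for m unfolding H_def
   by (rule borel_measurable_vec_lambda) (use pF(3) in \<open>simp add: pow4_integrable_def\<close>)
  have lip: "\<bar>\<phi> y - \<phi> z\<bar> \<le> B * (\<Sum>i\<in>UNIV. \<bar>y $ i - z $ i\<bar>)" for y z
   by (rule bounded_partials_Lipschitz[OF \<phi> B])
  have gro: "\<bar>\<phi> y\<bar> \<le> \<bar>\<phi> 0\<bar> + B * (\<Sum>i\<in>UNIV. \<bar>y $ i\<bar>)" for y using lip[of y 0] by simp
  have p\<phi>: "pow4_integrable M (\<lambda>w. \<phi> (Y w))" if Y: "\<And>i. pow4_integrable M (\<lambda>w. Y w $ i)" and [measurable]: "Y \<in> borel_measurable M" for Y
  proof -
   obtain C where C: "C \<ge> 0" "\<And>a::'d => real. (\<Sum>i\<in>UNIV. a i) ^ 4 \<le> C * (\<Sum>i\<in>UNIV. a i ^ 4)"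
    using sum_pow4_le[of "UNIV :: 'd set"] by auto
   have "integrable M (\<lambda>w. norm (\<phi> (Y w)) ^ 4)"
   proof (rule Bochner_Integration.integrable_bound)
    show "integrable M (\<lambda>w. 8 * \<bar>\<phi> 0\<bar> ^ 4 + 8 * (B ^ 4 * (C * (\<Sum>i\<in>UNIV. \<bar>Y w $ i\<bar> ^ 4))))"
     using Y by (simp add: pow4_integrable_def)
    have "norm (\<phi> y) ^ 4 \<le> 8 * \<bar>\<phi> 0\<bar> ^ 4 + 8 * (B ^ 4 * (C * (\<Sum>i\<in>UNIV. \<bar>y $ i\<bar> ^ 4)))" for y
    proof -
     have "norm (\<phi> y) ^ 4 \<le> (\<bar>\<phi> 0\<bar> + B * (\<Sum>i\<in>UNIV. \<bar>y $ i\<bar>)) ^ 4"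
      unfolding real_norm_def by (intro power_mono gro) simp
     also have "\<dots> \<le> 8 * \<bar>\<phi> 0\<bar> ^ 4 + 8 * (B * (\<Sum>i\<in>UNIV. \<bar>y $ i\<bar>)) ^ 4" by (rule pow4_add_le)
     also have "\<dots> \<le> 8 * \<bar>\<phi> 0\<bar> ^ 4 + 8 * (B ^ 4 * (C * (\<Sum>i\<in>UNIV. \<bar>y $ i\<bar> ^ 4)))"
      unfolding power_mult_distrib by (intro add_left_mono mult_left_mono C(2)) auto
     finally show ?thesis .
    qed
    then show "AE w in M. norm (norm (\<phi> (Y w)) ^ 4) \<le> norm (8 * \<bar>\<phi> 0\<bar> ^ 4 + 8 * (B ^ 4 * (C * (\<Sum>i\<in>UNIV. \<bar>Y w $ i\<bar> ^ 4))))"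
     by (intro AE_I2) (auto intro: order_trans[OF _ abs_ge_self])
   qed measurable
   then show ?thesis by (simp add: pow4_integrable_def)
  qed
  have pd\<phi>: "pow4_integrable M (\<lambda>w. d\<phi> i (Y w))" if [measurable]: "Y \<in> borel_measurable M" for Y i
  proof -
   have "norm (norm (d\<phi> i y) ^ 4) \<le> B ^ 4" for y using power_mono[OF B[of i y], of 4] by simp
   then have "integrable M (\<lambda>w. norm (d\<phi> i (Y w)) ^ 4)"
    by (intro integrable_const_bound[where B="B ^ 4"] AE_I2) auto
   then show ?thesis by (simp add: pow4_integrable_def)
  qed
  have L\<phi>: "L4_tendsto M (\<lambda>m w. \<phi> (H m w)) (\<lambda>w. \<phi> (F w))"
  proof (rule L4_tendsto_Lipschitz[OF L4h, where L=B])
   show "pow4_integrable M (\<lambda>w. \<phi> (H m w))" for m by (rule p\<phi>) (simp_all add: H_def[of m] pF, simp flip: H_def)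
   show "pow4_integrable M (\<lambda>w. \<phi> (F w))" by (rule p\<phi>) (simp_all add: pF Fm')
   show "norm (\<phi> (H m w) - \<phi> (F w)) \<le> B * (\<Sum>i\<in>UNIV. \<bar>hs i m w - F w $ i\<bar>)" for m w
    using lip[of "H m w" "F w"] by (simp add: H_def)
  qed
  have Ld\<phi>: "L4_tendsto M (\<lambda>m w. d\<phi> i (H m w)) (\<lambda>w. d\<phi> i (F w))" for i
  proof (rule L4_tendsto_Lipschitz[OF L4h pd\<phi> pd\<phi>, where L="\<bar>L\<bar>"])
   fix m w
   have "norm (d\<phi> i (H m w) - d\<phi> i (F w)) \<le> \<bar>L\<bar> * norm (H m w - F w)"
    unfolding real_norm_def by (rule order_trans[OF L]) (intro mult_right_mono, auto)
   also have "\<dots> \<le> \<bar>L\<bar> * (\<Sum>i\<in>UNIV. \<bar>hs i m w - F w $ i\<bar>)"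
    using norm_le_l1_cart[of "H m w - F w"] by (intro mult_left_mono) (auto simp: H_def)
   finally show "norm (d\<phi> i (H m w) - d\<phi> i (F w)) \<le> \<bar>L\<bar> * (\<Sum>i\<in>UNIV. \<bar>hs i m w - F w $ i\<bar>)" .
  qed measurable
  have pre: "(LINT w|M. hs j m w * \<phi> (H m w)) = (\<Sum>i\<in>UNIV. LINT w|M. (1 / real (q j)) * (gr j m w \<bullet> (d\<phi> i (H m w) *\<^sub>R gr i m w)))" for m
  proof -
   define \<Phi> where "\<Phi> i = hermite_sum (S i m) (c i m) (q i)" for i
   define G where "G x = (\<Sum>i\<in>UNIV. d\<phi> i (\<chi> i. \<Phi> i x) *\<^sub>R hermite_grad (S i m) (c i m) (q i) x)" for x
   have c\<Phi>: "cylindrical_on (I m) (\<Phi> i)" for i unfolding \<Phi>_def by (rule cylindrical_on_hermite_sum[OF I(2,1)])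
   have 1: "cylindrical_on (I m) (\<lambda>x. \<phi> (\<chi> i. \<Phi> i x))" by (rule cylindrical_on_vector_function[OF c\<Phi> c\<phi> gro])
   have 2: "cylindrical_on (I m) (\<lambda>x. k \<bullet> G x)" for k
   proof -
    have "cylindrical_on (I m) (\<lambda>x. d\<phi> i (\<chi> i. \<Phi> i x))" for i
     by (rule cylindrical_on_vector_function[OF c\<Phi> cd\<phi>, where A=B and B=0]) (use B in auto)
    then show ?thesis unfolding G_def inner_sum_right inner_scaleR_right
     by (intro cylindrical_on_sum cylindrical_on_mult cylindrical_on_hermite_grad I)
   qed
   have 3: "direction_deriv k (\<lambda>x. \<phi> (\<chi> i. \<Phi> i x)) (\<lambda>x. k \<bullet> G x)" for k
   proof -
    have "direction_deriv k (\<lambda>x. \<phi> (\<chi> i. \<Phi> i x)) (\<lambda>x. \<Sum>i\<in>UNIV. (k \<bullet> hermite_grad (S i m) (c i m) (q i) x) * d\<phi> i (\<chi> i. \<Phi> i x))"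
     by (rule direction_deriv_vector_function[OF \<phi>]) (simp add: \<Phi>_def direction_deriv_hermite_sum)
    then show ?thesis unfolding G_def inner_sum_right inner_scaleR_right by (simp add: mult.commute)
   qed
   have "(LINT w|M. hs j m w * \<phi> (H m w)) = (LINT w|M. (1 / real (q j)) * (gr j m w \<bullet> G (fld w)))"
    using hermite_sum_IBP[OF A(1)[of j m] A(2)[of j m] q[of j] I(1) 1 2 3, of "c j m"]
    by (simp add: hs_def gr_def H_def \<Phi>_def)
   also have "\<dots> = (LINT w|M. (\<Sum>i\<in>UNIV. (1 / real (q j)) * (gr j m w \<bullet> (d\<phi> i (H m w) *\<^sub>R gr i m w))))"
    by (simp add: G_def H_def hs_def gr_def \<Phi>_def inner_sum_right sum_distrib_left)
   also have "\<dots> = (\<Sum>i\<in>UNIV. LINT w|M. (1 / real (q j)) * (gr j m w \<bullet> (d\<phi> i (H m w) *\<^sub>R gr i m w)))"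
    by (rule Bochner_Integration.integral_sum, rule integrable_mult_right, rule sq_integrable_inner)
      (rule L2_tendstoD(1)[OF L2g], rule L2_tendstoD(1)[OF L4_tendsto_scaleR[OF Ld\<phi> L4g]])
   finally show ?thesis .
  qed
  have "(\<lambda>m. LINT w|M. hs j m w * \<phi> (H m w)) \<longlonglongrightarrow> (LINT w|M. F w $ j * \<phi> (F w))"
   by (rule L2_tendsto_integral_mult[OF L2h L4_imp_L2[OF L\<phi>]])
  moreover have "(\<lambda>m. \<Sum>i\<in>UNIV. LINT w|M. (1 / real (q j)) * (gr j m w \<bullet> (d\<phi> i (H m w) *\<^sub>R gr i m w)))
    \<longlonglongrightarrow> (\<Sum>i\<in>UNIV. LINT w|M. (d\<phi> i (F w) *\<^sub>R U i w) \<bullet> ((1 / real (q j)) *\<^sub>R U j w))"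
   by (intro tendsto_sum limG L4_tendsto_scaleR Ld\<phi> L4g)
  ultimately have "(LINT w|M. F w $ j * \<phi> (F w)) = (\<Sum>i\<in>UNIV. LINT w|M. (d\<phi> i (F w) *\<^sub>R U i w) \<bullet> ((1 / real (q j)) *\<^sub>R U j w))"
   unfolding pre by (rule LIMSEQ_unique)
  also have "\<dots> = (\<Sum>i\<in>UNIV. LINT w|M. Gam M X F i j w * d\<phi> i (F w))"
   by (intro sum.cong refl Gint) measurable
  finally show ?thesis .
 qed
 have triple: "(LINT w|M. F w $ i * F w $ j * F w $ k) = (LINT w|M. Gam M X F i j w * F w $ k) + (LINT w|M. Gam M X F k j w * F w $ i)" for i j k
 proof -
  have pre: "(LINT w|M. hs j m w * (hs i m w *\<^sub>R hs k m w)) =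
    (LINT w|M. (1 / real (q j)) * (gr j m w \<bullet> (hs k m w *\<^sub>R gr i m w))) +
    (LINT w|M. (1 / real (q j)) * (gr j m w \<bullet> (hs i m w *\<^sub>R gr k m w)))" for m
  proof -
   define \<Phi> where "\<Phi> i = hermite_sum (S i m) (c i m) (q i)" for i
   define \<Gamma> where "\<Gamma> i = hermite_grad (S i m) (c i m) (q i)" for i
   define G where "G x = \<Phi> k x *\<^sub>R \<Gamma> i x + \<Phi> i x *\<^sub>R \<Gamma> k x" for x
   have c\<Phi>: "cylindrical_on (I m) (\<Phi> i)" for i unfolding \<Phi>_def by (rule cylindrical_on_hermite_sum[OF I(2,1)])
   have 1: "cylindrical_on (I m) (\<lambda>x. \<Phi> i x * \<Phi> k x)" by (intro cylindrical_on_mult c\<Phi>)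
   have 2: "cylindrical_on (I m) (\<lambda>x. v \<bullet> G x)" for v
    unfolding G_def inner_add_right inner_scaleR_right \<Gamma>_def
    by (intro cylindrical_on_add cylindrical_on_mult cylindrical_on_hermite_grad I c\<Phi>)
   have 3: "direction_deriv v (\<lambda>x. \<Phi> i x * \<Phi> k x) (\<lambda>x. v \<bullet> G x)" for v
    using direction_deriv_mult[OF direction_deriv_hermite_sum[of v "S i m" "c i m" "q i"] direction_deriv_hermite_sum[of v "S k m" "c k m" "q k"]]
    by (simp add: G_def \<Phi>_def \<Gamma>_def inner_add_right mult.commute)
   have ii: "integrable M (\<lambda>w. gr j m w \<bullet> (hs k m w *\<^sub>R gr i m w))" for i k
    by (rule sq_integrable_inner[OF L2_tendstoD(1)[OF L2g] L2_tendstoD(1)[OF L4_tendsto_scaleR[OF L4h L4g]]])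
   have "(LINT w|M. hs j m w * (hs i m w *\<^sub>R hs k m w)) = (LINT w|M. (1 / real (q j)) * (gr j m w \<bullet> G (fld w)))"
    using hermite_sum_IBP[OF A(1)[of j m] A(2)[of j m] q[of j] I(1) 1 2 3, of "c j m"]
    by (simp add: hs_def gr_def \<Phi>_def)
   also have "\<dots> = (LINT w|M. (1 / real (q j)) * (gr j m w \<bullet> (hs k m w *\<^sub>R gr i m w)) + (1 / real (q j)) * (gr j m w \<bullet> (hs i m w *\<^sub>R gr k m w)))"
    by (simp add: G_def hs_def gr_def \<Phi>_def \<Gamma>_def inner_add_right distrib_left add_divide_distrib)
   also have "\<dots> = (LINT w|M. (1 / real (q j)) * (gr j m w \<bullet> (hs k m w *\<^sub>R gr i m w))) +
     (LINT w|M. (1 / real (q j)) * (gr j m w \<bullet> (hs i m w *\<^sub>R gr k m w)))"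
    by (intro Bochner_Integration.integral_add integrable_mult_right ii)
   finally show ?thesis .
  qed
  have "(\<lambda>m. LINT w|M. hs j m w * (hs i m w *\<^sub>R hs k m w)) \<longlonglongrightarrow> (LINT w|M. F w $ j * (F w $ i *\<^sub>R F w $ k))"
   by (rule L2_tendsto_integral_mult[OF L2h L4_tendsto_scaleR[OF L4h L4h]])
  moreover have "(\<lambda>m. (LINT w|M. (1 / real (q j)) * (gr j m w \<bullet> (hs k m w *\<^sub>R gr i m w))) +
    (LINT w|M. (1 / real (q j)) * (gr j m w \<bullet> (hs i m w *\<^sub>R gr k m w))))
    \<longlonglongrightarrow> (LINT w|M. (F w $ k *\<^sub>R U i w) \<bullet> ((1 / real (q j)) *\<^sub>R U j w)) + (LINT w|M. (F w $ i *\<^sub>R U k w) \<bullet> ((1 / real (q j)) *\<^sub>R U j w))"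
   by (intro tendsto_add limG L4_tendsto_scaleR L4h L4g)
  ultimately have "(LINT w|M. F w $ j * (F w $ i *\<^sub>R F w $ k)) =
   (LINT w|M. (F w $ k *\<^sub>R U i w) \<bullet> ((1 / real (q j)) *\<^sub>R U j w)) + (LINT w|M. (F w $ i *\<^sub>R U k w) \<bullet> ((1 / real (q j)) *\<^sub>R U j w))"
   unfolding pre by (rule LIMSEQ_unique)
  then show ?thesis unfolding Gint[OF Fm] by (simp add: mult_ac)
 qed
 show ?thesis unfolding stein_kernel_def using sF mean sG ibp triple by blast
qed

end

section \<open>Partial derivatives\<close>

lemma has_derivative_partials:
 fixes f :: "real^'d::finite => real"
 assumes "f differentiable (at x)"
 shows "(f has_derivative (\<lambda>v. \<Sum>i\<in>UNIV. v $ i * partial i f x)) (at x)"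
proof -
 define D where "D = frechet_derivative f (at x)"
 have D: "(f has_derivative D) (at x)" using assms by (simp add: D_def frechet_derivative_works)
 then have lin: "linear D" by (rule has_derivative_linear)
 have "D v = (\<Sum>i\<in>UNIV. v $ i * partial i f x)" for v
 proof -
  have "D v = D (\<Sum>i\<in>UNIV. (v $ i) *\<^sub>R axis i 1)"
   using vec_lambda_eq_sum_axis[of "\<lambda>i. v $ i"] by simp
  also have "\<dots> = (\<Sum>i\<in>UNIV. v $ i * D (axis i 1))" by (simp add: linear_sum[OF lin] linear_cmul[OF lin])
  finally show ?thesis by (simp add: partial_def D_def)
 qed
 then have "D = (\<lambda>v. \<Sum>i\<in>UNIV. v $ i * partial i f x)" by (rule ext)
 with D show ?thesis by simp
qed

lemma DERIV_along_axis:
 fixes f :: "real^'d::finite => real"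
 assumes f: "\<And>x. (f has_derivative (\<lambda>v. \<Sum>i\<in>UNIV. v $ i * df i x)) (at x)"
 shows "((\<lambda>t. f (y + t *\<^sub>R axis i 1)) has_real_derivative df i (y + s *\<^sub>R axis i 1)) (at s)"
proof -
 have "((\<lambda>t. y + t *\<^sub>R axis i 1) has_derivative (\<lambda>h. h *\<^sub>R axis i 1)) (at s)"
  by (auto intro!: derivative_eq_intros)
 from has_derivative_compose[OF this f]
 have "((\<lambda>t. f (y + t *\<^sub>R axis i 1)) has_derivative (\<lambda>h. \<Sum>j\<in>UNIV. (h *\<^sub>R axis i 1) $ j * df j (y + s *\<^sub>R axis i 1))) (at s)" .
 moreover have "(\<Sum>j\<in>UNIV. (h *\<^sub>R axis i 1) $ j * df j (y + s *\<^sub>R axis i 1)) = df i (y + s *\<^sub>R axis i 1) * h" for h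
 proof -
  have "(\<Sum>j\<in>UNIV. (h *\<^sub>R axis i 1) $ j * df j (y + s *\<^sub>R axis i 1)) = (\<Sum>j\<in>UNIV. if j = i then h * df i (y + s *\<^sub>R axis i 1) else 0)"
   by (intro sum.cong) (auto simp: axis_def)
  then show ?thesis by (simp add: mult.commute)
 qed
 ultimately show ?thesis by (simp add: has_field_derivative_def mult_commute_abs)
qed

text \<open>Partial derivatives are limits of difference quotients, hence measurable even where they are discontinuous.\<close>

lemma partials_measurable:
 fixes f :: "real^'d::finite => real"
 assumes f: "\<And>x. (f has_derivative (\<lambda>v. \<Sum>i\<in>UNIV. v $ i * df i x)) (at x)"
 shows "df i \<in> borel_measurable borel"
proof -
 have "continuous_on UNIV f" using f by (intro continuous_at_imp_continuous_on) (auto intro: has_derivative_continuous)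
 then have [measurable]: "f \<in> borel_measurable borel" by (rule borel_measurable_continuous_onI)
 have "(\<lambda>n. (f (x + (1 / real (Suc n)) *\<^sub>R axis i 1) - f x) / (1 / real (Suc n))) \<longlonglongrightarrow> df i x" for x
 proof -
  have "((\<lambda>h. (f (x + h *\<^sub>R axis i 1) - f x) / h) \<longlongrightarrow> df i x) (at 0)"
   using DERIV_along_axis[OF f, of x i 0] by (simp add: DERIV_def)
  moreover have "filterlim (\<lambda>n. 1 / real (Suc n)) (at 0) sequentially"
   unfolding filterlim_at using lim_1_over_n LIMSEQ_Suc[OF lim_1_over_n] by (auto simp del: of_nat_Suc)
  ultimately show ?thesis by (rule filterlim_compose)
 qed
 then show ?thesis by (rule borel_measurable_LIMSEQ_real) measurable
qed

text \<open>Differentiability of one first-order partial derivative at a single point determines the leading term of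
 the second difference; the mean value theorem is applied in direction \<open>i\<close>.\<close>

lemma second_difference_limit:
 fixes f :: "real^'d::finite => real"
 assumes f: "\<And>x. (f has_derivative (\<lambda>v. \<Sum>i\<in>UNIV. v $ i * df i x)) (at x)"
  and d: "(df i has_derivative (\<lambda>v. \<Sum>k\<in>UNIV. v $ k * L k)) (at x)" and e: "e > 0"
 shows "\<exists>r>0. \<forall>h. 0 < h \<longrightarrow> h < r \<longrightarrow>
   \<bar>f (x + h *\<^sub>R axis i 1 + h *\<^sub>R axis j 1) - f (x + h *\<^sub>R axis i 1) - f (x + h *\<^sub>R axis j 1) + f x - h * h * L j\<bar> \<le> e * (h * h)"
proof -
 define D where "D v = (\<Sum>k\<in>UNIV. v $ k * L k)" for v :: "real^'d"
 obtain r where r: "r > 0" "\<And>y. norm (y - x) < r ==> norm (df i y - df i x - D (y - x)) \<le> (e / 3) * norm (y - x)"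
  using d e unfolding has_derivative_at_alt D_def by (metis divide_pos_pos zero_less_numeral)
 have lin: "linear D" unfolding D_def using has_derivative_linear[OF d] .
 have Dj: "D (h *\<^sub>R axis j 1) = h * L j" for h
 proof -
  have "D (axis j 1) = (\<Sum>k\<in>UNIV. if k = j then L j else 0)"
   unfolding D_def by (intro sum.cong) (auto simp: axis_def)
  then show ?thesis by (simp add: linear_cmul[OF lin])
 qed
 have "\<bar>f (x + h *\<^sub>R axis i 1 + h *\<^sub>R axis j 1) - f (x + h *\<^sub>R axis i 1) - f (x + h *\<^sub>R axis j 1) + f x - h * h * L j\<bar> \<le> e * (h * h)"
  if h: "0 < h" "h < r / 2" for h
 proof -
  define \<phi> where "\<phi> t = f ((x + h *\<^sub>R axis j 1) + t *\<^sub>R axis i 1) - f (x + t *\<^sub>R axis i 1)" for t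
  have d\<phi>: "(\<phi> has_real_derivative (df i ((x + h *\<^sub>R axis j 1) + t *\<^sub>R axis i 1) - df i (x + t *\<^sub>R axis i 1))) (at t)" for t
   unfolding \<phi>_def by (intro DERIV_diff DERIV_along_axis[OF f])
  from MVT2[OF h(1) d\<phi>]
  obtain \<xi> where xi: "0 < \<xi>" "\<xi> < h" "\<phi> h - \<phi> 0 = (h - 0) * (df i ((x + h *\<^sub>R axis j 1) + \<xi> *\<^sub>R axis i 1) - df i (x + \<xi> *\<^sub>R axis i 1))"
   by (elim exE conjE)
  define w1 where "w1 = h *\<^sub>R axis j 1 + \<xi> *\<^sub>R axis i (1::real)"
  define w2 where "w2 = \<xi> *\<^sub>R axis i (1::real)"
  have n1: "norm w1 \<le> 2 * h" using norm_triangle_ineq[of "h *\<^sub>R axis j (1::real)" "\<xi> *\<^sub>R axis i 1"] xi h by (simp add: w1_def)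
  have n2: "norm w2 \<le> h" using xi by (simp add: w2_def)
  have a1: "\<bar>df i (x + w1) - df i x - D w1\<bar> \<le> (e / 3) * (2 * h)"
  proof -
   have "\<bar>df i (x + w1) - df i x - D w1\<bar> \<le> (e / 3) * norm w1" using r(2)[of "x + w1"] n1 h by simp
   also have "\<dots> \<le> (e / 3) * (2 * h)" using e by (intro mult_left_mono n1) simp
   finally show ?thesis .
  qed
  have a2: "\<bar>df i (x + w2) - df i x - D w2\<bar> \<le> (e / 3) * h"
  proof -
   have "\<bar>df i (x + w2) - df i x - D w2\<bar> \<le> (e / 3) * norm w2" using r(2)[of "x + w2"] n2 h by simp
   also have "\<dots> \<le> (e / 3) * h" using e by (intro mult_left_mono n2) simp
   finally show ?thesis .
  qed
  have Dw: "D w1 - D w2 = h * L j" by (simp add: w1_def w2_def linear_add[OF lin] Dj)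
  have "\<bar>(df i (x + w1) - df i (x + w2)) - h * L j\<bar> \<le> e * h"
  proof -
   have "\<bar>(df i (x + w1) - df i (x + w2)) - h * L j\<bar> = \<bar>(df i (x + w1) - df i x - D w1) - (df i (x + w2) - df i x - D w2)\<bar>"
    unfolding Dw[symmetric] by (rule arg_cong[of _ _ abs]) simp
   also have "\<dots> \<le> (e / 3) * (2 * h) + (e / 3) * h" by (rule order_trans[OF abs_triangle_ineq4 add_mono[OF a1 a2]])
   also have "\<dots> = e * h" by simp
   finally show ?thesis .
  qed
  then have "\<bar>h * (df i (x + w1) - df i (x + w2)) - h * (h * L j)\<bar> \<le> h * (e * h)"
   using h(1) unfolding right_diff_distrib[symmetric] abs_mult by simp
  moreover have "\<phi> h - \<phi> 0 = h * (df i (x + w1) - df i (x + w2))" using xi(3) by (simp add: w1_def w2_def add.assoc)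
  moreover have "\<phi> h - \<phi> 0 = f (x + h *\<^sub>R axis i 1 + h *\<^sub>R axis j 1) - f (x + h *\<^sub>R axis i 1) - f (x + h *\<^sub>R axis j 1) + f x"
   by (simp add: \<phi>_def algebra_simps)
  ultimately show ?thesis by (simp add: mult_ac)
 qed
 then show ?thesis using r(1) by (intro exI[of _ "r / 2"]) auto
qed

text \<open>Schwarz's theorem for functions with differentiable partial derivatives: the second difference is symmetric in
 the two directions.\<close>

lemma partials_commute:
 fixes f :: "real^'d::finite => real"
 assumes f: "\<And>x. f differentiable (at x)" and d: "\<And>i x. partial i f differentiable (at x)"
 shows "partial j (partial i f) x = partial i (partial j f) x"
proof (rule ccontr)
 assume ne: "partial j (partial i f) x \<noteq> partial i (partial j f) x"
 define e where "e = \<bar>partial j (partial i f) x - partial i (partial j f) x\<bar> / 3"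
 have e: "e > 0" using ne by (simp add: e_def)
 note D = has_derivative_partials[OF f] has_derivative_partials[OF d]
 obtain r where r: "r > 0" "\<And>h. 0 < h ==> h < r ==>
   \<bar>f (x + h *\<^sub>R axis i 1 + h *\<^sub>R axis j 1) - f (x + h *\<^sub>R axis i 1) - f (x + h *\<^sub>R axis j 1) + f x - h * h * partial j (partial i f) x\<bar> \<le> e * (h * h)"
  using second_difference_limit[OF D(1) D(2) e, where i=i and x=x and j=j] by blast
 obtain r' where r': "r' > 0" "\<And>h. 0 < h ==> h < r' ==>
   \<bar>f (x + h *\<^sub>R axis j 1 + h *\<^sub>R axis i 1) - f (x + h *\<^sub>R axis j 1) - f (x + h *\<^sub>R axis i 1) + f x - h * h * partial i (partial j f) x\<bar> \<le> e * (h * h)"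
  using second_difference_limit[OF D(1) D(2) e, where i=j and x=x and j=i] by blast
 define h where "h = min r r' / 2"
 have h: "0 < h" "h < r" "h < r'" using r(1) r'(1) by (auto simp: h_def min_def)
 have c: "x + h *\<^sub>R axis j 1 + h *\<^sub>R axis i 1 = x + h *\<^sub>R axis i 1 + h *\<^sub>R axis j 1" by (simp add: algebra_simps)
 have "\<bar>h * h * partial j (partial i f) x - h * h * partial i (partial j f) x\<bar> \<le> 2 * (e * (h * h))"
  using r(2)[OF h(1,2)] r'(2)[OF h(1,3)] unfolding c by linarith
 then have "h * h * (3 * e) \<le> h * h * (2 * e)"
  using h(1) unfolding right_diff_distrib[symmetric] abs_mult e_def by (simp add: mult_ac)
 then show False using h(1) e by simp
qed

section \<open>Gaussian vectors\<close>

lemma borel_measurable_vec_nth[measurable (raw)]: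
 fixes f :: "'a => real^'d::finite"
 assumes "f \<in> borel_measurable M" shows "(\<lambda>x. f x $ i) \<in> borel_measurable M"
 by (rule measurable_compose[OF assms]) (intro borel_measurable_continuous_onI continuous_intros)

text \<open>Centred vectors, possibly degenerate.\<close>

definition gaussian_vector :: "'b measure => ('b => real^'d::finite) => bool" where
 "gaussian_vector N Z \<longleftrightarrow> prob_space N \<and> Z \<in> borel_measurable N \<and>
   (\<forall>t. \<exists>\<sigma>\<ge>0. distr N borel (\<lambda>w. t \<bullet> Z w) = normal_law 0 \<sigma>)"

definition jointly_gaussian :: "'b measure => ('b => real^'d::finite) => ('b => real) => bool" where
 "jointly_gaussian N Z W \<longleftrightarrow> prob_space N \<and> Z \<in> borel_measurable N \<and> W \<in> borel_measurable N \<and>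
   (\<forall>t s. \<exists>\<sigma>\<ge>0. distr N borel (\<lambda>w. t \<bullet> Z w + s * W w) = normal_law 0 \<sigma>)"

definition cov :: "'b measure => ('b => real^'d::finite) => 'd => 'd => real" where
 "cov N Z i j = (LINT w|N. Z w $ i * Z w $ j)"

lemma jointly_gaussian_linear:
 fixes Z :: "'b => real^'d::finite"
 shows "gaussian_vector N Z ==> jointly_gaussian N Z (\<lambda>w. b \<bullet> Z w)"
 unfolding gaussian_vector_def jointly_gaussian_def
proof (intro conjI allI; (elim conjE)?)
 fix t :: "real^'d" and s :: real assume a: "\<forall>t. \<exists>\<sigma>\<ge>0. distr N borel (\<lambda>w. t \<bullet> Z w) = normal_law 0 \<sigma>"
 have "(\<lambda>w. t \<bullet> Z w + s * (b \<bullet> Z w)) = (\<lambda>w. (t + s *\<^sub>R b) \<bullet> Z w)" by (simp add: inner_add_left)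
 then show "\<exists>\<sigma>\<ge>0. distr N borel (\<lambda>w. t \<bullet> Z w + s * (b \<bullet> Z w)) = normal_law 0 \<sigma>" using a by simp
qed auto

lemma jointly_gaussian_imp_vector: "jointly_gaussian N Z W ==> gaussian_vector N Z"
 unfolding gaussian_vector_def jointly_gaussian_def
proof (elim conjE, intro conjI allI)
 fix t assume "\<forall>t s. \<exists>\<sigma>\<ge>0. distr N borel (\<lambda>w. t \<bullet> Z w + s * W w) = normal_law 0 \<sigma>"
 from this[rule_format, of t 0] show "\<exists>\<sigma>\<ge>0. distr N borel (\<lambda>w. t \<bullet> Z w) = normal_law 0 \<sigma>" by simp
qed

lemma inner_vec_sum: "t \<bullet> z = (\<Sum>i\<in>UNIV. t $ i * z $ i)" for t z :: "real^'d::finite"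
 by (simp add: inner_vec_def)

lemma gaussian_family_of_vector:
 assumes "gaussian_vector N (Z :: 'b => real^'d::finite)"
 shows "gaussian_family N UNIV (\<lambda>i w. Z w $ i)"
 unfolding gaussian_family_def
proof (intro conjI ballI allI)
 show "prob_space N" "finite (UNIV :: 'd set)" using assms by (auto simp: gaussian_vector_def)
 have [measurable]: "Z \<in> borel_measurable N" using assms by (simp add: gaussian_vector_def)
 show "(\<lambda>w. Z w $ i) \<in> borel_measurable N" for i by measurable
 fix c :: "'d => real"
 have "(\<lambda>w. \<Sum>i\<in>UNIV. c i * Z w $ i) = (\<lambda>w. (\<chi> i. c i) \<bullet> Z w)" by (simp add: inner_vec_sum)
 then show "\<exists>\<sigma>\<ge>0. distr N borel (\<lambda>w. \<Sum>i\<in>UNIV. c i * Z w $ i) = normal_law 0 \<sigma>"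
  using assms by (simp add: gaussian_vector_def)
qed

lemma gaussian_vector_moments:
 assumes "gaussian_vector N (Z :: 'b => real^'d::finite)"
 shows "all_moments N (\<lambda>w. Z w $ i)" "all_moments N (\<lambda>w. t \<bullet> Z w)"
proof -
 note G = gaussian_family_of_vector[OF assms]
 show "all_moments N (\<lambda>w. Z w $ i)" by (rule gaussian_family_member(1)[OF G]) simp
 show "all_moments N (\<lambda>w. t \<bullet> Z w)"
  using gaussian_family_combination(1)[OF G, of "\<lambda>i. t $ i"] by (simp add: inner_vec_sum)
qed

lemma gaussian_vector_second_moment:
 assumes "gaussian_vector N (Z :: 'b => real^'d::finite)"
 shows "(LINT w|N. (s \<bullet> Z w) * (t \<bullet> Z w)) = (\<Sum>i\<in>UNIV. \<Sum>j\<in>UNIV. s $ i * t $ j * cov N Z i j)"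
proof -
 have int: "integrable N (\<lambda>w. (s $ i * t $ j) * (Z w $ i * Z w $ j))" for i j
  by (intro integrable_mult_right all_moments_integrable all_moments_mult gaussian_vector_moments[OF assms])
 have "(LINT w|N. (s \<bullet> Z w) * (t \<bullet> Z w)) = (LINT w|N. (\<Sum>i\<in>UNIV. \<Sum>j\<in>UNIV. (s $ i * t $ j) * (Z w $ i * Z w $ j)))"
  by (simp add: inner_vec_sum sum_product mult_ac)
 also have "\<dots> = (\<Sum>i\<in>UNIV. \<Sum>j\<in>UNIV. s $ i * t $ j * cov N Z i j)"
  using int by (simp add: cov_def)
 finally show ?thesis .
qed

lemma gaussian_vector_char:
 assumes "gaussian_vector N (Z :: 'b => real^'d::finite)"
 shows "(CLINT w|N. iexp (t \<bullet> Z w)) = exp (- (\<Sum>i\<in>UNIV. \<Sum>j\<in>UNIV. t $ i * t $ j * cov N Z i j) / 2)"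
 using gaussian_family_combination(3)[OF gaussian_family_of_vector[OF assms], of "\<lambda>i. t $ i"]
  gaussian_vector_second_moment[OF assms, of t t]
 by (simp add: inner_vec_sum power2_eq_square)

text \<open>Covariances determine the characteristic function and hence the law.\<close>

theorem gaussian_vector_unique:
 assumes Z: "gaussian_vector N (Z :: 'b => real^'d::finite)" and Z': "gaussian_vector N' (Z' :: 'c => real^'d)"
  and cov: "\<And>i j. cov N Z i j = cov N' Z' i j" and [measurable]: "f \<in> borel_measurable borel"
 shows "(LINT w|N. (f (Z w) :: real)) = (LINT w|N'. f (Z' w))"
proof -
 have P: "prob_space N" "prob_space N'" and m[measurable]: "Z \<in> borel_measurable N" "Z' \<in> borel_measurable N'"
  using Z Z' by (auto simp: gaussian_vector_def)
 have "(CLINT w|N. iexp (\<Sum>i\<in>UNIV. u i * Z w $ i)) = (CLINT w|N'. iexp (\<Sum>i\<in>UNIV. u i * Z' w $ i))" for u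
  using gaussian_vector_char[OF Z, of "\<chi> i. u i"] gaussian_vector_char[OF Z', of "\<chi> i. u i"]
  by (simp add: cov inner_vec_sum)
 then have eq: "distr N (PiM UNIV (\<lambda>_. borel)) (\<lambda>w. \<lambda>i\<in>UNIV. Z w $ i) = distr N' (PiM UNIV (\<lambda>_. borel)) (\<lambda>w. \<lambda>i\<in>UNIV. Z' w $ i)"
  by (intro joint_char_unique P) (auto simp del: restrict_UNIV)
 have mv[measurable]: "(\<lambda>x. \<chi> i. x i) \<in> borel_measurable (PiM (UNIV :: 'd set) (\<lambda>_. borel :: real measure))"
  by (rule borel_measurable_vec_lambda) measurable
 have mm: "(\<lambda>w. \<lambda>i\<in>UNIV. Z w $ i) \<in> measurable N (PiM UNIV (\<lambda>_. borel))" "(\<lambda>w. \<lambda>i\<in>UNIV. Z' w $ i) \<in> measurable N' (PiM UNIV (\<lambda>_. borel))"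
  by (intro measurable_restrict; measurable)+
 have v: "(\<chi> i. (\<lambda>i\<in>UNIV. y $ i) i) = y" for y :: "real^'d" by (simp add: vec_eq_iff)
 have mf: "(\<lambda>x. f (\<chi> i. x i)) \<in> borel_measurable (PiM (UNIV :: 'd set) (\<lambda>_. borel :: real measure))" by measurable
 show ?thesis
  using arg_cong[OF eq, of "\<lambda>D. integral\<^sup>L D (\<lambda>x. f (\<chi> i. x i))"]
  unfolding integral_distr[OF mm(1) mf] integral_distr[OF mm(2) mf] by (simp only: v)
qed

theorem jointly_gaussian_IBP:
 fixes Z :: "'b => real^'d::finite"
 assumes J: "jointly_gaussian N Z W"
  and \<phi>: "\<And>y. (\<phi> has_derivative (\<lambda>v. \<Sum>i\<in>UNIV. v $ i * d\<phi> i y)) (at y)"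
  and B: "\<And>i y. \<bar>d\<phi> i y\<bar> \<le> B"
 shows "(LINT w|N. W w * \<phi> (Z w)) = (\<Sum>i\<in>UNIV. (LINT w|N. W w * Z w $ i) * (LINT w|N. d\<phi> i (Z w)))"
proof -
 have P: "prob_space N" and [measurable]: "Z \<in> borel_measurable N" "W \<in> borel_measurable N"
  using J by (auto simp: jointly_gaussian_def)
 interpret prob_space N by fact
 define Y where "Y k w = (case k of None => W w | Some i => Z w $ i)" for k w
 have sum_option: "(\<Sum>k\<in>UNIV. g k) = g None + (\<Sum>i\<in>UNIV. g (Some i))" for g :: "'d option => real"
  unfolding UNIV_option_conv by (subst sum.insert) (auto simp: sum.reindex)
 have G: "gaussian_family N UNIV Y"
  unfolding gaussian_family_def
 proof (intro conjI ballI allI P)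
  show "Y k \<in> borel_measurable N" for k unfolding Y_def by (cases k) auto
  fix c :: "'d option => real"
  have "(\<lambda>w. \<Sum>k\<in>UNIV. c k * Y k w) = (\<lambda>w. (\<chi> i. c (Some i)) \<bullet> Z w + c None * W w)"
   unfolding sum_option by (simp add: Y_def inner_vec_sum add.commute)
  then show "\<exists>\<sigma>\<ge>0. distr N borel (\<lambda>w. \<Sum>k\<in>UNIV. c k * Y k w) = normal_law 0 \<sigma>"
   using J by (simp add: jointly_gaussian_def)
 qed auto
 define a where "a i = (LINT w|N. W w * Z w $ i)" for i
 have [measurable]: "d\<phi> i \<in> borel_measurable borel" for i by (rule partials_measurable[OF \<phi>])
 have "continuous_on UNIV \<phi>" using \<phi> by (intro continuous_at_imp_continuous_on) (auto intro: has_derivative_continuous)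
 then have [measurable]: "\<phi> \<in> borel_measurable borel" by (rule borel_measurable_continuous_onI)
 have B0: "0 \<le> B" using B[of undefined 0] by linarith
 define vv where "vv x = (\<chi> i. x (Some i))" for x :: "'d option => real"
 have [measurable]: "vv \<in> borel_measurable (PiM UNIV (\<lambda>_. borel))"
  unfolding vv_def by (rule borel_measurable_vec_lambda) measurable
 have vY: "vv (\<lambda>k\<in>UNIV. Y k w) = Z w" for w by (simp add: vv_def Y_def vec_eq_iff)
 have "(LINT w|N. Y None w * \<phi> (vv (\<lambda>k\<in>UNIV. Y k w))) = (LINT w|N. (\<Sum>i\<in>UNIV. a i * d\<phi> i (vv (\<lambda>k\<in>UNIV. Y k w))))"
 proof (rule gaussian_family_IBP[OF G, where K="\<bar>\<phi> 0\<bar> + B" and r=1 and K'="\<Sum>i\<in>UNIV. \<bar>a i\<bar> * B" and r'=0])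
  show "(\<lambda>x. \<phi> (vv x)) \<in> borel_measurable (PiM UNIV (\<lambda>_. borel))" by measurable
  show "(\<lambda>x. \<Sum>i\<in>UNIV. a i * d\<phi> i (vv x)) \<in> borel_measurable (PiM UNIV (\<lambda>_. borel))" by measurable
  fix x :: "'d option => real"
  define s where "s = (\<Sum>i\<in>UNIV. \<bar>x (Some i)\<bar>)"
  have "\<bar>\<phi> (vv x)\<bar> \<le> \<bar>\<phi> 0\<bar> + B * s"
   using bounded_partials_Lipschitz[OF \<phi> B, of "vv x" 0] by (simp add: vv_def s_def)
  also have "\<dots> \<le> (\<bar>\<phi> 0\<bar> + B) * (1 + s)" using B0 by (simp add: algebra_simps s_def sum_nonneg)
  also have "\<dots> \<le> (\<bar>\<phi> 0\<bar> + B) * (1 + (\<Sum>k\<in>UNIV. \<bar>x k\<bar>)) ^ 1"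
   unfolding power_one_right sum_option using B0 by (intro mult_left_mono) (auto simp: s_def)
  finally show "\<bar>\<phi> (vv x)\<bar> \<le> (\<bar>\<phi> 0\<bar> + B) * (1 + (\<Sum>k\<in>UNIV. \<bar>x k\<bar>)) ^ 1" .
  show "\<bar>\<Sum>i\<in>UNIV. a i * d\<phi> i (vv x)\<bar> \<le> (\<Sum>i\<in>UNIV. \<bar>a i\<bar> * B) * (1 + (\<Sum>k\<in>UNIV. \<bar>x k\<bar>)) ^ 0"
   by (simp, rule order_trans[OF sum_abs]) (auto simp: abs_mult intro!: sum_mono mult_left_mono B)
  have "((\<lambda>t. \<phi> (\<chi> i. x (Some i) + t * a i)) has_real_derivative (\<Sum>i\<in>UNIV. a i * d\<phi> i (\<chi> i. x (Some i) + 0 * a i))) (at 0)"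
   by (rule DERIV_along_curve[OF \<phi>]) (auto intro!: derivative_eq_intros)
  then show "((\<lambda>t. \<phi> (vv (\<lambda>k\<in>UNIV. x k + t * (LINT w|N. Y None w * Y k w)))) has_real_derivative
    (\<Sum>i\<in>UNIV. a i * d\<phi> i (vv (\<lambda>k\<in>UNIV. x k)))) (at 0)"
   by (simp add: vv_def Y_def a_def)
 qed auto
 moreover have "integrable N (\<lambda>w. d\<phi> i (Z w))" for i by (rule integrable_const_bound[where B=B]) (auto simp: B)
 ultimately show ?thesis unfolding vY by (simp add: Y_def a_def)
qed

lemma normal_law_of_char:
 assumes P: "prob_space N" and [measurable]: "W \<in> borel_measurable N" and v: "v \<ge> 0"
  and char: "\<And>s. (CLINT w|N. iexp (s * W w)) = complex_of_real (exp (- (s\<^sup>2 * v) / 2))"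
 shows "\<exists>\<sigma>\<ge>0. distr N borel W = normal_law 0 \<sigma>"
proof (intro exI conjI)
 interpret S: prob_space std_normal_distribution by (rule prob_space_std_normal)
 interpret N: prob_space N by fact
 have "distr N borel W = distr std_normal_distribution borel (\<lambda>x. 0 + sqrt v * x)"
 proof (intro Levy_uniqueness N.real_distribution_distr S.real_distribution_distr ext)
  fix s
  have "char (distr N borel W) s = (CLINT w|N. iexp (s * W w))"
   unfolding char_def by (rule integral_distr) auto
  also have "\<dots> = complex_of_real (exp (- (s\<^sup>2 * v) / 2))" by (rule char)
  also have "\<dots> = char std_normal_distribution (s * sqrt v)"
   using v by (simp add: char_std_normal_distribution power_mult_distrib)
  also have "\<dots> = char (distr std_normal_distribution borel (\<lambda>x. 0 + sqrt v * x)) s"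
   unfolding char_def by (subst integral_distr) (auto simp: mult.assoc)
  finally show "char (distr N borel W) s = char (distr std_normal_distribution borel (\<lambda>x. 0 + sqrt v * x)) s" .
 qed auto
 also have "\<dots> = normal_law 0 (sqrt v)" using v by (subst normal_law_affine) auto
 finally show "distr N borel W = normal_law 0 (sqrt v)" .
qed (use v in auto)

lemma integral_pair_product:
 fixes f :: "'a => 'c::{banach,second_countable_topology,real_normed_field}" and g :: "'b => 'c"
 assumes "prob_space M" "prob_space N" and f: "integrable M f" and g: "integrable N g"
 shows "integrable (M \<Otimes>\<^sub>M N) (\<lambda>x. f (fst x) * g (snd x))"
  and "(LINT x|(M \<Otimes>\<^sub>M N). f (fst x) * g (snd x)) = (LINT x|M. f x) * (LINT x|N. g x)"
proof -
 interpret M: prob_space M by fact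
 interpret N: prob_space N by fact
 interpret MN: pair_prob_space M N ..
 have [measurable]: "f \<in> borel_measurable M" "g \<in> borel_measurable N" using f g by auto
 have "integrable (M \<Otimes>\<^sub>M N) (\<lambda>(x, y). f x * g y)"
  by (rule MN.Fubini_integrable) (use f g in \<open>auto simp: norm_mult\<close>)
 then show i: "integrable (M \<Otimes>\<^sub>M N) (\<lambda>x. f (fst x) * g (snd x))" by (simp add: case_prod_unfold)
 show "(LINT x|(M \<Otimes>\<^sub>M N). f (fst x) * g (snd x)) = (LINT x|M. f x) * (LINT x|N. g x)"
  using MN.integral_fst'[OF i] by simp
qed

lemma gaussian_vector_combination:
 fixes A :: "'a => real^'d::finite" and Z :: "'b => real^'d"
 assumes A: "gaussian_vector M A" and Z: "gaussian_vector N Z"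
 shows "gaussian_vector (M \<Otimes>\<^sub>M N) (\<lambda>x. a *\<^sub>R A (fst x) + b *\<^sub>R Z (snd x))" (is "gaussian_vector _ ?Y")
  and "cov (M \<Otimes>\<^sub>M N) (\<lambda>x. a *\<^sub>R A (fst x) + b *\<^sub>R Z (snd x)) i j = a\<^sup>2 * cov M A i j + b\<^sup>2 * cov N Z i j"
proof -
 have P: "prob_space M" "prob_space N" and [measurable]: "A \<in> borel_measurable M" "Z \<in> borel_measurable N"
  using A Z by (auto simp: gaussian_vector_def)
 interpret M: prob_space M by fact
 interpret N: prob_space N by fact
 interpret MN: pair_prob_space M N ..
 show "gaussian_vector (M \<Otimes>\<^sub>M N) ?Y"
  unfolding gaussian_vector_def
 proof (intro conjI allI MN.prob_space_axioms)
  show m: "?Y \<in> borel_measurable (M \<Otimes>\<^sub>M N)" by measurable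
  fix t :: "real^'d"
  define v where "v = (LINT w|M. (a * (t \<bullet> A w))\<^sup>2) + (LINT w|N. (b * (t \<bullet> Z w))\<^sup>2)"
  have c: "(CLINT w|D. iexp (s * (e * (t \<bullet> V w)))) = complex_of_real (exp (- (s\<^sup>2 * (LINT w|D. (e * (t \<bullet> V w))\<^sup>2)) / 2))"
   if V: "gaussian_vector D V" for D and V :: "'z => real^'d" and e s
  proof -
   have "(CLINT w|D. iexp (((s * e) *\<^sub>R t) \<bullet> V w)) = exp (- (LINT w|D. (((s * e) *\<^sub>R t) \<bullet> V w) * (((s * e) *\<^sub>R t) \<bullet> V w)) / 2)"
    unfolding gaussian_vector_second_moment[OF V] by (rule gaussian_vector_char[OF V])
   moreover have "(((s * e) *\<^sub>R t) \<bullet> V w) * (((s * e) *\<^sub>R t) \<bullet> V w) = s\<^sup>2 * (e * (t \<bullet> V w))\<^sup>2" for w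
    by (simp add: power2_eq_square mult_ac)
   moreover have "((s * e) *\<^sub>R t) \<bullet> V w = s * (e * (t \<bullet> V w))" for w by simp
   ultimately show ?thesis by (simp only: integral_mult_right_zero)
  qed
  show "\<exists>\<sigma>\<ge>0. distr (M \<Otimes>\<^sub>M N) borel (\<lambda>x. t \<bullet> ?Y x) = normal_law 0 \<sigma>"
  proof (rule normal_law_of_char[where v=v, OF MN.prob_space_axioms])
   show "v \<ge> 0" by (simp add: v_def)
   fix s
   have "(CLINT x|M \<Otimes>\<^sub>M N. iexp (s * (t \<bullet> ?Y x))) = (CLINT x|M \<Otimes>\<^sub>M N. iexp (s * (a * (t \<bullet> A (fst x)))) * iexp (s * (b * (t \<bullet> Z (snd x)))))"
    by (simp add: inner_add_right distrib_left exp_add)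
   also have "\<dots> = (CLINT w|M. iexp (s * (a * (t \<bullet> A w)))) * (CLINT w|N. iexp (s * (b * (t \<bullet> Z w))))"
    by (rule integral_pair_product(2)[OF P M.integrable_iexp N.integrable_iexp]) auto
   also have "\<dots> = complex_of_real (exp (- (s\<^sup>2 * v) / 2))"
    unfolding c[OF A] c[OF Z] v_def by (simp add: field_simps flip: exp_add of_real_mult)
   finally show "(CLINT x|M \<Otimes>\<^sub>M N. iexp (s * (t \<bullet> ?Y x))) = complex_of_real (exp (- (s\<^sup>2 * v) / 2))" .
  qed (use m in measurable)
 qed
 have i0: "integrable M (\<lambda>w. A w $ i)" "integrable N (\<lambda>w. Z w $ i)" "integrable M (\<lambda>w. A w $ i * A w $ j)" "integrable N (\<lambda>w. Z w $ i * Z w $ j)" for i j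
  by (intro all_moments_integrable all_moments_mult gaussian_vector_moments A Z)+
 have m0: "(LINT w|M. A w $ i) = 0" "(LINT w|N. Z w $ i) = 0" for i
  using gaussian_family_member(2)[OF gaussian_family_of_vector[OF A], of i] gaussian_family_member(2)[OF gaussian_family_of_vector[OF Z], of i] by auto
 have i1: "integrable M (\<lambda>_. 1::real)" "integrable N (\<lambda>_. 1::real)" by auto
 note I1 = integral_pair_product[OF P i0(3)[of i j] i1(2)]
 note I2 = integral_pair_product[OF P i1(1) i0(4)[of i j]]
 note I3 = integral_pair_product[OF P i0(1)[of i] i0(2)[of j]]
 note I4 = integral_pair_product[OF P i0(1)[of j] i0(2)[of i]]
 have "?Y x $ i * ?Y x $ j = a\<^sup>2 * ((A (fst x) $ i * A (fst x) $ j) * 1) + b\<^sup>2 * (1 * (Z (snd x) $ i * Z (snd x) $ j))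
   + a * b * (A (fst x) $ i * Z (snd x) $ j) + a * b * (A (fst x) $ j * Z (snd x) $ i)" for x
  by (simp add: algebra_simps power2_eq_square)
 then have "cov (M \<Otimes>\<^sub>M N) ?Y i j = (LINT x|(M \<Otimes>\<^sub>M N). a\<^sup>2 * ((A (fst x) $ i * A (fst x) $ j) * 1) + b\<^sup>2 * (1 * (Z (snd x) $ i * Z (snd x) $ j))
   + a * b * (A (fst x) $ i * Z (snd x) $ j) + a * b * (A (fst x) $ j * Z (snd x) $ i))"
  by (simp only: cov_def)
 also have "\<dots> = a\<^sup>2 * cov M A i j + b\<^sup>2 * cov N Z i j"
  using I1 I2 I3 I4 m0 M.prob_space N.prob_space by (simp add: cov_def)
 finally show "cov (M \<Otimes>\<^sub>M N) ?Y i j = a\<^sup>2 * cov M A i j + b\<^sup>2 * cov N Z i j" .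
qed

section \<open>Interpolation between a random vector and a Gaussian vector\<close>

definition C2_test :: "(real^'d::finite => real) => ('d => real^'d => real) => ('d => 'd => real^'d => real) => real => bool" where
 "C2_test g dg ddg K \<longleftrightarrow> (\<forall>y. (g has_derivative (\<lambda>v. \<Sum>i\<in>UNIV. v $ i * dg i y)) (at y)) \<and>
   (\<forall>j y. (dg j has_derivative (\<lambda>v. \<Sum>i\<in>UNIV. v $ i * ddg i j y)) (at y)) \<and>
   (\<forall>i y. \<bar>dg i y\<bar> \<le> K) \<and> (\<forall>i j y. \<bar>ddg i j y\<bar> \<le> K)"

lemma C2_testD:
 assumes "C2_test g dg ddg K"
 shows "(g has_derivative (\<lambda>v. \<Sum>i\<in>UNIV. v $ i * dg i y)) (at y)"
  "(dg j has_derivative (\<lambda>v. \<Sum>i\<in>UNIV. v $ i * ddg i j y)) (at y)"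
  "\<bar>dg i y\<bar> \<le> K" "\<bar>ddg i j y\<bar> \<le> K" "0 \<le> K"
  "continuous_on UNIV g" "continuous_on UNIV (dg j)"
  "g \<in> borel_measurable borel" "dg j \<in> borel_measurable borel" "ddg i j \<in> borel_measurable borel"
  "\<bar>g y\<bar> \<le> \<bar>g 0\<bar> + K * (\<Sum>i\<in>UNIV. \<bar>y $ i\<bar>)"
proof -
 show d: "(g has_derivative (\<lambda>v. \<Sum>i\<in>UNIV. v $ i * dg i y)) (at y)"
  and dd: "(dg j has_derivative (\<lambda>v. \<Sum>i\<in>UNIV. v $ i * ddg i j y)) (at y)"
  and K: "\<bar>dg i y\<bar> \<le> K" "\<bar>ddg i j y\<bar> \<le> K" for y i j
  using assms by (simp_all add: C2_test_def)
 show "0 \<le> K" using K(1)[of undefined 0] by linarith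
 show c: "continuous_on UNIV g" "continuous_on UNIV (dg j)" for j
  using d dd by (auto intro!: continuous_at_imp_continuous_on intro: has_derivative_continuous)
 show "g \<in> borel_measurable borel" "dg j \<in> borel_measurable borel" by (intro borel_measurable_continuous_onI c)+
 show "ddg i j \<in> borel_measurable borel" by (rule partials_measurable[OF dd])
 show "\<bar>g y\<bar> \<le> \<bar>g 0\<bar> + K * (\<Sum>i\<in>UNIV. \<bar>y $ i\<bar>)"
  using bounded_partials_Lipschitz[OF d K(1), of y 0] by simp
qed

lemma gaussian_vector_IBP:
 fixes Z :: "'b => real^'d::finite"
 assumes Z: "gaussian_vector N Z"
  and \<phi>: "\<And>y. (\<phi> has_derivative (\<lambda>v. \<Sum>i\<in>UNIV. v $ i * d\<phi> i y)) (at y)"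
  and B: "\<And>i y. \<bar>d\<phi> i y\<bar> \<le> B"
 shows "(LINT w|N. Z w $ j * \<phi> (Z w)) = (\<Sum>i\<in>UNIV. cov N Z i j * (LINT w|N. d\<phi> i (Z w)))"
 using jointly_gaussian_IBP[OF jointly_gaussian_linear[OF Z, of "axis j 1"] \<phi> B]
 by (simp add: inner_axis' cov_def mult.commute)

lemma has_derivative_affine:
 fixes f :: "real^'d::finite => real"
 assumes f: "\<And>y. (f has_derivative (\<lambda>v. \<Sum>i\<in>UNIV. v $ i * df i y)) (at y)"
 shows "((\<lambda>z. f (s *\<^sub>R z + w)) has_derivative (\<lambda>v. \<Sum>i\<in>UNIV. v $ i * (s * df i (s *\<^sub>R y + w)))) (at y)"
proof -
 have "((\<lambda>z. s *\<^sub>R z + w) has_derivative (\<lambda>v. s *\<^sub>R v)) (at y)" by (auto intro!: derivative_eq_intros)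
 from has_derivative_compose[OF this f] show ?thesis by (simp add: mult_ac)
qed

lemma integrable_bounded_mult:
 fixes f g :: "'a => real"
 assumes f: "integrable M f" and [measurable]: "g \<in> borel_measurable M" and B: "\<And>x. \<bar>g x\<bar> \<le> B"
 shows "integrable M (\<lambda>x. f x * g x)"
proof (rule Bochner_Integration.integrable_bound)
 show "integrable M (\<lambda>x. B * f x)" using f by simp
 have "\<bar>f x * g x\<bar> \<le> \<bar>B * f x\<bar>" for x
  using mult_left_mono[OF order_trans[OF B abs_ge_self], of "\<bar>f x\<bar>" x] by (simp add: abs_mult mult.commute)
 then show "AE x in M. norm (f x * g x) \<le> norm (B * f x)" by (intro AE_I2) simp
qed (use f in measurable)

text \<open>With \<open>Y \<theta> = sin \<theta> A + cos \<theta> Z\<close> the derivative of \<open>E g(Y \<theta>)\<close> is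
 \<open>sin \<theta> cos \<theta> (\<Sum>i j. E[(\<tau>\<^sub>i\<^sub>j - cov\<^sub>i\<^sub>j) \<partial>\<^sub>i\<^sub>j g(Y \<theta>)])\<close>: one integration by parts with the kernel \<open>\<tau>\<close> of
 \<open>A\<close>, one for the Gaussian vector. Replacing the sum by \<open>\<alpha> + \<beta> sin \<theta>\<close> integrates to \<open>\<alpha> / 2 + \<beta> / 3\<close>; the factor
 \<open>2\<close> in the bound estimates the length \<open>\<pi> / 2\<close> of the interval. The hypothesis is stated for the sum as a whole, since in
 the applications only its asymptotic form is known.\<close>

theorem interpolation_bound:
 fixes A :: "'a => real^'d::finite" and Z :: "'b => real^'d"
 assumes M: "prob_space M" and Am: "A \<in> borel_measurable M" and Ai: "\<And>i. integrable M (\<lambda>w. A w $ i)"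
  and Z: "gaussian_vector N Z" and g: "C2_test g dg ddg K"
  and \<tau>: "\<And>i j. integrable M (\<tau> i j)"
  and kernel: "\<And>j s z. (LINT w|M. A w $ j * dg j (s *\<^sub>R A w + z)) = s * (\<Sum>i\<in>UNIV. LINT w|M. \<tau> i j w * ddg i j (s *\<^sub>R A w + z))"
  and bound: "\<And>\<theta>. 0 \<le> \<theta> ==> \<theta> \<le> pi / 2 ==> \<bar>(\<Sum>j\<in>UNIV. \<Sum>i\<in>UNIV. LINT x|(M \<Otimes>\<^sub>M N). (\<tau> i j (fst x) - cov N Z i j) *
    ddg i j (sin \<theta> *\<^sub>R A (fst x) + cos \<theta> *\<^sub>R Z (snd x))) - (\<alpha> + \<beta> * sin \<theta>)\<bar> \<le> \<epsilon>"
 shows "\<bar>(LINT w|M. g (A w)) - (LINT w|N. g (Z w)) - (\<alpha> / 2 + \<beta> / 3)\<bar> \<le> 2 * \<epsilon>"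
proof -
 have N: "prob_space N" and Zm: "Z \<in> borel_measurable N" using Z by (auto simp: gaussian_vector_def)
 note [measurable] = Am Zm C2_testD(8-10)[OF g]
 have \<tau>m[measurable]: "\<tau> i j \<in> borel_measurable M" for i j using \<tau> by auto
 interpret M: prob_space M by fact
 interpret N: prob_space N by fact
 interpret MN: pair_prob_space M N ..
 let ?P = "M \<Otimes>\<^sub>M N"
 interpret PL: pair_sigma_finite ?P lborel ..
 have K0: "0 \<le> K" by (rule C2_testD(5)[OF g])
 have \<epsilon>0: "0 \<le> \<epsilon>" using bound[of 0] by (rule order_trans[rotated]) auto
 have Zi: "integrable N (\<lambda>w. Z w $ i)" for i by (intro all_moments_integrable gaussian_vector_moments Z)
 define Y where "Y \<theta> x = sin \<theta> *\<^sub>R A (fst x) + cos \<theta> *\<^sub>R Z (snd x)" for \<theta> and x :: "'a \<times> 'b"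
 define h where "h \<theta> x = (\<Sum>j\<in>UNIV. (cos \<theta> * A (fst x) $ j - sin \<theta> * Z (snd x) $ j) * dg j (Y \<theta> x))" for \<theta> x
 define R where "R x = (\<Sum>j\<in>UNIV. (\<bar>A (fst x) $ j\<bar> + \<bar>Z (snd x) $ j\<bar>) * K)" for x :: "'a \<times> 'b"
 have [measurable]: "Y \<theta> \<in> borel_measurable ?P" for \<theta> unfolding Y_def by measurable
 have AP: "integrable ?P (\<lambda>x. A (fst x) $ j)" and ZP: "integrable ?P (\<lambda>x. Z (snd x) $ j)" and \<tau>P: "integrable ?P (\<lambda>x. \<tau> i j (fst x))" for i j
  using integral_pair_product(1)[OF M N Ai[of j], of "\<lambda>_. 1"] integral_pair_product(1)[OF M N _ Zi[of j], of "\<lambda>_. 1"]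
   integral_pair_product(1)[OF M N \<tau>[of i j], of "\<lambda>_. 1"] by auto
 have RP: "integrable ?P R" unfolding R_def using AP ZP by (intro Bochner_Integration.integrable_sum integrable_mult_left Bochner_Integration.integrable_add integrable_abs)
 have hR: "\<bar>h \<theta> x\<bar> \<le> R x" for \<theta> x
 proof -
  have "\<bar>(cos \<theta> * a - sin \<theta> * z) * dg j y\<bar> \<le> (\<bar>a\<bar> + \<bar>z\<bar>) * K" for a z j y
  proof -
   have "\<bar>cos \<theta> * a - sin \<theta> * z\<bar> \<le> \<bar>cos \<theta>\<bar> * \<bar>a\<bar> + \<bar>sin \<theta>\<bar> * \<bar>z\<bar>"
    unfolding abs_mult[symmetric] by (rule abs_triangle_ineq4)
   also have "\<dots> \<le> 1 * \<bar>a\<bar> + 1 * \<bar>z\<bar>" by (intro add_mono mult_right_mono) auto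
   finally show ?thesis unfolding abs_mult by (intro mult_mono C2_testD(3)[OF g]) auto
  qed
  then show ?thesis unfolding h_def R_def by (intro order_trans[OF sum_abs] sum_mono) auto
 qed
 have ftc: "(LINT \<theta>|lborel. indicator {0..pi/2} \<theta> * h \<theta> x) = g (A (fst x)) - g (Z (snd x))" for x
 proof -
  have "has_bochner_integral lborel (\<lambda>\<theta>. indicator {0..pi/2} \<theta> *\<^sub>R h \<theta> x) (g (Y (pi/2) x) - g (Y 0 x))"
  proof (rule has_bochner_integral_FTC_Icc)
   fix \<theta>
   have "((\<lambda>\<theta>. g (\<chi> i. sin \<theta> * A (fst x) $ i + cos \<theta> * Z (snd x) $ i)) has_real_derivative
     (\<Sum>i\<in>UNIV. (cos \<theta> * A (fst x) $ i - sin \<theta> * Z (snd x) $ i) * dg i (\<chi> i. sin \<theta> * A (fst x) $ i + cos \<theta> * Z (snd x) $ i))) (at \<theta>)"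
    by (rule DERIV_along_curve[OF C2_testD(1)[OF g]]) (auto intro!: derivative_eq_intros)
   moreover have "(\<chi> i. sin \<theta> * A (fst x) $ i + cos \<theta> * Z (snd x) $ i) = Y \<theta> x" for \<theta> by (simp add: Y_def vec_eq_iff)
   ultimately show "((\<lambda>\<theta>. g (Y \<theta> x)) has_vector_derivative h \<theta> x) (at \<theta> within {0..pi/2})"
    unfolding h_def has_real_derivative_iff_has_vector_derivative[symmetric]
    by (auto intro: has_field_derivative_at_within)
  next
   show "continuous_on {0..pi/2} (\<lambda>\<theta>. h \<theta> x)" unfolding h_def Y_def
    by (intro continuous_intros continuous_on_compose2[OF C2_testD(7)[OF g]]) auto
  qed auto
  then show ?thesis by (simp add: has_bochner_integral_integral_eq Y_def)
 qed
 define f where "f x \<theta> = indicator {0..pi/2} \<theta> * h \<theta> x" for x \<theta>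
 have fm: "case_prod f \<in> borel_measurable (?P \<Otimes>\<^sub>M lborel)"
  unfolding f_def h_def Y_def case_prod_unfold by measurable
 have fi: "integrable (?P \<Otimes>\<^sub>M lborel) (case_prod f)"
 proof (rule Bochner_Integration.integrable_bound[OF _ fm])
  have [measurable]: "R \<in> borel_measurable ?P" using RP by auto
  show "integrable (?P \<Otimes>\<^sub>M lborel) (\<lambda>(x, \<theta>). R x * indicator {0..pi/2} \<theta>)"
  proof (rule PL.Fubini_integrable)
   show "integrable ?P (\<lambda>x. LINT \<theta>|lborel. norm (case (x, \<theta>) of (x, \<theta>) => R x * indicator {0..pi/2} \<theta>))"
    using RP by (simp add: abs_mult)
  qed auto
  show "AE z in ?P \<Otimes>\<^sub>M lborel. norm (case_prod f z) \<le> norm (case z of (x, \<theta>) => R x * indicator {0..pi/2} \<theta>)"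
   using hR by (intro AE_I2) (auto simp: f_def abs_mult indicator_def intro: order_trans[OF _ abs_ge_self])
 qed
 define H where "H \<theta> = (LINT x|?P. h \<theta> x)" for \<theta>
 define S where "S \<theta> = (\<Sum>j\<in>UNIV. \<Sum>i\<in>UNIV. LINT x|?P. (\<tau> i j (fst x) - cov N Z i j) * ddg i j (Y \<theta> x))" for \<theta>
 have gi: "integrable M (\<lambda>w. g (A w))"
  by (rule Bochner_Integration.integrable_bound[where f="\<lambda>w. \<bar>g 0\<bar> + K * (\<Sum>i\<in>UNIV. \<bar>A w $ i\<bar>)"])
    (use Ai C2_testD(11)[OF g] in \<open>auto intro!: AE_I2 order_trans[OF C2_testD(11)[OF g] abs_ge_self]\<close>)
 have gZ: "integrable N (\<lambda>w. g (Z w))"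
  by (rule Bochner_Integration.integrable_bound[where f="\<lambda>w. \<bar>g 0\<bar> + K * (\<Sum>i\<in>UNIV. \<bar>Z w $ i\<bar>)"])
    (use Zi C2_testD(11)[OF g] in \<open>auto intro!: AE_I2 order_trans[OF C2_testD(11)[OF g] abs_ge_self]\<close>)
 have "(LINT w|M. g (A w)) - (LINT w|N. g (Z w)) = (LINT x|?P. g (A (fst x)) - g (Z (snd x)))"
  using integral_pair_product[OF M N gi, of "\<lambda>_. 1"] integral_pair_product[OF M N _ gZ, of "\<lambda>_. 1"]
  by (simp add: M.prob_space N.prob_space)
 also have "\<dots> = (LINT x|?P. LINT \<theta>|lborel. f x \<theta>)" by (simp add: f_def ftc)
 also have "\<dots> = (LINT \<theta>|lborel. LINT x|?P. f x \<theta>)" by (rule PL.Fubini_integral[symmetric, OF fi])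
 also have "\<dots> = (LINT \<theta>|lborel. indicator {0..pi/2} \<theta> * H \<theta>)" by (simp add: f_def H_def)
 finally have diff: "(LINT w|M. g (A w)) - (LINT w|N. g (Z w)) = (LINT \<theta>|lborel. indicator {0..pi/2} \<theta> * H \<theta>)" .
 have Hi: "integrable lborel (\<lambda>\<theta>. indicator {0..pi/2} \<theta> * H \<theta>)"
  using PL.integrable_snd[OF fi] by (simp add: f_def H_def)
 \<comment> \<open>both integrations by parts; the Gaussian one carries the sign of the derivative of cosine\<close>
 have HS: "H \<theta> = sin \<theta> * cos \<theta> * S \<theta>" for \<theta>
 proof -
  have i1: "integrable ?P (\<lambda>x. A (fst x) $ j * dg j (Y \<theta> x))" "integrable ?P (\<lambda>x. Z (snd x) $ j * dg j (Y \<theta> x))"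
   "integrable ?P (\<lambda>x. \<tau> i j (fst x) * ddg i j (Y \<theta> x))" "integrable ?P (\<lambda>x. c * ddg i j (Y \<theta> x))" for i j c
   by (rule integrable_bounded_mult[OF AP _ C2_testD(3)[OF g]] integrable_bounded_mult[OF ZP _ C2_testD(3)[OF g]]
     integrable_bounded_mult[OF \<tau>P _ C2_testD(4)[OF g]] integrable_bounded_mult[OF _ _ C2_testD(4)[OF g]]; simp)+
  have EA: "(LINT x|?P. A (fst x) $ j * dg j (Y \<theta> x)) = sin \<theta> * (\<Sum>i\<in>UNIV. LINT x|?P. \<tau> i j (fst x) * ddg i j (Y \<theta> x))" (is "_ = ?R") for j
  proof -
   have "(LINT x|?P. A (fst x) $ j * dg j (Y \<theta> x)) = (LINT b|N. LINT a|M. A a $ j * dg j (sin \<theta> *\<^sub>R A a + cos \<theta> *\<^sub>R Z b))"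
    using MN.integral_snd[of "\<lambda>a b. A a $ j * dg j (Y \<theta> (a, b))"] i1(1)[of j] by (simp add: case_prod_unfold Y_def)
   also have "\<dots> = (LINT b|N. sin \<theta> * (\<Sum>i\<in>UNIV. LINT a|M. \<tau> i j a * ddg i j (sin \<theta> *\<^sub>R A a + cos \<theta> *\<^sub>R Z b)))"
    by (simp only: kernel)
   also have "\<dots> = sin \<theta> * (\<Sum>i\<in>UNIV. LINT b|N. LINT a|M. \<tau> i j a * ddg i j (sin \<theta> *\<^sub>R A a + cos \<theta> *\<^sub>R Z b))"
   proof -
    have "integrable N (\<lambda>b. LINT a|M. \<tau> i j a * ddg i j (sin \<theta> *\<^sub>R A a + cos \<theta> *\<^sub>R Z b))" for i
     using MN.integrable_snd[of "\<lambda>a b. \<tau> i j a * ddg i j (Y \<theta> (a, b))"] i1(3)[of i j] by (simp add: case_prod_unfold Y_def)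
    then show ?thesis by simp
   qed
   also have "\<dots> = ?R"
   proof -
    have e: "(LINT b|N. LINT a|M. \<tau> i j a * ddg i j (sin \<theta> *\<^sub>R A a + cos \<theta> *\<^sub>R Z b)) = (LINT x|?P. \<tau> i j (fst x) * ddg i j (Y \<theta> x))" for i
    using MN.integral_snd[of "\<lambda>a b. \<tau> i j a * ddg i j (Y \<theta> (a, b))"] i1(3)[of i j] by (simp add: case_prod_unfold Y_def)
    show ?thesis by (simp only: e)
   qed
   finally show ?thesis .
  qed
  have EZ: "(LINT x|?P. Z (snd x) $ j * dg j (Y \<theta> x)) = cos \<theta> * (\<Sum>i\<in>UNIV. LINT x|?P. cov N Z i j * ddg i j (Y \<theta> x))" (is "_ = ?R") for j
  proof -
   have inner: "(LINT b|N. Z b $ j * dg j (sin \<theta> *\<^sub>R A a + cos \<theta> *\<^sub>R Z b)) = cos \<theta> * (\<Sum>i\<in>UNIV. LINT b|N. cov N Z i j * ddg i j (sin \<theta> *\<^sub>R A a + cos \<theta> *\<^sub>R Z b))" for a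
   proof -
    have "(LINT b|N. Z b $ j * dg j (cos \<theta> *\<^sub>R Z b + sin \<theta> *\<^sub>R A a)) = (\<Sum>i\<in>UNIV. cov N Z i j * (LINT b|N. cos \<theta> * ddg i j (cos \<theta> *\<^sub>R Z b + sin \<theta> *\<^sub>R A a)))"
    proof (rule gaussian_vector_IBP[OF Z has_derivative_affine[OF C2_testD(2)[OF g]], where B="1 * K"])
     show "\<bar>cos \<theta> * ddg i j (cos \<theta> *\<^sub>R y + sin \<theta> *\<^sub>R A a)\<bar> \<le> 1 * K" for i y
      unfolding abs_mult by (intro mult_mono C2_testD(4)[OF g]) auto
    qed
    then show ?thesis by (simp add: sum_distrib_left add.commute mult_ac)
   qed
   have "(LINT x|?P. Z (snd x) $ j * dg j (Y \<theta> x)) = (LINT a|M. LINT b|N. Z b $ j * dg j (sin \<theta> *\<^sub>R A a + cos \<theta> *\<^sub>R Z b))"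
    using MN.integral_fst[of "\<lambda>a b. Z b $ j * dg j (Y \<theta> (a, b))"] i1(2)[of j] by (simp add: case_prod_unfold Y_def)
   also have "\<dots> = (LINT a|M. cos \<theta> * (\<Sum>i\<in>UNIV. LINT b|N. cov N Z i j * ddg i j (sin \<theta> *\<^sub>R A a + cos \<theta> *\<^sub>R Z b)))"
    by (simp only: inner)
   also have "\<dots> = cos \<theta> * (\<Sum>i\<in>UNIV. LINT a|M. LINT b|N. cov N Z i j * ddg i j (sin \<theta> *\<^sub>R A a + cos \<theta> *\<^sub>R Z b))"
   proof -
    have "integrable M (\<lambda>a. LINT b|N. cov N Z i j * ddg i j (sin \<theta> *\<^sub>R A a + cos \<theta> *\<^sub>R Z b))" for i
     using MN.integrable_fst[of "\<lambda>a b. cov N Z i j * ddg i j (Y \<theta> (a, b))"] i1(4)[of "cov N Z i j" i j] by (simp add: case_prod_unfold Y_def del: integral_mult_right_zero)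
    then show ?thesis by (simp del: integral_mult_right_zero add: integral_mult_right_zero[of M "cos \<theta>"])
   qed
   also have "\<dots> = ?R"
   proof -
    have e: "(LINT a|M. LINT b|N. cov N Z i j * ddg i j (sin \<theta> *\<^sub>R A a + cos \<theta> *\<^sub>R Z b)) = (LINT x|?P. cov N Z i j * ddg i j (Y \<theta> x))" for i
    using MN.integral_fst[of "\<lambda>a b. cov N Z i j * ddg i j (Y \<theta> (a, b))"] i1(4)[of "cov N Z i j" i j] by (simp add: case_prod_unfold Y_def del: integral_mult_right_zero)
    show ?thesis by (simp only: e)
   qed
   finally show ?thesis .
  qed
  have "H \<theta> = (LINT x|?P. (\<Sum>j\<in>UNIV. cos \<theta> * (A (fst x) $ j * dg j (Y \<theta> x)) - sin \<theta> * (Z (snd x) $ j * dg j (Y \<theta> x))))"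
   by (simp add: H_def h_def left_diff_distrib mult.assoc)
  also have "\<dots> = (\<Sum>j\<in>UNIV. cos \<theta> * (LINT x|?P. A (fst x) $ j * dg j (Y \<theta> x)) - sin \<theta> * (LINT x|?P. Z (snd x) $ j * dg j (Y \<theta> x)))"
   using i1(1,2) by simp
  also have "\<dots> = (\<Sum>j\<in>UNIV. sin \<theta> * cos \<theta> * ((\<Sum>i\<in>UNIV. LINT x|?P. \<tau> i j (fst x) * ddg i j (Y \<theta> x)) - (\<Sum>i\<in>UNIV. LINT x|?P. cov N Z i j * ddg i j (Y \<theta> x))))"
   unfolding EA EZ by (intro sum.cong refl) (simp only: right_diff_distrib mult_ac)
  also have "\<dots> = sin \<theta> * cos \<theta> * S \<theta>"
  proof -
   have "(LINT x|?P. (\<tau> i j (fst x) - cov N Z i j) * ddg i j (Y \<theta> x)) = (LINT x|?P. \<tau> i j (fst x) * ddg i j (Y \<theta> x)) - (LINT x|?P. cov N Z i j * ddg i j (Y \<theta> x))" for i j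
    unfolding left_diff_distrib by (intro Bochner_Integration.integral_diff i1)
   then show ?thesis by (simp only: S_def sum_subtractf sum_distrib_left[symmetric])
  qed
  finally show ?thesis .
 qed
 define L where "L \<theta> = sin \<theta> * cos \<theta> * (\<alpha> + \<beta> * sin \<theta>)" for \<theta>
 have "has_bochner_integral lborel (\<lambda>\<theta>. indicator {0..pi/2} \<theta> *\<^sub>R L \<theta>)
   ((\<alpha> / 2 * sin (pi/2) ^ 2 + \<beta> / 3 * sin (pi/2) ^ 3) - (\<alpha> / 2 * sin 0 ^ 2 + \<beta> / 3 * sin 0 ^ 3))"
 proof (rule has_bochner_integral_FTC_Icc)
  fix \<theta> :: real
  have "((\<lambda>\<theta>. \<alpha> / 2 * sin \<theta> ^ 2 + \<beta> / 3 * sin \<theta> ^ 3) has_real_derivative L \<theta>) (at \<theta> within {0..pi/2})"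
   by (auto intro!: derivative_eq_intros simp: L_def power2_eq_square algebra_simps)
  then show "((\<lambda>\<theta>. \<alpha> / 2 * sin \<theta> ^ 2 + \<beta> / 3 * sin \<theta> ^ 3) has_vector_derivative L \<theta>) (at \<theta> within {0..pi/2})"
   by (simp add: has_real_derivative_iff_has_vector_derivative)
  show "continuous_on {0..pi/2} L" unfolding L_def by (intro continuous_intros)
 qed auto
 then have L: "integrable lborel (\<lambda>\<theta>. indicator {0..pi/2} \<theta> * L \<theta>)" "(LINT \<theta>|lborel. indicator {0..pi/2} \<theta> * L \<theta>) = \<alpha> / 2 + \<beta> / 3"
  by (simp_all add: has_bochner_integral_iff)
 have "\<bar>(LINT w|M. g (A w)) - (LINT w|N. g (Z w)) - (\<alpha> / 2 + \<beta> / 3)\<bar> = \<bar>LINT \<theta>|lborel. indicator {0..pi/2} \<theta> * H \<theta> - indicator {0..pi/2} \<theta> * L \<theta>\<bar>"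
  using diff L Hi by simp
 also have "\<dots> \<le> (LINT \<theta>|lborel. \<bar>indicator {0..pi/2} \<theta> * H \<theta> - indicator {0..pi/2} \<theta> * L \<theta>\<bar>)" by (rule integral_abs_bound)
 also have "\<dots> \<le> (LINT \<theta>|lborel. \<epsilon> * indicator {0..pi/2} \<theta>)"
 proof (rule integral_mono)
  show "integrable lborel (\<lambda>\<theta>. \<bar>indicator {0..pi/2} \<theta> * H \<theta> - indicator {0..pi/2} \<theta> * L \<theta>\<bar>)" using Hi L by simp
  show "integrable lborel (\<lambda>\<theta>. \<epsilon> * indicator {0..pi/2} \<theta>)" by simp
  fix \<theta> :: real
  have "\<bar>H \<theta> - L \<theta>\<bar> \<le> \<epsilon>" if "\<theta> \<in> {0..pi/2}"
  proof -
   have "H \<theta> - L \<theta> = (sin \<theta> * cos \<theta>) * (S \<theta> - (\<alpha> + \<beta> * sin \<theta>))" by (simp add: HS L_def algebra_simps)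
   then have "\<bar>H \<theta> - L \<theta>\<bar> = (\<bar>sin \<theta>\<bar> * \<bar>cos \<theta>\<bar>) * \<bar>S \<theta> - (\<alpha> + \<beta> * sin \<theta>)\<bar>" by (simp add: abs_mult)
   also have "\<dots> \<le> (1 * 1) * \<epsilon>"
    using bound[of \<theta>] that by (intro mult_mono) (auto simp: S_def Y_def)
   finally show ?thesis by simp
  qed
  then show "\<bar>indicator {0..pi/2} \<theta> * H \<theta> - indicator {0..pi/2} \<theta> * L \<theta>\<bar> \<le> \<epsilon> * indicator {0..pi/2} \<theta>"
   by (auto simp: indicator_def)
 qed
 also have "\<dots> = \<epsilon> * (pi / 2)" by simp
 also have "\<dots> \<le> 2 * \<epsilon>" using \<epsilon>0 pi_less_4 mult_left_mono[of "pi/2" 2 \<epsilon>] by simp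
 finally show ?thesis .
qed

section \<open>Test functions with three bounded derivatives\<close>

text \<open>\<open>D3 k i j\<close> is the derivative of \<open>D2 i j\<close> in direction \<open>k\<close>. The symmetries hold automatically for
 iterated partial derivatives, by \<open>partials_commute\<close>.\<close>

definition C3_test :: "(real^'d::finite => real) => ('d => real^'d => real) => ('d => 'd => real^'d => real) =>
  ('d => 'd => 'd => real^'d => real) => real => bool" where
 "C3_test g D1 D2 D3 K \<longleftrightarrow> C2_test g D1 D2 K \<and>
   (\<forall>i j y. (D2 i j has_derivative (\<lambda>v. \<Sum>k\<in>UNIV. v $ k * D3 k i j y)) (at y)) \<and>
   (\<forall>k i j y. \<bar>D3 k i j y\<bar> \<le> K) \<and>
   (\<forall>k i j y. D3 k i j y = D3 i k j y) \<and> (\<forall>k i j y. D3 k i j y = D3 k j i y)"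

lemma C3_testD:
 assumes "C3_test g D1 D2 D3 K"
 shows "C2_test g D1 D2 K" "(D2 i j has_derivative (\<lambda>v. \<Sum>k\<in>UNIV. v $ k * D3 k i j y)) (at y)"
  "\<bar>D3 k i j y\<bar> \<le> K" "\<bar>D2 i j y\<bar> \<le> K" "0 \<le> K"
  "D2 i j \<in> borel_measurable borel" "D3 k i j \<in> borel_measurable borel"
  "\<bar>D2 i j y - D2 i j z\<bar> \<le> K * (\<Sum>i\<in>UNIV. \<bar>y $ i - z $ i\<bar>)"
proof -
 show C2: "C2_test g D1 D2 K" and d: "(D2 i j has_derivative (\<lambda>v. \<Sum>k\<in>UNIV. v $ k * D3 k i j y)) (at y)"
  and b: "\<bar>D3 k i j y\<bar> \<le> K" for i j k y using assms by (simp_all add: C3_test_def)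
 show "\<bar>D2 i j y\<bar> \<le> K" "0 \<le> K" "D2 i j \<in> borel_measurable borel"
  using C2_testD(4,5,10)[OF C2] by auto
 show "D3 k i j \<in> borel_measurable borel" by (rule partials_measurable[OF d])
 show "\<bar>D2 i j y - D2 i j z\<bar> \<le> K * (\<Sum>i\<in>UNIV. \<bar>y $ i - z $ i\<bar>)"
  by (rule bounded_partials_Lipschitz[OF d b])
qed

lemma C3_test_partials:
 fixes g :: "real^'d::finite => real"
 assumes t: "three_times_differentiable g" and b: "bounded_derivatives3 g"
 shows "\<exists>K. C3_test g (\<lambda>i. partial i g) (\<lambda>i j. partial i (partial j g)) (\<lambda>k i j. partial k (partial i (partial j g))) K"
proof -
 have d: "g differentiable (at x)" "partial i g differentiable (at x)" "partial i (partial j g) differentiable (at x)" for i j x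
  using t by (auto simp: three_times_differentiable_def)
 define S where "S = (\<Union>i. range (partial i g)) \<union> (\<Union>i. \<Union>j. range (partial i (partial j g))) \<union>
   (\<Union>i. \<Union>j. \<Union>k. range (partial i (partial j (partial k g))))"
 have "bounded S" unfolding S_def
  by (intro bounded_Un[THEN iffD2] conjI bounded_UN ballI finite_UNIV) (use b in \<open>auto simp: bounded_derivatives3_def\<close>)
 then obtain K where K: "\<And>y. y \<in> S ==> \<bar>y\<bar> \<le> K" unfolding bounded_iff by auto
 have K1: "\<bar>partial i g y\<bar> \<le> K" "\<bar>partial i (partial j g) y\<bar> \<le> K" "\<bar>partial k (partial i (partial j g)) y\<bar> \<le> K" for i j k y
 proof -
  have m: "partial i g y \<in> S" "partial i (partial j g) y \<in> S" "partial k (partial i (partial j g)) y \<in> S"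
   unfolding S_def by (rule UnI1, rule UnI1, rule UN_I, rule UNIV_I, rule rangeI)
    (rule UnI1, rule UnI2, rule UN_I, rule UNIV_I, rule UN_I, rule UNIV_I, rule rangeI,
     rule UnI2, rule UN_I, rule UNIV_I, rule UN_I, rule UNIV_I, rule UN_I, rule UNIV_I, rule rangeI)
  show "\<bar>partial i g y\<bar> \<le> K" "\<bar>partial i (partial j g) y\<bar> \<le> K" "\<bar>partial k (partial i (partial j g)) y\<bar> \<le> K"
   by (rule K[OF m(1)] K[OF m(2)] K[OF m(3)])+
 qed
 have s: "partial i (partial j g) = partial j (partial i g)" for i j
  by (rule ext) (rule partials_commute[OF d(1,2)])
 have "C3_test g (\<lambda>i. partial i g) (\<lambda>i j. partial i (partial j g)) (\<lambda>k i j. partial k (partial i (partial j g))) K"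
  unfolding C3_test_def C2_test_def
 proof (intro conjI allI)
  show "partial k (partial i (partial j g)) y = partial i (partial k (partial j g)) y" for k i j y
   by (rule partials_commute[OF d(2,3)])
  show "partial k (partial i (partial j g)) y = partial k (partial j (partial i g)) y" for k i j y
   by (simp only: s[of i j])
 qed (rule has_derivative_partials d K1)+
 then show ?thesis by blast
qed

section \<open>Comparing Gaussian vectors with close covariances\<close>

definition covm :: "'b measure => ('b => real^'d::finite) => real^'d^'d" where
 "covm N Z = (\<chi> i j. cov N Z i j)"

definition cov_dist :: "'a measure => ('a => real^'d::finite) => 'b measure => ('b => real^'d) => real" where
 "cov_dist M A N Z = (\<Sum>j\<in>UNIV. \<Sum>i\<in>UNIV. \<bar>cov M A i j - cov N Z i j\<bar>)"

lemma cov_dist_nonneg: "0 \<le> cov_dist M A N Z" by (simp add: cov_dist_def sum_nonneg)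

lemma cov_sym: "cov N Z i j = cov N Z j i" by (simp add: cov_def mult.commute)

lemma transpose_covm: "transpose (covm N Z) = covm N Z"
 by (simp add: covm_def transpose_def vec_eq_iff cov_sym[of N Z])

lemma inner_symmetric_matrix:
 fixes C :: "real^'d::finite^'d"
 assumes "transpose C = C" shows "x \<bullet> (C *v y) = (C *v x) \<bullet> y"
 by (metis assms dot_lmul_matrix vector_transpose_matrix)

lemma gaussian_second_moment_matrix:
 assumes "gaussian_vector N (Z :: 'b => real^'d::finite)"
 shows "(LINT w|N. (s \<bullet> Z w) * (t \<bullet> Z w)) = s \<bullet> (covm N Z *v t)"
proof -
 have "s $ i * t $ j * cov N Z i j = s $ i * (cov N Z i j * t $ j)" for i j by simp
 then have "(\<Sum>i\<in>UNIV. \<Sum>j\<in>UNIV. s $ i * t $ j * cov N Z i j) = s \<bullet> (covm N Z *v t)"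
  by (simp only: inner_vec_sum matrix_vector_mult_def covm_def vec_lambda_beta sum_distrib_left)
 then show ?thesis unfolding gaussian_vector_second_moment[OF assms] .
qed

lemma prob_abs_integral_le:
 assumes "prob_space P" and "\<And>x. \<bar>f x\<bar> \<le> (K :: real)"
 shows "\<bar>LINT x|P. f x\<bar> \<le> K"
proof -
 interpret prob_space P by fact
 have "0 \<le> K" using assms(2)[of undefined] by linarith
 then show ?thesis
 proof (cases "integrable P f")
  case True
  have "\<bar>LINT x|P. f x\<bar> \<le> (LINT x|P. \<bar>f x\<bar>)" by (rule integral_abs_bound)
  also have "\<dots> \<le> (LINT x|P. K)" using True assms(2) by (intro integral_mono) auto
  finally show ?thesis by (simp add: prob_space)
 qed (simp add: not_integrable_integral_eq)
qed

lemma integral_norm_le_integral: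
 fixes f g :: "'a => real"
 assumes "integrable M f" "integrable M g" "\<And>x. norm (f x) \<le> g x"
 shows "norm (LINT x|M. f x) \<le> (LINT x|M. g x)"
 by (rule order_trans[OF integral_norm_bound]) (intro integral_mono integrable_norm assms)

text \<open>A Gaussian vector has its covariance matrix as a constant Stein kernel.\<close>

lemma gaussian_kernel:
 fixes A :: "'b => real^'d::finite"
 assumes A: "gaussian_vector M A" and g: "C2_test g dg ddg K"
 shows "(LINT w|M. A w $ j * dg j (s *\<^sub>R A w + z)) = s * (\<Sum>i\<in>UNIV. LINT w|M. cov M A i j * ddg i j (s *\<^sub>R A w + z))"
proof -
 have "(LINT w|M. A w $ j * dg j (s *\<^sub>R A w + z)) = (\<Sum>i\<in>UNIV. cov M A i j * (LINT w|M. s * ddg i j (s *\<^sub>R A w + z)))"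
 proof (rule gaussian_vector_IBP[OF A has_derivative_affine[OF C2_testD(2)[OF g]], where B="\<bar>s\<bar> * K"])
  show "\<bar>s * ddg i j (s *\<^sub>R y + z)\<bar> \<le> \<bar>s\<bar> * K" for i y
   unfolding abs_mult by (intro mult_left_mono C2_testD(4)[OF g]) auto
 qed
 then show ?thesis by (simp add: sum_distrib_left mult_ac)
qed

lemma gaussian_vectorD:
 assumes "gaussian_vector N (Z :: 'b => real^'d::finite)"
 shows "prob_space N" "Z \<in> borel_measurable N" "integrable N (\<lambda>w. Z w $ i)"
 using assms all_moments_integrable[OF gaussian_vector_moments(1)[OF assms]]
 by (auto simp: gaussian_vector_def)

text \<open>Interpolation with a constant kernel, where the sum in \<open>interpolation_bound\<close> is small because the
 covariances are close.\<close>

lemma gaussian_compare_C2: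
 fixes A :: "'a => real^'d::finite" and Z :: "'b => real^'d"
 assumes A: "gaussian_vector M A" and Z: "gaussian_vector N Z" and g: "C2_test g dg ddg K"
 shows "\<bar>(LINT w|M. g (A w)) - (LINT w|N. g (Z w))\<bar> \<le> 2 * (K * cov_dist M A N Z)"
proof -
 interpret M: prob_space M by (rule gaussian_vectorD[OF A])
 interpret N: prob_space N by (rule gaussian_vectorD[OF Z])
 interpret MN: pair_prob_space M N ..
 have "\<bar>(LINT w|M. g (A w)) - (LINT w|N. g (Z w)) - (0 / 2 + 0 / 3)\<bar> \<le> 2 * (K * cov_dist M A N Z)"
 proof (rule interpolation_bound[OF gaussian_vectorD[OF A] Z g _ gaussian_kernel[OF A g]])
  fix \<theta> :: real
  have "\<bar>\<Sum>j\<in>UNIV. \<Sum>i\<in>UNIV. LINT x|(M \<Otimes>\<^sub>M N). (cov M A i j - cov N Z i j) *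
    ddg i j (sin \<theta> *\<^sub>R A (fst x) + cos \<theta> *\<^sub>R Z (snd x))\<bar> \<le> (\<Sum>j\<in>UNIV. \<Sum>i\<in>UNIV. \<bar>cov M A i j - cov N Z i j\<bar> * K)"
  proof (intro order_trans[OF sum_abs] sum_mono)
   fix i j
   show "\<bar>LINT x|(M \<Otimes>\<^sub>M N). (cov M A i j - cov N Z i j) * ddg i j (sin \<theta> *\<^sub>R A (fst x) + cos \<theta> *\<^sub>R Z (snd x))\<bar>
     \<le> \<bar>cov M A i j - cov N Z i j\<bar> * K"
    unfolding integral_mult_right_zero abs_mult
    by (intro mult_left_mono prob_abs_integral_le MN.prob_space_axioms C2_testD(4)[OF g]) auto
  qed
  then show "\<bar>(\<Sum>j\<in>UNIV. \<Sum>i\<in>UNIV. LINT x|(M \<Otimes>\<^sub>M N). (cov M A i j - cov N Z i j) *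
    ddg i j (sin \<theta> *\<^sub>R A (fst x) + cos \<theta> *\<^sub>R Z (snd x))) - (0 + 0 * sin \<theta>)\<bar> \<le> K * cov_dist M A N Z"
   by (simp add: cov_dist_def sum_distrib_left mult.commute)
 qed simp
 then show ?thesis by simp
qed

lemma has_derivative_difference_quotient:
 fixes f :: "real^'d::finite => real"
 assumes f: "\<And>y. (f has_derivative (\<lambda>v. \<Sum>i\<in>UNIV. v $ i * df i y)) (at y)"
 shows "((\<lambda>x. c * (f (x + v) - f (x + w))) has_derivative
   (\<lambda>u. \<Sum>i\<in>UNIV. u $ i * (c * (df i (y + v) - df i (y + w))))) (at y)"
proof -
 have sh: "((\<lambda>x. f (x + v)) has_derivative (\<lambda>u. \<Sum>i\<in>UNIV. u $ i * df i (y + v))) (at y)" for v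
  using has_derivative_affine[OF f, where s=1 and w=v and y=y] by simp
 have "((\<lambda>x. c * (f (x + v) - f (x + w))) has_derivative
   (\<lambda>u. c * ((\<Sum>i\<in>UNIV. u $ i * df i (y + v)) - (\<Sum>i\<in>UNIV. u $ i * df i (y + w))))) (at y)"
  by (intro has_derivative_mult_right has_derivative_diff sh)
 also have "(\<lambda>u. c * ((\<Sum>i\<in>UNIV. u $ i * df i (y + v)) - (\<Sum>i\<in>UNIV. u $ i * df i (y + w)))) =
   (\<lambda>u. \<Sum>i\<in>UNIV. u $ i * (c * (df i (y + v) - df i (y + w))))"
  by (rule ext) (simp add: sum_distrib_left sum_subtractf[symmetric] algebra_simps)
 finally show ?thesis .
qed

text \<open>Second derivatives of a function with three bounded derivatives are not themselves test functions for the
 comparison of Gaussian vectors. Difference quotients of first derivatives are, at the price of a factor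
 \<open>1 / \<delta>\<close> in the bounds, and approximate them to order \<open>\<delta>\<close>.\<close>

lemma C3_difference_quotient:
 fixes g :: "real^'d::finite => real"
 assumes g: "C3_test g D1 D2 D3 K" and \<delta>: "\<delta> > 0"
 shows "C2_test (\<lambda>x. (1 / \<delta>) * (D1 j (x + (u + \<delta> *\<^sub>R axis i 1)) - D1 j (x + u)))
   (\<lambda>k x. (1 / \<delta>) * (D2 k j (x + (u + \<delta> *\<^sub>R axis i 1)) - D2 k j (x + u)))
   (\<lambda>l k x. (1 / \<delta>) * (D3 l k j (x + (u + \<delta> *\<^sub>R axis i 1)) - D3 l k j (x + u))) (2 * K / \<delta>)"
  and "\<bar>D2 i j (x + u) - (1 / \<delta>) * (D1 j (x + (u + \<delta> *\<^sub>R axis i 1)) - D1 j (x + u))\<bar> \<le> K * \<delta>"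
proof -
 note C2 = C3_testD(1)[OF g]
 have b: "\<bar>(1 / \<delta>) * (a - b)\<bar> \<le> 2 * K / \<delta>" if "\<bar>a\<bar> \<le> K" "\<bar>b\<bar> \<le> K" for a b
  using that \<delta> by (simp add: abs_mult divide_right_mono)
 show "C2_test (\<lambda>x. (1 / \<delta>) * (D1 j (x + (u + \<delta> *\<^sub>R axis i 1)) - D1 j (x + u)))
   (\<lambda>k x. (1 / \<delta>) * (D2 k j (x + (u + \<delta> *\<^sub>R axis i 1)) - D2 k j (x + u)))
   (\<lambda>l k x. (1 / \<delta>) * (D3 l k j (x + (u + \<delta> *\<^sub>R axis i 1)) - D3 l k j (x + u))) (2 * K / \<delta>)"
  unfolding C2_test_def
  by (intro conjI allI has_derivative_difference_quotient b C2_testD(2,4)[OF C2] C3_testD(2,3)[OF g])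
 obtain \<xi> where xi: "0 < \<xi>" "\<xi> < \<delta>" "D1 j (x + u + \<delta> *\<^sub>R axis i 1) - D1 j (x + u + 0 *\<^sub>R axis i 1) = (\<delta> - 0) * D2 i j (x + u + \<xi> *\<^sub>R axis i 1)"
  using MVT2[OF \<delta> DERIV_along_axis[OF C2_testD(2)[OF C2]]] by blast
 have e: "(1 / \<delta>) * (D1 j (x + (u + \<delta> *\<^sub>R axis i 1)) - D1 j (x + u)) = D2 i j (x + u + \<xi> *\<^sub>R axis i 1)"
  using xi(3) \<delta> by (simp add: add.assoc)
 have "\<bar>D2 i j (x + u) - D2 i j (x + u + \<xi> *\<^sub>R axis i 1)\<bar> \<le> K * (\<Sum>k\<in>UNIV. \<bar>(x + u) $ k - (x + u + \<xi> *\<^sub>R axis i 1) $ k\<bar>)"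
  by (rule C3_testD(8)[OF g])
 also have "(\<Sum>k\<in>UNIV. \<bar>(x + u) $ k - (x + u + \<xi> *\<^sub>R axis i 1) $ k\<bar>) = (\<Sum>k\<in>UNIV. if k = i then \<xi> else 0)"
  by (intro sum.cong) (use xi(1) in \<open>auto simp: axis_def\<close>)
 also have "K * \<dots> \<le> K * \<delta>" using xi C3_testD(5)[OF g] by (simp add: mult_left_mono)
 finally show "\<bar>D2 i j (x + u) - (1 / \<delta>) * (D1 j (x + (u + \<delta> *\<^sub>R axis i 1)) - D1 j (x + u))\<bar> \<le> K * \<delta>"
  unfolding e .
qed

text \<open>The approximation error \<open>2 K \<delta>\<close> and the comparison error \<open>4 K s / \<delta>\<close> balance at \<open>\<delta> = sqrt s\<close>, \<open>s\<close> being the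
 distance of the covariances. For \<open>s = 0\<close> the laws coincide.\<close>

lemma gaussian_compare_D2:
 fixes A :: "'a => real^'d::finite" and Z :: "'b => real^'d"
 assumes A: "gaussian_vector M A" and Z: "gaussian_vector N Z" and g: "C3_test g D1 D2 D3 K"
 shows "\<bar>(LINT w|M. D2 i j (A w + u)) - (LINT w|N. D2 i j (Z w + u))\<bar> \<le> 6 * K * sqrt (cov_dist M A N Z)"
proof (cases "cov_dist M A N Z = 0")
 case True
 then have "cov M A i j = cov N Z i j" for i j
  by (simp add: cov_dist_def sum_nonneg sum_nonneg_eq_0_iff)
 note C3_testD(6)[OF g, measurable]
 have "(LINT w|M. D2 i j (A w + u)) = (LINT w|N. D2 i j (Z w + u))"
  by (rule gaussian_vector_unique[OF A Z \<open>\<And>i j. cov M A i j = cov N Z i j\<close>]) measurable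
 then show ?thesis using True by simp
next
 case False
 define s where "s = cov_dist M A N Z"
 define \<delta> where "\<delta> = sqrt s"
 have s: "s > 0" using False cov_dist_nonneg[of M A N Z] by (simp add: s_def)
 then have \<delta>: "\<delta> > 0" "\<delta> * \<delta> = s" by (simp_all add: \<delta>_def)
 define h where "h x = (1 / \<delta>) * (D1 j (x + (u + \<delta> *\<^sub>R axis i 1)) - D1 j (x + u))" for x
 note q = C3_difference_quotient[OF g \<delta>(1), where j=j and u=u and i=i, folded h_def]
 have app: "\<bar>(LINT w|P. D2 i j (V w + u)) - (LINT w|P. h (V w))\<bar> \<le> K * \<delta>" if V: "gaussian_vector P V" for P and V :: "'c => real^'d"
 proof -
  interpret prob_space P by (rule gaussian_vectorD[OF V])
  note [measurable] = gaussian_vectorD(2)[OF V] C3_testD(6)[OF g] C2_testD(8)[OF q(1)]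
  have i1: "integrable P (\<lambda>w. D2 i j (V w + u))" by (rule integrable_const_bound[where B=K]) (simp_all add: C3_testD(4)[OF g])
  have i2: "integrable P (\<lambda>w. h (V w))"
  proof (rule integrable_const_bound[where B="K + K * \<delta>"])
   have "\<bar>h x\<bar> \<le> K + K * \<delta>" for x using q(2)[of x] C3_testD(4)[OF g, of i j "x + u"] by linarith
   then show "AE w in P. norm (h (V w)) \<le> K + K * \<delta>" by simp
  qed measurable
  have "(LINT w|P. D2 i j (V w + u)) - (LINT w|P. h (V w)) = (LINT w|P. D2 i j (V w + u) - h (V w))" using i1 i2 by simp
  then show ?thesis using prob_abs_integral_le[OF prob_space_axioms q(2)[of "V _"]] by simp
 qed
 have "\<bar>(LINT w|M. h (A w)) - (LINT w|N. h (Z w))\<bar> \<le> 2 * ((2 * K / \<delta>) * s)"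
  unfolding s_def by (rule gaussian_compare_C2[OF A Z q(1)])
 also have "\<dots> = 4 * K * \<delta>" using \<delta> by (simp add: field_simps)
 finally have "\<bar>(LINT w|M. D2 i j (A w + u)) - (LINT w|N. D2 i j (Z w + u))\<bar> \<le> 6 * K * \<delta>"
  using app[OF A] app[OF Z] by linarith
 then show ?thesis by (simp add: \<delta>_def s_def)
qed

text \<open>Along the interpolation the covariance stays as close to that of \<open>Z\<close> as at the end point, so each
 \<open>E[\<partial>\<^sub>i\<^sub>j g(Y \<theta>)]\<close> may be replaced by its value at \<open>Z\<close> with an error of order \<open>sqrt s\<close>.\<close>

lemma gaussian_compare_expansion:
 fixes A :: "'a => real^'d::finite" and Z :: "'b => real^'d"
 assumes A: "gaussian_vector M A" and Z: "gaussian_vector N Z" and g: "C3_test g D1 D2 D3 K"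
 shows "\<bar>(LINT w|M. g (A w)) - (LINT w|N. g (Z w)) -
    (\<Sum>j\<in>UNIV. \<Sum>i\<in>UNIV. (cov M A i j - cov N Z i j) * (LINT w|N. D2 i j (Z w))) / 2\<bar>
  \<le> 12 * K * sqrt (cov_dist M A N Z) * cov_dist M A N Z"
proof -
 interpret M: prob_space M by (rule gaussian_vectorD[OF A])
 interpret N: prob_space N by (rule gaussian_vectorD[OF Z])
 interpret MN: pair_prob_space M N ..
 define s where "s = cov_dist M A N Z"
 define \<alpha> where "\<alpha> = (\<Sum>j\<in>UNIV. \<Sum>i\<in>UNIV. (cov M A i j - cov N Z i j) * (LINT w|N. D2 i j (Z w)))"
 note C2 = C3_testD(1)[OF g]
 have "\<bar>(LINT w|M. g (A w)) - (LINT w|N. g (Z w)) - (\<alpha> / 2 + 0 / 3)\<bar> \<le> 2 * (6 * K * sqrt s * s)"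
 proof (rule interpolation_bound[OF gaussian_vectorD[OF A] Z C2 _ gaussian_kernel[OF A C2]])
  fix \<theta> :: real
  define Y where "Y x = sin \<theta> *\<^sub>R A (fst x) + cos \<theta> *\<^sub>R Z (snd x)" for x
  note Yg = gaussian_vector_combination(1)[OF A Z, of "sin \<theta>" "cos \<theta>", folded Y_def]
  note Yc = gaussian_vector_combination(2)[OF A Z, of "sin \<theta>" "cos \<theta>", folded Y_def]
  have "cov (M \<Otimes>\<^sub>M N) Y i j - cov N Z i j = (sin \<theta>)\<^sup>2 * (cov M A i j - cov N Z i j)" for i j
   unfolding Yc cos_squared_eq by (simp add: algebra_simps)
  then have "cov_dist (M \<Otimes>\<^sub>M N) Y N Z = (sin \<theta>)\<^sup>2 * s"
   by (simp add: cov_dist_def s_def abs_mult sum_distrib_left)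
  also have "\<dots> \<le> 1 * s" unfolding s_def by (intro mult_right_mono cov_dist_nonneg) (simp add: sin_squared_eq)
  finally have cd: "sqrt (cov_dist (M \<Otimes>\<^sub>M N) Y N Z) \<le> sqrt s" by simp
  have "\<bar>(LINT x|(M \<Otimes>\<^sub>M N). D2 i j (Y x)) - (LINT w|N. D2 i j (Z w))\<bar> \<le> 6 * K * sqrt s" for i j
  proof -
   have "\<bar>(LINT x|(M \<Otimes>\<^sub>M N). D2 i j (Y x)) - (LINT w|N. D2 i j (Z w))\<bar> \<le> 6 * K * sqrt (cov_dist (M \<Otimes>\<^sub>M N) Y N Z)"
    using gaussian_compare_D2[OF Yg Z g, of i j 0] by simp
   also have "\<dots> \<le> 6 * K * sqrt s" using C3_testD(5)[OF g] by (intro mult_left_mono cd) simp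
   finally show ?thesis .
  qed
  then have "\<bar>\<Sum>j\<in>UNIV. \<Sum>i\<in>UNIV. (cov M A i j - cov N Z i j) * ((LINT x|(M \<Otimes>\<^sub>M N). D2 i j (Y x)) - (LINT w|N. D2 i j (Z w)))\<bar>
    \<le> (\<Sum>j\<in>UNIV. \<Sum>i\<in>UNIV. \<bar>cov M A i j - cov N Z i j\<bar> * (6 * K * sqrt s))"
   by (intro order_trans[OF sum_abs] sum_mono) (simp add: abs_mult mult_left_mono)
  also have "\<dots> = 6 * K * sqrt s * s"
  proof -
   have "(\<Sum>j\<in>UNIV. \<Sum>i\<in>UNIV. \<bar>cov M A i j - cov N Z i j\<bar> * L) = L * s" for L
    by (simp add: s_def cov_dist_def sum_distrib_left mult.commute)
   then show ?thesis .
  qed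
  finally show "\<bar>(\<Sum>j\<in>UNIV. \<Sum>i\<in>UNIV. LINT x|(M \<Otimes>\<^sub>M N). (cov M A i j - cov N Z i j) *
    D2 i j (sin \<theta> *\<^sub>R A (fst x) + cos \<theta> *\<^sub>R Z (snd x))) - (\<alpha> + 0 * sin \<theta>)\<bar> \<le> 6 * K * sqrt s * s"
   by (simp add: \<alpha>_def Y_def right_diff_distrib sum_subtractf)
 qed simp
 then show ?thesis by (simp add: \<alpha>_def s_def)
qed

section \<open>Continuity of third-order terms in the covariance\<close>

lemma tendsto_of_uniform_approximation:
 fixes T :: "nat => real"
 assumes U: "\<And>\<delta>. \<delta> > 0 ==> (\<lambda>n. U \<delta> n) \<longlonglongrightarrow> v \<delta>"
  and T: "\<And>\<delta> n. \<delta> > 0 ==> \<bar>T n - U \<delta> n\<bar> \<le> R * \<delta>" and T0: "\<And>\<delta>. \<delta> > 0 ==> \<bar>T0 - v \<delta>\<bar> \<le> R * \<delta>"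
 shows "T \<longlonglongrightarrow> T0"
proof (rule LIMSEQ_I)
 fix e :: real assume e: "e > 0"
 define \<delta> where "\<delta> = (e / 3) / (\<bar>R\<bar> + 1)"
 have R1: "\<bar>R\<bar> + 1 \<noteq> 0" by linarith
 have \<delta>: "\<delta> > 0" using e by (simp add: \<delta>_def add_nonneg_pos)
 have "R * \<delta> \<le> \<bar>R\<bar> * \<delta>" using \<delta> by (intro mult_right_mono) auto
 also have "\<dots> < (\<bar>R\<bar> + 1) * \<delta>" using \<delta> by (intro mult_strict_right_mono) auto
 also have "\<dots> = e / 3" unfolding \<delta>_def times_divide_eq_right[symmetric] using R1 by (metis nonzero_mult_div_cancel_left times_divide_eq_right)
 finally have R: "R * \<delta> < e / 3" .
 obtain n0 where n0: "\<And>n. n \<ge> n0 ==> norm (U \<delta> n - v \<delta>) < e / 3"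
  using LIMSEQ_D[OF U[OF \<delta>], of "e / 3"] e by auto
 have "norm (T n - T0) < e" if "n \<ge> n0" for n
  using n0[OF that] T[OF \<delta>, of n] T0[OF \<delta>] R unfolding real_norm_def by linarith
 then show "\<exists>no. \<forall>n\<ge>no. norm (T n - T0) < e" by blast
qed

lemma cov_dist_tendsto_0:
 fixes A :: "nat => 'a => real^'d::finite"
 assumes "\<And>i j. (\<lambda>n. cov (N n) (A n) i j) \<longlonglongrightarrow> cov N' Z i j"
 shows "(\<lambda>n. cov_dist (N n) (A n) N' Z) \<longlonglongrightarrow> 0"
proof -
 have "(\<lambda>n. cov_dist (N n) (A n) N' Z) \<longlonglongrightarrow> (\<Sum>j\<in>UNIV. \<Sum>i\<in>UNIV. \<bar>cov N' Z i j - cov N' Z i j\<bar>)"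
  unfolding cov_dist_def by (intro tendsto_intros assms)
 then show ?thesis by simp
qed

context
 fixes N :: "nat => 'a measure" and A :: "nat => 'a => real^'d::finite" and N' :: "'b measure" and Z :: "'b => real^'d"
  and g :: "real^'d => real" and D1 D2 D3 and K :: real
 assumes A: "\<And>n. gaussian_vector (N n) (A n)" and Z: "gaussian_vector N' Z"
  and lim: "\<And>i j. (\<lambda>n. cov (N n) (A n) i j) \<longlonglongrightarrow> cov N' Z i j"
  and g: "C3_test g D1 D2 D3 K"
begin

lemma D2_expectation_tendsto: "(\<lambda>n. LINT w|N n. D2 i j (A n w + u)) \<longlonglongrightarrow> (LINT w|N'. D2 i j (Z w + u))"
proof (rule LIM_zero_cancel, rule Lim_null_comparison)
 show "\<forall>\<^sub>F n in sequentially. norm ((LINT w|N n. D2 i j (A n w + u)) - (LINT w|N'. D2 i j (Z w + u))) \<le> 6 * K * sqrt (cov_dist (N n) (A n) N' Z)"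
  using gaussian_compare_D2[OF A Z g] by simp
 have "(\<lambda>n. 6 * K * sqrt (cov_dist (N n) (A n) N' Z)) \<longlonglongrightarrow> 6 * K * sqrt 0"
  by (intro tendsto_intros cov_dist_tendsto_0 lim)
 then show "(\<lambda>n. 6 * K * sqrt (cov_dist (N n) (A n) N' Z)) \<longlonglongrightarrow> 0" by simp
qed

lemma second_moment_tendsto: "(\<lambda>n. LINT w|N n. (s \<bullet> A n w) * (t \<bullet> A n w)) \<longlonglongrightarrow> (LINT w|N'. (s \<bullet> Z w) * (t \<bullet> Z w))"
 unfolding gaussian_vector_second_moment[OF A] gaussian_vector_second_moment[OF Z] by (intro tendsto_intros lim)

text \<open>For difference quotients instead of \<open>D2\<close> this follows from integration by parts, and the replacement is
 uniformly close because second moments are bounded.\<close>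

lemma linear_times_D2_tendsto:
 "(\<lambda>n. LINT y|N n. (b \<bullet> A n y) * D2 i j (A n y)) \<longlonglongrightarrow> (LINT y|N'. (b \<bullet> Z y) * D2 i j (Z y))"
proof -
 define h where "h \<delta> x = (1 / \<delta>) * (D1 j (x + (0 + \<delta> *\<^sub>R axis i 1)) - D1 j (x + 0))" for \<delta> x
 define dh where "dh \<delta> k x = (1 / \<delta>) * (D2 k j (x + (0 + \<delta> *\<^sub>R axis i 1)) - D2 k j (x + 0))" for \<delta> k x
 note q = C3_difference_quotient[OF g, where u=0 and j=j and i=i, folded h_def dh_def]
 note [measurable] = C3_testD(6)[OF g]
 have app: "\<bar>(LINT y|P. (b \<bullet> V y) * D2 i j (V y)) - (LINT y|P. (b \<bullet> V y) * h \<delta> (V y))\<bar>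
   \<le> (1 + (LINT y|P. (b \<bullet> V y) * (b \<bullet> V y))) * (K * \<delta>)"
  if V: "gaussian_vector P V" and \<delta>: "\<delta> > 0" for P and V :: "'c => real^'d" and \<delta>
 proof -
  interpret prob_space P by (rule gaussian_vectorD[OF V])
  note [measurable] = gaussian_vectorD(2)[OF V] C2_testD(8)[OF q(1)[OF \<delta>]]
  note am = gaussian_vector_moments(2)[OF V, of b]
  have K0: "0 \<le> K * \<delta>" using \<delta> C3_testD(5)[OF g] by simp
  have qb: "\<bar>D2 i j x - h \<delta> x\<bar> \<le> K * \<delta>" for x using q(2)[OF \<delta>, of x] by simp
  have hb: "\<bar>h \<delta> x\<bar> \<le> K + K * \<delta>" for x using qb[of x] C3_testD(4)[OF g, of i j x] by linarith
  have i: "integrable P (\<lambda>y. (b \<bullet> V y) * D2 i j (V y))" "integrable P (\<lambda>y. (b \<bullet> V y) * h \<delta> (V y))"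
   by (rule integrable_bounded_mult[OF all_moments_integrable[OF am] _ C3_testD(4)[OF g]]
     integrable_bounded_mult[OF all_moments_integrable[OF am] _ hb]; measurable)+
  have i2: "integrable P (\<lambda>y. (b \<bullet> V y) * (b \<bullet> V y))" by (intro all_moments_integrable all_moments_mult am)
  have "\<bar>(LINT y|P. (b \<bullet> V y) * D2 i j (V y)) - (LINT y|P. (b \<bullet> V y) * h \<delta> (V y))\<bar>
    = norm (LINT y|P. (b \<bullet> V y) * D2 i j (V y) - (b \<bullet> V y) * h \<delta> (V y))" using i by simp
  also have "\<dots> \<le> (LINT y|P. (1 + (b \<bullet> V y) * (b \<bullet> V y)) * (K * \<delta>))"
  proof (rule integral_norm_le_integral)
   fix y
   define x where "x = b \<bullet> V y"
   have "\<bar>x\<bar> \<le> 1 + x * x" using zero_le_square[of "\<bar>x\<bar> - 1"] zero_le_square[of x]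
    by (simp add: algebra_simps abs_mult_self_eq)
   then have "\<bar>x\<bar> * \<bar>D2 i j (V y) - h \<delta> (V y)\<bar> \<le> (1 + x * x) * (K * \<delta>)" by (intro mult_mono qb) (auto simp: add_nonneg_nonneg)
   then show "norm ((b \<bullet> V y) * D2 i j (V y) - (b \<bullet> V y) * h \<delta> (V y)) \<le> (1 + (b \<bullet> V y) * (b \<bullet> V y)) * (K * \<delta>)"
    by (simp add: x_def abs_mult right_diff_distrib[symmetric])
  qed (use i i2 in auto)
  also have "\<dots> = (1 + (LINT y|P. (b \<bullet> V y) * (b \<bullet> V y))) * (K * \<delta>)" using i2 by (simp add: prob_space)
  finally show ?thesis .
 qed
 have Ul: "(\<lambda>n. LINT y|N n. (b \<bullet> A n y) * h \<delta> (A n y)) \<longlonglongrightarrow> (LINT y|N'. (b \<bullet> Z y) * h \<delta> (Z y))" if \<delta>: "\<delta> > 0" for \<delta>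
 proof -
  have dI: "(LINT y|P. dh \<delta> k (V y)) = (1 / \<delta>) * ((LINT y|P. D2 k j (V y + (0 + \<delta> *\<^sub>R axis i 1))) - (LINT y|P. D2 k j (V y + 0)))"
   if V: "gaussian_vector P V" for P and V :: "'c => real^'d" and k
  proof -
   interpret prob_space P by (rule gaussian_vectorD[OF V])
   note [measurable] = gaussian_vectorD(2)[OF V]
   have "integrable P (\<lambda>y. D2 k j (V y + w))" for w by (rule integrable_const_bound[where B=K]) (simp_all add: C3_testD(4)[OF g])
   from this[of "0 + \<delta> *\<^sub>R axis i 1"] this[of 0] show ?thesis
    unfolding dh_def integral_mult_right_zero by (simp only: Bochner_Integration.integral_diff)
  qed
  have *: "(LINT y|P. (b \<bullet> V y) * h \<delta> (V y)) = (\<Sum>k\<in>UNIV. (LINT y|P. (b \<bullet> V y) * (axis k 1 \<bullet> V y)) * (LINT y|P. dh \<delta> k (V y)))"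
   if V: "gaussian_vector P V" for P and V :: "'c => real^'d"
   using jointly_gaussian_IBP[OF jointly_gaussian_linear[OF V, of b] C2_testD(1,3)[OF q(1)[OF \<delta>]]]
   by (simp add: inner_axis')
  show ?thesis
   unfolding *[OF A] *[OF Z] dI[OF A] dI[OF Z] by (intro tendsto_intros second_moment_tendsto D2_expectation_tendsto)
 qed
 have "Bseq (\<lambda>n. LINT y|N n. (b \<bullet> A n y) * (b \<bullet> A n y))"
  using second_moment_tendsto by (intro convergent_imp_Bseq convergentI)
 then obtain R1 where R1: "\<And>n. \<bar>LINT y|N n. (b \<bullet> A n y) * (b \<bullet> A n y)\<bar> \<le> R1" unfolding Bseq_def by auto
 define R where "R = max R1 (LINT y|N'. (b \<bullet> Z y) * (b \<bullet> Z y))"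
 have Rb: "(1 + x) * (K * \<delta>) \<le> ((1 + R) * K) * \<delta>" if "x \<le> R" "\<delta> > 0" for x \<delta>
  using that C3_testD(5)[OF g] mult_right_mono[of "1 + x" "1 + R" "K * \<delta>"] by (simp add: mult.assoc)
 show ?thesis
 proof (rule tendsto_of_uniform_approximation[OF Ul])
  fix \<delta> :: real assume \<delta>: "\<delta> > 0"
  show "\<bar>(LINT y|N n. (b \<bullet> A n y) * D2 i j (A n y)) - (LINT y|N n. (b \<bullet> A n y) * h \<delta> (A n y))\<bar> \<le> ((1 + R) * K) * \<delta>" for n
   by (rule order_trans[OF app[OF A \<delta>] Rb[OF _ \<delta>]]) (use R1[of n] in \<open>simp add: R_def\<close>)
  show "\<bar>(LINT y|N'. (b \<bullet> Z y) * D2 i j (Z y)) - (LINT y|N'. (b \<bullet> Z y) * h \<delta> (Z y))\<bar> \<le> ((1 + R) * K) * \<delta>"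
   by (rule order_trans[OF app[OF Z \<delta>] Rb[OF _ \<delta>]]) (simp add: R_def)
 qed
qed

end

lemma tendsto_zero_mult_Bseq:
 fixes f g :: "nat => real"
 assumes "f \<longlonglongrightarrow> 0" "Bseq g" shows "(\<lambda>n. f n * g n) \<longlonglongrightarrow> 0"
 using bounded_bilinear.Zfun_prod_Bfun[OF bounded_bilinear_mult] assms by (simp add: tendsto_Zfun_iff)

text \<open>The kernel of a symmetric matrix is the orthogonal complement of its range.\<close>

lemma symmetric_matrix_decomposition:
 fixes C :: "real^'d::finite^'d"
 assumes C: "transpose C = C"
 shows "\<exists>b r. x = C *v b + r \<and> C *v r = 0"
proof -
 have sub: "span (range ((*v) C)) = range ((*v) C)"
  by (intro span_eq_iff[THEN iffD2] linear_subspace_image matrix_vector_mul_linear subspace_UNIV)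
 obtain y z where yz: "y \<in> span (range ((*v) C))" "\<And>w. w \<in> span (range ((*v) C)) ==> orthogonal z w" "x = y + z"
  using orthogonal_subspace_decomp_exists[of "range ((*v) C)" x] by blast
 have "z \<bullet> (C *v (C *v z)) = 0" using yz(2)[of "C *v (C *v z)"] by (simp add: sub orthogonal_def)
 then have "C *v z = 0" unfolding inner_symmetric_matrix[OF C, of z "C *v z"] by simp
 moreover obtain b where "y = C *v b" using yz(1) by (auto simp: sub)
 ultimately show ?thesis using yz(3) by blast
qed

text \<open>The hypothesis on \<open>c\<close> says that \<open>t \<mapsto> t \<bullet> c\<close> is a functional of norm at most one for the seminorm given by the
 covariance. Hence \<open>c\<close> has no component in the kernel, \<open>c\<^sub>k = E[W Z\<^sub>k]\<close> for a linear functional \<open>W\<close> of \<open>Z\<close>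
 with variance at most one, and the contraction equals \<open>E[W \<partial>\<^sub>i\<^sub>j g(Z)]\<close>.\<close>

lemma D3_contraction_bound:
 fixes Z :: "'b => real^'d::finite"
 assumes Z: "gaussian_vector N Z" and g: "C3_test g D1 D2 D3 K"
  and c: "\<And>t. (t \<bullet> c)\<^sup>2 \<le> (LINT w|N. (t \<bullet> Z w) * (t \<bullet> Z w))"
 shows "\<bar>\<Sum>k\<in>UNIV. c $ k * (LINT w|N. D3 k i j (Z w))\<bar> \<le> K"
proof -
 interpret prob_space N by (rule gaussian_vectorD[OF Z])
 note [measurable] = gaussian_vectorD(2)[OF Z] C3_testD(6)[OF g]
 define C where "C = covm N Z"
 note sym = transpose_covm[of N Z, folded C_def]
 note c' = c[unfolded gaussian_second_moment_matrix[OF Z], folded C_def]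
 obtain b r where br: "c = C *v b + r" "C *v r = 0" using symmetric_matrix_decomposition[OF sym] by blast
 have "r \<bullet> c = r \<bullet> r" unfolding br(1) by (simp add: inner_add_right inner_symmetric_matrix[OF sym] br(2))
 then have "(r \<bullet> r)\<^sup>2 \<le> 0" using c'[of r] by (simp add: br(2))
 then have "r = 0" by simp
 then have cb: "c = C *v b" using br by simp
 have b1: "b \<bullet> (C *v b) \<le> 1"
 proof (rule ccontr)
  assume "\<not> b \<bullet> (C *v b) \<le> 1"
  then have "1 * (b \<bullet> (C *v b)) < (b \<bullet> (C *v b)) * (b \<bullet> (C *v b))" by (intro mult_strict_right_mono) auto
  then show False using c'[of b] by (simp add: cb power2_eq_square)
 qed
 have "c $ k = (LINT w|N. (b \<bullet> Z w) * Z w $ k)" for k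
 proof -
  have "(LINT w|N. (b \<bullet> Z w) * Z w $ k) = (LINT w|N. (axis k 1 \<bullet> Z w) * (b \<bullet> Z w))" by (simp add: inner_axis' mult.commute)
  then show ?thesis unfolding gaussian_second_moment_matrix[OF Z] by (simp add: cb C_def inner_axis')
 qed
 then have e: "(\<Sum>k\<in>UNIV. c $ k * (LINT w|N. D3 k i j (Z w))) = (LINT w|N. (b \<bullet> Z w) * D2 i j (Z w))"
  using jointly_gaussian_IBP[OF jointly_gaussian_linear[OF Z, of b] C3_testD(2,3)[OF g]] by simp
 have D2K: "(D2 i j y)\<^sup>2 \<le> K\<^sup>2" for y using power_mono[OF C3_testD(4)[OF g, of i j y], of 2] by simp
 have sq: "sq_integrable N (\<lambda>w. D2 i j (Z w))" unfolding sq_integrable_def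
  by (intro conjI integrable_const_bound[where B="K\<^sup>2"]) (simp_all add: D2K)
 have "\<bar>LINT w|N. (b \<bullet> Z w) * D2 i j (Z w)\<bar> \<le> sqrt (LINT w|N. (b \<bullet> Z w)\<^sup>2) * sqrt (LINT w|N. (D2 i j (Z w))\<^sup>2)"
  by (rule abs_integral_mult_le[OF all_moments_sq_integrable[OF gaussian_vector_moments(2)[OF Z]] sq])
 also have "\<dots> \<le> 1 * K"
 proof (intro mult_mono)
  show "sqrt (LINT w|N. (b \<bullet> Z w)\<^sup>2) \<le> 1"
   using b1 gaussian_second_moment_matrix[OF Z, of b b] by (simp add: power2_eq_square C_def)
  have "\<bar>LINT w|N. (D2 i j (Z w))\<^sup>2\<bar> \<le> K\<^sup>2" by (rule prob_abs_integral_le[OF prob_space_axioms]) (simp add: D2K)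
  then show "sqrt (LINT w|N. (D2 i j (Z w))\<^sup>2) \<le> K" using C3_testD(5)[OF g] by (intro real_le_lsqrt) auto
 qed auto
 finally show ?thesis by (simp add: e)
qed

text \<open>Split \<open>c n\<close> along the range and the kernel of the limiting covariance \<open>C\<close>. The kernel part \<open>r n\<close> satisfies
 \<open>\<parallel>r\<parallel>\<^sup>4 = (r \<bullet> c)\<^sup>2 \<le> r \<bullet> (C\<^sub>n - C) r\<close>, because \<open>C r = 0\<close>, and so tends to zero. In a direction \<open>C b\<close> of the range, third
 derivatives are integrated by parts into second derivatives, whose expectations converge.\<close>

theorem D3_contraction_tendsto:
 fixes N :: "nat => 'a measure" and A :: "nat => 'a => real^'d::finite" and N' :: "'b measure" and Z :: "'b => real^'d"
 assumes A: "\<And>n. gaussian_vector (N n) (A n)" and Z: "gaussian_vector N' Z"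
  and lim: "\<And>i j. (\<lambda>n. cov (N n) (A n) i j) \<longlonglongrightarrow> cov N' Z i j"
  and g: "C3_test g D1 D2 D3 K"
  and c: "\<And>n t. (t \<bullet> c n)\<^sup>2 \<le> (LINT w|N n. (t \<bullet> A n w) * (t \<bullet> A n w))"
 shows "(\<lambda>n. \<Sum>k\<in>UNIV. c n $ k * ((LINT w|N n. D3 k i j (A n w)) - (LINT w|N'. D3 k i j (Z w)))) \<longlonglongrightarrow> 0"
proof -
 define C where "C = covm N' Z"
 note sym = transpose_covm[of N' Z, folded C_def]
 define G where "G n = (\<chi> k. (LINT w|N n. D3 k i j (A n w)) - (LINT w|N'. D3 k i j (Z w)))" for n
 have DA: "\<bar>LINT w|N n. D3 k i j (A n w)\<bar> \<le> K" for k n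
  by (intro prob_abs_integral_le gaussian_vectorD(1)[OF A] C3_testD(3)[OF g])
 have DZ: "\<bar>LINT w|N'. D3 k i j (Z w)\<bar> \<le> K" for k
  by (intro prob_abs_integral_le gaussian_vectorD(1)[OF Z] C3_testD(3)[OF g])
 have GK: "\<bar>G n $ k\<bar> \<le> 2 * K" for n k
  using abs_triangle_ineq4[of "LINT w|N n. D3 k i j (A n w)" "LINT w|N'. D3 k i j (Z w)"] DA[where k=k and n=n] DZ[where k=k]
  by (simp add: G_def)
 have "\<forall>k. \<exists>b r. axis k 1 = C *v b + r \<and> C *v r = 0" using symmetric_matrix_decomposition[OF sym] by blast
 then obtain b \<rho> where b\<rho>: "\<And>k. axis k 1 = C *v b k + \<rho> k" "\<And>k. C *v \<rho> k = 0" by metis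
 define r where "r n = (\<Sum>k\<in>UNIV. c n $ k *\<^sub>R \<rho> k)" for n
 have "c n = (\<Sum>k\<in>UNIV. c n $ k *\<^sub>R (C *v b k + \<rho> k))" for n
  unfolding b\<rho>(1)[symmetric] vec_lambda_eq_sum_axis[symmetric] by simp
 then have dec: "c n = (\<Sum>k\<in>UNIV. c n $ k *\<^sub>R (C *v b k)) + r n" for n
  unfolding r_def by (simp add: scaleR_add_right sum.distrib)
 have Cr: "C *v r n = 0" for n
 proof -
  have "C *v r n = (\<Sum>k\<in>UNIV. c n $ k *\<^sub>R (C *v \<rho> k))"
   unfolding r_def by (simp add: linear_sum[OF matrix_vector_mul_linear] linear_cmul[OF matrix_vector_mul_linear])
  then show ?thesis by (simp add: b\<rho>(2))
 qed
 have rc: "r n \<bullet> c n = r n \<bullet> r n" for n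
 proof -
  have "r n \<bullet> c n = (\<Sum>k\<in>UNIV. c n $ k * (r n \<bullet> (C *v b k))) + r n \<bullet> r n"
   using arg_cong[OF dec[of n], of "\<lambda>x. r n \<bullet> x"] by (simp only: inner_add_right inner_sum_right inner_scaleR_right)
  then show ?thesis by (simp add: inner_symmetric_matrix[OF sym] Cr)
 qed
 \<comment> \<open>the kernel part is small: the limiting covariance does not see it\<close>
 have rs: "norm (r n) \<le> sqrt (cov_dist (N n) (A n) N' Z)" for n
 proof (cases "r n = 0")
  case False
  have "(norm (r n))\<^sup>2 * (norm (r n))\<^sup>2 = (r n \<bullet> c n)\<^sup>2" by (simp add: rc power2_eq_square dot_square_norm)
  also have "\<dots> \<le> r n \<bullet> (covm (N n) (A n) *v r n)" using c[of "r n" n] unfolding gaussian_second_moment_matrix[OF A] .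
  also have "\<dots> = r n \<bullet> (covm (N n) (A n) *v r n) - r n \<bullet> (C *v r n)" by (simp add: Cr)
  also have "\<dots> = (\<Sum>k\<in>UNIV. \<Sum>l\<in>UNIV. (r n $ k * r n $ l) * (cov (N n) (A n) k l - cov N' Z k l))"
  proof -
   have e: "x \<bullet> (covm P V *v x) = (\<Sum>k\<in>UNIV. \<Sum>l\<in>UNIV. (x $ k * x $ l) * cov P V k l)" for x and P and V :: "'z => real^'d"
   proof -
    have "x $ k * (cov P V k l * x $ l) = x $ k * x $ l * cov P V k l" for k l by simp
    then show ?thesis
     by (simp only: inner_vec_sum matrix_vector_mult_def covm_def vec_lambda_beta sum_distrib_left)
   qed
   show ?thesis unfolding C_def e by (simp only: sum_subtractf right_diff_distrib)
  qed
  also have "\<dots> \<le> (\<Sum>k\<in>UNIV. \<Sum>l\<in>UNIV. (norm (r n))\<^sup>2 * \<bar>cov (N n) (A n) k l - cov N' Z k l\<bar>)"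
  proof (intro sum_mono)
   fix k l
   have "\<bar>r n $ k\<bar> * \<bar>r n $ l\<bar> \<le> norm (r n) * norm (r n)" by (intro mult_mono component_le_norm_cart) auto
   then have "\<bar>r n $ k * r n $ l\<bar> * \<bar>cov (N n) (A n) k l - cov N' Z k l\<bar> \<le> (norm (r n))\<^sup>2 * \<bar>cov (N n) (A n) k l - cov N' Z k l\<bar>"
    by (intro mult_right_mono) (simp_all add: abs_mult power2_eq_square)
   then show "(r n $ k * r n $ l) * (cov (N n) (A n) k l - cov N' Z k l) \<le> (norm (r n))\<^sup>2 * \<bar>cov (N n) (A n) k l - cov N' Z k l\<bar>"
    by (simp flip: abs_mult)
  qed
  also have "\<dots> = (norm (r n))\<^sup>2 * cov_dist (N n) (A n) N' Z"
   unfolding cov_dist_def by (subst sum.swap) (simp add: sum_distrib_left)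
  finally have "(norm (r n))\<^sup>2 \<le> cov_dist (N n) (A n) N' Z" using False by (metis mult_le_cancel_left_pos zero_less_norm_iff zero_less_power)
  then show ?thesis by (rule real_le_rsqrt)
 qed (simp add: cov_dist_nonneg)
 have "(\<lambda>n. sqrt (cov_dist (N n) (A n) N' Z)) \<longlonglongrightarrow> sqrt 0" by (intro tendsto_intros cov_dist_tendsto_0 lim)
 then have r0: "(\<lambda>n. norm (r n)) \<longlonglongrightarrow> 0" using rs by (intro tendsto_zero_of_le[where f="\<lambda>n. norm (r n)"]) auto
 have rG: "(\<lambda>n. r n \<bullet> G n) \<longlonglongrightarrow> 0"
 proof (rule Lim_null_comparison)
  have "\<bar>r n \<bullet> G n\<bar> \<le> norm (r n) * (2 * K) * real CARD('d)" for n
  proof -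
   have "\<bar>r n \<bullet> G n\<bar> \<le> (\<Sum>k\<in>UNIV. \<bar>r n $ k * G n $ k\<bar>)" unfolding inner_vec_sum by (rule sum_abs)
   also have "\<dots> \<le> (\<Sum>k\<in>(UNIV :: 'd set). norm (r n) * (2 * K))"
    unfolding abs_mult by (intro sum_mono mult_mono component_le_norm_cart GK) auto
   finally show ?thesis by (simp add: mult_ac)
  qed
  then show "\<forall>\<^sub>F n in sequentially. norm (r n \<bullet> G n) \<le> norm (r n) * (2 * K) * real CARD('d)" by simp
  have "(\<lambda>n. norm (r n) * (2 * K) * real CARD('d)) \<longlonglongrightarrow> 0 * (2 * K) * real CARD('d)" by (intro tendsto_intros r0)
  then show "(\<lambda>n. norm (r n) * (2 * K) * real CARD('d)) \<longlonglongrightarrow> 0" by simp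
 qed
 have bG: "(\<lambda>n. (C *v b) \<bullet> G n) \<longlonglongrightarrow> 0" for b
 proof -
  define p where "p n l = (LINT w|N n. (b \<bullet> A n w) * (axis l 1 \<bullet> A n w))" for n l
  have pl: "(\<lambda>n. p n l) \<longlonglongrightarrow> (C *v b) $ l" for l
  proof -
   have "(LINT w|N'. (b \<bullet> Z w) * (axis l 1 \<bullet> Z w)) = (C *v b) $ l"
    unfolding gaussian_second_moment_matrix[OF Z] C_def[symmetric] by (simp add: inner_symmetric_matrix[OF sym] inner_axis)
   then show ?thesis unfolding p_def using second_moment_tendsto[OF A Z lim g, where s=b and t="axis l 1"] by simp
  qed
  have IA: "(LINT w|N n. (b \<bullet> A n w) * D2 i j (A n w)) = (\<Sum>l\<in>UNIV. p n l * (LINT w|N n. D3 l i j (A n w)))" for n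
   using jointly_gaussian_IBP[OF jointly_gaussian_linear[OF A[of n], of b] C3_testD(2,3)[OF g]] by (simp add: p_def inner_axis')
  have IZ: "(LINT w|N'. (b \<bullet> Z w) * D2 i j (Z w)) = (\<Sum>l\<in>UNIV. (C *v b) $ l * (LINT w|N'. D3 l i j (Z w)))"
  proof -
   have "(C *v b) $ l = (LINT w|N'. (b \<bullet> Z w) * Z w $ l)" for l
    using gaussian_second_moment_matrix[OF Z, of b "axis l 1"]
    unfolding C_def[symmetric] by (simp add: inner_symmetric_matrix[OF sym] inner_axis inner_axis')
   then show ?thesis
    using jointly_gaussian_IBP[OF jointly_gaussian_linear[OF Z, of b] C3_testD(2,3)[OF g]] by simp
  qed
  have e: "(C *v b) \<bullet> G n = ((LINT w|N n. (b \<bullet> A n w) * D2 i j (A n w)) - (LINT w|N'. (b \<bullet> Z w) * D2 i j (Z w)))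
    - (\<Sum>l\<in>UNIV. (p n l - (C *v b) $ l) * (LINT w|N n. D3 l i j (A n w)))" for n
   unfolding IA IZ inner_vec_sum[of "C *v b"] G_def vec_lambda_beta
   by (simp only: sum_subtractf[symmetric]) (intro sum.cong refl, simp add: algebra_simps)
  have "(\<lambda>n. (\<Sum>l\<in>UNIV. (p n l - (C *v b) $ l) * (LINT w|N n. D3 l i j (A n w)))) \<longlonglongrightarrow> (\<Sum>l\<in>(UNIV :: 'd set). 0)"
  proof (rule tendsto_sum)
   fix l
   show "(\<lambda>n. (p n l - (C *v b) $ l) * (LINT w|N n. D3 l i j (A n w))) \<longlonglongrightarrow> 0"
    by (rule tendsto_zero_mult_Bseq[OF LIM_zero[OF pl]]) (use DA in \<open>auto intro!: BseqI'\<close>)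
  qed
  moreover have "(\<lambda>n. (LINT w|N n. (b \<bullet> A n w) * D2 i j (A n w)) - (LINT w|N'. (b \<bullet> Z w) * D2 i j (Z w))) \<longlonglongrightarrow> 0"
   by (rule LIM_zero[OF linear_times_D2_tendsto[OF A Z lim g]])
  ultimately show ?thesis unfolding e using tendsto_diff by fastforce
 qed
 have cB: "Bseq (\<lambda>n. c n $ k)" for k
 proof -
  have "Bseq (\<lambda>n. LINT w|N n. (axis k 1 \<bullet> A n w) * (axis k 1 \<bullet> A n w))"
   using second_moment_tendsto[OF A Z lim g] by (intro convergent_imp_Bseq convergentI)
  then obtain R where R: "\<And>n. \<bar>LINT w|N n. (axis k 1 \<bullet> A n w) * (axis k 1 \<bullet> A n w)\<bar> \<le> R" unfolding Bseq_def by auto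
  have "\<bar>c n $ k\<bar> \<le> sqrt R" for n
  proof -
   have "(c n $ k)\<^sup>2 \<le> (LINT w|N n. (axis k 1 \<bullet> A n w) * (axis k 1 \<bullet> A n w))"
    using c[of "axis k 1" n] unfolding inner_axis'[of k 1 "c n"] by simp
   then have "(c n $ k)\<^sup>2 \<le> R" using R[of n] by linarith
   then have "sqrt ((c n $ k)\<^sup>2) \<le> sqrt R" by (rule real_sqrt_le_mono)
   then show ?thesis by simp
  qed
  then show ?thesis by (intro BseqI'[of _ "sqrt R"]) simp
 qed
 have "(\<lambda>n. \<Sum>k\<in>UNIV. ((C *v b k) \<bullet> G n) * c n $ k) \<longlonglongrightarrow> (\<Sum>k\<in>(UNIV :: 'd set). 0)"
  by (intro tendsto_sum tendsto_zero_mult_Bseq bG cB)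
 then have "(\<lambda>n. (\<Sum>k\<in>UNIV. ((C *v b k) \<bullet> G n) * c n $ k) + r n \<bullet> G n) \<longlonglongrightarrow> 0 + 0"
  by (intro tendsto_add rG) simp
 moreover have "(\<Sum>k\<in>UNIV. c n $ k * ((LINT w|N n. D3 k i j (A n w)) - (LINT w|N'. D3 k i j (Z w))))
   = (\<Sum>k\<in>UNIV. ((C *v b k) \<bullet> G n) * c n $ k) + r n \<bullet> G n" for n
 proof -
  have "(\<Sum>k\<in>UNIV. c n $ k * ((LINT w|N n. D3 k i j (A n w)) - (LINT w|N'. D3 k i j (Z w)))) = c n \<bullet> G n"
   by (simp add: inner_vec_sum G_def)
  also have "\<dots> = (\<Sum>k\<in>UNIV. ((C *v b k) \<bullet> G n) * c n $ k) + r n \<bullet> G n"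
   by (subst dec) (simp add: inner_add_left inner_sum_left mult.commute)
  finally show ?thesis .
 qed
 ultimately show ?thesis by simp
qed

section \<open>Consequences of being asymptotically close to normal\<close>

lemma fortet_mourier_upper:
 fixes P Q :: "'e::euclidean_space measure"
 assumes P: "prob_space P" and Q: "prob_space Q"
  and f: "a + b \<le> 1" "\<And>x. \<bar>f x\<bar> \<le> a" "b-lipschitz_on UNIV f"
 shows "\<bar>(LINT x|P. f x) - (LINT x|Q. f x)\<bar> \<le> fortet_mourier P Q"
 unfolding fortet_mourier_def
proof (rule cSUP_upper)
 show "f \<in> {f. \<exists>a b. a + b \<le> 1 \<and> (\<forall>x. \<bar>f x\<bar> \<le> a) \<and> b-lipschitz_on UNIV f}" using f by blast
 show "bdd_above ((\<lambda>f. \<bar>(LINT x|P. f x) - (LINT x|Q. f x)\<bar>) ` {f. \<exists>a b. a + b \<le> 1 \<and> (\<forall>x. \<bar>f x\<bar> \<le> a) \<and> b-lipschitz_on UNIV f})"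
 proof (rule bdd_aboveI2)
  fix h :: "'e => real" assume "h \<in> {f. \<exists>a b. a + b \<le> 1 \<and> (\<forall>x. \<bar>f x\<bar> \<le> a) \<and> b-lipschitz_on UNIV f}"
  then obtain a b where h: "a + b \<le> 1" "\<And>x. \<bar>h x\<bar> \<le> a" "b-lipschitz_on UNIV h" by blast
  have "0 \<le> b" using h(3) by (rule lipschitz_on_nonneg)
  then have "\<bar>h x\<bar> \<le> 1" for x using h(1) h(2)[of x] by linarith
  then have "\<bar>LINT x|P. h x\<bar> \<le> 1" "\<bar>LINT x|Q. h x\<bar> \<le> 1" using prob_abs_integral_le[OF P] prob_abs_integral_le[OF Q] by blast+
  then show "\<bar>(LINT x|P. h x) - (LINT x|Q. h x)\<bar> \<le> 2" by linarith
 qed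
qed

lemma gaussian_law_moments:
 fixes \<nu> :: "'e::euclidean_space measure"
 assumes G: "gaussian_law \<nu>"
 shows "prob_space \<nu>" "all_moments \<nu> (\<lambda>x. t \<bullet> x)"
  "(LINT x|\<nu>. t \<bullet> x) = 0 ==> \<exists>\<sigma>\<ge>0. distr \<nu> borel (\<lambda>x. t \<bullet> x) = normal_law 0 \<sigma>"
proof -
 have s[measurable_cong]: "sets \<nu> = sets borel" using G by (simp add: gaussian_law_def)
 have law: "\<exists>m. \<exists>\<sigma>\<ge>0. distr \<nu> borel (\<lambda>x. t \<bullet> x) = normal_law m \<sigma>" for t
  using G by (simp add: gaussian_law_def)
 have m: "(\<lambda>x. t \<bullet> x) \<in> borel_measurable \<nu>" for t by measurable
 show P: "prob_space \<nu>"
 proof -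
  obtain mm \<sigma> where l: "\<sigma> \<ge> 0" "distr \<nu> borel (\<lambda>x. 0 \<bullet> x) = normal_law mm \<sigma>" using law[of 0] by blast
  have "prob_space (normal_law mm \<sigma>)" unfolding normal_law_affine[OF l(1)]
   by (rule prob_space.prob_space_distr[OF prob_space_std_normal]) measurable
  then show ?thesis using prob_space_distrD[OF m[of 0]] l(2) by simp
 qed
 obtain mm \<sigma> where l: "\<sigma> \<ge> 0" "distr \<nu> borel (\<lambda>x. t \<bullet> x) = normal_law mm \<sigma>" using law[of t] by blast
 show "all_moments \<nu> (\<lambda>x. t \<bullet> x)" by (rule normal_law_all_moments[OF P m l])
 show "\<exists>\<sigma>\<ge>0. distr \<nu> borel (\<lambda>x. t \<bullet> x) = normal_law 0 \<sigma>" if "(LINT x|\<nu>. t \<bullet> x) = 0"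
  using normal_law_mean[OF P m l] that l by auto
qed

lemma centered_gaussian_vectorD:
 fixes Z :: "'b => real^'d::finite"
 assumes "centered_gaussian_vector N Z C"
 shows "gaussian_vector N Z" "cov N Z i j = C $ i $ j"
proof -
 have P: "prob_space N" and [measurable]: "Z \<in> borel_measurable N" and G: "gaussian_law (distr N borel Z)"
  and m0: "\<And>i. (LINT w|N. Z w $ i) = 0" and c: "\<And>i j. (LINT w|N. Z w $ i * Z w $ j) = C $ i $ j"
  using assms by (auto simp: centered_gaussian_vector_def)
 show "cov N Z i j = C $ i $ j" by (simp add: cov_def c)
 have Zi: "integrable N (\<lambda>w. Z w $ i)" for i
  using all_moments_integrable[OF gaussian_law_moments(2)[OF G, of "axis i 1"]]
  by (simp add: inner_axis' integrable_distr_eq)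
 have "(LINT x|distr N borel Z. t \<bullet> x) = 0" for t
  using Zi by (simp add: integral_distr inner_vec_sum m0)
 then have "\<exists>\<sigma>\<ge>0. distr (distr N borel Z) borel (\<lambda>x. t \<bullet> x) = normal_law 0 \<sigma>" for t
  by (rule gaussian_law_moments(3)[OF G])
 then show "gaussian_vector N Z" unfolding gaussian_vector_def using P by (simp add: distr_distr comp_def)
qed

text \<open>Centring and the second moments determine all covariances of the approximating pair.\<close>

lemma ACN_gaussian_pairs:
 fixes F :: "nat => 'a => real^'d::finite" and W :: "nat => 'a => real"
 assumes M: "prob_space M" and ACN: "ACN M (\<lambda>n w. (F n w, W n w))"
  and F0: "\<And>n i. (LINT w|M. F n w $ i) = 0" and W0: "\<And>n. (LINT w|M. W n w) = 0"
 obtains \<nu> :: "nat => ((real^'d) \<times> real) measure" where "\<And>n. sets (\<nu> n) = sets borel" "\<And>n. jointly_gaussian (\<nu> n) fst snd"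
  "\<And>n i j. cov (\<nu> n) fst i j = moment2 M (F n) i j"
  "\<And>n i. (LINT x|\<nu> n. snd x * fst x $ i) = (LINT w|M. W n w * F n w $ i)"
  "\<And>n. integrable (\<nu> n) (\<lambda>x. (snd x)\<^sup>2)" "\<And>n. (LINT x|\<nu> n. (snd x)\<^sup>2) = (LINT w|M. (W n w)\<^sup>2)"
  "(\<lambda>n. fortet_mourier (distr M borel (\<lambda>w. (F n w, W n w))) (\<nu> n)) \<longlonglongrightarrow> 0"
proof -
 note HD = that
 interpret M: prob_space M by fact
 obtain \<nu> where G: "\<And>n. gaussian_law (\<nu> n)"
  and mean: "\<And>n. (LINT x|\<nu> n. x) = (LINT w|M. (F n w, W n w))"
  and cv: "\<And>n u v. (LINT x|\<nu> n. (u \<bullet> x) * (v \<bullet> x)) = (LINT w|M. (u \<bullet> (F n w, W n w)) * (v \<bullet> (F n w, W n w)))"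
  and FM: "(\<lambda>n. fortet_mourier (distr M borel (\<lambda>w. (F n w, W n w))) (\<nu> n)) \<longlonglongrightarrow> 0"
  and sq: "\<And>n. sq_integrable M (\<lambda>w. (F n w, W n w))"
  using ACN unfolding ACN_def by blast
 have sets: "sets (\<nu> n) = sets borel" for n using G[of n] by (simp add: gaussian_law_def)
 have Yi: "integrable M (\<lambda>w. (F n w, W n w))" for n
 proof (rule Bochner_Integration.integrable_bound)
  show "integrable M (\<lambda>w. 1 + (norm (F n w, W n w))\<^sup>2)" "(\<lambda>w. (F n w, W n w)) \<in> borel_measurable M"
   using sq[of n] by (auto simp: sq_integrable_def)
  have "norm u \<le> norm (1 + (norm u)\<^sup>2)" for u :: "(real^'d) \<times> real"
  proof -
   have "0 \<le> (norm u - 1)\<^sup>2" by simp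
   then have "2 * norm u \<le> 1 + (norm u)\<^sup>2" by (simp add: power2_eq_square algebra_simps)
   then show ?thesis using norm_ge_zero[of u] abs_ge_self[of "1 + (norm u)\<^sup>2"] unfolding real_norm_def by linarith
  qed
  then show "AE w in M. norm (F n w, W n w) \<le> norm (1 + (norm (F n w, W n w))\<^sup>2)" by (intro AE_I2)
 qed
 have mean0: "(LINT x|\<nu> n. t \<bullet> x) = 0" for t n
 proof -
  have bi: "integrable (\<nu> n) (\<lambda>x. (b \<bullet> x) *\<^sub>R b)" for b
   by (rule integrable_scaleR_left, rule all_moments_integrable, rule gaussian_law_moments(2)[OF G])
  have "(\<Sum>b\<in>Basis. (b \<bullet> x) *\<^sub>R b) = x" for x :: "(real^'d) \<times> real"
   unfolding inner_commute[of _ x] by (rule euclidean_representation)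
  moreover have "integrable (\<nu> n) (\<lambda>x. \<Sum>b\<in>Basis. (b \<bullet> x) *\<^sub>R b)"
   by (rule Bochner_Integration.integrable_sum) (rule bi)
  ultimately have i: "integrable (\<nu> n) (\<lambda>x. x)" by simp
  have "(LINT x|\<nu> n. t \<bullet> x) = t \<bullet> (LINT w|M. (F n w, W n w))" using i by (simp add: mean)
  also have "\<dots> = (LINT w|M. t \<bullet> (F n w, W n w))" using Yi[of n] by simp
  also have "\<dots> = (LINT w|M. (\<Sum>i\<in>UNIV. fst t $ i * F n w $ i) + snd t * W n w)"
   by (simp add: inner_prod_def inner_vec_sum)
  also have "\<dots> = 0"
  proof -
   have "integrable M (\<lambda>w. (axis i 1, 0) \<bullet> (F n w, W n w))" "integrable M (\<lambda>w. (0, 1) \<bullet> (F n w, W n w))" for i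
    using Yi[of n] by (intro integrable_inner_right; simp)+
   then have "integrable M (\<lambda>w. F n w $ i)" "integrable M (W n)" for i by (simp_all add: inner_axis')
   then show ?thesis by (simp add: F0 W0)
  qed
  finally show ?thesis .
 qed
 have fsm: "fst \<in> borel_measurable (\<nu> n)" "snd \<in> borel_measurable (\<nu> n)" for n
  unfolding measurable_cong_sets[OF sets refl]
  by (auto intro!: borel_measurable_continuous_onI continuous_intros)
 have JG: "jointly_gaussian (\<nu> n) fst snd" for n
  unfolding jointly_gaussian_def
 proof (intro conjI allI gaussian_law_moments(1)[OF G] fsm)
  fix t :: "real^'d" and s :: real
  have "(\<lambda>x. t \<bullet> fst x + s * snd x) = (\<lambda>x. (t, s) \<bullet> x)" by (simp add: inner_prod_def)
  then show "\<exists>\<sigma>\<ge>0. distr (\<nu> n) borel (\<lambda>x. t \<bullet> fst x + s * snd x) = normal_law 0 \<sigma>"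
   using gaussian_law_moments(3)[OF G mean0] by simp
 qed
 have c1: "cov (\<nu> n) fst i j = moment2 M (F n) i j" for n i j
  using cv[of n "(axis i 1, 0)" "(axis j 1, 0)"] by (simp add: inner_prod_def inner_axis' cov_def moment2_def)
 have c2: "(LINT x|\<nu> n. snd x * fst x $ i) = (LINT w|M. W n w * F n w $ i)" for n i
  using cv[of n "(0, 1)" "(axis i 1, 0)"] by (simp add: inner_prod_def inner_axis')
 have c3: "(LINT x|\<nu> n. (snd x)\<^sup>2) = (LINT w|M. (W n w)\<^sup>2)" for n
  using cv[of n "(0, 1)" "(0, 1)"] by (simp add: inner_prod_def power2_eq_square)
 have c4: "integrable (\<nu> n) (\<lambda>x. (snd x)\<^sup>2)" for n
  using all_moments_integrable[OF all_moments_mult[OF gaussian_law_moments(2)[OF G] gaussian_law_moments(2)[OF G]], of n "(0, 1)" "(0, 1)"]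
  by (simp add: inner_prod_def power2_eq_square)
 show thesis by (rule HD[OF sets JG c1 c2 c4 c3 FM])
qed

text \<open>The Fortet--Mourier metric only sees bounded functions: the unbounded factor is truncated at level \<open>R\<close>, which
 costs \<open>B / R\<close> on either side by the bound on the second moment.\<close>

lemma fortet_mourier_unbounded_factor:
 fixes P Q :: "((real^'d::finite) \<times> real) measure" and \<phi> :: "real^'d => real"
 assumes P: "prob_space P" "sets P = sets borel" "integrable P (\<lambda>x. (snd x)\<^sup>2)" "(LINT x|P. (snd x)\<^sup>2) \<le> 1"
  and Q: "prob_space Q" "sets Q = sets borel" "integrable Q (\<lambda>x. (snd x)\<^sup>2)" "(LINT x|Q. (snd x)\<^sup>2) \<le> 1"
  and B: "\<And>y. \<bar>\<phi> y\<bar> \<le> B" and L: "\<And>y z. \<bar>\<phi> y - \<phi> z\<bar> \<le> L * norm (y - z)" "0 \<le> L" and R: "R > 0"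
 shows "\<bar>(LINT x|P. snd x * \<phi> (fst x)) - (LINT x|Q. snd x * \<phi> (fst x))\<bar> \<le> 2 * (B / R) + (R * B + R * L + B + 1) * fortet_mourier P Q"
proof -
 have B0: "0 \<le> B" using B[of 0] by linarith
 define c where "c w = max (- R) (min R w)" for w :: real
 define \<kappa> where "\<kappa> = R * B + R * L + B + 1"
 have "0 \<le> R * B" "0 \<le> R * L" using R B0 L by auto
 then have \<kappa>: "\<kappa> > 0" using B0 unfolding \<kappa>_def by linarith
 have c1: "\<bar>c w\<bar> \<le> R" "\<bar>c w - c v\<bar> \<le> \<bar>w - v\<bar>" for w v using R by (auto simp: c_def)
 have c2: "\<bar>w - c w\<bar> \<le> w\<^sup>2 / R" for w
 proof (cases "\<bar>w\<bar> \<le> R")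
  case True
  then have "c w = w" by (auto simp: c_def)
  then show ?thesis using R by simp
 next
  case False
  then have "R * \<bar>w - c w\<bar> \<le> \<bar>w\<bar> * \<bar>w\<bar>" using R by (intro mult_mono) (auto simp: c_def)
  then show ?thesis using R by (simp add: field_simps power2_eq_square)
 qed
 have "L-lipschitz_on UNIV \<phi>" using L by (intro lipschitz_onI) (auto simp: dist_real_def dist_norm)
 then have \<phi>c: "continuous_on UNIV \<phi>" by (rule lipschitz_on_continuous_on)
 have fstm: "continuous_on UNIV (\<lambda>x :: (real^'d) \<times> real. \<phi> (fst x))"
  by (rule continuous_on_compose2[OF \<phi>c]) (auto intro: continuous_intros)
 have main: "\<bar>(LINT x|D. snd x * \<phi> (fst x)) - (LINT x|D. c (snd x) * \<phi> (fst x))\<bar> \<le> B / R"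
  if D: "prob_space D" "sets D = sets borel" "integrable D (\<lambda>x. (snd x)\<^sup>2)" "(LINT x|D. (snd x)\<^sup>2) \<le> 1" for D :: "((real^'d) \<times> real) measure"
 proof -
  interpret D: prob_space D by fact
  have [measurable]: "(\<lambda>x. \<phi> (fst x)) \<in> borel_measurable D" "snd \<in> borel_measurable D"
   unfolding measurable_cong_sets[OF D(2) refl]
   by (auto intro!: borel_measurable_continuous_onI fstm continuous_intros)
  have [measurable]: "c \<in> borel_measurable borel" unfolding c_def by measurable
  have "sq_integrable D snd" using D(3) by (simp add: sq_integrable_def)
  then have si: "integrable D snd" by (rule D.sq_integrable_integrable)
  have i1: "integrable D (\<lambda>x. snd x * \<phi> (fst x))" by (rule integrable_bounded_mult[OF si _ B]) measurable
  have i2: "integrable D (\<lambda>x. c (snd x) * \<phi> (fst x))"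
   by (rule integrable_bounded_mult[OF _ _ B], rule D.integrable_const_bound[where B=R]) (auto simp: c1)
  have "\<bar>(LINT x|D. snd x * \<phi> (fst x)) - (LINT x|D. c (snd x) * \<phi> (fst x))\<bar>
    = norm (LINT x|D. snd x * \<phi> (fst x) - c (snd x) * \<phi> (fst x))" using i1 i2 by simp
  also have "\<dots> \<le> (LINT x|D. (B / R) * (snd x)\<^sup>2)"
  proof (rule integral_norm_le_integral)
   fix x :: "(real^'d) \<times> real"
   have "\<bar>snd x - c (snd x)\<bar> * \<bar>\<phi> (fst x)\<bar> \<le> ((snd x)\<^sup>2 / R) * B" using R by (intro mult_mono c2 B) auto
   moreover have "snd x * \<phi> (fst x) - c (snd x) * \<phi> (fst x) = (snd x - c (snd x)) * \<phi> (fst x)" by (simp add: left_diff_distrib)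
   ultimately show "norm (snd x * \<phi> (fst x) - c (snd x) * \<phi> (fst x)) \<le> (B / R) * (snd x)\<^sup>2"
    by (simp add: abs_mult mult.commute)
  qed (use i1 i2 D(3) in auto)
  also have "\<dots> = (B / R) * (LINT x|D. (snd x)\<^sup>2)" by simp
  also have "\<dots> \<le> (B / R) * 1" using B0 R D(4) by (intro mult_left_mono) auto
  finally show ?thesis by simp
 qed
 have lip: "((R * L + B) / \<kappa>)-lipschitz_on UNIV (\<lambda>x :: (real^'d) \<times> real. c (snd x) * \<phi> (fst x) / \<kappa>)"
 proof (rule lipschitz_onI)
  fix x y :: "(real^'d) \<times> real"
  have "\<bar>c (snd x) * \<phi> (fst x) - c (snd y) * \<phi> (fst y)\<bar>
    = \<bar>c (snd x) * (\<phi> (fst x) - \<phi> (fst y)) + (c (snd x) - c (snd y)) * \<phi> (fst y)\<bar>" by (simp add: algebra_simps)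
  also have "\<dots> \<le> \<bar>c (snd x)\<bar> * \<bar>\<phi> (fst x) - \<phi> (fst y)\<bar> + \<bar>c (snd x) - c (snd y)\<bar> * \<bar>\<phi> (fst y)\<bar>"
   by (rule order_trans[OF abs_triangle_ineq]) (simp add: abs_mult)
  also have "\<dots> \<le> R * (L * norm (fst x - fst y)) + \<bar>snd x - snd y\<bar> * B"
   using R by (intro add_mono mult_mono c1 L B) auto
  also have "\<dots> \<le> R * (L * norm (x - y)) + norm (x - y) * B"
  proof -
   have e: "(fst x - fst y, snd x - snd y) = x - y" by (simp add: prod_eq_iff)
   have "norm (fst x - fst y) \<le> norm (x - y)" "norm (snd x - snd y) \<le> norm (x - y)"
    using norm_fst_le[of "fst x - fst y" "snd x - snd y"] norm_snd_le[of "snd x - snd y" "fst x - fst y"] unfolding e .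
   then show ?thesis using R L B0 by (intro add_mono mult_left_mono mult_right_mono) auto
  qed
  also have "\<dots> = (R * L + B) * norm (x - y)" by (simp add: distrib_right mult.assoc mult.commute[of _ B])
  finally have "\<bar>c (snd x) * \<phi> (fst x) - c (snd y) * \<phi> (fst y)\<bar> \<le> (R * L + B) * norm (x - y)" .
  then have "\<bar>c (snd x) * \<phi> (fst x) - c (snd y) * \<phi> (fst y)\<bar> / \<kappa> \<le> ((R * L + B) * norm (x - y)) / \<kappa>"
   using \<kappa> by (intro divide_right_mono) auto
  then show "dist (c (snd x) * \<phi> (fst x) / \<kappa>) (c (snd y) * \<phi> (fst y) / \<kappa>) \<le> (R * L + B) / \<kappa> * dist x y"
   using \<kappa> by (simp add: dist_real_def dist_norm diff_divide_distrib[symmetric])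
 qed (use R L B0 \<kappa> in auto)
 have bnd: "\<bar>c (snd x) * \<phi> (fst x) / \<kappa>\<bar> \<le> R * B / \<kappa>" for x :: "(real^'d) \<times> real"
 proof -
  have "\<bar>c (snd x)\<bar> * \<bar>\<phi> (fst x)\<bar> \<le> R * B" using R by (intro mult_mono c1 B) auto
  then show ?thesis using \<kappa> by (simp add: abs_mult divide_right_mono)
 qed
 have "R * B / \<kappa> + (R * L + B) / \<kappa> \<le> 1" using \<kappa> by (simp add: add_divide_distrib[symmetric] \<kappa>_def)
 from fortet_mourier_upper[OF P(1) Q(1) this bnd lip]
 have "\<bar>(LINT x|P. c (snd x) * \<phi> (fst x)) - (LINT x|Q. c (snd x) * \<phi> (fst x))\<bar> \<le> \<kappa> * fortet_mourier P Q"
  using \<kappa> by (simp add: diff_divide_distrib[symmetric] field_simps)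
 then show ?thesis using main[OF P] main[OF Q] unfolding \<kappa>_def by linarith
qed

text \<open>Uniformity over \<open>\<phi>\<close> is needed because the function of \<open>F\<close> depends on the interpolation parameter and on the index.\<close>

lemma fortet_mourier_unbounded_factor_eventually:
 fixes P Q :: "nat => ((real^'d::finite) \<times> real) measure"
 assumes P: "\<And>n. prob_space (P n)" "\<And>n. sets (P n) = sets borel" "\<And>n. integrable (P n) (\<lambda>x. (snd x)\<^sup>2)" "\<And>n. (LINT x|P n. (snd x)\<^sup>2) \<le> 1"
  and Q: "\<And>n. prob_space (Q n)" "\<And>n. sets (Q n) = sets borel" "\<And>n. integrable (Q n) (\<lambda>x. (snd x)\<^sup>2)" "\<And>n. (LINT x|Q n. (snd x)\<^sup>2) \<le> 1"
  and FM: "(\<lambda>n. fortet_mourier (P n) (Q n)) \<longlonglongrightarrow> 0" and B: "0 \<le> B" and L: "0 \<le> L" and \<epsilon>: "\<epsilon> > 0"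
 shows "\<forall>\<^sub>F n in sequentially. \<forall>\<phi>. (\<forall>y. \<bar>\<phi> y\<bar> \<le> B) \<longrightarrow> (\<forall>y z. \<bar>\<phi> y - \<phi> z\<bar> \<le> L * norm (y - z)) \<longrightarrow>
   \<bar>(LINT x|P n. snd x * \<phi> (fst x)) - (LINT x|Q n. snd x * \<phi> (fst x))\<bar> \<le> \<epsilon>"
proof -
 \<comment> \<open>truncation level making the truncation error at most \<open>\<epsilon> / 2\<close>\<close>
 define R where "R = 4 * B / \<epsilon> + 1"
 have R: "R > 0" using B \<epsilon> by (simp add: R_def add_nonneg_pos)
 have "4 * B \<le> \<epsilon> * R" using \<epsilon> by (simp add: R_def distrib_left)
 then have BR: "2 * (B / R) \<le> \<epsilon> / 2" using R by (simp add: field_simps)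
 have "(\<lambda>n. (R * B + R * L + B + 1) * fortet_mourier (P n) (Q n)) \<longlonglongrightarrow> (R * B + R * L + B + 1) * 0"
  by (intro tendsto_intros FM)
 then have "\<forall>\<^sub>F n in sequentially. (R * B + R * L + B + 1) * fortet_mourier (P n) (Q n) < \<epsilon> / 2"
  by (rule order_tendstoD(2)) (use \<epsilon> in simp)
 then show ?thesis
 proof eventually_elim
  case (elim n)
  show ?case
  proof (intro allI impI)
   fix \<phi> :: "real^'d => real" assume "\<forall>y. \<bar>\<phi> y\<bar> \<le> B" "\<forall>y z. \<bar>\<phi> y - \<phi> z\<bar> \<le> L * norm (y - z)"
   then show "\<bar>(LINT x|P n. snd x * \<phi> (fst x)) - (LINT x|Q n. snd x * \<phi> (fst x))\<bar> \<le> \<epsilon>"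
    using fortet_mourier_unbounded_factor[OF P(1,2,3,4)[of n] Q(1,2,3,4)[of n], of \<phi> B L R] L R BR elim by force
  qed
 qed
qed

text \<open>Integration by parts for fixed \<open>Z\<close>; then \<open>sin \<theta> V + cos \<theta> Z\<close> has the law of \<open>Z\<close>, as \<open>V\<close> and \<open>Z\<close> are independent with equal
 covariances.\<close>

lemma jointly_gaussian_interpolation_IBP:
 fixes Z :: "'b => real^'d::finite" and V :: "'c => real^'d" and W :: "'c => real"
 assumes J: "jointly_gaussian \<nu> V W" and Z: "gaussian_vector N Z" and cov: "\<And>i j. cov \<nu> V i j = cov N Z i j"
  and g: "C3_test g D1 D2 D3 K" and Wi: "integrable \<nu> W"
 shows "(LINT x|\<nu>. W x * (LINT w|N. D2 i j (sin \<theta> *\<^sub>R V x + cos \<theta> *\<^sub>R Z w))) =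
   sin \<theta> * (\<Sum>k\<in>UNIV. (LINT x|\<nu>. W x * V x $ k) * (LINT w|N. D3 k i j (Z w)))"
proof -
 note V = jointly_gaussian_imp_vector[OF J]
 note [measurable] = gaussian_vectorD(2)[OF V] gaussian_vectorD(2)[OF Z] C3_testD(6,7)[OF g]
 have [measurable]: "W \<in> borel_measurable \<nu>" using Wi by auto
 interpret \<nu>: prob_space \<nu> by (rule gaussian_vectorD[OF V])
 interpret N: prob_space N by (rule gaussian_vectorD[OF Z])
 interpret NN: pair_prob_space \<nu> N ..
 have Wp: "integrable (\<nu> \<Otimes>\<^sub>M N) (\<lambda>x. W (fst x))"
  using integral_pair_product(1)[OF \<nu>.prob_space_axioms N.prob_space_axioms Wi, of "\<lambda>_. 1"] by simp
 have int: "integrable (\<nu> \<Otimes>\<^sub>M N) (\<lambda>(x, w). W x * D2 i j (sin \<theta> *\<^sub>R V x + cos \<theta> *\<^sub>R Z w))"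
  unfolding case_prod_unfold by (rule integrable_bounded_mult[OF Wp _ C3_testD(4)[OF g]]) measurable
 have int3: "integrable (\<nu> \<Otimes>\<^sub>M N) (\<lambda>(x, w). D3 k i j (sin \<theta> *\<^sub>R V x + cos \<theta> *\<^sub>R Z w))" for k
  unfolding case_prod_unfold
  by (rule NN.integrable_const_bound[where B=K]) (simp_all add: C3_testD(3)[OF g])
 have ibp: "(LINT x|\<nu>. W x * D2 i j (sin \<theta> *\<^sub>R V x + z)) =
   (\<Sum>k\<in>UNIV. (LINT x|\<nu>. W x * V x $ k) * (LINT x|\<nu>. sin \<theta> * D3 k i j (sin \<theta> *\<^sub>R V x + z)))" for z
 proof (rule jointly_gaussian_IBP[OF J has_derivative_affine[OF C3_testD(2)[OF g]], where B="1 * K"])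
  show "\<bar>sin \<theta> * D3 k i j (sin \<theta> *\<^sub>R y + z)\<bar> \<le> 1 * K" for k y
   unfolding abs_mult by (intro mult_mono C3_testD(3)[OF g]) auto
 qed
 have "(LINT x|\<nu>. W x * (LINT w|N. D2 i j (sin \<theta> *\<^sub>R V x + cos \<theta> *\<^sub>R Z w))) = (LINT x|\<nu>. LINT w|N. W x * D2 i j (sin \<theta> *\<^sub>R V x + cos \<theta> *\<^sub>R Z w))"
  by simp
 also have "\<dots> = (LINT w|N. LINT x|\<nu>. W x * D2 i j (sin \<theta> *\<^sub>R V x + cos \<theta> *\<^sub>R Z w))"
  by (rule NN.Fubini_integral[OF int, symmetric])
 also have "\<dots> = (LINT w|N. (\<Sum>k\<in>UNIV. (LINT x|\<nu>. W x * V x $ k) * (sin \<theta> * (LINT x|\<nu>. D3 k i j (sin \<theta> *\<^sub>R V x + cos \<theta> *\<^sub>R Z w)))))"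
  unfolding ibp integral_mult_right_zero ..
 also have "\<dots> = (\<Sum>k\<in>UNIV. (LINT x|\<nu>. W x * V x $ k) * (sin \<theta> * (LINT w|N. LINT x|\<nu>. D3 k i j (sin \<theta> *\<^sub>R V x + cos \<theta> *\<^sub>R Z w))))"
  using NN.integrable_snd[OF int3] by simp
 also have "\<dots> = (\<Sum>k\<in>UNIV. (LINT x|\<nu>. W x * V x $ k) * (sin \<theta> * (LINT w|N. D3 k i j (Z w))))"
 proof -
  have "(LINT w|N. LINT x|\<nu>. D3 k i j (sin \<theta> *\<^sub>R V x + cos \<theta> *\<^sub>R Z w)) = (LINT w|N. D3 k i j (Z w))" for k
  proof -
   have "(LINT w|N. LINT x|\<nu>. D3 k i j (sin \<theta> *\<^sub>R V x + cos \<theta> *\<^sub>R Z w)) = (LINT x|(\<nu> \<Otimes>\<^sub>M N). D3 k i j (sin \<theta> *\<^sub>R V (fst x) + cos \<theta> *\<^sub>R Z (snd x)))"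
    using NN.integral_snd[OF int3[of k]] by (simp add: case_prod_unfold)
   also have "\<dots> = (LINT w|N. D3 k i j (Z w))"
   proof (rule gaussian_vector_unique[OF gaussian_vector_combination(1)[OF V Z] Z])
    have sc: "(sin \<theta>)\<^sup>2 * c + (cos \<theta>)\<^sup>2 * c = c" for c :: real
     using sin_cos_squared_add[of \<theta>] by (metis distrib_right mult_1)
    show "cov (\<nu> \<Otimes>\<^sub>M N) (\<lambda>x. sin \<theta> *\<^sub>R V (fst x) + cos \<theta> *\<^sub>R Z (snd x)) i j = cov N Z i j" for i j
     unfolding gaussian_vector_combination(2)[OF V Z] cov by (rule sc)
   qed measurable
   finally show ?thesis .
  qed
  then show ?thesis by simp
 qed
 also have "\<dots> = sin \<theta> * (\<Sum>k\<in>UNIV. (LINT x|\<nu>. W x * V x $ k) * (LINT w|N. D3 k i j (Z w)))"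
  by (simp add: sum_distrib_left mult_ac)
 finally show ?thesis .
qed

text \<open>Averaging over \<open>Z\<close> turns \<open>D2 (sin \<theta> y + cos \<theta> Z)\<close> into a function of \<open>y\<close> whose bounds do not depend on \<open>\<theta>\<close> and the
 index, so the limit is uniform.\<close>

theorem ACN_interpolation_limit:
 fixes F :: "nat => 'a => real^'d::finite" and W :: "nat => 'a => real" and N :: "nat => 'b measure" and Z :: "nat => 'b => real^'d"
 assumes M: "prob_space M" and ACN: "ACN M (\<lambda>n u. (F n u, W n u))"
  and Fm: "\<And>n. F n \<in> borel_measurable M" and F0: "\<And>n i. (LINT u|M. F n u $ i) = 0"
  and W: "\<And>n. sq_integrable M (W n)" and W0: "\<And>n. (LINT u|M. W n u) = 0" and W1: "\<And>n. (LINT u|M. (W n u)\<^sup>2) \<le> 1"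
  and Z: "\<And>n. gaussian_vector (N n) (Z n)" and cov: "\<And>n i j. cov (N n) (Z n) i j = moment2 M (F n) i j"
  and g: "C3_test g D1 D2 D3 K" and \<epsilon>: "\<epsilon> > 0"
 shows "\<forall>\<^sub>F n in sequentially. \<forall>\<theta>. \<bar>(LINT x|(M \<Otimes>\<^sub>M N n). W n (fst x) * D2 i j (sin \<theta> *\<^sub>R F n (fst x) + cos \<theta> *\<^sub>R Z n (snd x)))
   - sin \<theta> * (\<Sum>k\<in>UNIV. (LINT u|M. W n u * F n u $ k) * (LINT u|N n. D3 k i j (Z n u)))\<bar> \<le> \<epsilon>"
proof -
 interpret M: prob_space M by fact
 note [measurable] = Fm C3_testD(6)[OF g]
 have Wm[measurable]: "W n \<in> borel_measurable M" for n using W by (simp add: sq_integrable_def)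
 show ?thesis
 proof (rule ACN_gaussian_pairs[OF M ACN F0 W0])
  fix \<nu> :: "nat => ((real^'d) \<times> real) measure"
  assume sets: "\<And>n. sets (\<nu> n) = sets borel" and JG: "\<And>n. jointly_gaussian (\<nu> n) fst snd"
  and cv: "\<And>n i j. cov (\<nu> n) fst i j = moment2 M (F n) i j"
  and c3: "\<And>n i. (LINT x|\<nu> n. snd x * fst x $ i) = (LINT u|M. W n u * F n u $ i)"
  and sq: "\<And>n. integrable (\<nu> n) (\<lambda>x. (snd x)\<^sup>2)" "\<And>n. (LINT x|\<nu> n. (snd x)\<^sup>2) = (LINT u|M. (W n u)\<^sup>2)"
  and FM: "(\<lambda>n. fortet_mourier (distr M borel (\<lambda>u. (F n u, W n u))) (\<nu> n)) \<longlonglongrightarrow> 0"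
 define P where "P n = distr M borel (\<lambda>u. (F n u, W n u))" for n
 have Pm: "(\<lambda>u. (F n u, W n u)) \<in> borel_measurable M" for n by measurable
 have sndb: "(\<lambda>x :: (real^'d) \<times> real. (snd x)\<^sup>2) \<in> borel_measurable borel"
  by (auto intro!: borel_measurable_continuous_onI continuous_intros)
 have Pp: "prob_space (P n)" "sets (P n) = sets borel" "integrable (P n) (\<lambda>x. (snd x)\<^sup>2)" "(LINT x|P n. (snd x)\<^sup>2) \<le> 1" for n
  unfolding P_def using W[of n] W1[of n]
  by (auto simp: M.prob_space_distr[OF Pm] integrable_distr_eq[OF Pm sndb] integral_distr[OF Pm sndb] sq_integrable_def)
 have \<nu>p: "prob_space (\<nu> n)" for n using JG[of n] by (simp add: jointly_gaussian_def)
 define L where "L = K * real CARD('d)"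
 have L0: "0 \<le> L" using C3_testD(5)[OF g] by (simp add: L_def)
 have "\<forall>\<^sub>F n in sequentially. \<forall>\<phi>. (\<forall>y. \<bar>\<phi> y\<bar> \<le> K) \<longrightarrow> (\<forall>y z. \<bar>\<phi> y - \<phi> z\<bar> \<le> L * norm (y - z)) \<longrightarrow>
   \<bar>(LINT x|P n. snd x * \<phi> (fst x)) - (LINT x|\<nu> n. snd x * \<phi> (fst x))\<bar> \<le> \<epsilon>"
  by (rule fortet_mourier_unbounded_factor_eventually[OF Pp \<nu>p sets sq(1) _ FM[folded P_def] C3_testD(5)[OF g] L0 \<epsilon>])
    (simp add: sq(2) W1)
 then show ?thesis
 proof eventually_elim
  case (elim n)
  show ?case
  proof
   fix \<theta> :: real
   interpret N: prob_space "N n" by (rule gaussian_vectorD[OF Z])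
   interpret MN: pair_prob_space M "N n" ..
   note [measurable] = gaussian_vectorD(2)[OF Z[of n]]
   define \<phi> where "\<phi> y = (LINT u|N n. D2 i j (sin \<theta> *\<^sub>R y + cos \<theta> *\<^sub>R Z n u))" for y
   have \<phi>B: "\<bar>\<phi> y\<bar> \<le> K" for y unfolding \<phi>_def by (intro prob_abs_integral_le N.prob_space_axioms C3_testD(4)[OF g])
   have \<phi>L: "\<bar>\<phi> y - \<phi> z\<bar> \<le> L * norm (y - z)" for y z
   proof -
    have "integrable (N n) (\<lambda>u. D2 i j (sin \<theta> *\<^sub>R y + cos \<theta> *\<^sub>R Z n u))" for y
     by (rule N.integrable_const_bound[where B=K]) (simp_all add: C3_testD(4)[OF g])
    then have "\<phi> y - \<phi> z = (LINT u|N n. D2 i j (sin \<theta> *\<^sub>R y + cos \<theta> *\<^sub>R Z n u) - D2 i j (sin \<theta> *\<^sub>R z + cos \<theta> *\<^sub>R Z n u))"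
     by (simp add: \<phi>_def)
    moreover have "\<bar>D2 i j (sin \<theta> *\<^sub>R y + w) - D2 i j (sin \<theta> *\<^sub>R z + w)\<bar> \<le> L * norm (y - z)" for w
    proof -
     have "\<bar>D2 i j (sin \<theta> *\<^sub>R y + w) - D2 i j (sin \<theta> *\<^sub>R z + w)\<bar>
       \<le> K * (\<Sum>i\<in>UNIV. \<bar>(sin \<theta> *\<^sub>R y + w) $ i - (sin \<theta> *\<^sub>R z + w) $ i\<bar>)" by (rule C3_testD(8)[OF g])
     also have "\<dots> \<le> K * (\<Sum>i\<in>(UNIV :: 'd set). norm (y - z))"
     proof (intro mult_left_mono sum_mono C3_testD(5)[OF g])
      fix i
      have "\<bar>(sin \<theta> *\<^sub>R y + w) $ i - (sin \<theta> *\<^sub>R z + w) $ i\<bar> = \<bar>sin \<theta>\<bar> * \<bar>(y - z) $ i\<bar>"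
       by (simp add: abs_mult[symmetric] right_diff_distrib)
      also have "\<dots> \<le> 1 * norm (y - z)" by (intro mult_mono component_le_norm_cart) auto
      finally show "\<bar>(sin \<theta> *\<^sub>R y + w) $ i - (sin \<theta> *\<^sub>R z + w) $ i\<bar> \<le> norm (y - z)" by simp
     qed
     finally show ?thesis by (simp add: L_def mult_ac)
    qed
    ultimately show ?thesis by (simp add: prob_abs_integral_le[OF N.prob_space_axioms])
   qed
   have \<phi>c: "continuous_on UNIV \<phi>"
    by (rule lipschitz_on_continuous_on[of L], rule lipschitz_onI) (use \<phi>L L0 in \<open>auto simp: dist_real_def dist_norm\<close>)
   have "continuous_on UNIV (\<lambda>x :: (real^'d) \<times> real. snd x * \<phi> (fst x))"
    by (intro continuous_intros continuous_on_compose2[OF \<phi>c]) auto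
   then have \<phi>b: "(\<lambda>x :: (real^'d) \<times> real. snd x * \<phi> (fst x)) \<in> borel_measurable borel" by (rule borel_measurable_continuous_onI)
   have 1: "(LINT x|P n. snd x * \<phi> (fst x)) = (LINT u|M. W n u * \<phi> (F n u))"
    unfolding P_def by (simp add: integral_distr[OF Pm \<phi>b])
   have Wp: "integrable (M \<Otimes>\<^sub>M N n) (\<lambda>x. W n (fst x))"
    using integral_pair_product(1)[OF M N.prob_space_axioms M.sq_integrable_integrable[OF W], of "\<lambda>_. 1"] by simp
   have "integrable (M \<Otimes>\<^sub>M N n) (\<lambda>x. W n (fst x) * D2 i j (sin \<theta> *\<^sub>R F n (fst x) + cos \<theta> *\<^sub>R Z n (snd x)))"
    by (rule integrable_bounded_mult[OF Wp _ C3_testD(4)[OF g]]) measurable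
   then have 2: "(LINT x|(M \<Otimes>\<^sub>M N n). W n (fst x) * D2 i j (sin \<theta> *\<^sub>R F n (fst x) + cos \<theta> *\<^sub>R Z n (snd x))) = (LINT u|M. W n u * \<phi> (F n u))"
    using MN.integral_fst[of "\<lambda>x u. W n x * D2 i j (sin \<theta> *\<^sub>R F n x + cos \<theta> *\<^sub>R Z n u)"] by (simp add: case_prod_unfold \<phi>_def)
   have si: "integrable (\<nu> n) snd"
   proof -
    interpret \<nu>: prob_space "\<nu> n" by (rule \<nu>p)
    have "sq_integrable (\<nu> n) snd" using JG[of n] sq(1)[of n] by (simp add: sq_integrable_def jointly_gaussian_def)
    then show ?thesis by (rule \<nu>.sq_integrable_integrable)
   qed
   have 3: "(LINT x|\<nu> n. snd x * \<phi> (fst x)) = sin \<theta> * (\<Sum>k\<in>UNIV. (LINT u|M. W n u * F n u $ k) * (LINT u|N n. D3 k i j (Z n u)))"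
    using jointly_gaussian_interpolation_IBP[OF JG Z _ g si, where i=i and j=j and \<theta>=\<theta>] by (simp add: cv cov \<phi>_def c3)
   show "\<bar>(LINT x|(M \<Otimes>\<^sub>M N n). W n (fst x) * D2 i j (sin \<theta> *\<^sub>R F n (fst x) + cos \<theta> *\<^sub>R Z n (snd x)))
    - sin \<theta> * (\<Sum>k\<in>UNIV. (LINT u|M. W n u * F n u $ k) * (LINT u|N n. D3 k i j (Z n u)))\<bar> \<le> \<epsilon>"
    using elim[rule_format, of \<phi>] \<phi>B \<phi>L unfolding 1 2 3 by blast
  qed
 qed
 qed
qed

section \<open>Standardised Stein kernels\<close>

definition std_dev :: "'a measure => ('a => real) => real" where
 "std_dev M Y = sqrt (prob_space.variance M Y)"

text \<open>If the standard deviation is zero, \<open>standardize M Y\<close> is \<open>0\<close>; the last equation still holds since then \<open>Y\<close> is almost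
 surely constant.\<close>

definition standardize :: "'a measure => ('a => real) => 'a => real" where
 "standardize M Y w = (Y w - prob_space.expectation M Y) / std_dev M Y"

lemma standardize:
 assumes M: "prob_space M" and Y: "sq_integrable M Y"
 shows "0 \<le> std_dev M Y" "sq_integrable M (standardize M Y)" "(LINT w|M. standardize M Y w) = 0"
  "(LINT w|M. (standardize M Y w)\<^sup>2) \<le> 1"
  "AE w in M. Y w - (LINT w|M. Y w) = std_dev M Y * standardize M Y w"
proof -
 interpret prob_space M by fact
 note Yi = sq_integrable_integrable[OF Y]
 define m where "m = (LINT w|M. Y w)"
 define V where "V = (LINT w|M. (Y w - m)\<^sup>2)"
 have V0: "0 \<le> V" by (simp add: V_def)
 have sd: "std_dev M Y = sqrt V" by (simp add: std_dev_def V_def m_def)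
 show "0 \<le> std_dev M Y" using V0 by (simp add: sd)
 have sq: "sq_integrable M (\<lambda>w. Y w - m)" by (intro sq_integrable_diff Y sq_integrable_const)
 have st: "standardize M Y = (\<lambda>w. (1 / sqrt V) * (Y w - m))" by (rule ext) (simp add: standardize_def sd m_def)
 show "sq_integrable M (standardize M Y)" unfolding st by (intro sq_integrable_mult_const sq)
 show "(LINT w|M. standardize M Y w) = 0" using Yi by (simp add: st m_def prob_space)
 have "(LINT w|M. (standardize M Y w)\<^sup>2) = (1 / V) * V"
  unfolding st power_mult_distrib integral_mult_right_zero using V0 by (simp add: V_def power_divide)
 then show "(LINT w|M. (standardize M Y w)\<^sup>2) \<le> 1" by simp
 show "AE w in M. Y w - (LINT w|M. Y w) = std_dev M Y * standardize M Y w"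
 proof (cases "V = 0")
  case True
  have "integrable M (\<lambda>w. (Y w - m)\<^sup>2)" using sq by (simp add: sq_integrable_def)
  then have "AE w in M. (Y w - m)\<^sup>2 = 0"
   using True by (subst integral_nonneg_eq_0_iff_AE[symmetric]) (auto simp: V_def)
  then show ?thesis by eventually_elim (simp add: sd True m_def)
 next
  case False
  then show ?thesis by (intro AE_I2) (simp add: st sd m_def)
 qed
qed

lemma smooth_test_coordinate: "smooth_test (\<lambda>y :: real^'d::finite. y $ i) (\<lambda>k y. if k = i then 1 else 0)"
 unfolding smooth_test_def
proof (intro conjI allI)
 fix y :: "real^'d"
 have "((\<lambda>y. y $ i) has_derivative (\<lambda>v. v $ i)) (at y)" by (rule bounded_linear_imp_has_derivative[OF bounded_linear_vec_nth])
 moreover have "(\<lambda>v :: real^'d. v $ i) = (\<lambda>v. \<Sum>k\<in>UNIV. v $ k * (if k = i then 1 else 0))" by (rule ext) (simp add: if_distrib cong: if_cong)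
 ultimately show "((\<lambda>y. y $ i) has_derivative (\<lambda>v. \<Sum>k\<in>UNIV. v $ k * (if k = i then 1 else 0))) (at y)" by simp
 show "\<exists>B. \<forall>k (y :: real^'d). \<bar>(if k = i then 1 else 0) :: real\<bar> \<le> B" by (intro exI[of _ 1]) simp
 show "\<exists>L. \<forall>k (y :: real^'d) z. \<bar>((if k = i then 1 else 0) :: real) - (if k = i then 1 else 0)\<bar> \<le> L * norm (y - z)"
  by (intro exI[of _ 0]) simp
qed

lemma stein_kernelD:
 assumes "stein_kernel M F G"
 shows "sq_integrable M (\<lambda>w. F w $ i)" "(LINT w|M. F w $ i) = 0" "sq_integrable M (G i j)"
  "F \<in> borel_measurable M" "(LINT w|M. G i j w) = moment2 M F i j"
  "moment3 M F i j k = (LINT w|M. G i j w * F w $ k) + (LINT w|M. G k j w * F w $ i)"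
  "smooth_test \<phi> d\<phi> ==> (LINT w|M. F w $ j * \<phi> (F w)) = (\<Sum>i\<in>UNIV. LINT w|M. G i j w * d\<phi> i (F w))"
proof -
 show Fs: "sq_integrable M (\<lambda>w. F w $ i)" and "(LINT w|M. F w $ i) = 0" "sq_integrable M (G i j)"
  "moment3 M F i j k = (LINT w|M. G i j w * F w $ k) + (LINT w|M. G k j w * F w $ i)" for i j k
  using assms by (simp_all add: stein_kernel_def moment3_def)
 have "(\<lambda>w. \<chi> i. F w $ i) \<in> borel_measurable M"
  by (rule borel_measurable_vec_lambda) (use Fs in \<open>simp add: sq_integrable_def\<close>)
 then show "F \<in> borel_measurable M" by simp
 show IBP: "(LINT w|M. F w $ j * \<phi> (F w)) = (\<Sum>i\<in>UNIV. LINT w|M. G i j w * d\<phi> i (F w))" if "smooth_test \<phi> d\<phi>" for \<phi> d\<phi>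
  using assms that by (simp add: stein_kernel_def)
 have "(LINT w|M. F w $ j * F w $ i) = (\<Sum>k\<in>UNIV. if k = i then (LINT w|M. G k j w) else 0)"
  unfolding IBP[OF smooth_test_coordinate] by (intro sum.cong) auto
 then show "(LINT w|M. G i j w) = moment2 M F i j" by (simp add: moment2_def mult.commute)
qed

text \<open>Cauchy--Schwarz, written with the Gaussian vector that shares the covariance of \<open>F\<close>.\<close>

lemma covector_bound:
 fixes F :: "'a => real^'d::finite" and Z :: "'b => real^'d"
 assumes F: "\<And>i. sq_integrable M (\<lambda>w. F w $ i)" and W: "sq_integrable M W" "(LINT w|M. (W w)\<^sup>2) \<le> 1"
  and Z: "gaussian_vector N Z" and cov: "\<And>i j. cov N Z i j = moment2 M F i j"
 shows "(t \<bullet> (\<chi> k. LINT w|M. W w * F w $ k))\<^sup>2 \<le> (LINT w|N. (t \<bullet> Z w) * (t \<bullet> Z w))"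
proof -
 have tF: "sq_integrable M (\<lambda>w. t \<bullet> F w)" unfolding inner_vec_sum by (intro sq_integrable_sum sq_integrable_mult_const F)
 have i: "integrable M (\<lambda>w. W w * F w $ k)" "integrable M (\<lambda>w. F w $ k * F w $ l)" for k l
  by (intro sq_integrable_mult W F)+
 have "t \<bullet> (\<chi> k. LINT w|M. W w * F w $ k) = (\<Sum>k\<in>UNIV. (LINT w|M. t $ k * (W w * F w $ k)))" by (simp add: inner_vec_sum)
 also have "\<dots> = (LINT w|M. (\<Sum>k\<in>UNIV. t $ k * (W w * F w $ k)))"
  by (rule Bochner_Integration.integral_sum[symmetric]) (intro integrable_mult_right i)
 also have "\<dots> = (LINT w|M. W w * (t \<bullet> F w))" by (simp add: inner_vec_sum sum_distrib_left mult_ac)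
 finally have "(t \<bullet> (\<chi> k. LINT w|M. W w * F w $ k))\<^sup>2 \<le> (LINT w|M. (W w)\<^sup>2) * (LINT w|M. (t \<bullet> F w)\<^sup>2)"
  using integral_mult_Cauchy_Schwarz[OF W(1) tF] by simp
 also have "\<dots> \<le> 1 * (LINT w|M. (t \<bullet> F w)\<^sup>2)" by (intro mult_right_mono W) simp
 also have "(LINT w|M. (t \<bullet> F w)\<^sup>2) = (LINT w|M. (\<Sum>k\<in>UNIV. \<Sum>l\<in>UNIV. (t $ k * t $ l) * (F w $ k * F w $ l)))"
  by (intro Bochner_Integration.integral_cong refl) (simp only: power2_eq_square inner_vec_sum sum_product mult_ac)
 also have "\<dots> = (\<Sum>k\<in>UNIV. \<Sum>l\<in>UNIV. (t $ k * t $ l) * moment2 M F k l)"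
  using i(2) by (simp add: moment2_def)
 also have "\<dots> = (LINT w|N. (t \<bullet> Z w) * (t \<bullet> Z w))" by (simp add: gaussian_vector_second_moment[OF Z] cov)
 finally show ?thesis by simp
qed

text \<open>Both halves of the identity for third moments contribute equally against a symmetric tensor.\<close>

lemma sum_symmetric_triple:
 fixes a T :: "'d::finite => 'd => 'd => real"
 assumes s12: "\<And>i j k. T i j k = T j i k" and s23: "\<And>i j k. T i j k = T i k j"
 shows "(\<Sum>i\<in>UNIV. \<Sum>j\<in>UNIV. \<Sum>k\<in>UNIV. (a i j k + a k j i) / fact 3 * T i j k) = (\<Sum>j\<in>UNIV. \<Sum>i\<in>UNIV. \<Sum>k\<in>UNIV. a i j k * T k i j) / 3"
proof -
 have T: "T i j k = T k i j" "T i j k = T k j i" for i j k using s12 s23 by metis+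
 have "(\<Sum>i\<in>UNIV. \<Sum>j\<in>UNIV. \<Sum>k\<in>UNIV. a i j k * T i j k) = (\<Sum>j\<in>UNIV. \<Sum>i\<in>UNIV. \<Sum>k\<in>UNIV. a i j k * T i j k)"
  by (rule sum.swap)
 then have 1: "(\<Sum>i\<in>UNIV. \<Sum>j\<in>UNIV. \<Sum>k\<in>UNIV. a i j k * T i j k) = (\<Sum>j\<in>UNIV. \<Sum>i\<in>UNIV. \<Sum>k\<in>UNIV. a i j k * T k i j)"
  by (rule trans) (intro sum.cong refl arg_cong2[where f="(*)"] T(1))
 have "(\<Sum>i\<in>UNIV. \<Sum>j\<in>UNIV. \<Sum>k\<in>UNIV. a k j i * T i j k) = (\<Sum>j\<in>UNIV. \<Sum>i\<in>UNIV. \<Sum>k\<in>UNIV. a k j i * T i j k)"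
  by (rule sum.swap)
 also have "\<dots> = (\<Sum>j\<in>UNIV. \<Sum>k\<in>UNIV. \<Sum>i\<in>UNIV. a k j i * T i j k)"
  by (intro sum.cong refl sum.swap)
 also have "\<dots> = (\<Sum>j\<in>UNIV. \<Sum>i\<in>UNIV. \<Sum>k\<in>UNIV. a i j k * T k i j)"
  by (intro sum.cong refl arg_cong2[where f="(*)"] s23)
 finally have 2: "(\<Sum>i\<in>UNIV. \<Sum>j\<in>UNIV. \<Sum>k\<in>UNIV. a k j i * T i j k) = (\<Sum>j\<in>UNIV. \<Sum>i\<in>UNIV. \<Sum>k\<in>UNIV. a i j k * T k i j)" .
 have "(a i j k + a k j i) / fact 3 * T i j k = (a i j k * T i j k + a k j i * T i j k) * (1 / 6)" for i j k
  by (simp add: fact_numeral distrib_right)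
 then have "(\<Sum>i\<in>UNIV. \<Sum>j\<in>UNIV. \<Sum>k\<in>UNIV. (a i j k + a k j i) / fact 3 * T i j k) =
   ((\<Sum>i\<in>UNIV. \<Sum>j\<in>UNIV. \<Sum>k\<in>UNIV. a i j k * T i j k) + (\<Sum>i\<in>UNIV. \<Sum>j\<in>UNIV. \<Sum>k\<in>UNIV. a k j i * T i j k)) * (1 / 6)"
  by (simp only: sum_distrib_right[symmetric] sum.distrib[symmetric])
 then show ?thesis unfolding 1 2 by simp
qed

section \<open>Edgeworth expansion at the rate of the Stein kernel\<close>

lemma stein_kernel_interpolation:
 fixes F :: "'a => real^'d::finite"
 assumes S: "stein_kernel M F G" and g: "C3_test g D1 D2 D3 K"
 shows "(LINT x|M. F x $ j * D1 j (s *\<^sub>R F x + z)) = s * (\<Sum>i\<in>UNIV. LINT x|M. G i j x * D2 i j (s *\<^sub>R F x + z))"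
proof -
 have "smooth_test (\<lambda>y. D1 j (s *\<^sub>R y + z)) (\<lambda>i y. s * D2 i j (s *\<^sub>R y + z))"
  unfolding smooth_test_def
 proof (intro conjI allI exI)
  show "((\<lambda>y. D1 j (s *\<^sub>R y + z)) has_derivative (\<lambda>v. \<Sum>i\<in>UNIV. v $ i * (s * D2 i j (s *\<^sub>R y + z)))) (at y)" for y
   by (rule has_derivative_affine[OF C2_testD(2)[OF C3_testD(1)[OF g]]])
  show "\<bar>s * D2 i j (s *\<^sub>R y + z)\<bar> \<le> \<bar>s\<bar> * K" for i y
   unfolding abs_mult by (intro mult_left_mono C3_testD(4)[OF g]) simp
  fix i and y w :: "real^'d"
  have "\<bar>D2 i j (s *\<^sub>R y + z) - D2 i j (s *\<^sub>R w + z)\<bar> \<le> K * (\<Sum>k\<in>UNIV. \<bar>(s *\<^sub>R y + z) $ k - (s *\<^sub>R w + z) $ k\<bar>)"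
   by (rule C3_testD(8)[OF g])
  also have "\<dots> \<le> K * (\<Sum>k\<in>(UNIV :: 'd set). \<bar>s\<bar> * norm (y - w))"
  proof (intro mult_left_mono sum_mono C3_testD(5)[OF g])
   fix k
   have "\<bar>(s *\<^sub>R y + z) $ k - (s *\<^sub>R w + z) $ k\<bar> = \<bar>s\<bar> * \<bar>(y - w) $ k\<bar>"
    by (simp add: abs_mult[symmetric] right_diff_distrib)
   also have "\<dots> \<le> \<bar>s\<bar> * norm (y - w)" by (intro mult_left_mono component_le_norm_cart) simp
   finally show "\<bar>(s *\<^sub>R y + z) $ k - (s *\<^sub>R w + z) $ k\<bar> \<le> \<bar>s\<bar> * norm (y - w)" .
  qed
  finally have "\<bar>s\<bar> * \<bar>D2 i j (s *\<^sub>R y + z) - D2 i j (s *\<^sub>R w + z)\<bar> \<le> \<bar>s\<bar> * (K * (\<Sum>k\<in>(UNIV :: 'd set). \<bar>s\<bar> * norm (y - w)))"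
   by (intro mult_left_mono) auto
  then show "\<bar>s * D2 i j (s *\<^sub>R y + z) - s * D2 i j (s *\<^sub>R w + z)\<bar> \<le> (\<bar>s\<bar> * K * real CARD('d) * \<bar>s\<bar>) * norm (y - w)"
   by (simp add: abs_mult right_diff_distrib[symmetric] mult_ac)
 qed
 from stein_kernelD(7)[OF S this, of j] show ?thesis by (simp add: sum_distrib_left mult_ac)
qed

lemma bounded_pair_integral:
 fixes A :: "'a => real^'d::finite" and Z :: "'b => real^'d" and U :: "'a => real" and f :: "real^'d => real"
 assumes M: "prob_space M" and N: "prob_space N" and [measurable]: "A \<in> borel_measurable M" "Z \<in> borel_measurable N"
  and U: "integrable M U" and [measurable]: "f \<in> borel_measurable borel" and B: "\<And>y. \<bar>f y\<bar> \<le> B"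
 shows "(LINT x|(M \<Otimes>\<^sub>M N). U (fst x) * f (a *\<^sub>R A (fst x) + b *\<^sub>R Z (snd x))) = (LINT w|M. U w * (LINT \<eta>|N. f (a *\<^sub>R A w + b *\<^sub>R Z \<eta>)))"
proof -
 interpret M: prob_space M by fact
 interpret N: prob_space N by fact
 interpret MN: pair_prob_space M N ..
 have Up: "integrable (M \<Otimes>\<^sub>M N) (\<lambda>x. U (fst x))" using integral_pair_product(1)[OF M N U, of "\<lambda>_. 1"] by simp
 have "integrable (M \<Otimes>\<^sub>M N) (\<lambda>x. U (fst x) * f (a *\<^sub>R A (fst x) + b *\<^sub>R Z (snd x)))"
  by (rule integrable_bounded_mult[OF Up _ B]) measurable
 then show ?thesis
  using MN.integral_fst[of "\<lambda>x w. U x * f (a *\<^sub>R A x + b *\<^sub>R Z w)"] by (simp add: case_prod_unfold)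
qed

lemma stein_kernel_standardized:
 fixes F :: "'a => real^'d::finite" and Z :: "'b => real^'d"
 assumes M: "prob_space M" and S: "stein_kernel M F G" and Z: "gaussian_vector N Z"
  and cov: "\<And>i j. cov N Z i j = moment2 M F i j" and g: "C3_test g D1 D2 D3 K"
 shows "(LINT w|M. G i j w * F w $ k) = std_dev M (G i j) * (LINT w|M. standardize M (G i j) w * F w $ k)"
  and "(LINT x|(M \<Otimes>\<^sub>M N). (G i j (fst x) - cov N Z i j) * D2 i j (a *\<^sub>R F (fst x) + b *\<^sub>R Z (snd x))) =
   std_dev M (G i j) * (LINT x|(M \<Otimes>\<^sub>M N). standardize M (G i j) (fst x) * D2 i j (a *\<^sub>R F (fst x) + b *\<^sub>R Z (snd x)))"
  and "\<bar>LINT x|(M \<Otimes>\<^sub>M N). standardize M (G i j) (fst x) * D2 i j (a *\<^sub>R F (fst x) + b *\<^sub>R Z (snd x))\<bar> \<le> K"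
proof -
 interpret M: prob_space M by fact
 interpret N: prob_space N by (rule gaussian_vectorD[OF Z])
 note Sd = stein_kernelD[OF S]
 note W = standardize[OF M Sd(3)[of i j]]
 note [measurable] = Sd(4) gaussian_vectorD(2)[OF Z] C3_testD(6)[OF g]
 have Gm[measurable]: "G i j \<in> borel_measurable M" and Wm[measurable]: "standardize M (G i j) \<in> borel_measurable M"
  using Sd(3)[of i j] W(2) by (auto simp: sq_integrable_def)
 have ae: "AE w in M. (G i j w - moment2 M F i j) = std_dev M (G i j) * standardize M (G i j) w"
  using W(5) by (simp add: Sd(5))
 have [measurable]: "(\<lambda>w. F w $ k) \<in> borel_measurable M" by measurable
 have "(LINT w|M. (G i j w - moment2 M F i j) * F w $ k) = (LINT w|M. std_dev M (G i j) * (standardize M (G i j) w * F w $ k))"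
  by (rule integral_cong_AE) (measurable, use ae in eventually_elim, simp)
 moreover have "(LINT w|M. (G i j w - moment2 M F i j) * F w $ k) = (LINT w|M. G i j w * F w $ k) - moment2 M F i j * (LINT w|M. F w $ k)"
  using sq_integrable_mult[OF Sd(3)[of i j] Sd(1)[of k]] M.sq_integrable_integrable[OF Sd(1)[of k]]
  by (simp add: left_diff_distrib)
 ultimately show "(LINT w|M. G i j w * F w $ k) = std_dev M (G i j) * (LINT w|M. standardize M (G i j) w * F w $ k)"
  by (simp add: Sd(2))
 note pair = bounded_pair_integral[OF M N.prob_space_axioms Sd(4) gaussian_vectorD(2)[OF Z] _ C3_testD(6)[OF g] C3_testD(4)[OF g]]
 define \<phi> where "\<phi> y = (LINT \<eta>|N. D2 i j (a *\<^sub>R y + b *\<^sub>R Z \<eta>))" for y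
 have \<phi>m[measurable]: "(\<lambda>w. \<phi> (F w)) \<in> borel_measurable M" unfolding \<phi>_def by measurable
 have Gi: "integrable M (\<lambda>w. G i j w - moment2 M F i j)" using M.sq_integrable_integrable[OF Sd(3)[of i j]] by simp
 have Wi: "integrable M (standardize M (G i j))" by (rule M.sq_integrable_integrable[OF W(2)])
 have "(LINT x|(M \<Otimes>\<^sub>M N). (G i j (fst x) - cov N Z i j) * D2 i j (a *\<^sub>R F (fst x) + b *\<^sub>R Z (snd x))) =
   (LINT w|M. (G i j w - moment2 M F i j) * \<phi> (F w))" unfolding cov \<phi>_def by (rule pair[OF Gi])
 also have "\<dots> = (LINT w|M. std_dev M (G i j) * (standardize M (G i j) w * \<phi> (F w)))"
  by (rule integral_cong_AE) (measurable, use ae in eventually_elim, simp)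
 also have "\<dots> = std_dev M (G i j) * (LINT w|M. standardize M (G i j) w * \<phi> (F w))" by simp
 also have e: "(LINT w|M. standardize M (G i j) w * \<phi> (F w)) = (LINT x|(M \<Otimes>\<^sub>M N). standardize M (G i j) (fst x) * D2 i j (a *\<^sub>R F (fst x) + b *\<^sub>R Z (snd x)))"
  unfolding \<phi>_def by (rule pair[OF Wi, symmetric])
 finally show "(LINT x|(M \<Otimes>\<^sub>M N). (G i j (fst x) - cov N Z i j) * D2 i j (a *\<^sub>R F (fst x) + b *\<^sub>R Z (snd x))) =
   std_dev M (G i j) * (LINT x|(M \<Otimes>\<^sub>M N). standardize M (G i j) (fst x) * D2 i j (a *\<^sub>R F (fst x) + b *\<^sub>R Z (snd x)))" .
 have \<phi>K: "\<bar>\<phi> y\<bar> \<le> K" for y unfolding \<phi>_def by (intro prob_abs_integral_le N.prob_space_axioms C3_testD(4)[OF g])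
 have \<phi>2: "(\<phi> y)\<^sup>2 \<le> K\<^sup>2" for y using power_mono[OF \<phi>K[of y], of 2] by simp
 have \<phi>s: "sq_integrable M (\<lambda>w. \<phi> (F w))" unfolding sq_integrable_def
  by (intro conjI M.integrable_const_bound[where B="K\<^sup>2"]) (simp_all add: \<phi>2)
 have "\<bar>LINT w|M. standardize M (G i j) w * \<phi> (F w)\<bar> \<le> sqrt (LINT w|M. (standardize M (G i j) w)\<^sup>2) * sqrt (LINT w|M. (\<phi> (F w))\<^sup>2)"
  by (rule abs_integral_mult_le[OF W(2) \<phi>s])
 also have "\<dots> \<le> 1 * K"
 proof (intro mult_mono)
  show "sqrt (LINT w|M. (standardize M (G i j) w)\<^sup>2) \<le> 1" using W(4) by simp
  have "\<bar>LINT w|M. (\<phi> (F w))\<^sup>2\<bar> \<le> K\<^sup>2" by (rule prob_abs_integral_le[OF M]) (simp add: \<phi>2)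
  then show "sqrt (LINT w|M. (\<phi> (F w))\<^sup>2) \<le> K" using C3_testD(5)[OF g] by (intro real_le_lsqrt) auto
 qed auto
 finally show "\<bar>LINT x|(M \<Otimes>\<^sub>M N). standardize M (G i j) (fst x) * D2 i j (a *\<^sub>R F (fst x) + b *\<^sub>R Z (snd x))\<bar> \<le> K"
  unfolding e by simp
qed

text \<open>The scale \<open>r\<close> only has to dominate the standard deviations: this covers both the intrinsic scale of the vector and the
 larger one that also accounts for the distance to a limiting covariance.\<close>

theorem edgeworth_rate:
 fixes F :: "nat => 'a => real^'d::finite" and N :: "nat => 'b measure" and Z :: "nat => 'b => real^'d"
 assumes M: "prob_space M" and S: "\<And>n. stein_kernel M (F n) (G n)"
  and Z: "\<And>n. gaussian_vector (N n) (Z n)" and cov: "\<And>n i j. cov (N n) (Z n) i j = moment2 M (F n) i j"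
  and g: "C3_test g D1 D2 D3 K"
  and r: "\<And>n. r n > 0" and sr: "\<And>n i j. std_dev M (G n i j) \<le> r n"
  and alt: "\<And>i j. ACN M (\<lambda>n w. (F n w, standardize M (G n i j) w)) \<or> (\<lambda>n. std_dev M (G n i j) / r n) \<longlonglongrightarrow> 0"
 shows "(\<lambda>n. ((LINT w|M. g (F n w)) - (LINT w|N n. g (Z n w)) -
   (\<Sum>i\<in>UNIV. \<Sum>j\<in>UNIV. \<Sum>k\<in>UNIV. moment3 M (F n) i j k / fact 3 * (LINT w|N n. D3 i j k (Z n w)))) / r n) \<longlonglongrightarrow> 0"
proof -
 interpret M: prob_space M by fact
 note Sd = stein_kernelD[OF S]
 define s where "s n i j = std_dev M (G n i j)" for n i j
 define W where "W n i j = standardize M (G n i j)" for n i j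
 note Wp = standardize[OF M Sd(3), folded s_def W_def]
 define I where "I n i j \<theta> = (LINT x|(M \<Otimes>\<^sub>M N n). W n i j (fst x) * D2 i j (sin \<theta> *\<^sub>R F n (fst x) + cos \<theta> *\<^sub>R Z n (snd x)))" for n i j \<theta>
 define T where "T n i j = (\<Sum>k\<in>UNIV. (LINT w|M. W n i j w * F n w $ k) * (LINT w|N n. D3 k i j (Z n w)))" for n i j
 define a where "a n i j k = (LINT w|M. G n i j w * F n w $ k)" for n i j k
 define \<beta> where "\<beta> n = (\<Sum>j\<in>UNIV. \<Sum>i\<in>UNIV. \<Sum>k\<in>UNIV. a n i j k * (LINT w|N n. D3 k i j (Z n w)))" for n
 note st = stein_kernel_standardized[OF M S Z cov g, folded s_def W_def]
 have TK: "\<bar>T n i j\<bar> \<le> K" for n i j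
 proof -
  have "\<bar>\<Sum>k\<in>UNIV. (\<chi> k. LINT w|M. W n i j w * F n w $ k) $ k * (LINT w|N n. D3 k i j (Z n w))\<bar> \<le> K"
   by (rule D3_contraction_bound[OF Z g covector_bound[OF Sd(1) Wp(2,4) Z cov]])
  then show ?thesis by (simp add: T_def)
 qed
 have IK: "\<bar>I n i j \<theta>\<bar> \<le> K" for n i j \<theta> unfolding I_def by (rule st(3))
 have unif: "\<forall>\<^sub>F n in sequentially. \<forall>\<theta>. s n i j * \<bar>I n i j \<theta> - sin \<theta> * T n i j\<bar> \<le> \<epsilon> * r n" if \<epsilon>: "\<epsilon> > 0" for \<epsilon> i j
  using alt[of i j]
 proof
  assume "ACN M (\<lambda>n w. (F n w, standardize M (G n i j) w))"
  from ACN_interpolation_limit[OF M this[folded W_def] Sd(4) Sd(2) Wp(2,3,4) Z cov g \<epsilon>, of i j]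
  show ?thesis
  proof eventually_elim
   case (elim n)
   show ?case
   proof
    fix \<theta>
    have "s n i j * \<bar>I n i j \<theta> - sin \<theta> * T n i j\<bar> \<le> r n * \<epsilon>"
     using elim[rule_format, of \<theta>] sr[of n i j] r[of n] by (intro mult_mono) (auto simp: I_def T_def s_def)
    then show "s n i j * \<bar>I n i j \<theta> - sin \<theta> * T n i j\<bar> \<le> \<epsilon> * r n" by (simp add: mult.commute)
   qed
  qed
 next
  assume "(\<lambda>n. std_dev M (G n i j) / r n) \<longlonglongrightarrow> 0"
  \<comment> \<open>\<open>2 K\<close> bounds the bracket; the additional \<open>1\<close> keeps the denominator positive\<close>
  then have "\<forall>\<^sub>F n in sequentially. s n i j / r n < \<epsilon> / (2 * K + 1)"
   unfolding s_def by (rule order_tendstoD(2)) (use \<epsilon> C3_testD(5)[OF g] in simp)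
  then show ?thesis
  proof eventually_elim
   case (elim n)
   have K1: "2 * K + 1 > 0" using C3_testD(5)[OF g] by simp
   have "s n i j * (2 * K + 1) \<le> \<epsilon> * r n" using elim r[of n] K1 by (simp add: field_simps)
   moreover have "s n i j * \<bar>I n i j \<theta> - sin \<theta> * T n i j\<bar> \<le> s n i j * (2 * K + 1)" for \<theta>
   proof (intro mult_left_mono Wp(1))
    have "\<bar>sin \<theta> * T n i j\<bar> \<le> 1 * K" unfolding abs_mult by (intro mult_mono TK) auto
    then show "\<bar>I n i j \<theta> - sin \<theta> * T n i j\<bar> \<le> 2 * K + 1" using IK[of n i j \<theta>] by linarith
   qed
   ultimately show ?case using order_trans by blast
  qed
 qed
 define d where "d = real CARD('d) * real CARD('d)"
 have d: "d > 0" by (simp add: d_def)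
 have key: "\<forall>\<^sub>F n in sequentially. \<bar>(LINT w|M. g (F n w)) - (LINT w|N n. g (Z n w)) - \<beta> n / 3\<bar> \<le> 2 * (d * (\<epsilon> * r n))" if \<epsilon>: "\<epsilon> > 0" for \<epsilon>
 proof -
  have "\<forall>\<^sub>F n in sequentially. \<forall>i j. \<forall>\<theta>. s n i j * \<bar>I n i j \<theta> - sin \<theta> * T n i j\<bar> \<le> \<epsilon> * r n"
   by (intro eventually_all_finite unif[OF \<epsilon>])
  then show ?thesis
  proof eventually_elim
   case (elim n)
   have "\<bar>(LINT w|M. g (F n w)) - (LINT w|N n. g (Z n w)) - (0 / 2 + \<beta> n / 3)\<bar> \<le> 2 * (d * (\<epsilon> * r n))"
   proof (rule interpolation_bound[OF M Sd(4) M.sq_integrable_integrable[OF Sd(1)] Z C3_testD(1)[OF g] M.sq_integrable_integrable[OF Sd(3)] stein_kernel_interpolation[OF S g]])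
    fix \<theta> :: real
    have "\<beta> n * sin \<theta> = (\<Sum>j\<in>UNIV. \<Sum>i\<in>UNIV. s n i j * (sin \<theta> * T n i j))"
     unfolding \<beta>_def a_def st(1) T_def by (simp add: sum_distrib_left sum_distrib_right mult_ac)
    then have "\<bar>(\<Sum>j\<in>UNIV. \<Sum>i\<in>UNIV. LINT x|(M \<Otimes>\<^sub>M N n). (G n i j (fst x) - cov (N n) (Z n) i j) *
      D2 i j (sin \<theta> *\<^sub>R F n (fst x) + cos \<theta> *\<^sub>R Z n (snd x))) - (0 + \<beta> n * sin \<theta>)\<bar>
     = \<bar>\<Sum>j\<in>UNIV. \<Sum>i\<in>UNIV. s n i j * (I n i j \<theta> - sin \<theta> * T n i j)\<bar>"
     unfolding st(2) I_def[symmetric] by (simp add: right_diff_distrib sum_subtractf)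
    also have "\<dots> \<le> (\<Sum>j\<in>(UNIV :: 'd set). \<Sum>i\<in>(UNIV :: 'd set). \<epsilon> * r n)"
    proof (intro order_trans[OF sum_abs] sum_mono)
     fix i j
     show "\<bar>s n i j * (I n i j \<theta> - sin \<theta> * T n i j)\<bar> \<le> \<epsilon> * r n"
      using elim Wp(1)[of n i j] by (simp add: abs_mult)
    qed
    also have "\<dots> = d * (\<epsilon> * r n)" by (simp add: d_def)
    finally show "\<bar>(\<Sum>j\<in>UNIV. \<Sum>i\<in>UNIV. LINT x|(M \<Otimes>\<^sub>M N n). (G n i j (fst x) - cov (N n) (Z n) i j) *
      D2 i j (sin \<theta> *\<^sub>R F n (fst x) + cos \<theta> *\<^sub>R Z n (snd x))) - (0 + \<beta> n * sin \<theta>)\<bar> \<le> d * (\<epsilon> * r n)" .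
   qed
   then show ?case by simp
  qed
 qed
 have Ts: "(LINT w|N n. D3 i j k (Z n w)) = (LINT w|N n. D3 j i k (Z n w))" "(LINT w|N n. D3 i j k (Z n w)) = (LINT w|N n. D3 i k j (Z n w))" for n i j k
 proof -
  have "D3 i j k = D3 j i k" "D3 i j k = D3 i k j" using g by (auto simp: C3_test_def)
  then show "(LINT w|N n. D3 i j k (Z n w)) = (LINT w|N n. D3 j i k (Z n w))" "(LINT w|N n. D3 i j k (Z n w)) = (LINT w|N n. D3 i k j (Z n w))"
   by simp_all
 qed
 have edge: "(\<Sum>i\<in>UNIV. \<Sum>j\<in>UNIV. \<Sum>k\<in>UNIV. moment3 M (F n) i j k / fact 3 * (LINT w|N n. D3 i j k (Z n w))) = \<beta> n / 3" for n
  unfolding Sd(6) a_def[symmetric] \<beta>_def by (rule sum_symmetric_triple[OF Ts])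
 show ?thesis
  unfolding edge
 proof (rule tendstoI)
  fix e :: real assume e: "e > 0"
  define \<epsilon> where "\<epsilon> = e / (4 * d)"
  have "\<epsilon> > 0" using e d by (simp add: \<epsilon>_def)
  from key[OF this]
  show "\<forall>\<^sub>F n in sequentially. dist (((LINT w|M. g (F n w)) - (LINT w|N n. g (Z n w)) - \<beta> n / 3) / r n) 0 < e"
  proof eventually_elim
   case (elim n)
   have "2 * (d * (\<epsilon> * r n)) = (e / 2) * r n" using d by (simp add: \<epsilon>_def field_simps)
   also have "\<dots> < e * r n" using e r[of n] by simp
   finally have "\<bar>(LINT w|M. g (F n w)) - (LINT w|N n. g (Z n w)) - \<beta> n / 3\<bar> < e * r n" using elim by linarith
   then show ?case using r[of n] by (simp add: dist_real_def abs_div pos_divide_less_eq)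
  qed
 qed
qed

text \<open>The pair \<open>(i0, j0)\<close> only serves to provide Gaussian vectors with the covariance of \<open>F n\<close>. The error splits into that of
 the expansion around them, that of the second-order comparison of Gaussian vectors, and the change of the third-order
 term.\<close>

theorem edgeworth_rate_limit_covariance:
 fixes F :: "nat => 'a => real^'d::finite" and N :: "'b measure" and Z :: "'b => real^'d"
 assumes M: "prob_space M" and S: "\<And>n. stein_kernel M (F n) (G n)"
  and Z: "gaussian_vector N Z" and g: "C3_test g D1 D2 D3 K"
  and lim: "\<And>i j. (\<lambda>n. moment2 M (F n) i j) \<longlonglongrightarrow> cov N Z i j"
  and r: "\<And>n. r n > 0" and sr: "\<And>n i j. std_dev M (G n i j) \<le> r n"
  and cr: "\<And>n i j. \<bar>moment2 M (F n) i j - cov N Z i j\<bar> \<le> r n"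
  and alt: "\<And>i j. ACN M (\<lambda>n w. (F n w, standardize M (G n i j) w)) \<or> (\<lambda>n. std_dev M (G n i j) / r n) \<longlonglongrightarrow> 0"
  and ex: "ACN M (\<lambda>n w. (F n w, standardize M (G n i0 j0) w))"
 shows "(\<lambda>n. ((LINT w|M. g (F n w)) - (LINT w|N. g (Z w)) -
   (\<Sum>i\<in>UNIV. \<Sum>j\<in>UNIV. (moment2 M (F n) i j - cov N Z i j) / 2 * (LINT w|N. D2 i j (Z w))) -
   (\<Sum>i\<in>UNIV. \<Sum>j\<in>UNIV. \<Sum>k\<in>UNIV. moment3 M (F n) i j k / fact 3 * (LINT w|N. D3 i j k (Z w)))) / r n) \<longlonglongrightarrow> 0"
proof -
 interpret M: prob_space M by fact
 note Sd = stein_kernelD[OF S]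
 define s where "s n i j = std_dev M (G n i j)" for n i j
 define W where "W n i j = standardize M (G n i j)" for n i j
 note Wp = standardize[OF M Sd(3), folded s_def W_def]
 show ?thesis
 proof (rule ACN_gaussian_pairs[OF M ex Sd(2) standardize(3)[OF M Sd(3)]])
  fix \<nu> :: "nat => ((real^'d) \<times> real) measure"
  assume "\<And>n. jointly_gaussian (\<nu> n) fst snd" and cv: "\<And>n i j. cov (\<nu> n) fst i j = moment2 M (F n) i j"
  then have A: "gaussian_vector (\<nu> n) fst" for n by (intro jointly_gaussian_imp_vector)
  have clim: "(\<lambda>n. cov (\<nu> n) fst i j) \<longlonglongrightarrow> cov N Z i j" for i j unfolding cv by (rule lim)
  define E0 where "E0 n = ((LINT w|M. g (F n w)) - (LINT x|\<nu> n. g (fst x)) -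
   (\<Sum>i\<in>UNIV. \<Sum>j\<in>UNIV. \<Sum>k\<in>UNIV. moment3 M (F n) i j k / fact 3 * (LINT x|\<nu> n. D3 i j k (fst x))))" for n
  have E0: "(\<lambda>n. E0 n / r n) \<longlonglongrightarrow> 0" unfolding E0_def by (rule edgeworth_rate[OF M S A cv g r sr alt])
  define E1 where "E1 n = (LINT x|\<nu> n. g (fst x)) - (LINT w|N. g (Z w)) -
   (\<Sum>j\<in>UNIV. \<Sum>i\<in>UNIV. (cov (\<nu> n) fst i j - cov N Z i j) * (LINT w|N. D2 i j (Z w))) / 2" for n
  define d where "d = real CARD('d) * real CARD('d)"
  have E1: "(\<lambda>n. E1 n / r n) \<longlonglongrightarrow> 0"
  proof (rule Lim_null_comparison)
   have "\<bar>E1 n / r n\<bar> \<le> 12 * K * sqrt (cov_dist (\<nu> n) fst N Z) * d" for n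
   proof -
    have "cov_dist (\<nu> n) fst N Z \<le> (\<Sum>j\<in>(UNIV :: 'd set). \<Sum>i\<in>(UNIV :: 'd set). r n)"
     unfolding cov_dist_def cv by (intro sum_mono cr)
    then have cd: "cov_dist (\<nu> n) fst N Z \<le> d * r n" by (simp add: d_def)
    have "\<bar>E1 n\<bar> \<le> 12 * K * sqrt (cov_dist (\<nu> n) fst N Z) * cov_dist (\<nu> n) fst N Z"
     unfolding E1_def by (rule gaussian_compare_expansion[OF A Z g])
    also have "\<dots> \<le> 12 * K * sqrt (cov_dist (\<nu> n) fst N Z) * (d * r n)"
     using C3_testD(5)[OF g] cov_dist_nonneg[of "\<nu> n" fst N Z] by (intro mult_left_mono cd) auto
    finally show ?thesis using r[of n] by (simp add: pos_divide_le_eq mult.assoc)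
   qed
   then show "\<forall>\<^sub>F n in sequentially. norm (E1 n / r n) \<le> 12 * K * sqrt (cov_dist (\<nu> n) fst N Z) * d" by simp
   have "(\<lambda>n. 12 * K * sqrt (cov_dist (\<nu> n) fst N Z) * d) \<longlonglongrightarrow> 12 * K * sqrt 0 * d"
    by (intro tendsto_intros cov_dist_tendsto_0 clim)
   then show "(\<lambda>n. 12 * K * sqrt (cov_dist (\<nu> n) fst N Z) * d) \<longlonglongrightarrow> 0" by simp
  qed
  define T where "T n i j k = (LINT x|\<nu> n. D3 i j k (fst x)) - (LINT w|N. D3 i j k (Z w))" for n i j k
  have Ts: "T n i j k = T n j i k" "T n i j k = T n i k j" for n i j k
  proof -
   have "D3 i j k = D3 j i k" "D3 i j k = D3 i k j" using g by (auto simp: C3_test_def)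
   then show "T n i j k = T n j i k" "T n i j k = T n i k j" by (simp_all add: T_def)
  qed
  define c where "c n i j = (\<chi> k. LINT w|M. W n i j w * F n w $ k)" for n i j
  define E2 where "E2 n = (\<Sum>i\<in>UNIV. \<Sum>j\<in>UNIV. \<Sum>k\<in>UNIV. moment3 M (F n) i j k / fact 3 * T n i j k)" for n
  have E2e: "E2 n / r n = (\<Sum>j\<in>UNIV. \<Sum>i\<in>UNIV. (\<Sum>k\<in>UNIV. c n i j $ k * T n k i j) * (s n i j / r n)) / 3" for n
  proof -
   have "E2 n = (\<Sum>j\<in>UNIV. \<Sum>i\<in>UNIV. \<Sum>k\<in>UNIV. (LINT w|M. G n i j w * F n w $ k) * T n k i j) / 3"
    unfolding E2_def Sd(6) by (rule sum_symmetric_triple[OF Ts])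
   also have "\<dots> = (\<Sum>j\<in>UNIV. \<Sum>i\<in>UNIV. (\<Sum>k\<in>UNIV. c n i j $ k * T n k i j) * s n i j) / 3"
    unfolding stein_kernel_standardized(1)[OF M S A cv g] c_def s_def W_def
    by (simp add: sum_distrib_left sum_distrib_right mult_ac)
   finally show ?thesis by (simp add: sum_divide_distrib mult.commute[of 3 "r n"])
  qed
  have ct: "(\<lambda>n. (\<Sum>k\<in>UNIV. c n i j $ k * T n k i j)) \<longlonglongrightarrow> 0" for i j
   unfolding T_def
   by (rule D3_contraction_tendsto[OF A Z clim g, of "\<lambda>n. c n i j"]) (unfold c_def, rule covector_bound[OF Sd(1) Wp(2,4) A cv])
  have sB: "Bseq (\<lambda>n. s n i j / r n)" for i j
  proof (rule BseqI')
   show "norm (s n i j / r n) \<le> 1" for n using sr[of n i j] Wp(1)[of n i j] r[of n] by (simp add: s_def)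
  qed
  have "(\<lambda>n. (\<Sum>j\<in>UNIV. \<Sum>i\<in>UNIV. (\<Sum>k\<in>UNIV. c n i j $ k * T n k i j) * (s n i j / r n)) / 3) \<longlonglongrightarrow>
    (\<Sum>j\<in>(UNIV :: 'd set). \<Sum>i\<in>(UNIV :: 'd set). 0) / 3"
   by (intro tendsto_divide tendsto_sum tendsto_zero_mult_Bseq ct sB tendsto_const) simp
  then have E2: "(\<lambda>n. E2 n / r n) \<longlonglongrightarrow> 0" unfolding E2e by simp
  have sw: "(\<Sum>j\<in>UNIV. \<Sum>i\<in>UNIV. (cov (\<nu> n) fst i j - cov N Z i j) * (LINT w|N. D2 i j (Z w))) / 2 =
    (\<Sum>i\<in>UNIV. \<Sum>j\<in>UNIV. (moment2 M (F n) i j - cov N Z i j) / 2 * (LINT w|N. D2 i j (Z w)))" for n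
   unfolding cv by (subst sum.swap) (simp add: sum_divide_distrib)
  have E2': "E2 n = (\<Sum>i\<in>UNIV. \<Sum>j\<in>UNIV. \<Sum>k\<in>UNIV. moment3 M (F n) i j k / fact 3 * (LINT x|\<nu> n. D3 i j k (fst x)))
    - (\<Sum>i\<in>UNIV. \<Sum>j\<in>UNIV. \<Sum>k\<in>UNIV. moment3 M (F n) i j k / fact 3 * (LINT w|N. D3 i j k (Z w)))" for n
   unfolding E2_def T_def by (simp only: right_diff_distrib sum_subtractf)
  have "(\<lambda>n. E0 n / r n + E1 n / r n + E2 n / r n) \<longlonglongrightarrow> 0 + 0 + 0" by (intro tendsto_add E0 E1 E2)
  moreover have "E0 n / r n + E1 n / r n + E2 n / r n = ((LINT w|M. g (F n w)) - (LINT w|N. g (Z w)) -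
   (\<Sum>i\<in>UNIV. \<Sum>j\<in>UNIV. (moment2 M (F n) i j - cov N Z i j) / 2 * (LINT w|N. D2 i j (Z w))) -
   (\<Sum>i\<in>UNIV. \<Sum>j\<in>UNIV. \<Sum>k\<in>UNIV. moment3 M (F n) i j k / fact 3 * (LINT w|N. D3 i j k (Z w)))) / r n" for n
   unfolding E0_def E1_def E2' sw add_divide_distrib[symmetric] by (rule arg_cong[where f="\<lambda>x. x / r n"]) simp
  ultimately show ?thesis by simp
 qed
qed

section \<open>Limes superior conditions\<close>

lemma limsup_not_pos_imp_tendsto_0:
 assumes nonneg: "\<And>n. 0 \<le> x n" and l: "\<not> limsup (\<lambda>n. ereal (x n)) > 0"
 shows "x \<longlonglongrightarrow> 0"
proof (rule tendstoI)
 fix e :: real assume e: "e > 0"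
 have "limsup (\<lambda>n. ereal (x n)) < ereal e" using l e by (simp add: not_less order.strict_trans1)
 from Limsup_lessD[OF this] show "\<forall>\<^sub>F n in sequentially. dist (x n) 0 < e"
  by eventually_elim (use nonneg in \<open>simp add: dist_real_def\<close>)
qed

lemma sqrt_sum_squares_le_sum2:
 fixes f :: "'d::finite => 'd => real"
 assumes f: "\<And>i j. 0 \<le> f i j"
 shows "sqrt (\<Sum>i\<in>UNIV. \<Sum>j\<in>UNIV. (f i j)\<^sup>2) \<le> (\<Sum>i\<in>UNIV. \<Sum>j\<in>UNIV. f i j)"
  and "f i j \<le> sqrt (\<Sum>i\<in>UNIV. \<Sum>j\<in>UNIV. (f i j)\<^sup>2)"
proof -
 have "sqrt (\<Sum>i\<in>UNIV. \<Sum>j\<in>UNIV. (f i j)\<^sup>2) = L2_set (\<lambda>i. L2_set (f i) UNIV) UNIV" by (simp add: L2_set_def sum_nonneg)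
 also have "\<dots> \<le> (\<Sum>i\<in>UNIV. L2_set (f i) UNIV)" by (rule L2_set_le_sum) (rule L2_set_nonneg)
 also have "\<dots> \<le> (\<Sum>i\<in>UNIV. \<Sum>j\<in>UNIV. f i j)" by (intro sum_mono L2_set_le_sum f)
 finally show "sqrt (\<Sum>i\<in>UNIV. \<Sum>j\<in>UNIV. (f i j)\<^sup>2) \<le> (\<Sum>i\<in>UNIV. \<Sum>j\<in>UNIV. f i j)" .
 have "(f i j)\<^sup>2 \<le> (\<Sum>j\<in>UNIV. (f i j)\<^sup>2)" by (rule member_le_sum) auto
 also have "\<dots> \<le> (\<Sum>i\<in>UNIV. \<Sum>j\<in>UNIV. (f i j)\<^sup>2)" by (rule member_le_sum[where f="\<lambda>i. \<Sum>j\<in>UNIV. (f i j)\<^sup>2"]) (auto simp: sum_nonneg)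
 finally show "f i j \<le> sqrt (\<Sum>i\<in>UNIV. \<Sum>j\<in>UNIV. (f i j)\<^sup>2)" by (rule real_le_rsqrt)
qed

theorem proposition4p1:
  fixes M :: "'a measure"
    and X :: "'h::{real_inner, banach, second_countable_topology} \<Rightarrow> 'a \<Rightarrow> real"
    and q :: "'d::finite \<Rightarrow> nat"
    and f :: "nat \<Rightarrow> 'd \<Rightarrow> 'h tensor"
    and F :: "nat \<Rightarrow> 'a \<Rightarrow> real^'d"
    and g :: "real^'d \<Rightarrow> real"
  assumes "isonormal_gaussian_process M X"
    and "\<And>i. q i \<ge> 1"
    and "\<And>n i. f n i \<in> sym_tensors (q i)"
    and "\<And>n i. is_multiple_integral M X (q i) (f n i) (\<lambda>\<omega>. F n \<omega> $ i)"
    and "three_times_differentiable g"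
    and "bounded_derivatives3 g"
  shows
    "(\<forall>(N :: nat \<Rightarrow> 'b measure) (Z :: nat \<Rightarrow> 'b \<Rightarrow> real^'d).
        (\<forall>n. centered_gaussian_vector (N n) (Z n) (\<chi> i j. moment2 M (F n) i j)) \<longrightarrow>
        (\<forall>n. Delta_Gam M X (F n) \<noteq> 0) \<longrightarrow>
        (\<forall>i j. limsup (\<lambda>n. ereal (sqrt (prob_space.variance M (Gam M X (F n) i j))
                                     / Delta_Gam M X (F n))) > 0 \<longrightarrow>
             ACN M (\<lambda>n \<omega>. (F n \<omega>, Gam_normalized M X (F n) i j \<omega>))) \<longrightarrow>
        (\<lambda>n. ((\<integral>\<omega>. g (F n \<omega>) \<partial>M) - edgeworth3_same M (F n) (N n) (Z n) g)
              / Delta_Gam M X (F n)) \<longlonglongrightarrow> 0)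
     \<and>
     (\<forall>(C :: real^'d^'d) (N :: 'b measure) (Z :: 'b \<Rightarrow> real^'d).
        covariance_matrix C \<longrightarrow>
        centered_gaussian_vector N Z C \<longrightarrow>
        (\<forall>n. phi_C M X (F n) C \<noteq> 0) \<longrightarrow>
        (\<lambda>n. Delta_C M (F n) C) \<longlonglongrightarrow> 0 \<longrightarrow>
        (\<forall>i j. limsup (\<lambda>n. ereal ((sqrt (prob_space.variance M (Gam M X (F n) i j))
                                      + \<bar>moment2 M (F n) i j - C $ i $ j\<bar>)
                                     / phi_C M X (F n) C)) > 0 \<longrightarrow>
             ACN M (\<lambda>n \<omega>. (F n \<omega>, Gam_normalized M X (F n) i j \<omega>))) \<longrightarrow>
        (\<lambda>n. ((\<integral>\<omega>. g (F n \<omega>) \<partial>M) - edgeworth3 M (F n) C N Z g)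
              / phi_C M X (F n) C) \<longlonglongrightarrow> 0)"
proof -
  interpret isonormal_gaussian_process M X by fact
  have q: "q i \<ge> 1" for i by fact
  have Fch: "(\<lambda>w. F n w $ i) \<in> wiener_chaos M X (q i)" for n i
  proof -
    have "is_multiple_integral M X (q i) (f n i) (\<lambda>w. F n w $ i)" by fact
    then show ?thesis unfolding is_multiple_integral_def wiener_chaos_def by blast
  qed
  have S: "stein_kernel M (F n) (Gam M X (F n))" for n by (rule chaos_stein_kernel[OF Fch q])
  note M = prob_space_axioms
  note sd = standardize(1)[OF M stein_kernelD(3)[OF S]]
  obtain K where g: "C3_test g (\<lambda>i. partial i g) (\<lambda>i j. partial i (partial j g)) (\<lambda>k i j. partial k (partial i (partial j g))) K"
    using C3_test_partials[OF \<open>three_times_differentiable g\<close> \<open>bounded_derivatives3 g\<close>] by blast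
  have norm: "Gam_normalized M X (F n) i j = standardize M (Gam M X (F n) i j)" for n i j
    unfolding Gam_normalized_def standardize_def std_dev_def ..
  have sd_sq: "(std_dev M (Gam M X (F n) i j))\<^sup>2 = variance (Gam M X (F n) i j)" for n i j by (simp add: std_dev_def)
  have DG: "Delta_Gam M X (F n) = sqrt (\<Sum>i\<in>UNIV. \<Sum>j\<in>UNIV. (std_dev M (Gam M X (F n) i j))\<^sup>2)" for n
    unfolding sd_sq Delta_Gam_def ..
  have sd_DG: "std_dev M (Gam M X (F n) i j) \<le> Delta_Gam M X (F n)" for n i j
    unfolding DG by (rule sqrt_sum_squares_le_sum2(2)[OF sd])
  have DG0: "0 \<le> Delta_Gam M X (F n)" for n using order_trans[OF sd sd_DG] .
  show ?thesis
  proof (intro conjI allI impI)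
    fix N :: "nat => 'b measure" and Z :: "nat => 'b => real^'d"
    assume "\<forall>n. centered_gaussian_vector (N n) (Z n) (\<chi> i j. moment2 M (F n) i j)"
    then have CZ: "centered_gaussian_vector (N n) (Z n) (\<chi> i j. moment2 M (F n) i j)" for n ..
    have Z: "gaussian_vector (N n) (Z n)" and cov: "cov (N n) (Z n) i j = moment2 M (F n) i j" for n i j
      using centered_gaussian_vectorD[OF CZ] by simp_all
    assume "\<forall>n. Delta_Gam M X (F n) \<noteq> 0"
    then have r: "Delta_Gam M X (F n) > 0" for n using DG0[of n] by (simp add: less_le)
    assume acn: "\<forall>i j. limsup (\<lambda>n. ereal (sqrt (variance (Gam M X (F n) i j)) / Delta_Gam M X (F n))) > 0 \<longrightarrow>
      ACN M (\<lambda>n w. (F n w, Gam_normalized M X (F n) i j w))"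
    have alt: "ACN M (\<lambda>n w. (F n w, standardize M (Gam M X (F n) i j) w)) \<or>
        (\<lambda>n. std_dev M (Gam M X (F n) i j) / Delta_Gam M X (F n)) \<longlonglongrightarrow> 0" for i j
    proof (cases "limsup (\<lambda>n. ereal (std_dev M (Gam M X (F n) i j) / Delta_Gam M X (F n))) > 0")
      case True
      then show ?thesis using acn unfolding norm std_dev_def by blast
    next
      case False
      then have "(\<lambda>n. std_dev M (Gam M X (F n) i j) / Delta_Gam M X (F n)) \<longlonglongrightarrow> 0"
        by (intro limsup_not_pos_imp_tendsto_0) (simp add: sd DG0)
      then show ?thesis ..
    qed
    show "(\<lambda>n. ((LINT w|M. g (F n w)) - edgeworth3_same M (F n) (N n) (Z n) g) / Delta_Gam M X (F n)) \<longlonglongrightarrow> 0"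
      using edgeworth_rate[OF M S Z cov g r sd_DG alt] by (simp only: edgeworth3_same_def diff_diff_eq)
  next
    fix C :: "real^'d^'d" and N :: "'b measure" and Z :: "'b => real^'d"
    assume CZ: "centered_gaussian_vector N Z C"
    note Z = centered_gaussian_vectorD(1)[OF CZ]
    have cov: "C $ i $ j = cov N Z i j" for i j by (simp add: centered_gaussian_vectorD(2)[OF CZ])
    define s where "s n i j = std_dev M (Gam M X (F n) i j)" for n i j
    define e where "e n i j = \<bar>moment2 M (F n) i j - C $ i $ j\<bar>" for n i j
    define \<phi> where "\<phi> n = phi_C M X (F n) C" for n
    have DC: "Delta_C M (F n) C = sqrt (\<Sum>i\<in>UNIV. \<Sum>j\<in>UNIV. (e n i j)\<^sup>2)" for n by (simp add: Delta_C_def e_def)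
    have e0: "0 \<le> e n i j" for n i j by (simp add: e_def)
    have s0: "0 \<le> s n i j" for n i j unfolding s_def by (rule sd)
    have e_DC: "e n i j \<le> Delta_C M (F n) C" for n i j unfolding DC by (rule sqrt_sum_squares_le_sum2(2)[OF e0])
    have DC0: "0 \<le> Delta_C M (F n) C" for n using order_trans[OF e0 e_DC] .
    assume "\<forall>n. phi_C M X (F n) C \<noteq> 0"
    then have r: "\<phi> n > 0" for n using DG0[of n] DC0[of n] by (simp add: less_le \<phi>_def phi_C_def)
    have s\<phi>: "s n i j \<le> \<phi> n" and e\<phi>: "e n i j \<le> \<phi> n" for n i j
      using sd_DG[of n i j] e_DC[of n i j] DG0[of n] DC0[of n] by (simp_all add: s_def \<phi>_def phi_C_def)
    assume DC_lim: "(\<lambda>n. Delta_C M (F n) C) \<longlonglongrightarrow> 0"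
    have lim: "(\<lambda>n. moment2 M (F n) i j) \<longlonglongrightarrow> cov N Z i j" for i j
    proof -
      have "(\<lambda>n. \<bar>moment2 M (F n) i j - C $ i $ j\<bar>) \<longlonglongrightarrow> 0"
        by (rule tendsto_zero_of_le[OF _ _ DC_lim]) (use e_DC in \<open>simp_all add: e_def\<close>)
      then show ?thesis unfolding cov by (simp add: tendsto_rabs_zero_iff LIM_zero_cancel)
    qed
    assume "\<forall>i j. limsup (\<lambda>n. ereal ((sqrt (variance (Gam M X (F n) i j)) + \<bar>moment2 M (F n) i j - C $ i $ j\<bar>) / phi_C M X (F n) C)) > 0 \<longrightarrow>
      ACN M (\<lambda>n w. (F n w, Gam_normalized M X (F n) i j w))"
    then have acn: "limsup (\<lambda>n. ereal ((s n i j + e n i j) / \<phi> n)) > 0 ==>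
      ACN M (\<lambda>n w. (F n w, standardize M (Gam M X (F n) i j) w))" for i j
      unfolding norm s_def e_def \<phi>_def std_dev_def by blast
    have nonacn: "(\<lambda>n. (s n i j + e n i j) / \<phi> n) \<longlonglongrightarrow> 0"
      if "\<not> ACN M (\<lambda>n w. (F n w, standardize M (Gam M X (F n) i j) w))" for i j
    proof (rule limsup_not_pos_imp_tendsto_0)
      show "0 \<le> (s n i j + e n i j) / \<phi> n" for n using s0[of n i j] e0[of n i j] r[of n] by simp
    qed (use acn that in blast)
    have alt: "ACN M (\<lambda>n w. (F n w, standardize M (Gam M X (F n) i j) w)) \<or>
        (\<lambda>n. std_dev M (Gam M X (F n) i j) / \<phi> n) \<longlonglongrightarrow> 0" for i j
    proof (rule disjCI)
      assume "\<not> (\<lambda>n. std_dev M (Gam M X (F n) i j) / \<phi> n) \<longlonglongrightarrow> 0"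
      moreover have "(\<lambda>n. std_dev M (Gam M X (F n) i j) / \<phi> n) \<longlonglongrightarrow> 0"
        if "\<not> ACN M (\<lambda>n w. (F n w, standardize M (Gam M X (F n) i j) w))"
      proof (rule tendsto_zero_of_le[OF _ _ nonacn[OF that]])
        show "0 \<le> std_dev M (Gam M X (F n) i j) / \<phi> n" for n using s0[of n i j] r[of n] by (simp add: s_def)
        show "std_dev M (Gam M X (F n) i j) / \<phi> n \<le> (s n i j + e n i j) / \<phi> n" for n
          using e0[of n i j] r[of n] by (simp add: s_def divide_right_mono)
      qed
      ultimately show "ACN M (\<lambda>n w. (F n w, standardize M (Gam M X (F n) i j) w))" by blast
    qed
    \<comment> \<open>otherwise all the ratios would tend to zero, although they add up to at least one\<close>
    have "\<exists>i j. ACN M (\<lambda>n w. (F n w, standardize M (Gam M X (F n) i j) w))"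
    proof (rule ccontr)
      assume "\<nexists>i j. ACN M (\<lambda>n w. (F n w, standardize M (Gam M X (F n) i j) w))"
      then have "(\<lambda>n. (s n i j + e n i j) / \<phi> n) \<longlonglongrightarrow> 0" for i j by (intro nonacn) blast
      then have l: "(\<lambda>n. \<Sum>i\<in>UNIV. \<Sum>j\<in>UNIV. (s n i j + e n i j) / \<phi> n) \<longlonglongrightarrow> (\<Sum>i\<in>(UNIV :: 'd set). \<Sum>j\<in>(UNIV :: 'd set). 0)"
        by (intro tendsto_sum)
      have ge1: "1 \<le> (\<Sum>i\<in>UNIV. \<Sum>j\<in>UNIV. (s n i j + e n i j) / \<phi> n)" for n
      proof -
        have "Delta_Gam M X (F n) \<le> (\<Sum>i\<in>UNIV. \<Sum>j\<in>UNIV. s n i j)"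
          unfolding DG s_def[symmetric] by (rule sqrt_sum_squares_le_sum2(1)[OF s0])
        moreover have "Delta_C M (F n) C \<le> (\<Sum>i\<in>UNIV. \<Sum>j\<in>UNIV. e n i j)"
          unfolding DC by (rule sqrt_sum_squares_le_sum2(1)[OF e0])
        ultimately have "\<phi> n \<le> (\<Sum>i\<in>UNIV. \<Sum>j\<in>UNIV. s n i j + e n i j)" by (simp add: \<phi>_def phi_C_def sum.distrib)
        then have "1 \<le> (\<Sum>i\<in>UNIV. \<Sum>j\<in>UNIV. s n i j + e n i j) / \<phi> n" using r[of n] by (simp add: pos_le_divide_eq)
        then show ?thesis by (simp only: sum_divide_distrib)
      qed
      from l have "1 \<le> (\<Sum>i\<in>(UNIV :: 'd set). \<Sum>j\<in>(UNIV :: 'd set). (0::real))"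
        by (rule LIMSEQ_le_const) (use ge1 in blast)
      then show False by simp
    qed
    then obtain i0 j0 where ex: "ACN M (\<lambda>n w. (F n w, standardize M (Gam M X (F n) i0 j0) w))" by blast
    show "(\<lambda>n. ((LINT w|M. g (F n w)) - edgeworth3 M (F n) C N Z g) / phi_C M X (F n) C) \<longlonglongrightarrow> 0"
      using edgeworth_rate_limit_covariance[OF M S Z g lim r s\<phi>[unfolded s_def] e\<phi>[unfolded e_def cov] alt ex]
      by (simp only: edgeworth3_def cov \<phi>_def diff_diff_eq add.assoc)
  qed
qed

end
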